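(* Let $\phi$ be a subharmonic, non-harmonic function on $\mathbb{C}$ such that $\mu=\Delta\phi$ is a doubling measure. Let $g$ be an entire function such that $\bar g\,k_\lambda\in L^2(e^{-2\phi})$ for every $\lambda\in\mathbb{C}$. Then the Hankel operator $H_{\bar g}$ (densely defined on $\operatorname{Span}\{k_\lambda:\lambda\in\mathbb{C}\}$) extends to a bounded linear operator on $\mathcal{F}^2_\phi$ if and only if the function $|g'|\rho$ is bounded on $\mathbb{C}$.
   Context: A nonnegative Borel measure $\mu$ on $\mathbb{C}$ is doubling if there is $C>0$ with $\mu(D(z,2r))\le C\mu(D(z,r))$ for all $z\in\mathbb{C}$, $r>0$. For $z\in\mathbb{C}$, $\rho(z)>0$ denotes the radius such that $\mu(D(z,\rho(z)))=1$, where $\mu=\Delta\phi$. $dm$ is Lebesgue measure on $\mathbb{C}$. $L^2(e^{-2\phi})$ is the space of measurable $f$ with $\int_{\mathbb{C}}|f|^2e^{-2\phi}\,dm<\infty$, and the generalized Fock space is $\mathcal{F}^2_\phi=\{f \text{ entire}: \int_{\mathbb{C}}|f|^2e^{-2\phi}\,dm<\infty\}$, a closed subspace of $L^2(e^{-2\phi})$; $P$ is the orthogonal projection of $L^2(e^{-2\phi})$ onto $\mathcal{F}^2_\phi$. $K(z,\lambda)$ is the reproducing (Bergman) kernel of $\mathcal{F}^2_\phi$ and $k_\lambda(z)=K(z,\lambda)/K(\lambda,\lambda)^{1/2}$ is the normalized reproducing kernel. For $f\in\operatorname{Span}\{k_\lambda\}$ (a dense subspace of $\mathcal{F}^2_\phi$)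 the big Hankel operator with symbol $\bar g$ is $H_{\bar g}f=(I-P)(\bar g f)$. *)

theory Defs
  imports "HOL-Analysis.Analysis"
begin

definition dx :: "(complex \<Rightarrow> real) \<Rightarrow> complex \<Rightarrow> real" where
  "dx f z = deriv (\<lambda>t::real. f (z + of_real t)) 0"

definition dy :: "(complex \<Rightarrow> real) \<Rightarrow> complex \<Rightarrow> real" where
  "dy f z = deriv (\<lambda>t::real. f (z + \<i> * of_real t)) 0"

definition C1p :: "(complex \<Rightarrow> real) \<Rightarrow> bool" where
  "C1p f \<longleftrightarrow>
     (\<forall>z. (\<lambda>t::real. f (z + of_real t)) differentiable (at 0)
        \<and> (\<lambda>t::real. f (z + \<i> * of_real t)) differentiable (at 0))
     \<and> continuous_on UNIV (dx f) \<and> continuous_on UNIV (dy f)"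

definition C2 :: "(complex \<Rightarrow> real) \<Rightarrow> bool" where
  "C2 f \<longleftrightarrow> C1p f \<and> C1p (dx f) \<and> C1p (dy f)"

definition lap :: "(complex \<Rightarrow> real) \<Rightarrow> complex \<Rightarrow> real" where
  "lap f z = dx (dx f) z + dy (dy f) z"

text \<open>Test functions: C^2 with compact support (equivalent, for identifying the
  distributional Laplacian of a locally integrable function, to C^\<infinity>_c).\<close>
definition test_fn :: "(complex \<Rightarrow> real) \<Rightarrow> bool" where
  "test_fn \<psi> \<longleftrightarrow> C2 \<psi> \<and> compact (closure {z. \<psi> z \<noteq> 0})"

definition usc :: "(complex \<Rightarrow> real) \<Rightarrow> bool" where
  "usc f \<longleftrightarrow> (\<forall>z. \<forall>e>0. eventually (\<lambda>w. f w < f z + e) (at z))"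

definition subharmonic :: "(complex \<Rightarrow> real) \<Rightarrow> bool" where
  "subharmonic f \<longleftrightarrow> usc f \<and>
     (\<forall>z. \<forall>r>0. interval_lebesgue_integrable lborel 0 (2*pi) (\<lambda>t. f (z + of_real r * cis t))
        \<and> f z \<le> (1 / (2*pi)) * (LBINT t=0..2*pi. f (z + of_real r * cis t)))"

definition harmonic :: "(complex \<Rightarrow> real) \<Rightarrow> bool" where
  "harmonic f \<longleftrightarrow> C2 f \<and> (\<forall>z. lap f z = 0)"

definition is_laplacian :: "(complex \<Rightarrow> real) \<Rightarrow> complex measure \<Rightarrow> bool" where
  "is_laplacian \<phi> \<mu> \<longleftrightarrow> sets \<mu> = sets borel \<and>
     (\<forall>K. compact K \<longrightarrow> emeasure \<mu> K < \<infinity>) \<and>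
     (\<forall>\<psi>. test_fn \<psi> \<longrightarrow>
        integrable lborel (\<lambda>z. \<phi> z * lap \<psi> z) \<and> integrable \<mu> \<psi> \<and>
        (\<integral>z. \<phi> z * lap \<psi> z \<partial>lborel) = (\<integral>z. \<psi> z \<partial>\<mu>))"

definition doubling :: "complex measure \<Rightarrow> bool" where
  "doubling \<mu> \<longleftrightarrow> (\<exists>C>0. \<forall>z r. r > 0 \<longrightarrow>
      emeasure \<mu> (ball z (2*r)) \<le> ennreal C * emeasure \<mu> (ball z r))"

text \<open>\<rho>(z): the radius with \<mu>(D(z,\<rho>(z))) = 1 (written as a supremum, which equals
  that radius whenever it exists).\<close>
definition rho :: "complex measure \<Rightarrow> complex \<Rightarrow> real" where
  "rho \<mu> z = Sup {r. r > 0 \<and> emeasure \<mu> (ball z r) \<le> 1}"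

definition L2w :: "(complex \<Rightarrow> real) \<Rightarrow> (complex \<Rightarrow> complex) \<Rightarrow> bool" where
  "L2w \<phi> f \<longleftrightarrow> f \<in> borel_measurable lborel \<and>
     integrable lborel (\<lambda>z. (cmod (f z))\<^sup>2 * exp (- 2 * \<phi> z))"

definition wnorm :: "(complex \<Rightarrow> real) \<Rightarrow> (complex \<Rightarrow> complex) \<Rightarrow> real" where
  "wnorm \<phi> f = sqrt (\<integral>z. (cmod (f z))\<^sup>2 * exp (- 2 * \<phi> z) \<partial>lborel)"

definition wip :: "(complex \<Rightarrow> real) \<Rightarrow> (complex \<Rightarrow> complex) \<Rightarrow> (complex \<Rightarrow> complex) \<Rightarrow> complex" where
  "wip \<phi> f h = (\<integral>z. f z * cnj (h z) * of_real (exp (- 2 * \<phi> z)) \<partial>lborel)"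

definition Fock :: "(complex \<Rightarrow> real) \<Rightarrow> (complex \<Rightarrow> complex) set" where
  "Fock \<phi> = {f. f holomorphic_on UNIV \<and> L2w \<phi> f}"

definition bergman :: "(complex \<Rightarrow> real) \<Rightarrow> complex \<Rightarrow> complex \<Rightarrow> complex" where
  "bergman \<phi> w = (THE k. k \<in> Fock \<phi> \<and> (\<forall>f\<in>Fock \<phi>. f w = wip \<phi> f k))"

definition nk :: "(complex \<Rightarrow> real) \<Rightarrow> complex \<Rightarrow> complex \<Rightarrow> complex" where
  "nk \<phi> w z = bergman \<phi> w z / of_real (sqrt (Re (bergman \<phi> w w)))"

definition proj :: "(complex \<Rightarrow> real) \<Rightarrow> (complex \<Rightarrow> complex) \<Rightarrow> (complex \<Rightarrow> complex)" where
  "proj \<phi> h = (THE f. f \<in> Fock \<phi> \<and> (\<forall>u\<in>Fock \<phi>. wip \<phi> (\<lambda>z. h z - f z) u = 0))"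

definition kspan :: "(complex \<Rightarrow> real) \<Rightarrow> (complex \<Rightarrow> complex) set" where
  "kspan \<phi> = {f. \<exists>A c. finite A \<and> f = (\<lambda>z. \<Sum>w\<in>A. c w * nk \<phi> w z)}"

definition hankel :: "(complex \<Rightarrow> real) \<Rightarrow> (complex \<Rightarrow> complex) \<Rightarrow> (complex \<Rightarrow> complex) \<Rightarrow> (complex \<Rightarrow> complex)" where
  "hankel \<phi> g f = (\<lambda>z. cnj (g z) * f z - proj \<phi> (\<lambda>w. cnj (g w) * f w) z)"

text \<open>H_{\<bar>g} extends to a bounded linear operator T from the Fock space into
  L^2(e^{-2\<phi>}) (values in L^2 identified up to a.e. equality, i.e. null weighted norm).\<close>
definition hankel_bounded :: "(complex \<Rightarrow> real) \<Rightarrow> (complex \<Rightarrow> complex) \<Rightarrow> bool" where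
  "hankel_bounded \<phi> g \<longleftrightarrow> (\<exists>T C.
     (\<forall>f\<in>Fock \<phi>. L2w \<phi> (T f) \<and> wnorm \<phi> (T f) \<le> C * wnorm \<phi> f) \<and>
     (\<forall>f\<in>Fock \<phi>. \<forall>h\<in>Fock \<phi>. \<forall>a b.
        wnorm \<phi> (\<lambda>z. T (\<lambda>w. a * f w + b * h w) z - (a * T f z + b * T h z)) = 0) \<and>
     (\<forall>f\<in>kspan \<phi>. wnorm \<phi> (\<lambda>z. T f z - hankel \<phi> g f z) = 0))"

end

theory Submission
 imports Defs "HOL-Complex_Analysis.Complex_Analysis"
begin

text \<open>The measure \<open>\<mu>\<close> is doubling, so \<open>\<phi>\<close> differs by a bounded amount from a \<open>C\<^sup>2\<close> function \<open>\<psi>\<close> whose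
 Laplacian is comparable to \<open>1 / \<rho>\<^sup>2\<close>, and weighted \<open>L\<^sup>2\<close> estimates of Hoermander type are available for \<open>\<psi>\<close>.
 If \<open>|g'| \<rho>\<close> is bounded, solving \<open>dbar u = cnj (g') f\<close> with such an estimate subtracts from \<open>cnj g * f\<close> an entire
 function at bounded cost. Conversely, on a disc of radius comparable to \<open>\<rho> l\<close> one has \<open>\<psi> = Re H + O(1)\<close> with \<open>H\<close>
 holomorphic; correcting a cutoff of \<open>exp H\<close> to an entire function gives a peak function at \<open>l\<close>, so the normalized
 kernel at \<open>l\<close> is comparable to \<open>exp H / \<rho> l\<close> near \<open>l\<close>. Dividing the image of the kernel under the Hankel operator by the kernel
 leaves \<open>cnj g\<close> minus a holomorphic function, which is paired with \<open>z - l\<close> to extract \<open>g' l\<close>.\<close>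

text \<open>The potential \<phi> is only upper semicontinuous and its Laplacian only a measure, so
  \<phi> itself is never differentiated. It is tested on the bumps \<open>bp k t\<close>, powers of
  1 - |w|^2/t^2 cut off at 0: differentiating one in space or in the scale t returns bumps of lower
  exponent, and so the scale derivative and the Laplacian of an average of \<phi> are smoothed
  masses of \<mu> at that scale. The average wanted is the one at scale s * \<rho> z, but \<rho> is
  not smooth. It is assembled from increments over dyadic scales, each multiplied by a smooth cutoff
  in the mass at that scale. Terms in which a derivative hits a cutoff are smaller than the main
  Laplacian by a factor s, so a small fixed s keeps the Laplacian positive. A peak at l needs a
  correction that vanishes at l, hence a weight that is singular there.\<close>

definition pd_at :: "complex \<Rightarrow> (complex \<Rightarrow> 'a::real_normed_vector) \<Rightarrow> 'a \<Rightarrow> complex \<Rightarrow> bool" where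
 "pd_at e f d z \<longleftrightarrow> ((\<lambda>t::real. f (z + e * of_real t)) has_vector_derivative d) (at 0)"

text \<open>A relation instead of an operator such as \<open>dx\<close>: derivatives travel as
  explicit witnesses and obey algebraic rules for real and complex values alike. Only the directions
  1 and \<i> matter in the end.\<close>

definition has_pd :: "complex \<Rightarrow> (complex \<Rightarrow> 'a::real_normed_vector) \<Rightarrow> (complex \<Rightarrow> 'a) \<Rightarrow> bool" where
 "has_pd e f f' \<longleftrightarrow> (\<forall>z. pd_at e f (f' z) z)"

definition csupp :: "(complex \<Rightarrow> 'a::zero) \<Rightarrow> bool" where
 "csupp f \<longleftrightarrow> (\<exists>r. \<forall>z. f z \<noteq> 0 \<longrightarrow> norm z \<le> r)"

text \<open>The measure is a parameter because kernels are convolved both with \<phi> against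
  Lebesgue measure and with the constant 1 against \<mu>.\<close>

definition loc_int :: "complex measure \<Rightarrow> (complex \<Rightarrow> 'a::{banach,second_countable_topology}) \<Rightarrow> bool" where
 "loc_int M f \<longleftrightarrow> (\<forall>R. set_integrable M (ball 0 R) f)"

section \<open>Directional derivatives and differentiation under the integral sign\<close>

lemma hvd_iff_tendsto:
 fixes f :: "real \<Rightarrow> 'a::real_normed_vector"
 shows "(f has_vector_derivative D) (at x) \<longleftrightarrow> ((\<lambda>y. (f y - f x) /\<^sub>R (y - x)) \<longlongrightarrow> D) (at x)"
proof -
 have *: "norm ((1 / norm (y - x)) *\<^sub>R (f y - (f x + (y - x) *\<^sub>R D))) = norm ((f y - f x) /\<^sub>R (y - x) - D)"
  if "y \<noteq> x" for y
 proof -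
  have "(f y - f x) /\<^sub>R (y - x) - D = (1/(y-x)) *\<^sub>R (f y - (f x + (y - x) *\<^sub>R D))"
   using that by (simp add: scaleR_diff_right scaleR_add_right divide_inverse)
  then show ?thesis by simp
 qed
 have "(f has_vector_derivative D) (at x) \<longleftrightarrow>
   ((\<lambda>y. (1 / norm (y - x)) *\<^sub>R (f y - (f x + (y - x) *\<^sub>R D))) \<longlongrightarrow> 0) (at x)"
  unfolding has_vector_derivative_def has_derivative_within by (auto intro: bounded_linear_intros)
 also have "\<dots> \<longleftrightarrow> ((\<lambda>y. norm ((1 / norm (y - x)) *\<^sub>R (f y - (f x + (y - x) *\<^sub>R D)))) \<longlongrightarrow> 0) (at x)"
  by (simp only: tendsto_norm_zero_iff)
 also have "\<dots> \<longleftrightarrow> ((\<lambda>y. norm ((f y - f x) /\<^sub>R (y - x) - D)) \<longlongrightarrow> 0) (at x)"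
  by (rule tendsto_cong) (unfold eventually_at_filter, rule always_eventually, intro allI impI, rule *)
 also have "\<dots> \<longleftrightarrow> ((\<lambda>y. (f y - f x) /\<^sub>R (y - x)) \<longlongrightarrow> D) (at x)"
  by (simp only: tendsto_norm_zero_iff) (rule Lim_null[symmetric])
 finally show ?thesis .
qed

text \<open>Phrased on \<open>closed_segment\<close> so that the endpoints may come in either
  order.\<close>

lemma mvt_bound:
 fixes f :: "real \<Rightarrow> 'a::real_normed_vector"
 assumes "\<And>t. t \<in> closed_segment a b ==> (f has_vector_derivative f' t) (at t)"
  and "\<And>t. t \<in> closed_segment a b ==> norm (f' t) \<le> B"
 shows "norm (f b - f a) \<le> B * \<bar>b - a\<bar>"
proof -
 have "norm (f b - f a) \<le> B * norm (b - a)"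
 proof (rule differentiable_bound[of "closed_segment a b" f "\<lambda>t h. h *\<^sub>R f' t"])
  show "(f has_derivative (\<lambda>h. h *\<^sub>R f' x)) (at x within closed_segment a b)" if "x \<in> closed_segment a b" for x
   using assms(1)[OF that] by (simp add: has_vector_derivative_def has_derivative_at_withinI)
  show "onorm (\<lambda>h. h *\<^sub>R f' x) \<le> B" if "x \<in> closed_segment a b" for x
  proof (rule onorm_bound)
   show "0 \<le> B" using assms(2)[OF that] norm_ge_zero order_trans by blast
   show "norm (h *\<^sub>R f' x) \<le> B * norm h" for h
    using mult_right_mono[OF assms(2)[OF that], of "\<bar>h\<bar>"] by (simp add: mult.commute)
  qed
 qed auto
 then show ?thesis by simp
qed

text \<open>The difference quotients converge pointwise and, by the mean value inequality, are
  dominated by \<open>w\<close>; dominated convergence along sequences gives the limit.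
  Measurability of \<open>b' t0\<close> comes out of the same pointwise limit.\<close>

lemma has_vector_derivative_integral:
 fixes b :: "real \<Rightarrow> 'c \<Rightarrow> 'a::{banach,second_countable_topology}"
 assumes d: "d > 0"
  and int: "\<And>t. \<bar>t - t0\<bar> < d ==> integrable M (b t)"
  and der: "\<And>t x. \<bar>t - t0\<bar> < d ==> x \<in> space M ==> ((\<lambda>t. b t x) has_vector_derivative b' t x) (at t)"
  and bd: "\<And>t x. \<bar>t - t0\<bar> < d ==> x \<in> space M ==> norm (b' t x) \<le> w x"
  and w: "integrable M w"
 shows "((\<lambda>t. \<integral>x. b t x \<partial>M) has_vector_derivative (\<integral>x. b' t0 x \<partial>M)) (at t0)"
proof -
 have seq: "(\<lambda>n. \<integral>x. (b (X n) x - b t0 x) /\<^sub>R (X n - t0) \<partial>M) \<longlonglongrightarrow> (\<integral>x. b' t0 x \<partial>M)"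
  if X: "\<And>n. \<bar>X n - t0\<bar> < d" "\<And>n. X n \<noteq> t0" "X \<longlonglongrightarrow> t0" for X
 proof -
  have lim: "(\<lambda>n. (b (X n) x - b t0 x) /\<^sub>R (X n - t0)) \<longlonglongrightarrow> b' t0 x" if x: "x \<in> space M" for x
  proof -
   have "((\<lambda>y. (b y x - b t0 x) /\<^sub>R (y - t0)) \<longlongrightarrow> b' t0 x) (at t0)"
    using der[of t0 x] d x by (simp add: hvd_iff_tendsto)
   then have "((\<lambda>y. (b y x - b t0 x) /\<^sub>R (y - t0)) \<circ> X) \<longlonglongrightarrow> b' t0 x"
    using X(2,3) unfolding tendsto_at_iff_sequentially by auto
   then show ?thesis by (simp add: o_def)
  qed
  have m: "(\<lambda>x. (b (X n) x - b t0 x) /\<^sub>R (X n - t0)) \<in> borel_measurable M" for n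
   using borel_measurable_integrable[OF int[OF X(1)[of n]]] borel_measurable_integrable[OF int[of t0]] d
   by simp
  show ?thesis
  proof (rule integral_dominated_convergence[where w=w])
   show "b' t0 \<in> borel_measurable M"
    by (rule borel_measurable_LIMSEQ_metric[OF m lim])
   show "AE x in M. norm ((b (X n) x - b t0 x) /\<^sub>R (X n - t0)) \<le> w x" for n
   proof (rule AE_I2)
    fix x assume x: "x \<in> space M"
    have "norm (b (X n) x - b t0 x) \<le> w x * \<bar>X n - t0\<bar>"
    proof (rule mvt_bound[where f'="\<lambda>t. b' t x"])
     fix t assume "t \<in> closed_segment t0 (X n)"
     then have "\<bar>t - t0\<bar> < d"
      using X(1)[of n] by (auto simp: closed_segment_eq_real_ivl split: if_splits)
     then show "((\<lambda>t. b t x) has_vector_derivative b' t x) (at t)" "norm (b' t x) \<le> w x"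
      using der bd x by auto
    qed
    then show "norm ((b (X n) x - b t0 x) /\<^sub>R (X n - t0)) \<le> w x"
     using X(2)[of n] by (simp add: divide_simps)
   qed
  qed (use lim m w in auto)
 qed
 have ev: "\<forall>\<^sub>F y in at t0. \<bar>y - t0\<bar> < d"
  using d by (auto simp: eventually_at dist_real_def)
 have "((\<lambda>y. ((\<integral>x. b y x \<partial>M) - (\<integral>x. b t0 x \<partial>M)) /\<^sub>R (y - t0)) \<longlongrightarrow> (\<integral>x. b' t0 x \<partial>M)) (at t0)"
  unfolding tendsto_at_iff_sequentially
 proof (intro allI impI)
  fix X assume X: "\<forall>i. X i \<in> UNIV - {t0}" "X \<longlonglongrightarrow> t0"
  obtain N where N: "\<And>n. n \<ge> N ==> \<bar>X n - t0\<bar> < d"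
   using LIMSEQ_D[OF X(2) d] by auto
  let ?Y = "\<lambda>n. X (n + N)"
  have Y: "\<And>n. \<bar>?Y n - t0\<bar> < d" "\<And>n. ?Y n \<noteq> t0" "?Y \<longlonglongrightarrow> t0"
   using N X LIMSEQ_ignore_initial_segment[OF X(2), of N] by auto
  have "(\<lambda>n. ((\<integral>x. b (?Y n) x \<partial>M) - (\<integral>x. b t0 x \<partial>M)) /\<^sub>R (?Y n - t0)) \<longlonglongrightarrow> (\<integral>x. b' t0 x \<partial>M)"
   using seq[OF Y] int[OF Y(1)] int[of t0] d by simp
  then show "((\<lambda>y. ((\<integral>x. b y x \<partial>M) - (\<integral>x. b t0 x \<partial>M)) /\<^sub>R (y - t0)) \<circ> X) \<longlonglongrightarrow> (\<integral>x. b' t0 x \<partial>M)"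
   unfolding o_def by (rule LIMSEQ_offset)
 qed
 then show ?thesis by (simp add: hvd_iff_tendsto)
qed

lemma pd_at_line:
 assumes "has_pd e f f'"
 shows "((\<lambda>t::real. f (z + e * of_real t)) has_vector_derivative f' (z + e * of_real t)) (at t)"
proof -
 have "((\<lambda>s::real. f ((z + e * of_real t) + e * of_real s)) has_vector_derivative f' (z + e * of_real t)) (at 0)"
  using assms by (auto simp: has_pd_def pd_at_def)
 then have "((\<lambda>s::real. f (z + e * of_real (t + s))) has_vector_derivative f' (z + e * of_real t)) (at 0)"
  by (simp add: algebra_simps)
 then have "((\<lambda>s::real. f (z + e * of_real s)) has_vector_derivative f' (z + e * of_real t)) (at (t+0))"
  unfolding has_vector_derivative_def by (subst (asm) has_derivative_at, subst has_derivative_at)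
   (simp add: has_derivative_def)
 then show ?thesis by simp
qed

lemma pd_at_const [simp]: "pd_at e (\<lambda>_. c) 0 z"
 by (simp add: pd_at_def)

lemma pd_at_add: "pd_at e f a z ==> pd_at e g b z ==> pd_at e (\<lambda>z. f z + g z) (a + b) z"
 unfolding pd_at_def by (rule has_vector_derivative_add)

lemma pd_at_diff: "pd_at e f a z ==> pd_at e g b z ==> pd_at e (\<lambda>z. f z - g z) (a - b) z"
 unfolding pd_at_def by (rule has_vector_derivative_diff)

lemma pd_at_minus: "pd_at e f a z ==> pd_at e (\<lambda>z. - f z) (- a) z"
 unfolding pd_at_def by (rule has_vector_derivative_minus)

lemma pd_at_mult:
 fixes f g :: "complex \<Rightarrow> 'a::real_normed_algebra"
 shows "pd_at e f a z ==> pd_at e g b z ==> pd_at e (\<lambda>z. f z * g z) (f z * b + a * g z) z"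
 unfolding pd_at_def by (drule (1) has_vector_derivative_mult) simp

lemma pd_at_cmult:
 fixes f :: "complex \<Rightarrow> 'a::real_normed_algebra"
 shows "pd_at e f a z ==> pd_at e (\<lambda>z. c * f z) (c * a) z"
 unfolding pd_at_def by (rule has_vector_derivative_mult_right)

lemma pd_at_sum:
 "(\<And>i. i \<in> I ==> pd_at e (f i) (a i) z) ==> pd_at e (\<lambda>z. \<Sum>i\<in>I. f i z) (\<Sum>i\<in>I. a i) z"
 unfolding pd_at_def by (rule has_vector_derivative_sum)

lemma pd_at_linear:
 assumes "bounded_linear L" "pd_at e f a z"
 shows "pd_at e (\<lambda>z. L (f z)) (L a) z"
 using bounded_linear.has_vector_derivative[OF assms(1)] assms(2) unfolding pd_at_def by blast

lemma pd_at_of_real: "pd_at e f a z ==> pd_at e (\<lambda>z. of_real (f z) :: complex) (of_real a) z"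
 by (rule pd_at_linear[OF bounded_linear_of_real])

lemma pd_at_cnj: "pd_at e f a z ==> pd_at e (\<lambda>z. cnj (f z)) (cnj a) z"
 by (rule pd_at_linear[OF bounded_linear_cnj])

lemma pd_at_chain:
 fixes f :: "complex \<Rightarrow> real"
 assumes "pd_at e f a z" "(g has_real_derivative b) (at (f z))"
 shows "pd_at e (\<lambda>z. g (f z)) (b * a) z"
proof -
 have "((g \<circ> (\<lambda>t::real. f (z + e * of_real t))) has_vector_derivative a *\<^sub>R b) (at 0)"
  using assms unfolding pd_at_def has_real_derivative_iff_has_vector_derivative
  by (intro vector_diff_chain_at) auto
 then show ?thesis by (simp add: pd_at_def o_def mult.commute)
qed

lemma pd_at_cong:
 assumes "pd_at e f a z" "\<forall>\<^sub>F w in nhds z. f w = g w"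
 shows "pd_at e g a z"
proof -
 have "((\<lambda>t::real. z + e * of_real t) \<longlongrightarrow> z + e * of_real 0) (nhds 0)"
  by (intro tendsto_intros filterlim_ident)
 then have "\<forall>\<^sub>F t in nhds (0::real). f (z + e * of_real t) = g (z + e * of_real t)"
  using assms(2) unfolding filterlim_iff by (auto simp only: of_real_0 mult_zero_right add_0_right)
 then show ?thesis
  using assms(1) unfolding pd_at_def
  by (subst (asm) has_vector_derivative_cong_ev[where g="\<lambda>t. g (z + e * of_real t)"])
    (auto dest: eventually_nhds_x_imp_x)
qed

lemma pd_at_field:
 assumes "(f has_field_derivative d) (at z)"
 shows "pd_at e f (e * d) z"
proof -
 have "((f \<circ> (\<lambda>t::real. z + e * of_real t)) has_vector_derivative (e * 1) * d) (at 0)"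
  by (rule field_vector_diff_chain_at) (use assms in \<open>auto intro!: derivative_eq_intros\<close>)
 then show ?thesis by (simp add: pd_at_def o_def)
qed

lemma has_pd_translate: "has_pd e f f' ==> has_pd e (\<lambda>z. f (z + c)) (\<lambda>z. f' (z + c))"
 unfolding has_pd_def pd_at_def
proof
 fix z assume a: "\<forall>z. ((\<lambda>t. f (z + e * of_real t)) has_vector_derivative f' z) (at 0)"
 have "(\<lambda>t::real. f (z + e * of_real t + c)) = (\<lambda>t. f ((z + c) + e * of_real t))"
  by (simp add: algebra_simps)
 then show "((\<lambda>t. f (z + e * of_real t + c)) has_vector_derivative f' (z + c)) (at 0)"
  using a by simp
qed

lemma has_pd_unique: "pd_at e f a z ==> pd_at e f b z ==> a = b"
 unfolding pd_at_def by (rule vector_derivative_unique_at)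

lemma csupp_bound:
 fixes f :: "complex \<Rightarrow> 'a::real_normed_vector"
 assumes "continuous_on UNIV f" "csupp f"
 obtains B r where "B > 0" "r > 0" "\<And>z. norm (f z) \<le> B" "\<And>z. norm z \<ge> r ==> f z = 0"
proof -
 obtain r0 where r0: "\<And>z. f z \<noteq> 0 ==> norm z \<le> r0" using assms(2) unfolding csupp_def by blast
 have "compact (f ` cball 0 r0)"
  using assms(1) by (intro compact_continuous_image) (auto intro: continuous_on_subset)
 then have "bounded (f ` cball 0 r0)" by (rule compact_imp_bounded)
 then obtain B where "\<forall>y\<in>f ` cball 0 r0. norm y \<le> B"
  unfolding bounded_iff by blast
 then have B: "\<And>z. norm z \<le> r0 ==> norm (f z) \<le> B"
  by auto
 show ?thesis
 proof (rule that[of "max B 0 + 1" "max r0 0 + 1"])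
  show "norm (f z) \<le> max B 0 + 1" for z
  proof (cases "f z = 0")
   case False
   then show ?thesis using B[OF r0[of z]] by linarith
  qed simp
  show "f z = 0" if "norm z \<ge> max r0 0 + 1" for z
   using r0[of z] that by linarith
 qed auto
qed

lemma csupp_pd:
 assumes "has_pd e f f'" "csupp f"
 shows "csupp f'"
proof -
 obtain r where r: "\<And>z. f z \<noteq> 0 ==> norm z \<le> r" using assms(2) unfolding csupp_def by blast
 have "f' z = 0" if z: "norm z > r" for z
 proof -
  have "\<forall>\<^sub>F w in nhds z. w \<in> {w. norm w > r}"
   using z by (intro eventually_nhds_in_open) (auto intro: open_Collect_less continuous_intros)
  then have "\<forall>\<^sub>F w in nhds z. 0 = f w"
   by eventually_elim (use r in \<open>metis mem_Collect_eq not_less\<close>)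
  then have "pd_at e f 0 z" by (rule pd_at_cong[OF pd_at_const])
  then show ?thesis using assms(1) has_pd_unique unfolding has_pd_def by blast
 qed
 then show ?thesis unfolding csupp_def by (meson not_less)
qed

section \<open>Convolution with compactly supported kernels\<close>

lemma loc_int_mult:
 fixes f g :: "complex \<Rightarrow> 'a::{real_normed_field,banach,second_countable_topology}"
 assumes "loc_int M f" "g \<in> borel_measurable M" "\<And>z. norm (g z) \<le> B" "\<And>z. norm z \<ge> R ==> g z = 0"
 shows "integrable M (\<lambda>z. g z * f z)"
proof -
 have i: "integrable M (\<lambda>z. indicator (ball 0 R) z *\<^sub>R f z)"
  using assms(1) by (auto simp: loc_int_def set_integrable_def)
 have eq: "(\<lambda>z. g z * f z) = (\<lambda>z. g z * (indicator (ball 0 R) z *\<^sub>R f z))"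
  using assms(4) by (auto simp: fun_eq_iff indicator_def not_less)
 show ?thesis unfolding eq
 proof (rule Bochner_Integration.integrable_bound[where f="\<lambda>z. B * norm (indicator (ball 0 R) z *\<^sub>R f z)"])
  show "integrable M (\<lambda>z. B * norm (indicator (ball 0 R) z *\<^sub>R f z))" using i by (intro integrable_mult_right integrable_norm)
  show "(\<lambda>z. g z * (indicator (ball 0 R) z *\<^sub>R f z)) \<in> borel_measurable M"
   using assms(2) borel_measurable_integrable[OF i] by (rule borel_measurable_times)
  have "norm (g z * (indicator (ball 0 R) z *\<^sub>R f z)) \<le> B * norm (indicator (ball 0 R) z *\<^sub>R f z)" for z
   unfolding norm_mult by (rule mult_right_mono[OF assms(3)]) simp
  then show "AE z in M. norm (g z * (indicator (ball 0 R) z *\<^sub>R f z)) \<le> norm (B * norm (indicator (ball 0 R) z *\<^sub>R f z))"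
   by (intro AE_I2) (unfold real_norm_def, rule order_trans[OF _ abs_ge_self])
 qed
qed

lemma loc_int_borel:
 assumes "loc_int M f" "sets M = sets borel"
 shows "f \<in> borel_measurable M"
proof -
 have "(\<lambda>z. indicator (ball 0 (real n)) z *\<^sub>R f z) \<in> borel_measurable M" for n
  using assms(1) borel_measurable_integrable unfolding loc_int_def set_integrable_def by blast
 moreover have "(\<lambda>n. indicator (ball 0 (real n)) z *\<^sub>R f z) \<longlonglongrightarrow> f z" for z
 proof (rule tendsto_eventually)
  obtain N :: nat where "norm z < real N" using reals_Archimedean2 by blast
  then show "\<forall>\<^sub>F n in sequentially. indicator (ball 0 (real n)) z *\<^sub>R f z = f z"
   by (intro eventually_sequentiallyI[of N]) (auto simp: indicator_def)
 qed
 ultimately show ?thesis by (rule borel_measurable_LIMSEQ_metric)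
qed

lemma integrable_csupp_mult:
 fixes f g :: "complex \<Rightarrow> 'a::{real_normed_field,banach,second_countable_topology}"
 assumes "loc_int M f" "sets M = sets borel" "continuous_on UNIV g" "csupp g"
 shows "integrable M (\<lambda>z. g (z - c) * f z)"
proof -
 obtain B r where "B > 0" "r > 0" and B: "\<And>z. norm (g z) \<le> B" "\<And>z. norm z \<ge> r ==> g z = 0"
  by (rule csupp_bound[OF assms(3,4)]) blast
 have [measurable_cong]: "sets M = sets borel" by fact
 have [measurable]: "g \<in> borel_measurable borel"
  using assms(3) by (rule borel_measurable_continuous_onI)
 show ?thesis
 proof (rule loc_int_mult[OF assms(1), where B=B and R="r + norm c"])
  show "g (z - c) = 0" if "norm z \<ge> r + norm c" for z
   using that norm_triangle_ineq2[of z c] by (intro B(2)) linarith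
  show "(\<lambda>z. g (z - c)) \<in> borel_measurable M" by measurable
  show "norm (g (z - c)) \<le> B" for z by (rule B)
 qed
qed

text \<open>The derivative in \<open>z\<close> falls on the kernel, so local integrability of
  \<open>f\<close> suffices; the minus sign stems from the argument \<open>w - z\<close>. For
  parameters in a unit interval all translated kernels live in one ball, and the sup of
  \<open>k'\<close> times \<open>norm (f w)\<close> on that ball dominates.\<close>

lemma pd_conv:
 fixes f k :: "complex \<Rightarrow> 'a::{real_normed_field,banach,second_countable_topology}"
 assumes pd: "has_pd e k k'" and c: "continuous_on UNIV k" "continuous_on UNIV k'" and cs: "csupp k"
  and M: "sets M = sets borel" and f: "loc_int M f"
 shows "has_pd e (\<lambda>z. \<integral>w. k (w - z) * f w \<partial>M) (\<lambda>z. - (\<integral>w. k' (w - z) * f w \<partial>M))"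
 unfolding has_pd_def pd_at_def
proof
 fix z :: complex
 obtain B r where B: "B > 0" "r > 0" "\<And>z. norm (k' z) \<le> B" "\<And>z. norm z \<ge> r ==> k' z = 0"
  by (rule csupp_bound[OF c(2) csupp_pd[OF pd cs]]) blast
 let ?R = "r + norm z + norm e"
 have sm: "space M = UNIV" using M sets_eq_imp_space_eq by fastforce
 have i: "integrable M (\<lambda>w. indicator (ball 0 ?R) w *\<^sub>R f w)"
  using f by (auto simp: loc_int_def set_integrable_def)
 have "((\<lambda>t. \<integral>w. k (w - (z + e * of_real t)) * f w \<partial>M) has_vector_derivative
   (\<integral>w. - k' (w - (z + e * of_real 0)) * f w \<partial>M)) (at 0)"
 proof (rule has_vector_derivative_integral[where d=1 and w="\<lambda>w. B * norm (indicator (ball 0 ?R) w *\<^sub>R f w)"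
    and b'="\<lambda>t w. - k' (w - (z + e * of_real t)) * f w"])
  show "integrable M (\<lambda>w. k (w - (z + e * of_real t)) * f w)" for t
   by (rule integrable_csupp_mult[OF f M c(1) cs])
  show "integrable M (\<lambda>w. B * norm (indicator (ball 0 ?R) w *\<^sub>R f w))" using i by (intro integrable_mult_right integrable_norm)
  fix t :: real and w :: complex assume t: "\<bar>t - 0\<bar> < 1"
  have "((\<lambda>s. k ((w - z) + e * of_real s)) has_vector_derivative k' ((w - z) + e * of_real (-t))) (at (-t))"
   by (rule pd_at_line[OF pd])
  then have "((\<lambda>s. k ((w - z) + e * of_real s)) \<circ> (\<lambda>s. - s) has_vector_derivative (-1) *\<^sub>R k' ((w - z) + e * of_real (-t))) (at t)"
   by (intro vector_diff_chain_at) (auto intro!: derivative_eq_intros)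
  then have "((\<lambda>s. k (w - (z + e * of_real s))) has_vector_derivative - k' (w - (z + e * of_real t))) (at t)"
   by (simp add: o_def algebra_simps)
  then show "((\<lambda>t. k (w - (z + e * of_real t)) * f w) has_vector_derivative
    - k' (w - (z + e * of_real t)) * f w) (at t)"
   by (rule has_vector_derivative_mult_left)
  show "norm (- k' (w - (z + e * of_real t)) * f w) \<le> B * norm (indicator (ball 0 ?R) w *\<^sub>R f w)"
  proof (cases "norm w < ?R")
   case True
   then show ?thesis using B(3) by (simp add: norm_mult mult_right_mono)
  next
   case False
   have "norm (e * of_real t) \<le> norm e * 1"
    unfolding norm_mult using t by (intro mult_left_mono) auto
   then have "norm (w - (z + e * of_real t)) \<ge> r"
    using False norm_triangle_ineq2[of w "z + e * of_real t"] norm_triangle_ineq[of z "e * of_real t"] by linarith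
   then show ?thesis using B(1) by (simp add: B(4))
  qed
 qed auto
 then show "((\<lambda>t. \<integral>w. k (w - (z + e * of_real t)) * f w \<partial>M) has_vector_derivative
   - (\<integral>w. k' (w - z) * f w \<partial>M)) (at 0)"
  by simp
qed

lemma cont_conv:
 fixes f k :: "complex \<Rightarrow> 'a::{real_normed_field,banach,second_countable_topology}"
 assumes c: "continuous_on UNIV k" and cs: "csupp k"
  and M: "sets M = sets borel" and f: "loc_int M f"
 shows "continuous_on UNIV (\<lambda>z. \<integral>w. k (w - z) * f w \<partial>M)"
 unfolding continuous_on_sequentially o_def
proof (intro ballI allI impI, elim conjE)
 fix X :: "nat \<Rightarrow> complex" and z assume X: "X \<longlonglongrightarrow> z"
 obtain B r where B: "B > 0" "r > 0" "\<And>z. norm (k z) \<le> B" "\<And>z. norm z \<ge> r ==> k z = 0"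
  by (rule csupp_bound[OF c cs]) blast
 obtain K where K: "\<And>n. norm (X n) \<le> K"
  using convergent_imp_bounded[OF X] unfolding bounded_iff by auto
 let ?R = "r + K"
 have i: "integrable M (\<lambda>w. indicator (ball 0 ?R) w *\<^sub>R f w)"
  using f by (auto simp: loc_int_def set_integrable_def)
 show "(\<lambda>n. \<integral>w. k (w - X n) * f w \<partial>M) \<longlonglongrightarrow> (\<integral>w. k (w - z) * f w \<partial>M)"
 proof (rule integral_dominated_convergence[where w="\<lambda>w. B * norm (indicator (ball 0 ?R) w *\<^sub>R f w)"])
  show "integrable M (\<lambda>w. B * norm (indicator (ball 0 ?R) w *\<^sub>R f w))" using i by (intro integrable_mult_right integrable_norm)
  show "AE w in M. (\<lambda>n. k (w - X n) * f w) \<longlonglongrightarrow> k (w - z) * f w"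
   using c by (intro AE_I2 tendsto_mult tendsto_const isCont_tendsto_compose[where g=k] tendsto_diff X)
    (auto simp: continuous_on_eq_continuous_at)
  show "AE w in M. norm (k (w - X n) * f w) \<le> B * norm (indicator (ball 0 ?R) w *\<^sub>R f w)" for n
  proof (rule AE_I2)
   fix w
   show "norm (k (w - X n) * f w) \<le> B * norm (indicator (ball 0 ?R) w *\<^sub>R f w)"
   proof (cases "norm w < ?R")
    case True
    then show ?thesis using B(3) by (simp add: norm_mult mult_right_mono)
   next
    case False
    then have "norm (w - X n) \<ge> r"
     using norm_triangle_ineq2[of w "X n"] K[of n] by linarith
    then show ?thesis using B(1) by (simp add: B(4))
   qed
  qed
 qed (use borel_measurable_integrable[OF integrable_csupp_mult[OF f M c cs]] in auto)
qed

lemma loc_int_continuous: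
 fixes f :: "complex \<Rightarrow> 'a::{banach,second_countable_topology}"
 assumes "continuous_on UNIV f"
 shows "loc_int lborel f"
 unfolding loc_int_def
proof
 fix R
 have "set_integrable lborel (cball 0 R) f"
  unfolding set_integrable_def
  by (rule borel_integrable_compact) (use assms continuous_on_subset in auto)
 then show "set_integrable lborel (ball 0 R) f"
  by (rule set_integrable_subset) auto
qed

lemma integral_lborel_translate:
 fixes f :: "complex \<Rightarrow> 'a::{banach,second_countable_topology}"
 shows "(\<integral>w. f (w + c) \<partial>lborel) = (\<integral>w. f w \<partial>lborel)"
proof (cases "f \<in> borel_measurable borel")
 case True
 have "(\<integral>w. f w \<partial>lborel) = (\<integral>w. f w \<partial>(distr lborel borel ((+) c)))"
  by (simp add: lborel_distr_plus)
 also have "\<dots> = (\<integral>w. f (c + w) \<partial>lborel)"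
  by (rule integral_distr) (use True in auto)
 finally show ?thesis by (simp add: add.commute)
next
 \<comment> \<open>In the nonmeasurable case neither function is integrable, so both integrals take
   the default value 0.\<close>
 case False
 have "\<not> integrable lborel f" using False by (auto dest: borel_measurable_integrable)
 moreover have "\<not> integrable lborel (\<lambda>w. f (w + c))"
 proof
  assume "integrable lborel (\<lambda>w. f (w + c))"
  then have [measurable]: "(\<lambda>w. f (w + c)) \<in> borel_measurable borel" by (auto dest: borel_measurable_integrable)
  have "(\<lambda>w. (\<lambda>w. f (w + c)) (w - c)) \<in> borel_measurable borel" by measurable
  then show False using False by simp
 qed
 ultimately show ?thesis by (simp add: not_integrable_integral_eq)
qed

text \<open>The integral of a translate of \<open>p\<close> does not depend on the translation,
  while differentiating it under the integral gives minus the integral of \<open>p'\<close>. This is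
  the only form of Stokes' formula in the development.\<close>

lemma integral_pd_0:
 fixes p :: "complex \<Rightarrow> 'a::{real_normed_field,banach,second_countable_topology}"
 assumes "has_pd e p p'" "continuous_on UNIV p" "continuous_on UNIV p'" "csupp p"
 shows "(\<integral>w. p' w \<partial>lborel) = 0"
proof -
 have "has_pd e (\<lambda>z. \<integral>w. p (w - z) * 1 \<partial>lborel) (\<lambda>z. - (\<integral>w. p' (w - z) * 1 \<partial>lborel))"
  by (rule pd_conv[OF assms]) (auto intro: loc_int_continuous)
 moreover have "(\<integral>w. p (w - z) \<partial>lborel) = (\<integral>w. p w \<partial>lborel)" for z
  using integral_lborel_translate[of p "-z"] by simp
 ultimately have "pd_at e (\<lambda>z. \<integral>w. p w \<partial>lborel) (- (\<integral>w. p' w \<partial>lborel)) 0"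
  unfolding has_pd_def by (simp, drule_tac x=0 in spec, simp)
 from has_pd_unique[OF this pd_at_const] show ?thesis by simp
qed

section \<open>Radial bumps and their derivatives in space and in scale\<close>

lemma max0_power_deriv:
 assumes "k \<ge> 2"
 shows "((\<lambda>x::real. max 0 x ^ k) has_real_derivative real k * max 0 x ^ (k - 1)) (at x)"
proof -
 consider "x > 0" | "x < 0" | "x = 0" by linarith
 then show ?thesis
 proof cases
  case 1
  have "((\<lambda>x. x ^ k) has_real_derivative real k * x ^ (k - 1)) (at x)"
   by (auto intro!: derivative_eq_intros)
  then have "((\<lambda>x. max 0 x ^ k) has_real_derivative real k * x ^ (k - 1)) (at x)"
   by (rule has_field_derivative_transform_within_open[where S="{0<..}"]) (use 1 in auto)
  then show ?thesis using 1 by simp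
 next
  case 2
  have "((\<lambda>x::real. max 0 x ^ k) has_real_derivative 0) (at x)"
   by (rule has_field_derivative_transform_within_open[where S="{..<0}" and f="\<lambda>_. 0"]) (use 2 assms in auto)
  moreover have "max 0 x ^ (k - 1) = 0" using 2 assms by (simp add: power_0_left)
  ultimately show ?thesis by (simp only: mult_zero_right)
 next
  case 3
  have "continuous (at 0) (\<lambda>h::real. max 0 h ^ (k - 1))" by (intro continuous_intros)
  then have "(\<lambda>h::real. max 0 h ^ (k - 1)) \<midarrow>0\<rightarrow> 0"
   using assms by (simp add: isCont_def power_0_left)
  moreover have "\<forall>\<^sub>F h in at 0. max 0 h ^ (k - 1) = ((max 0 (x + h)) ^ k - (max 0 x) ^ k) / h"
   unfolding eventually_at_filter
  proof (intro always_eventually allI impI)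
   fix h :: real assume h: "h \<noteq> 0"
   obtain j where j: "k = Suc (Suc j)" using assms by (metis add_2_eq_Suc le_Suc_ex)
   show "max 0 h ^ (k - 1) = ((max 0 (x + h)) ^ k - (max 0 x) ^ k) / h"
    using h 3 j by (cases "h > 0") (auto simp: max_def)
  qed
  ultimately have "(\<lambda>h. ((max 0 (x + h)) ^ k - (max 0 x) ^ k) / h) \<midarrow>0\<rightarrow> 0"
   by (rule Lim_transform_eventually)
  then show ?thesis using 3 assms by (simp add: DERIV_def power_0_left)
 qed
qed

text \<open>A truncated polynomial in |w|^2: it is of class C^(k-1), lives on the disc of radius
  \<open>t\<close>, and its derivatives stay in the same family with smaller exponent, which makes
  every later identity between kernels algebraic.\<close>

definition bp :: "nat \<Rightarrow> real \<Rightarrow> complex \<Rightarrow> real" where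
 "bp k t w = max 0 (1 - (cmod w)\<^sup>2 / t\<^sup>2) ^ k"

definition dbp :: "complex \<Rightarrow> nat \<Rightarrow> real \<Rightarrow> complex \<Rightarrow> real" where
 "dbp e k t w = - (2 * real k / t\<^sup>2) * ((w \<bullet> e) * bp (k - 1) t w)"

definition ddbp :: "complex \<Rightarrow> nat \<Rightarrow> real \<Rightarrow> complex \<Rightarrow> real" where
 "ddbp e k t w = - (2 * real k / t\<^sup>2) * ((w \<bullet> e) * dbp e (k - 1) t w + (e \<bullet> e) * bp (k - 1) t w)"

lemma pd_at_norm2: "pd_at e (\<lambda>w. (cmod w)\<^sup>2) (2 * (z \<bullet> e)) z"
 unfolding pd_at_def cmod_power2 inner_complex_def has_real_derivative_iff_has_vector_derivative[symmetric]
 by (auto intro!: derivative_eq_intros simp: algebra_simps)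

lemma pd_at_id: "pd_at e (\<lambda>w. w) e z"
 using pd_at_field[of "\<lambda>w. w" 1 z e] by simp

lemma pd_at_inner: "pd_at e (\<lambda>w. w \<bullet> c) (e \<bullet> c) z"
 by (rule pd_at_linear[OF bounded_linear_inner_left pd_at_id])

lemma bp_pd:
 assumes "k \<ge> 2"
 shows "has_pd e (bp k t) (dbp e k t)"
 unfolding has_pd_def
proof
 fix z
 have "pd_at e (\<lambda>w. 1 - (1/t\<^sup>2) * (cmod w)\<^sup>2) (0 - (1/t\<^sup>2) * (2 * (z \<bullet> e))) z"
  by (intro pd_at_diff pd_at_const pd_at_cmult pd_at_norm2)
 from pd_at_chain[OF this max0_power_deriv[OF assms]]
 show "pd_at e (bp k t) (dbp e k t z) z"
  unfolding bp_def[abs_def] dbp_def by (simp add: field_simps)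
qed

lemma dbp_pd:
 assumes "k \<ge> 3"
 shows "has_pd e (dbp e k t) (ddbp e k t)"
 unfolding has_pd_def
proof
 fix z
 have *: "pd_at e (bp (k - 1) t) (dbp e (k - 1) t z) z"
  by (rule bp_pd[unfolded has_pd_def, rule_format]) (use assms in simp)
 show "pd_at e (dbp e k t) (ddbp e k t z) z"
  unfolding dbp_def[of e k t, abs_def] ddbp_def
  by (intro pd_at_cmult pd_at_mult pd_at_inner *)
qed

lemma bp_nonneg [simp]: "bp k t w \<ge> 0" by (simp add: bp_def)

lemma bp_le_1 [simp]: "bp k t w \<le> 1"
 unfolding bp_def by (rule power_le_one) auto

lemma bp_abs_le [simp]: "\<bar>bp k t w\<bar> \<le> 1"
 by simp

lemma bp_eq_0:
 assumes "k \<ge> 1" "t > 0" "cmod w \<ge> t"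
 shows "bp k t w = 0"
proof -
 have "t\<^sup>2 \<le> (cmod w)\<^sup>2" using assms by (intro power_mono) auto
 then have "max 0 (1 - (cmod w)\<^sup>2 / t\<^sup>2) = 0" using assms(2) by (simp add: field_simps)
 then show ?thesis using assms(1) by (simp add: bp_def power_0_left)
qed

lemma bp_cont [continuous_intros]:
 assumes "continuous_on S f" "continuous_on S g" "\<And>x. x \<in> S ==> f x \<noteq> 0"
 shows "continuous_on S (\<lambda>x. bp k (f x) (g x))"
 unfolding bp_def by (intro continuous_intros assms) (use assms in auto)

lemma dbp_cont [continuous_intros]:
 assumes "continuous_on S f" "continuous_on S g" "\<And>x. x \<in> S ==> f x \<noteq> 0"
 shows "continuous_on S (\<lambda>x. dbp e k (f x) (g x))"
 unfolding dbp_def by (intro continuous_intros assms) (use assms in auto)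

lemma ddbp_cont [continuous_intros]:
 assumes "continuous_on S f" "continuous_on S g" "\<And>x. x \<in> S ==> f x \<noteq> 0"
 shows "continuous_on S (\<lambda>x. ddbp e k (f x) (g x))"
 unfolding ddbp_def by (intro continuous_intros assms) (use assms in auto)

lemma bp_csupp: "k \<ge> 1 ==> t > 0 ==> csupp (bp k t)"
 unfolding csupp_def using bp_eq_0 by (metis nle_le)

lemma dbp_csupp: "k \<ge> 2 ==> t > 0 ==> csupp (dbp e k t)"
 using csupp_pd[OF bp_pd bp_csupp] by auto

text \<open>This identity trades a factor |w|^2/t^2 for a raised exponent; it is what closes the
  family of bumps under the Laplacian and under differentiation in \<open>t\<close>.\<close>

lemma bp_step:
 assumes "k \<ge> 1"
 shows "(cmod w)\<^sup>2 / t\<^sup>2 * bp k t w = bp k t w - bp (Suc k) t w"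
proof (cases "1 - (cmod w)\<^sup>2 / t\<^sup>2 > 0")
 case True
 then show ?thesis by (simp add: bp_def algebra_simps)
next
 case False
 then have "max 0 (1 - (cmod w)\<^sup>2 / t\<^sup>2) = 0" by simp
 then show ?thesis using assms by (simp add: bp_def power_0_left)
qed

text \<open>Adding the directions 1 and \<i> turns the squared inner products into |w|^2, which
  \<open>bp_step\<close> absorbs, so the Laplacian is a combination of two lower bumps.\<close>

lemma ddbp_lap:
 assumes "k \<ge> 3"
 shows "ddbp 1 k t w + ddbp \<i> k t w = (4 * real k / t\<^sup>2) * (real (k - 1) * bp (k - 2) t w - real k * bp (k - 1) t w)"
proof -
 obtain j where j: "k = Suc (Suc (Suc j))"
  using le_Suc_ex[OF assms] by (auto simp: eval_nat_numeral)
 have c: "(Re w)\<^sup>2 + (Im w)\<^sup>2 = (cmod w)\<^sup>2" by (simp add: cmod_power2)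
 have "ddbp 1 k t w + ddbp \<i> k t w =
   (4 * real k / t\<^sup>2) * (real (k - 1) * (((Re w)\<^sup>2 + (Im w)\<^sup>2) / t\<^sup>2 * bp (k - 2) t w) - bp (k - 1) t w)"
  unfolding ddbp_def dbp_def j divide_inverse
  by (simp add: inner_complex_def power2_eq_square algebra_simps)
 also have "\<dots> = (4 * real k / t\<^sup>2) * (real (k - 1) * (bp (k - 2) t w - bp (k - 1) t w) - bp (k - 1) t w)"
  unfolding c using bp_step[of "k - 2" w t] j by simp
 also have "\<dots> = (4 * real k / t\<^sup>2) * (real (k - 1) * bp (k - 2) t w - real k * bp (k - 1) t w)"
  unfolding j by (simp add: algebra_simps)
 finally show ?thesis .
qed

lemma dx_eq: "has_pd 1 f f1 ==> dx f = f1"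
 unfolding has_pd_def pd_at_def dx_def fun_eq_iff
 by (auto intro!: DERIV_imp_deriv simp: has_real_derivative_iff_has_vector_derivative)

lemma dy_eq: "has_pd \<i> f f1 ==> dy f = f1"
 unfolding has_pd_def pd_at_def dy_def fun_eq_iff
 by (auto intro!: DERIV_imp_deriv simp: has_real_derivative_iff_has_vector_derivative)

lemma C1pI:
 assumes "has_pd 1 f f1" "has_pd \<i> f f2" "continuous_on UNIV f1" "continuous_on UNIV f2"
 shows "C1p f"
proof -
 have "(\<lambda>t::real. f (z + of_real t)) differentiable (at 0)" for z
  using assms(1)[unfolded has_pd_def pd_at_def has_real_derivative_iff_has_vector_derivative[symmetric], rule_format, of z]
  unfolding real_differentiable_def by auto
 moreover have "(\<lambda>t::real. f (z + \<i> * of_real t)) differentiable (at 0)" for z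
  using assms(2)[unfolded has_pd_def pd_at_def has_real_derivative_iff_has_vector_derivative[symmetric], rule_format, of z]
  unfolding real_differentiable_def by auto
 ultimately show ?thesis
  using assms dx_eq[OF assms(1)] dy_eq[OF assms(2)] by (simp add: C1p_def)
qed

text \<open>The mixed derivatives of the bump are needed for membership in \<open>C2\<close> only.\<close>

lemma dbp_pd_mixed:
 assumes "k \<ge> 3"
 shows "has_pd c (dbp e k t) (\<lambda>w. - (2 * real k / t\<^sup>2) * ((w \<bullet> e) * dbp c (k - 1) t w + (c \<bullet> e) * bp (k - 1) t w))"
 unfolding has_pd_def
proof
 fix z
 have *: "pd_at c (bp (k - 1) t) (dbp c (k - 1) t z) z"
  by (rule bp_pd[unfolded has_pd_def, rule_format]) (use assms in simp)
 show "pd_at c (dbp e k t) (- (2 * real k / t\<^sup>2) * ((z \<bullet> e) * dbp c (k - 1) t z + (c \<bullet> e) * bp (k - 1) t z)) z"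
  unfolding dbp_def[of e k t, abs_def]
  by (intro pd_at_cmult pd_at_mult pd_at_inner *)
qed

lemma bp_test_fn:
 assumes k: "k \<ge> 3" and t: "t > 0"
 shows "test_fn (\<lambda>w. bp k t (w - z))"
  and "lap (\<lambda>w. bp k t (w - z)) w = (4 * real k / t\<^sup>2) * (real (k - 1) * bp (k - 2) t (w - z) - real k * bp (k - 1) t (w - z))"
proof -
 have p: "has_pd e (\<lambda>w. bp k t (w - z)) (\<lambda>w. dbp e k t (w - z))" for e
  using has_pd_translate[OF bp_pd[of k e t], of "-z"] k by simp
 have m: "has_pd c (\<lambda>w. dbp e k t (w - z))
  (\<lambda>w. - (2 * real k / t\<^sup>2) * (((w-z) \<bullet> e) * dbp c (k - 1) t (w-z) + (c \<bullet> e) * bp (k - 1) t (w-z)))" for e c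
  using has_pd_translate[OF dbp_pd_mixed[of k c e t], of "-z"] k by simp
 have d: "dx (\<lambda>w. bp k t (w - z)) = (\<lambda>w. dbp 1 k t (w - z))" "dy (\<lambda>w. bp k t (w - z)) = (\<lambda>w. dbp \<i> k t (w - z))"
  by (rule dx_eq dy_eq p)+
 have "C1p (\<lambda>w. bp k t (w - z))"
  by (rule C1pI[OF p p]) (use t in \<open>auto intro!: continuous_intros\<close>)
 moreover have "C1p (\<lambda>w. dbp e k t (w - z))" for e
  by (rule C1pI[OF m m]) (use t in \<open>auto intro!: continuous_intros\<close>)
 ultimately have "C2 (\<lambda>w. bp k t (w - z))" by (simp add: C2_def d)
 moreover have "compact (closure {w. bp k t (w - z) \<noteq> 0})"
 proof -
  have "{w. bp k t (w - z) \<noteq> 0} \<subseteq> cball z t"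
   using bp_eq_0[of k t] k t by (force simp: dist_norm norm_minus_commute)
  then have "bounded {w. bp k t (w - z) \<noteq> 0}" using bounded_subset bounded_cball by blast
  then show ?thesis by (simp add: compact_closure)
 qed
 ultimately show "test_fn (\<lambda>w. bp k t (w - z))" by (simp add: test_fn_def)
 have "has_pd e (\<lambda>w. dbp e k t (w - z)) (\<lambda>w. ddbp e k t (w - z))" for e
  using has_pd_translate[OF dbp_pd[of k e t], of "-z"] k by simp
 then have "lap (\<lambda>w. bp k t (w - z)) w = ddbp 1 k t (w - z) + ddbp \<i> k t (w - z)"
  unfolding lap_def d using dx_eq dy_eq by metis
 then show "lap (\<lambda>w. bp k t (w - z)) w = (4 * real k / t\<^sup>2) * (real (k - 1) * bp (k - 2) t (w - z) - real k * bp (k - 1) t (w - z))"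
  using ddbp_lap[OF k] by simp
qed

lemma bp_deriv_t:
 assumes "k \<ge> 2" "t > 0"
 shows "((\<lambda>t. bp k t w) has_real_derivative (2 * real k / t) * (bp (k - 1) t w - bp k t w)) (at t)"
proof -
 have "((\<lambda>t. 1 - (cmod w)\<^sup>2 / t\<^sup>2) has_real_derivative 2 * (cmod w)\<^sup>2 / t^3) (at t)"
  using assms(2) by (auto intro!: derivative_eq_intros simp: field_simps power2_eq_square power3_eq_cube)
 from DERIV_chain2[OF max0_power_deriv[OF assms(1)] this]
 have "((\<lambda>t. bp k t w) has_real_derivative real k * bp (k - 1) t w * (2 * (cmod w)\<^sup>2 / t^3)) (at t)"
  by (simp add: bp_def[abs_def])
 also have "real k * bp (k - 1) t w * (2 * (cmod w)\<^sup>2 / t^3) = (2 * real k / t) * ((cmod w)\<^sup>2 / t\<^sup>2 * bp (k - 1) t w)"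
  using assms(2) by (simp add: power2_eq_square power3_eq_cube mult_ac)
 also have "\<dots> = (2 * real k / t) * (bp (k - 1) t w - bp k t w)"
  using bp_step[of "k - 1" w t] assms(1) by simp
 finally show ?thesis .
qed

lemma integrable_bp:
 fixes f :: "complex \<Rightarrow> 'a::{real_normed_field,banach,second_countable_topology}"
 assumes "loc_int M f" "sets M = sets borel" "k \<ge> 1" "t > 0"
 shows "integrable M (\<lambda>w. of_real (bp k t (w - z)) * f w)"
proof (rule integrable_csupp_mult[OF assms(1,2), of "\<lambda>w. of_real (bp k t w)"])
 show "continuous_on UNIV (\<lambda>w. of_real (bp k t w) :: 'a)" using assms by (intro continuous_intros) auto
 show "csupp (\<lambda>w. of_real (bp k t w) :: 'a)" using bp_csupp[of k t] assms by (simp add: csupp_def)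
qed

text \<open>The kernel on the right is the Laplacian of \<open>bp 4 t\<close> divided by
  \<open>8 * t\<close>. Hence the change of an average with its scale is always a pairing with a
  Laplacian: zero for constants (\<open>integral_bp3\<close>), a mass of \<mu> for the potential
  (\<open>A_deriv_t\<close>).\<close>

lemma bp3_avg_deriv:
 fixes f :: "complex \<Rightarrow> 'a::{real_normed_field,banach,second_countable_topology}"
 assumes f: "loc_int M f" and M: "sets M = sets borel" and t: "t > 0"
 shows "((\<lambda>t. \<integral>w. of_real (bp 3 t (w - z) / t\<^sup>2) * f w \<partial>M) has_vector_derivative
   (\<integral>w. of_real ((2 / t^3) * (3 * bp 2 t (w - z) - 4 * bp 3 t (w - z))) * f w \<partial>M)) (at t)"
proof (rule has_vector_derivative_integral[where d="t/2"
   and b'="\<lambda>t w. of_real ((2 / t^3) * (3 * bp 2 t (w - z) - 4 * bp 3 t (w - z))) * f w"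
   and w="\<lambda>w. (112/t^3) * norm (indicator (ball 0 (norm z + 2*t)) w *\<^sub>R f w)"])
 have i: "integrable M (\<lambda>w. indicator (ball 0 (norm z + 2*t)) w *\<^sub>R f w)"
  using f by (auto simp: loc_int_def set_integrable_def)
 show "integrable M (\<lambda>w. (112/t^3) * norm (indicator (ball 0 (norm z + 2*t)) w *\<^sub>R f w))"
  using i by (intro integrable_mult_right integrable_norm)
 fix s assume "\<bar>s - t\<bar> < t / 2"
 then have s: "s > t / 2" "s < 2 * t" "s > 0" using t by linarith+
 have "integrable M (\<lambda>w. of_real (1/s\<^sup>2) * (of_real (bp 3 s (w - z)) * f w))"
  by (intro integrable_mult_right integrable_bp[OF f M]) (use s in auto)
 then show "integrable M (\<lambda>w. of_real (bp 3 s (w - z) / s\<^sup>2) * f w)"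
  by (simp add: mult.assoc)
 fix w :: complex
 have "((\<lambda>t. bp 3 t (w - z) / t\<^sup>2) has_real_derivative (2 / s^3) * (3 * bp 2 s (w - z) - 4 * bp 3 s (w - z))) (at s)"
  using s(3) by (auto intro!: derivative_eq_intros bp_deriv_t simp: field_simps power2_eq_square power3_eq_cube)
 then have "((\<lambda>t. of_real (bp 3 t (w - z) / t\<^sup>2) :: 'a) has_vector_derivative of_real ((2 / s^3) * (3 * bp 2 s (w - z) - 4 * bp 3 s (w - z)))) (at s)"
  unfolding has_real_derivative_iff_has_vector_derivative
  by (rule bounded_linear.has_vector_derivative[OF bounded_linear_of_real])
 then show "((\<lambda>t. of_real (bp 3 t (w - z) / t\<^sup>2) * f w) has_vector_derivative
   of_real ((2 / s^3) * (3 * bp 2 s (w - z) - 4 * bp 3 s (w - z))) * f w) (at s)"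
  by (rule has_vector_derivative_mult_left)
 show "norm (of_real ((2 / s^3) * (3 * bp 2 s (w - z) - 4 * bp 3 s (w - z))) * f w)
   \<le> (112/t^3) * norm (indicator (ball 0 (norm z + 2*t)) w *\<^sub>R f w)"
 proof (cases "norm w < norm z + 2 * t")
  case True
  \<comment> \<open>The constant 112 is 16 * 7: the scale stays above \<open>t/2\<close>, and a
    combination 3x - 4y of values in [0,1] has modulus at most 7.\<close>
  have "(t/2)^3 \<le> s^3" using s t by (intro power_mono) auto
  then have "2 / s^3 \<le> 16 / t^3" using t s by (simp add: field_simps power_divide)
  moreover have "\<bar>3 * bp 2 s (w - z) - 4 * bp 3 s (w - z)\<bar> \<le> 7"
   using bp_le_1[of 2 s "w - z"] bp_le_1[of 3 s "w - z"] bp_nonneg[of 2 s "w - z"] bp_nonneg[of 3 s "w - z"]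
   by (simp only: abs_le_iff) linarith
  ultimately have "\<bar>2 / s^3\<bar> * \<bar>3 * bp 2 s (w - z) - 4 * bp 3 s (w - z)\<bar> \<le> (16 / t^3) * 7"
   using s(3) t by (intro mult_mono) auto
  then have "\<bar>(2 / s^3) * (3 * bp 2 s (w - z) - 4 * bp 3 s (w - z))\<bar> \<le> 112 / t^3"
   unfolding abs_mult by simp
  then have "\<bar>(2 / s^3) * (3 * bp 2 s (w - z) - 4 * bp 3 s (w - z))\<bar> * norm (f w) \<le> 112 / t^3 * norm (f w)"
   by (rule mult_right_mono) simp
  then show ?thesis using True unfolding norm_mult norm_of_real by simp
 next
  case False
  then have "norm (w - z) \<ge> s" using norm_triangle_ineq2[of w z] s by linarith
  then show ?thesis using s t by (simp add: bp_eq_0)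
 qed
qed (use t in auto)

text \<open>The mass of the unit bump, carried along unevaluated; the estimates depend on it through
  its positivity.\<close>

definition J3 :: real where "J3 = (\<integral>w. bp 3 1 w \<partial>lborel)"

lemma integral_lap_bp4: "t > 0 ==> (\<integral>w. 3 * bp 2 t (w - z) - 4 * bp 3 t (w - z) \<partial>lborel) = 0"
proof -
 assume t: "t > 0"
 have d: "(\<integral>w. ddbp e 4 t w \<partial>lborel) = 0" for e
  by (rule integral_pd_0[OF dbp_pd]) (use t in \<open>auto intro!: continuous_intros dbp_csupp\<close>)
 have i: "integrable lborel (\<lambda>w. ddbp e 4 t w)" for e
 proof -
  have "integrable lborel (\<lambda>w. ddbp e 4 t (w - 0) * 1)"
   using csupp_pd[OF dbp_pd[of 4 e t] dbp_csupp[of 4 t e]] t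
   by (intro integrable_csupp_mult loc_int_continuous) (auto intro!: continuous_intros)
  then show ?thesis by simp
 qed
 have "0 = (\<integral>w. ddbp 1 4 t w + ddbp \<i> 4 t w \<partial>lborel)" by (simp add: i d)
 also have "\<dots> = (\<integral>w. (16 / t\<^sup>2) * (3 * bp 2 t w - 4 * bp 3 t w) \<partial>lborel)"
  by (subst ddbp_lap) auto
 also have "\<dots> = (16 / t\<^sup>2) * (\<integral>w. 3 * bp 2 t w - 4 * bp 3 t w \<partial>lborel)"
  by (rule integral_mult_right_zero)
 finally have "(\<integral>w. 3 * bp 2 t w - 4 * bp 3 t w \<partial>lborel) = 0" using t by simp
 then show ?thesis
  using integral_lborel_translate[of "\<lambda>w. 3 * bp 2 t w - 4 * bp 3 t w" "-z"] by simp
qed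

lemma const_pos_reals:
 fixes G :: "real \<Rightarrow> 'a::real_normed_vector"
 assumes "\<And>t. t > 0 ==> (G has_vector_derivative 0) (at t)" "s > 0" "t > 0"
 shows "G s = G t"
proof -
 have "norm (G s - G t) \<le> 0 * \<bar>s - t\<bar>"
  by (rule mvt_bound[where f'="\<lambda>_. 0"]) (use assms in \<open>auto simp: closed_segment_eq_real_ivl split: if_splits\<close>)
 then show ?thesis by simp
qed

text \<open>Instead of a change of variables: the integral of \<open>bp 3 t / t^2\<close> has
  derivative zero in \<open>t\<close>, because by \<open>bp3_avg_deriv\<close> that derivative is
  the integral of the Laplacian of a compactly supported function.\<close>

lemma integral_bp3: "t > 0 ==> (\<integral>w. bp 3 t (w - z) \<partial>lborel) = J3 * t\<^sup>2"
proof -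
 assume t: "t > 0"
 have "((\<lambda>t. \<integral>w. of_real (bp 3 t (w - z) / t\<^sup>2) * (1::real) \<partial>lborel) has_vector_derivative 0) (at s)" if "s > 0" for s
 proof -
  have "(\<integral>w. of_real ((2 / s^3) * (3 * bp 2 s (w - z) - 4 * bp 3 s (w - z))) * (1::real) \<partial>lborel) =
    (\<integral>w. (2 / s^3) * (3 * bp 2 s (w - z) - 4 * bp 3 s (w - z)) \<partial>lborel)" by simp
  also have "\<dots> = (2 / s^3) * (\<integral>w. 3 * bp 2 s (w - z) - 4 * bp 3 s (w - z) \<partial>lborel)"
   by (rule integral_mult_right_zero)
  finally show ?thesis
   using bp3_avg_deriv[of lborel "\<lambda>_. 1::real" s z] that integral_lap_bp4[OF that, of z]
   by (simp only: loc_int_continuous continuous_on_const sets_lborel mult_zero_right)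
 qed
 from const_pos_reals[OF this t zero_less_one]
 have "(\<integral>w. bp 3 t (w - z) / t\<^sup>2 \<partial>lborel) = (\<integral>w. bp 3 1 (w - z) \<partial>lborel)" by simp
 also have "\<dots> = J3" unfolding J3_def using integral_lborel_translate[of "bp 3 1" "-z"] by simp
 finally show ?thesis using t by (simp add: field_simps)
qed

lemma J3_pos: "J3 > 0"
proof -
 have i: "integrable lborel (bp 3 1)"
  using integrable_bp[of lborel "\<lambda>_. 1::real" 3 1 0] by (simp add: loc_int_continuous)
 have "J3 \<ge> 0" unfolding J3_def by (rule integral_nonneg_AE) auto
 moreover have "J3 \<noteq> 0"
 proof
  assume "J3 = 0"
  then have "AE w in lborel. bp 3 1 w = 0"
   unfolding J3_def using i by (subst (asm) integral_nonneg_eq_0_iff_AE) auto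
  then have "AE w in lborel. w \<notin> ball (0::complex) 1"
  proof eventually_elim
   fix w assume "bp 3 1 w = 0"
   then have "1 - (cmod w)\<^sup>2 \<le> 0" by (auto simp: bp_def max_def split: if_splits)
   then show "w \<notin> ball (0::complex) 1"
    using power_less_one_iff[of "cmod w" 2] by (auto simp: not_less abs_square_le_1)
  qed
  then have "emeasure lborel (ball (0::complex) 1) = 0"
   by (subst (asm) AE_iff_measurable[where N="ball 0 1"]) auto
  then show False
   using emeasure_lborel_ball_finite content_ball_pos[of 1 "0::complex"] by (simp add: measure_def)
 qed
 ultimately show ?thesis by simp
qed

lemma bp_cont_eta [continuous_intros, simp]:
 "t \<noteq> 0 ==> continuous_on S (bp k t)" "t \<noteq> 0 ==> continuous_on S (dbp e k t)"
 "t \<noteq> 0 ==> continuous_on S (ddbp e k t)"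
 by (intro continuous_intros; simp)+

section \<open>Integration by parts, cutoffs, and Weyl's lemma for dbar\<close>

definition C1c :: "(complex \<Rightarrow> 'a::real_normed_vector) \<Rightarrow> (complex \<Rightarrow> 'a) \<Rightarrow> (complex \<Rightarrow> 'a) \<Rightarrow> bool" where
 "C1c f fx fy \<longleftrightarrow> has_pd 1 f fx \<and> has_pd \<i> f fy \<and>
   continuous_on UNIV f \<and> continuous_on UNIV fx \<and> continuous_on UNIV fy"

text \<open>For C^2 functions one would integrate by parts twice. With C^1 only, one integration by
  parts is done with \<open>a\<close> translated by \<open>z\<close>, which moves the translation
  onto \<open>b\<close>; both sides are then differentiated in the real direction at 0, where the
  kernel rule of \<open>pd_conv\<close> applies to each.\<close>

lemma integral_jacobian_C1c:
 fixes a b :: "complex \<Rightarrow> 'a::{real_normed_field,banach,second_countable_topology}"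
 assumes a: "C1c a ax ay" "csupp a" and b: "C1c b bx by'" "csupp b"
 shows "(\<integral>w. ax w * by' w \<partial>lborel) = (\<integral>w. ay w * bx w \<partial>lborel)"
proof -
 note A = a(1)[unfolded C1c_def] and B = b(1)[unfolded C1c_def]
 have ca: "csupp ay" "csupp ax" and cb: "csupp by'"
  using csupp_pd A B a b by blast+
 have ibp: "(\<integral>w. a (w - z) * by' w \<partial>lborel) = - (\<integral>w. b (w - (-z)) * ay w \<partial>lborel)" for z
 proof -
  have pa: "has_pd e (\<lambda>w. a (w - z)) (\<lambda>w. a' (w - z))" if "has_pd e a a'" for e a'
   using has_pd_translate[OF that, of "-z"] by simp
  have cz: "continuous_on UNIV (\<lambda>w. g (w - z))" if "continuous_on UNIV g" for g :: "complex \<Rightarrow> 'a"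
   by (rule continuous_on_compose2[OF that]) (auto intro!: continuous_intros)
  have "has_pd \<i> (\<lambda>w. a (w - z) * b w) (\<lambda>w. a (w - z) * by' w + ay (w - z) * b w)"
   using pa[of \<i> ay] A B unfolding has_pd_def by (auto intro!: pd_at_mult)
  moreover have "csupp (\<lambda>w. a (w - z) * b w)" using b(2) unfolding csupp_def by auto
  ultimately have "(\<integral>w. a (w - z) * by' w + ay (w - z) * b w \<partial>lborel) = 0"
   using A B by (intro integral_pd_0) (auto intro!: continuous_intros cz)
  moreover have "integrable lborel (\<lambda>w. a (w - z) * by' w)" "integrable lborel (\<lambda>w. ay (w - z) * b w)"
   using A B ca a(2) by (auto intro!: integrable_csupp_mult loc_int_continuous)
  ultimately have "(\<integral>w. a (w - z) * by' w \<partial>lborel) = - (\<integral>w. ay (w - z) * b w \<partial>lborel)"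
   by (simp add: eq_neg_iff_add_eq_0)
  also have "(\<integral>w. ay (w - z) * b w \<partial>lborel) = (\<integral>w. b (w - (-z)) * ay w \<partial>lborel)"
   using integral_lborel_translate[of "\<lambda>w. ay (w - z) * b w" z] by (simp add: mult.commute)
  finally show ?thesis .
 qed
 have 1: "pd_at 1 (\<lambda>z. \<integral>w. a (w - z) * by' w \<partial>lborel) (- (\<integral>w. ax (w - 0) * by' w \<partial>lborel)) 0"
 proof -
  have "has_pd 1 (\<lambda>z. \<integral>w. a (w - z) * by' w \<partial>lborel) (\<lambda>z. - (\<integral>w. ax (w - z) * by' w \<partial>lborel))"
   by (rule pd_conv) (use A B a(2) in \<open>auto intro: loc_int_continuous\<close>)
  then show ?thesis unfolding has_pd_def by blast
 qed
 have "pd_at 1 (\<lambda>z. \<integral>w. b (w - z) * ay w \<partial>lborel) (- (\<integral>w. bx (w - z) * ay w \<partial>lborel)) z" for z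
 proof -
  have "has_pd 1 (\<lambda>z. \<integral>w. b (w - z) * ay w \<partial>lborel) (\<lambda>z. - (\<integral>w. bx (w - z) * ay w \<partial>lborel))"
   by (rule pd_conv) (use A B b(2) in \<open>auto intro: loc_int_continuous\<close>)
  then show ?thesis unfolding has_pd_def by blast
 qed
 from this[of 0, unfolded pd_at_def]
 have 2: "((\<lambda>t. \<integral>w. b (w - of_real t) * ay w \<partial>lborel) has_vector_derivative (- (\<integral>w. bx w * ay w \<partial>lborel))) (at (- 0))"
  by simp
 have "((\<lambda>t. \<integral>w. b (w - of_real t) * ay w \<partial>lborel) \<circ> (\<lambda>s. - s) has_vector_derivative (-1) *\<^sub>R (- (\<integral>w. bx w * ay w \<partial>lborel))) (at 0)"
  by (rule vector_diff_chain_at[where f="\<lambda>s. - s" and x=0]) (use 2 in \<open>auto intro!: derivative_eq_intros\<close>)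
 then have 3: "pd_at 1 (\<lambda>z. - (\<integral>w. b (w - (-z)) * ay w \<partial>lborel)) (- (\<integral>w. bx w * ay w \<partial>lborel)) 0"
  unfolding pd_at_def by (intro has_vector_derivative_minus) (simp add: o_def)
 from has_pd_unique[OF 1[unfolded ibp] 3]
 have "(\<integral>w. ax w * by' w \<partial>lborel) = (\<integral>w. bx w * ay w \<partial>lborel)" by simp
 then show ?thesis by (simp add: mult.commute)
qed

text \<open>A C^2 step from 1 (up to 1/2) to 0 (from 1 on), since the cube of a positive part is
  C^2. It serves with two arguments: |w|^2/R^2, as a cutoff in the plane, and a mass of \<mu>, as a
  selector of scales in \<open>FF\<close>.\<close>

definition cutF :: "real \<Rightarrow> real" where
 "cutF m = max 0 (1 - max 0 (2 * m - 1) ^ 3) ^ 3"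
definition cutF' :: "real \<Rightarrow> real" where
 "cutF' m = - 18 * (max 0 (1 - max 0 (2 * m - 1) ^ 3) ^ 2 * max 0 (2 * m - 1) ^ 2)"
definition cutF'' :: "real \<Rightarrow> real" where
 "cutF'' m = - 18 * (max 0 (1 - max 0 (2 * m - 1) ^ 3) ^ 2 * (4 * max 0 (2 * m - 1))
   + (2 * max 0 (1 - max 0 (2 * m - 1) ^ 3) * (- (6 * max 0 (2 * m - 1) ^ 2))) * max 0 (2 * m - 1) ^ 2)"

lemma cutF_deriv: "(cutF has_real_derivative cutF' m) (at m)"
proof -
 have 1: "((\<lambda>m. max 0 (2 * m - 1) ^ 3) has_real_derivative 3 * max 0 (2 * m - 1) ^ 2 * 2) (at m)"
  by (rule DERIV_chain2[OF max0_power_deriv[of 3, simplified]]) (auto intro!: derivative_eq_intros)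
 have 2: "((\<lambda>m. 1 - max 0 (2 * m - 1) ^ 3) has_real_derivative 0 - 3 * max 0 (2 * m - 1) ^ 2 * 2) (at m)"
  by (intro DERIV_diff 1 DERIV_const)
 from DERIV_chain2[OF max0_power_deriv[of 3, simplified] 2]
 show ?thesis unfolding cutF_def[abs_def] cutF'_def by (simp add: algebra_simps)
qed

lemma cutF'_deriv: "(cutF' has_real_derivative cutF'' m) (at m)"
proof -
 have 1: "((\<lambda>m. max 0 (2 * m - 1) ^ 3) has_real_derivative 3 * max 0 (2 * m - 1) ^ 2 * 2) (at m)"
  by (rule DERIV_chain2[OF max0_power_deriv[of 3, simplified]]) (auto intro!: derivative_eq_intros)
 have 2: "((\<lambda>m. 1 - max 0 (2 * m - 1) ^ 3) has_real_derivative 0 - 3 * max 0 (2 * m - 1) ^ 2 * 2) (at m)"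
  by (intro DERIV_diff 1 DERIV_const)
 have 3: "((\<lambda>m. max 0 (2 * m - 1) ^ 2) has_real_derivative 2 * max 0 (2 * m - 1) * 2) (at m)"
  by (rule DERIV_chain2[OF max0_power_deriv[of 2, simplified]]) (auto intro!: derivative_eq_intros)
 have 4: "((\<lambda>m. max 0 (1 - max 0 (2 * m - 1) ^ 3) ^ 2) has_real_derivative
   2 * max 0 (1 - max 0 (2 * m - 1) ^ 3) * (0 - 3 * max 0 (2 * m - 1) ^ 2 * 2)) (at m)"
  by (rule DERIV_chain2[OF max0_power_deriv[of 2, simplified] 2])
 show ?thesis unfolding cutF'_def[abs_def] cutF''_def
  by (rule DERIV_cong[OF DERIV_cmult[OF DERIV_mult[OF 4 3]]]) (simp add: algebra_simps)
qed

lemma cutF_range: "0 \<le> cutF m" "cutF m \<le> 1"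
 unfolding cutF_def by (auto intro!: power_le_one)

lemma cutF_1: "m \<le> 1/2 ==> cutF m = 1" and cutF'_1: "m \<le> 1/2 ==> cutF' m = 0" and cutF''_1: "m \<le> 1/2 ==> cutF'' m = 0"
proof -
 have "m \<le> 1/2 ==> max 0 (2 * m - 1) = 0" by simp
 then show "m \<le> 1/2 ==> cutF m = 1" "m \<le> 1/2 ==> cutF' m = 0" "m \<le> 1/2 ==> cutF'' m = 0"
  by (simp_all add: cutF_def cutF'_def cutF''_def)
qed

lemma cutF_aux: "m \<ge> 1 ==> max 0 (1 - max 0 (2 * m - 1) ^ 3) = (0::real)"
 using one_le_power[of "max 0 (2 * m - 1)" 3] by simp

lemma cutF_0: "m \<ge> 1 ==> cutF m = 0" and cutF'_0: "m \<ge> 1 ==> cutF' m = 0" and cutF''_0: "m \<ge> 1 ==> cutF'' m = 0"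
 by (simp_all add: cutF_def cutF'_def cutF''_def cutF_aux)

lemma cutF_antimono: "m \<le> n ==> cutF n \<le> cutF m"
proof -
 assume "m \<le> n"
 then have "max 0 (2 * m - 1) ^ 3 \<le> max 0 (2 * n - 1) ^ 3" by (intro power_mono) auto
 then have "1 - max 0 (2 * n - 1) ^ 3 \<le> 1 - max 0 (2 * m - 1) ^ 3" by linarith
 then show ?thesis unfolding cutF_def by (intro power_mono max.mono) auto
qed

lemma cutF'_bound: "\<bar>cutF' m\<bar> \<le> 18" and cutF''_bound: "\<bar>cutF'' m\<bar> \<le> 288"
proof -
 show "\<bar>cutF' m\<bar> \<le> 18"
 proof (cases "m \<ge> 1")
  case False
  have "max 0 (2*m-1) \<le> 1" using False by auto
  moreover have "max 0 (1 - max 0 (2 * m - 1) ^ 3) \<le> 1" by auto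
  ultimately have "max 0 (1 - max 0 (2 * m - 1) ^ 3) ^ 2 * max 0 (2 * m - 1) ^ 2 \<le> 1 * 1"
   by (intro mult_mono power_le_one) auto
  then show ?thesis unfolding cutF'_def by (simp add: abs_mult)
 qed (simp add: cutF'_0)
 show "\<bar>cutF'' m\<bar> \<le> 288"
 proof (cases "m \<ge> 1")
  case False
  let ?u = "max 0 (2*m-1)" and ?v = "max 0 (1 - max 0 (2 * m - 1) ^ 3)"
  have u: "0 \<le> ?u" "?u \<le> 1" "0 \<le> ?v" "?v \<le> 1" using False by auto
  have "?v ^ 2 * (4 * ?u) \<le> 1 * 4" using u by (intro mult_mono power_le_one) auto
  moreover have "0 \<le> ?v ^ 2 * (4 * ?u)" using u by auto
  moreover have "(2 * ?v * (6 * ?u ^ 2)) * ?u ^ 2 \<le> (2 * 6) * 1"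
   using u by (intro mult_mono power_le_one) (auto intro: power_le_one)
  moreover have "0 \<le> (2 * ?v * (6 * ?u ^ 2)) * ?u ^ 2" using u by auto
  moreover have "(2 * ?v * (- (6 * ?u ^ 2))) * ?u ^ 2 = - ((2 * ?v * (6 * ?u ^ 2)) * ?u ^ 2)"
   by (simp only: mult_minus_left mult_minus_right)
  \<comment> \<open>The two terms are bounded by 4 and 12, and 18 * (4 + 12) = 288.\<close>
  ultimately have "\<bar>?v ^ 2 * (4 * ?u) + (2 * ?v * (- (6 * ?u ^ 2))) * ?u ^ 2\<bar> \<le> 16"
   unfolding abs_le_iff by linarith
  then show ?thesis unfolding cutF''_def abs_mult[of "- 18"] abs_neg_numeral by linarith
 qed (simp add: cutF''_0)
qed

lemma cutF_cont [continuous_intros]: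
 assumes "continuous_on S f"
 shows "continuous_on S (\<lambda>x. cutF (f x))" "continuous_on S (\<lambda>x. cutF' (f x))" "continuous_on S (\<lambda>x. cutF'' (f x))"
 unfolding cutF_def cutF'_def cutF''_def by (intro continuous_intros assms)+

definition cutoff :: "real \<Rightarrow> complex \<Rightarrow> real" where
 "cutoff R w = cutF ((cmod w)\<^sup>2 / R\<^sup>2)"
definition dcutoff :: "complex \<Rightarrow> real \<Rightarrow> complex \<Rightarrow> real" where
 "dcutoff e R w = cutF' ((cmod w)\<^sup>2 / R\<^sup>2) * (2 * (w \<bullet> e) / R\<^sup>2)"

lemma cutoff_pd: "has_pd e (cutoff R) (dcutoff e R)"
 unfolding has_pd_def
proof
 fix z
 have "pd_at e (\<lambda>w. (1/R\<^sup>2) * (cmod w)\<^sup>2) ((1/R\<^sup>2) * (2 * (z \<bullet> e))) z"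
  by (intro pd_at_cmult pd_at_norm2)
 then have "pd_at e (\<lambda>w. (cmod w)\<^sup>2 / R\<^sup>2) (2 * (z \<bullet> e) / R\<^sup>2) z" by simp
 from pd_at_chain[OF this cutF_deriv]
 show "pd_at e (cutoff R) (dcutoff e R z) z"
  unfolding cutoff_def[abs_def] dcutoff_def .
qed

lemma cutoff_cont: "R > 0 ==> continuous_on S (cutoff R)" "R > 0 ==> continuous_on S (dcutoff e R)"
 unfolding cutoff_def[abs_def] dcutoff_def[abs_def] by (auto intro!: continuous_intros)

lemma cutoff_0:
 assumes "R > 0" "cmod w \<ge> R"
 shows "cutoff R w = 0" "dcutoff e R w = 0"
proof -
 have "(cmod w)\<^sup>2 / R\<^sup>2 \<ge> 1" using assms power_mono[of R "cmod w" 2] by (simp add: field_simps)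
 then show "cutoff R w = 0" "dcutoff e R w = 0" by (simp_all add: cutoff_def dcutoff_def cutF_0 cutF'_0)
qed

lemma cutoff_1:
 assumes "R > 0" "cmod w \<le> R / 2"
 shows "cutoff R w = 1" "dcutoff e R w = 0"
proof -
 have "(cmod w)\<^sup>2 \<le> (R/2)\<^sup>2" using assms by (intro power_mono) auto
 then have "(cmod w)\<^sup>2 / R\<^sup>2 \<le> (R/2)\<^sup>2 / R\<^sup>2" by (intro divide_right_mono) auto
 also have "\<dots> \<le> 1/2" using assms by (simp add: power_divide)
 finally have "(cmod w)\<^sup>2 / R\<^sup>2 \<le> 1/2" .
 then show "cutoff R w = 1" "dcutoff e R w = 0" by (simp_all add: cutoff_def dcutoff_def cutF_1 cutF'_1)
qed

lemma cutoff_range: "0 \<le> cutoff R w" "cutoff R w \<le> 1"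
 by (simp_all add: cutoff_def cutF_range)

lemma cutoff_csupp: "R > 0 ==> csupp (cutoff R)"
 unfolding csupp_def using cutoff_0(1) by (metis nle_le)

lemma C1c_mult:
 fixes a b :: "complex \<Rightarrow> 'a::{real_normed_field}"
 assumes "C1c a ax ay" "C1c b bx by'"
 shows "C1c (\<lambda>w. a w * b w) (\<lambda>w. a w * bx w + ax w * b w) (\<lambda>w. a w * by' w + ay w * b w)"
 using assms unfolding C1c_def has_pd_def by (auto intro!: pd_at_mult continuous_intros)

lemma C1c_of_real:
 assumes "C1c a ax ay"
 shows "C1c (\<lambda>w. complex_of_real (a w)) (\<lambda>w. of_real (ax w)) (\<lambda>w. of_real (ay w))"
 using assms unfolding C1c_def has_pd_def by (auto intro!: pd_at_of_real continuous_intros)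

lemma cutoff_C1c: "R > 0 ==> C1c (cutoff R) (dcutoff 1 R) (dcutoff \<i> R)"
 unfolding C1c_def by (auto intro: cutoff_pd cutoff_cont)

text \<open>Here only \<open>b\<close> has compact support. Multiplying \<open>a\<close> by a cutoff
  equal to 1 on the supports of the derivatives of \<open>b\<close> changes neither
  integrand.\<close>

lemma integral_jacobian:
 fixes a b :: "complex \<Rightarrow> complex"
 assumes a: "C1c a ax ay" and b: "C1c b bx by'" "csupp b"
 shows "(\<integral>w. ax w * by' w \<partial>lborel) = (\<integral>w. ay w * bx w \<partial>lborel)"
proof -
 obtain r0 where r0: "\<And>z. b z \<noteq> 0 ==> norm z \<le> r0" using b(2) unfolding csupp_def by blast
 have cb: "csupp bx" "csupp by'" using csupp_pd b unfolding C1c_def by blast+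
 obtain r1 where r1: "\<And>z. bx z \<noteq> 0 ==> norm z \<le> r1" using cb(1) unfolding csupp_def by blast
 obtain r2 where r2: "\<And>z. by' z \<noteq> 0 ==> norm z \<le> r2" using cb(2) unfolding csupp_def by blast
 \<comment> \<open>The factor 2 is needed because \<open>cutoff R\<close> equals 1 only up to radius
   \<open>R/2\<close>.\<close>
 define R where "R = 2 * (1 + \<bar>r0\<bar> + \<bar>r1\<bar> + \<bar>r2\<bar>)"
 have R: "R > 0" by (auto simp: R_def)
 let ?c = "\<lambda>w. complex_of_real (cutoff R w)"
 have c: "C1c ?c (\<lambda>w. of_real (dcutoff 1 R w)) (\<lambda>w. of_real (dcutoff \<i> R w))"
  by (intro C1c_of_real cutoff_C1c R)
 have cs: "csupp (\<lambda>w. ?c w * a w)" using cutoff_csupp[OF R] unfolding csupp_def by auto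
 have "(\<integral>w. (?c w * ax w + of_real (dcutoff 1 R w) * a w) * by' w \<partial>lborel) =
    (\<integral>w. (?c w * ay w + of_real (dcutoff \<i> R w) * a w) * bx w \<partial>lborel)"
  by (rule integral_jacobian_C1c[OF C1c_mult[OF c a] cs b])
 moreover have "(?c w * ax w + of_real (dcutoff 1 R w) * a w) * by' w = ax w * by' w" for w
  using cutoff_1[OF R, of w] r2[of w] by (cases "by' w = 0") (auto simp: R_def)
 moreover have "(?c w * ay w + of_real (dcutoff \<i> R w) * a w) * bx w = ay w * bx w" for w
  using cutoff_1[OF R, of w] r1[of w] by (cases "bx w = 0") (auto simp: R_def)
 ultimately show ?thesis by simp
qed

text \<open>Going from \<open>z\<close> to \<open>y\<close> first horizontally and then vertically,
  continuity of the partial derivatives bounds each remainder by a third of e * |y - z|; the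
  Cauchy-Riemann equation makes the two linear parts one complex multiplication.\<close>

lemma cauchy_riemann_has_field_derivative:
 fixes h :: "complex \<Rightarrow> complex"
 assumes h: "C1c h hx hy" and cr: "hx z + \<i> * hy z = 0"
 shows "(h has_field_derivative hx z) (at z)"
  unfolding has_field_derivative_def has_derivative_within
 proof (intro conjI bounded_linear_mult_right)
  show "((\<lambda>y. (1 / norm (y - z)) *\<^sub>R (h y - (h z + hx z * (y - z)))) \<longlongrightarrow> 0) (at z)"
  proof (rule LIM_I)
   fix e :: real assume e: "e > 0"
   have "isCont hx z" "isCont hy z" using h by (auto simp: C1c_def continuous_on_eq_continuous_at)
   then obtain d1 d2 where d: "d1 > 0" "\<And>w. dist w z < d1 ==> dist (hx w) (hx z) < e/3"
     "d2 > 0" "\<And>w. dist w z < d2 ==> dist (hy w) (hy z) < e/3"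
    unfolding continuous_at_eps_delta by (metis e divide_pos_pos zero_less_numeral)
   show "\<exists>s>0. \<forall>y. y \<noteq> z \<and> norm (y - z) < s \<longrightarrow>
     norm ((1 / norm (y - z)) *\<^sub>R (h y - (h z + hx z * (y - z))) - 0) < e"
   proof (intro exI[of _ "min d1 d2"] conjI allI impI)
    fix y assume y: "y \<noteq> z \<and> norm (y - z) < min d1 d2"
    define a b where "a = Re (y - z)" and "b = Im (y - z)"
    have yz: "y = z + of_real a + \<i> * of_real b" by (simp add: a_def b_def complex_eq_iff)
    have ab: "\<bar>a\<bar> \<le> norm (y - z)" "\<bar>b\<bar> \<le> norm (y - z)"
     unfolding a_def b_def by (rule abs_Re_le_cmod abs_Im_le_cmod)+
    have 1: "norm ((h (z + 1 * of_real a) - hx z * of_real a) - (h (z + 1 * of_real 0) - hx z * of_real 0)) \<le> e/3 * \<bar>a - 0\<bar>"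
    proof (rule mvt_bound)
     fix t assume t: "t \<in> closed_segment 0 a"
     show "((\<lambda>t. h (z + 1 * of_real t) - hx z * of_real t) has_vector_derivative hx (z + 1 * of_real t) - hx z * 1) (at t)"
      using h by (intro has_vector_derivative_diff pd_at_line has_vector_derivative_mult_right)
       (auto simp: C1c_def intro!: derivative_eq_intros)
     have "\<bar>t\<bar> \<le> \<bar>a\<bar>" using t by (auto simp: closed_segment_eq_real_ivl split: if_splits)
     then have "dist (z + of_real t) z < d1" using ab y by (simp add: dist_norm)
     then show "norm (hx (z + 1 * of_real t) - hx z * 1) \<le> e/3"
      using d(2)[of "z + of_real t"] by (simp add: dist_norm)
    qed
    have 2: "norm ((h ((z + of_real a) + \<i> * of_real b) - hy z * of_real b) - (h ((z + of_real a) + \<i> * of_real 0) - hy z * of_real 0)) \<le> e/3 * \<bar>b - 0\<bar>"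
    proof (rule mvt_bound)
     fix t assume t: "t \<in> closed_segment 0 b"
     show "((\<lambda>t. h ((z + of_real a) + \<i> * of_real t) - hy z * of_real t) has_vector_derivative hy ((z + of_real a) + \<i> * of_real t) - hy z * 1) (at t)"
      using h by (intro has_vector_derivative_diff pd_at_line has_vector_derivative_mult_right)
       (auto simp: C1c_def intro!: derivative_eq_intros)
     have "\<bar>t\<bar> \<le> \<bar>b\<bar>" using t by (auto simp: closed_segment_eq_real_ivl split: if_splits)
     then have "cmod (of_real a + \<i> * of_real t) \<le> cmod (y - z)"
      unfolding cmod_def using yz by (auto simp: abs_le_square_iff)
     then have "dist ((z + of_real a) + \<i> * of_real t) z < d2" using y by (simp add: dist_norm algebra_simps)
     then show "norm (hy ((z + of_real a) + \<i> * of_real t) - hy z * 1) \<le> e/3"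
      using d(4)[of "(z + of_real a) + \<i> * of_real t"] by (simp add: dist_norm)
    qed
    have "hy z = \<i> * hx z" using cr
     by (metis (no_types, opaque_lifting) add_eq_0_iff complex_i_mult_minus minus_minus mult_minus_right)
    then have eq: "h y - (h z + hx z * (y - z)) =
     ((h (z + 1 * of_real a) - hx z * of_real a) - (h (z + 1 * of_real 0) - hx z * of_real 0)) +
     ((h ((z + of_real a) + \<i> * of_real b) - hy z * of_real b) - (h ((z + of_real a) + \<i> * of_real 0) - hy z * of_real 0))"
     by (simp add: yz algebra_simps)
    have "norm (h y - (h z + hx z * (y - z))) \<le> e/3 * \<bar>a - 0\<bar> + e/3 * \<bar>b - 0\<bar>"
     unfolding eq by (rule norm_triangle_mono[OF 1 2])
    then have "norm (h y - (h z + hx z * (y - z))) \<le> e/3 * \<bar>a\<bar> + e/3 * \<bar>b\<bar>"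
     by simp
    also have "\<dots> \<le> e/3 * norm (y - z) + e/3 * norm (y - z)"
     using ab e by (intro add_mono mult_left_mono) auto
    also have "\<dots> < e * norm (y - z)" using e y by simp
    finally show "norm ((1 / norm (y - z)) *\<^sub>R (h y - (h z + hx z * (y - z))) - 0) < e"
     unfolding diff_0_right norm_scaleR using y by (simp add: pos_divide_less_eq)
   qed (use d in auto)
  qed
 qed

lemma holomorphic_of_cauchy_riemann:
 fixes h :: "complex \<Rightarrow> complex"
 assumes h: "C1c h hx hy" and cr: "\<And>z. hx z + \<i> * hy z = 0"
 shows "h holomorphic_on UNIV"
 using cauchy_riemann_has_field_derivative[OF h cr]
 by (meson holomorphic_onI field_differentiable_def field_differentiable_at_within)

text \<open>All radial averages of \<open>q\<close> around a point agree, because their scale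
  derivative pairs \<open>q\<close> with a dbar derivative; the average at scale 1 is smooth and
  inherits the Cauchy-Riemann equation from its kernel. The conclusion speaks of averages and not of
  almost everywhere equality, and \<open>h\<close> carries the factor \<open>J3\<close> of the
  unnormalized bump.\<close>

lemma weyl_dbar:
 fixes q :: "complex \<Rightarrow> complex"
 assumes q: "loc_int lborel q"
  and weak: "\<And>\<gamma> \<gamma>x \<gamma>y. C1c \<gamma> \<gamma>x \<gamma>y ==> csupp \<gamma> ==> (\<integral>w. (\<gamma>x w + \<i> * \<gamma>y w) * q w \<partial>lborel) = 0"
 shows "\<exists>h. h holomorphic_on UNIV \<and> (\<forall>t>0. \<forall>z. (\<integral>w. of_real (bp 3 t (w - z) / t\<^sup>2) * q w \<partial>lborel) = h z)"
proof -
 have trans: "(\<integral>w. (\<gamma>x (w - z) + \<i> * \<gamma>y (w - z)) * q w \<partial>lborel) = 0" if gC: "C1c \<gamma> \<gamma>x \<gamma>y" and gs: "csupp \<gamma>" for \<gamma> \<gamma>x \<gamma>y z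
 proof -
  obtain r where r0: "\<And>w. \<gamma> w \<noteq> 0 ==> norm w \<le> r" using gs by (auto simp: csupp_def)
  have r: "csupp (\<lambda>w. \<gamma> (w + -z))" unfolding csupp_def
  proof (intro exI[of _ "r + norm z"] allI impI)
   fix w assume "\<gamma> (w + -z) \<noteq> 0"
   then show "norm w \<le> r + norm z" using r0[of "w + -z"] norm_triangle_ineq2[of w z] by simp
  qed
  have "C1c (\<lambda>w. \<gamma> (w + -z)) (\<lambda>w. \<gamma>x (w + -z)) (\<lambda>w. \<gamma>y (w + -z))"
   using gC unfolding C1c_def
   by (auto intro!: has_pd_translate continuous_on_compose2[of UNIV _ _ "\<lambda>w. w + -z"] continuous_intros simp del: add_uminus_conv_diff)
  from weak[OF this r] show ?thesis by simp
 qed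
 define H where "H t z = (\<integral>w. of_real (bp 3 t (w - z) / t\<^sup>2) * q w \<partial>lborel)" for t z
 let ?\<gamma>x = "\<lambda>t w. of_real (bp 3 t w) + cnj w * of_real (dbp 1 3 t w)"
 let ?\<gamma>y = "\<lambda>t w. - \<i> * of_real (bp 3 t w) + cnj w * of_real (dbp \<i> 3 t w)"
 have bpC: "C1c (\<lambda>w. complex_of_real (bp 3 t w)) (\<lambda>w. of_real (dbp 1 3 t w)) (\<lambda>w. of_real (dbp \<i> 3 t w))" if "t > 0" for t
  by (rule C1c_of_real) (use that bp_pd[of 3] in \<open>auto simp: C1c_def intro!: continuous_intros\<close>)
 \<comment> \<open>The test function \<open>cnj w * bp 3 t w\<close> is chosen because its dbar
   derivative is minus \<open>t^3\<close> times the kernel of \<open>bp3_avg_deriv\<close>.\<close>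
 have g: "C1c (\<lambda>w. cnj w * of_real (bp 3 t w)) (\<lambda>w. cnj w * of_real (dbp 1 3 t w) + 1 * of_real (bp 3 t w)) (\<lambda>w. cnj w * of_real (dbp \<i> 3 t w) + (-\<i>) * of_real (bp 3 t w))"
  if "t > 0" for t
 proof (rule C1c_mult[OF _ bpC[OF that]])
  show "C1c cnj (\<lambda>w. 1) (\<lambda>w. - \<i>)"
   using pd_at_cnj[OF pd_at_id, of 1] pd_at_cnj[OF pd_at_id, of \<i>]
   unfolding C1c_def has_pd_def by (auto intro!: continuous_intros)
 qed
 have gs: "csupp (\<lambda>w. cnj w * complex_of_real (bp 3 t w))" "csupp (\<lambda>w. complex_of_real (bp 3 t w))" if "t > 0" for t
  using bp_csupp[of 3 t] that by (auto simp: csupp_def)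
 have lapq: "(\<integral>w. of_real (8 * bp 3 t (w - z) - 6 * bp 2 t (w - z)) * q w \<partial>lborel) = 0" if t: "t > 0" for t z
 proof -
  have id: "(cnj w * of_real (dbp 1 3 t w) + 1 * of_real (bp 3 t w)) + \<i> * (cnj w * of_real (dbp \<i> 3 t w) + (-\<i>) * of_real (bp 3 t w))
    = of_real (8 * bp 3 t w - 6 * bp 2 t w)" for w
  proof -
   have "(cnj w * of_real (dbp 1 3 t w) + 1 * of_real (bp 3 t w)) + \<i> * (cnj w * of_real (dbp \<i> 3 t w) + (-\<i>) * of_real (bp 3 t w))
    = cnj w * (of_real (dbp 1 3 t w) + \<i> * of_real (dbp \<i> 3 t w)) + of_real (2 * bp 3 t w)"
    by (simp add: algebra_simps)
   also have "of_real (dbp 1 3 t w) + \<i> * of_real (dbp \<i> 3 t w) = w * of_real (- (6 / t\<^sup>2) * bp 2 t w)"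
    by (simp add: dbp_def complex_eq_iff inner_complex_def)
   also have "cnj w * (w * of_real (- (6 / t\<^sup>2) * bp 2 t w)) = of_real (- 6 * ((cmod w)\<^sup>2 / t\<^sup>2 * bp 2 t w))"
    by (simp add: complex_norm_square mult_ac flip: of_real_power)
   also have "(cmod w)\<^sup>2 / t\<^sup>2 * bp 2 t w = bp 2 t w - bp 3 t w"
    using bp_step[of 2 w t] by simp
   finally show ?thesis by (simp add: algebra_simps)
  qed
  from trans[OF g[OF t] gs(1)[OF t], of z] show ?thesis by (simp only: id)
 qed
 have indep: "H s z = H t z" if "s > 0" "t > 0" for s t z
 proof (rule const_pos_reals[OF _ that])
  fix t :: real assume t: "t > 0"
  have eq: "(2 / t^3) * (3 * x - 4 * y) = (- 1 / t^3) * (8 * y - 6 * x)" for x y :: real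
   by (simp add: algebra_simps diff_divide_distrib)
  have "(\<integral>w. of_real ((2 / t^3) * (3 * bp 2 t (w - z) - 4 * bp 3 t (w - z))) * q w \<partial>lborel)
   = (\<integral>w. of_real (- 1 / t^3) * (of_real (8 * bp 3 t (w - z) - 6 * bp 2 t (w - z)) * q w) \<partial>lborel)"
   by (simp only: eq of_real_mult mult.assoc)
  also have "\<dots> = 0" by (simp only: integral_mult_right_zero lapq[OF t] mult_zero_right)
  finally have z0: "(\<integral>w. of_real ((2 / t^3) * (3 * bp 2 t (w - z) - 4 * bp 3 t (w - z))) * q w \<partial>lborel) = 0" .
  show "((\<lambda>t. H t z) has_vector_derivative 0) (at t)"
   unfolding H_def using bp3_avg_deriv[OF q sets_lborel t, of z] unfolding z0 .
 qed
 have "H 1 holomorphic_on UNIV"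
 proof (rule holomorphic_of_cauchy_riemann)
  have p: "has_pd e (H 1) (\<lambda>z. - (\<integral>w. of_real (dbp e 3 1 (w - z)) * q w \<partial>lborel))" for e
  proof -
   have "has_pd e (\<lambda>w. complex_of_real (bp 3 1 w)) (\<lambda>w. of_real (dbp e 3 1 w))"
    using bp_pd[of 3 e 1] unfolding has_pd_def by (auto intro: pd_at_of_real)
   from pd_conv[OF this _ _ _ _ q] show ?thesis unfolding H_def[abs_def]
    using gs(2)[of 1] by (auto intro!: continuous_intros)
  qed
  have c: "continuous_on UNIV (\<lambda>z. - (\<integral>w. of_real (dbp e 3 1 (w - z)) * q w \<partial>lborel))" for e
   using dbp_csupp[of 3 1 e] q
   by (intro continuous_on_minus cont_conv[where k="\<lambda>w. complex_of_real (dbp e 3 1 w)"]) (auto intro!: continuous_intros simp: csupp_def)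
  have "continuous_on UNIV (H 1)"
   using cont_conv[of "\<lambda>w. complex_of_real (bp 3 1 w)" lborel q] gs(2)[of 1] q
   unfolding H_def[abs_def] by (auto intro!: continuous_intros)
  with p c show "C1c (H 1) (\<lambda>z. - (\<integral>w. of_real (dbp 1 3 1 (w - z)) * q w \<partial>lborel)) (\<lambda>z. - (\<integral>w. of_real (dbp \<i> 3 1 (w - z)) * q w \<partial>lborel))"
   by (simp add: C1c_def)
  fix z
  have i: "integrable lborel (\<lambda>w. of_real (dbp e 3 1 (w - z)) * q w)" for e
   using dbp_csupp[of 3 1 e] q
   by (intro integrable_csupp_mult[where g="\<lambda>w. complex_of_real (dbp e 3 1 w)"]) (auto intro!: continuous_intros simp: csupp_def)
  have "(\<integral>w. (of_real (dbp 1 3 1 (w - z)) + \<i> * of_real (dbp \<i> 3 1 (w - z))) * q w \<partial>lborel) = 0"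
   using trans[OF bpC gs(2)] by simp
  then have *: "(\<integral>w. of_real (dbp 1 3 1 (w - z)) * q w \<partial>lborel) + (\<integral>w. \<i> * (of_real (dbp \<i> 3 1 (w - z)) * q w) \<partial>lborel) = 0"
   unfolding distrib_right mult.assoc
   by (subst (asm) Bochner_Integration.integral_add[OF i integrable_mult_right[OF i]])
  have neg: "- a + \<i> * - b = - (a + \<i> * b)" for a b by simp
  show "- (\<integral>w. of_real (dbp 1 3 1 (w - z)) * q w \<partial>lborel) + \<i> * - (\<integral>w. of_real (dbp \<i> 3 1 (w - z)) * q w \<partial>lborel) = 0"
   unfolding neg using * unfolding integral_mult_right_zero by (simp only: neg_equal_0_iff_equal)
 qed
 then show ?thesis
 proof (intro exI[of _ "H 1"] conjI allI impI)
  fix t :: real and z assume "t > 0"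
  then show "(\<integral>w. of_real (bp 3 t (w - z) / t\<^sup>2) * q w \<partial>lborel) = H 1 z"
   using indep[of t 1 z] unfolding H_def by simp
 qed
qed

section \<open>The Hilbert space of square integrable functions and representation of
  functionals\<close>

definition sqi :: "(complex \<Rightarrow> complex) \<Rightarrow> bool" where
 "sqi f \<longleftrightarrow> f \<in> borel_measurable borel \<and> integrable lborel (\<lambda>z. (cmod (f z))\<^sup>2)"

text \<open>The squared norm, so that quadratic identities stay free of roots. No weight appears:
  weights are absorbed into the functions, and one space serves both Hoermander's estimate and the
  Fock space.\<close>

definition sqn :: "(complex \<Rightarrow> complex) \<Rightarrow> real" where
 "sqn f = (\<integral>z. (cmod (f z))\<^sup>2 \<partial>lborel)"

definition ip :: "(complex \<Rightarrow> complex) \<Rightarrow> (complex \<Rightarrow> complex) \<Rightarrow> complex" where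
 "ip f g = (\<integral>z. f z * cnj (g z) \<partial>lborel)"

lemma sqn_nonneg [simp]: "sqn f \<ge> 0"
 by (simp add: sqn_def)

lemma two_mult_le: "2 * (a * b) \<le> a\<^sup>2 + b\<^sup>2" for a b :: real
 using sum_squares_bound[of a b] by (simp add: mult.assoc)

lemma borel_measurable_cnj [measurable (raw)]:
 "f \<in> borel_measurable M ==> (\<lambda>x. cnj (f x)) \<in> borel_measurable M"
 by (rule borel_measurable_continuous_on) (auto intro: continuous_intros)

lemma sqi_ip:
 assumes "sqi f" "sqi g"
 shows "integrable lborel (\<lambda>z. f z * cnj (g z))"
proof (rule Bochner_Integration.integrable_bound[where f="\<lambda>z. (cmod (f z))\<^sup>2 + (cmod (g z))\<^sup>2"])
 show "integrable lborel (\<lambda>z. (cmod (f z))\<^sup>2 + (cmod (g z))\<^sup>2)"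
  using assms by (auto simp: sqi_def)
 have [measurable]: "f \<in> borel_measurable borel" "g \<in> borel_measurable borel" using assms by (auto simp: sqi_def)
 show "(\<lambda>z. f z * cnj (g z)) \<in> borel_measurable lborel" by measurable
 have "cmod (f z) * cmod (g z) \<le> (cmod (f z))\<^sup>2 + (cmod (g z))\<^sup>2" for z
  by (rule order_trans[OF _ two_mult_le]) simp
 then show "AE z in lborel. norm (f z * cnj (g z)) \<le> norm ((cmod (f z))\<^sup>2 + (cmod (g z))\<^sup>2)"
  by (auto simp: norm_mult)
qed

lemma cmod_add_sq: "(cmod (a + b))\<^sup>2 = (cmod a)\<^sup>2 + 2 * Re (a * cnj b) + (cmod b)\<^sup>2"
 unfolding cmod_power2 by (simp add: power2_eq_square algebra_simps)

lemma sqi_add_mult: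
 assumes "sqi f" "sqi g"
 shows "sqi (\<lambda>z. f z + c * g z)"
  and "sqn (\<lambda>z. f z + c * g z) = sqn f + 2 * Re (cnj c * ip f g) + (cmod c)\<^sup>2 * sqn g"
proof -
 have [measurable]: "f \<in> borel_measurable borel" "g \<in> borel_measurable borel" using assms by (auto simp: sqi_def)
 note i = sqi_ip[OF assms]
 have eq: "(cmod (f z + c * g z))\<^sup>2 = (cmod (f z))\<^sup>2 + 2 * Re (cnj c * (f z * cnj (g z))) + (cmod c)\<^sup>2 * (cmod (g z))\<^sup>2" for z
  unfolding cmod_add_sq by (simp add: norm_mult power_mult_distrib mult_ac)
 have i2: "integrable lborel (\<lambda>z. 2 * Re (cnj c * (f z * cnj (g z))))"
  using i by (intro integrable_mult_right integrable_Re)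
 have i13: "integrable lborel (\<lambda>z. (cmod (f z))\<^sup>2)" "integrable lborel (\<lambda>z. (cmod c)\<^sup>2 * (cmod (g z))\<^sup>2)"
  using assms by (auto simp: sqi_def)
 show "sqi (\<lambda>z. f z + c * g z)"
  unfolding sqi_def eq using i2 i13 by (intro conjI Bochner_Integration.integrable_add) auto
 have "(\<integral>z. 2 * Re (cnj c * (f z * cnj (g z))) \<partial>lborel) = 2 * Re (cnj c * ip f g)"
 proof -
  have "(\<integral>z. Re (cnj c * (f z * cnj (g z))) \<partial>lborel) = Re (\<integral>z. cnj c * (f z * cnj (g z)) \<partial>lborel)"
   by (rule integral_Re) (intro integrable_mult_right i)
  then show ?thesis unfolding ip_def integral_mult_right_zero by simp
 qed
 then show "sqn (\<lambda>z. f z + c * g z) = sqn f + 2 * Re (cnj c * ip f g) + (cmod c)\<^sup>2 * sqn g"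
  unfolding sqn_def eq using i2 i13 by simp
qed

lemma ip_cnj: "ip g f = cnj (ip f g)"
proof -
 have "cnj (ip f g) = (\<integral>z. cnj (f z * cnj (g z)) \<partial>lborel)" unfolding ip_def by (rule integral_bounded_linear'[OF bounded_linear_cnj bounded_linear_cnj, symmetric]) simp
 then show ?thesis unfolding ip_def by (simp add: mult.commute)
qed

lemma ip_linear:
 assumes "sqi f" "sqi g" "sqi h"
 shows "ip (\<lambda>z. f z + c * g z) h = ip f h + c * ip g h"
proof -
 have "ip (\<lambda>z. f z + c * g z) h = (\<integral>z. f z * cnj (h z) + c * (g z * cnj (h z)) \<partial>lborel)"
  unfolding ip_def by (simp add: algebra_simps)
 also have "\<dots> = ip f h + c * ip g h"
  unfolding ip_def using sqi_ip[OF assms(1,3)] sqi_ip[OF assms(2,3)] by simp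
 finally show ?thesis .
qed

lemma ip_cauchy_schwarz:
 assumes "sqi f" "sqi g"
 shows "(cmod (ip f g))\<^sup>2 \<le> sqn f * sqn g"
proof -
 have *: "0 \<le> sqn f - 2 * s * (cmod (ip f g))\<^sup>2 + s\<^sup>2 * (cmod (ip f g))\<^sup>2 * sqn g" for s :: real
 proof -
  let ?c = "- of_real s * ip f g"
  have 1: "Re (cnj ?c * ip f g) = - s * (cmod (ip f g))\<^sup>2"
   unfolding cmod_power2 by (simp add: power2_eq_square algebra_simps)
  have 2: "(cmod ?c)\<^sup>2 = s\<^sup>2 * (cmod (ip f g))\<^sup>2" by (simp add: norm_mult power_mult_distrib)
  show ?thesis
   using sqn_nonneg[of "\<lambda>z. f z + ?c * g z"] unfolding sqi_add_mult(2)[OF assms] 1 2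
   by simp
 qed
 show ?thesis
 proof (cases "sqn g = 0")
  case True
  have "(cmod (ip f g))\<^sup>2 = 0"
  proof (rule ccontr)
   assume "(cmod (ip f g))\<^sup>2 \<noteq> 0"
   \<comment> \<open>With \<open>sqn g = 0\<close> this value of s makes the quadratic expression
     equal to -1.\<close>
   then show False using *[of "(sqn f + 1) / (2 * (cmod (ip f g))\<^sup>2)"] True by simp
  qed
  then show ?thesis using True by simp
 next
  case False
  then have p: "sqn g > 0" using sqn_nonneg[of g] by linarith
  have "0 \<le> sqn f - (cmod (ip f g))\<^sup>2 / sqn g"
   using *[of "1 / sqn g"] p by (simp add: power2_eq_square field_simps)
  then show ?thesis using p by (simp add: field_simps)
 qed
qed

text \<open>This is how estimates pass to limits: for the completeness of the function spaces, and
  for the step from mollified solutions to the solution itself.\<close>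

lemma fatou_bound:
 fixes f :: "nat \<Rightarrow> 'a \<Rightarrow> real"
 assumes f: "\<And>n. integrable M (f n)" "\<And>n x. 0 \<le> f n x" "\<And>n. n \<ge> n0 ==> (\<integral>x. f n x \<partial>M) \<le> B"
  and g: "g \<in> borel_measurable M" and lim: "AE x in M. (\<lambda>n. f n x) \<longlonglongrightarrow> g x"
 shows "integrable M g" "(\<integral>x. g x \<partial>M) \<le> B"
proof -
 have g0: "AE x in M. 0 \<le> g x"
  using lim by eventually_elim (rule LIMSEQ_le_const, auto simp: f(2))
 have "0 \<le> (\<integral>x. f n0 x \<partial>M)" by (rule integral_nonneg_AE) (simp add: f(2))
 then have "B \<ge> 0" using f(3)[of n0] by simp
 have "(\<integral>\<^sup>+x. ennreal (g x) \<partial>M) = (\<integral>\<^sup>+x. liminf (\<lambda>n. ennreal (f n x)) \<partial>M)"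
 proof (rule nn_integral_cong_AE)
  show "AE x in M. ennreal (g x) = liminf (\<lambda>n. ennreal (f n x))"
   using lim
  proof eventually_elim
   case (elim x)
   then have "(\<lambda>n. ennreal (f n x)) \<longlonglongrightarrow> ennreal (g x)" by (rule tendsto_ennrealI)
   from lim_imp_Liminf[OF _ this] show ?case by simp
  qed
 qed
 also have "\<dots> \<le> liminf (\<lambda>n. \<integral>\<^sup>+x. ennreal (f n x) \<partial>M)"
  using f(1) by (intro nn_integral_liminf) auto
 also have "\<dots> \<le> ennreal B"
 proof -
  have "(\<integral>\<^sup>+x. ennreal (f n x) \<partial>M) \<le> ennreal B" if "n \<ge> n0" for n
   using f(3)[OF that] by (subst nn_integral_eq_integral) (auto simp: f ennreal_leI)
  then have "\<forall>\<^sub>F n in sequentially. (\<integral>\<^sup>+x. ennreal (f n x) \<partial>M) \<le> ennreal B"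
   by (auto simp: eventually_sequentially)
  then have "liminf (\<lambda>n. \<integral>\<^sup>+x. ennreal (f n x) \<partial>M) \<le> liminf (\<lambda>n. ennreal B)"
   by (rule Liminf_mono)
  then show ?thesis by (simp add: Liminf_const)
 qed
 finally have fin: "(\<integral>\<^sup>+x. ennreal (g x) \<partial>M) \<le> ennreal B" .
 have "(\<integral>\<^sup>+x. ennreal (norm (g x)) \<partial>M) = (\<integral>\<^sup>+x. ennreal (g x) \<partial>M)"
  by (rule nn_integral_cong_AE) (use g0 in eventually_elim, simp)
 then have "(\<integral>\<^sup>+x. ennreal (norm (g x)) \<partial>M) < \<infinity>"
  using fin by (simp add: order_le_less_trans[OF _ ennreal_less_top])
 then show ig: "integrable M g" by (intro integrableI_bounded g)
 have "ennreal (\<integral>x. g x \<partial>M) \<le> ennreal B"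
  using fin nn_integral_eq_integral[OF ig g0] by simp
 then show "(\<integral>x. g x \<partial>M) \<le> B" using \<open>B \<ge> 0\<close> by (simp add: ennreal_le_iff)
qed

text \<open>Multiplied by a positive weight that is integrable and square integrable, the sequence
  becomes Cauchy in L^1, hence has an almost everywhere convergent subsequence; Fatou's lemma turns
  the Cauchy bound into convergence in norm. The rate assumed is the one a minimizing sequence has
  in \<open>riesz_L2\<close>.\<close>

lemma L2_complete:
 assumes f: "\<And>n. sqi (f n)"
  and cauchy: "\<And>n m. sqn (\<lambda>z. f n z - f m z) \<le> 2 * (1 / real (Suc n) + 1 / real (Suc m))"
 shows "\<exists>u. sqi u \<and> (\<lambda>n. sqn (\<lambda>z. f n z - u z)) \<longlonglongrightarrow> 0"
proof -
 have fm [measurable]: "f n \<in> borel_measurable borel" for n using f by (auto simp: sqi_def)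
 have fd: "sqi (\<lambda>z. f n z - f m z)" for n m
  using sqi_add_mult(1)[OF f[of n] f[of m], of "-1"] by simp
 obtain wt :: "complex \<Rightarrow> real" where wt: "wt \<in> borel_measurable lborel" "\<And>x. 0 < wt x" "\<And>x. wt x \<le> 1" "integrable lborel wt"
  using sigma_finite_measure.obtain_positive_integrable_function[OF sigma_finite_lborel] by blast
 have [measurable]: "wt \<in> borel_measurable borel" using wt(1) by simp
 have wsq: "sqi (\<lambda>z. of_real (wt z))"
 proof -
  have "integrable lborel (\<lambda>z. (wt z)\<^sup>2)"
  proof (rule Bochner_Integration.integrable_bound[OF wt(4)])
   show "AE z in lborel. norm ((wt z)\<^sup>2) \<le> norm (wt z)"
    using wt(2,3) by (intro AE_I2) (simp add: power2_eq_square mult_left_le abs_mult less_imp_le)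
  qed measurable
  then show ?thesis by (simp add: sqi_def)
 qed
 let ?s = "\<lambda>n z. f n z * of_real (wt z)"
 have int: "integrable lborel (?s n)" for n
  using sqi_ip[OF f wsq] by simp
 have dist: "(\<integral>z. norm (?s n z - ?s m z) \<partial>lborel) \<le> sqrt (sqn (\<lambda>z. f n z - f m z)) * sqrt (sqn (\<lambda>z. of_real (wt z)))" for n m
 proof -
  have s1: "sqi (\<lambda>z. of_real (cmod (f n z - f m z)))" using fd[of n m] by (simp add: sqi_def)
  have "ip (\<lambda>z. of_real (cmod (f n z - f m z))) (\<lambda>z. of_real (wt z)) = of_real (\<integral>z. cmod (f n z - f m z) * wt z \<partial>lborel)"
   unfolding ip_def by (simp flip: of_real_mult)
  moreover have "(\<integral>z. norm (?s n z - ?s m z) \<partial>lborel) = (\<integral>z. cmod (f n z - f m z) * wt z \<partial>lborel)"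
   using less_imp_le[OF wt(2)] by (intro Bochner_Integration.integral_cong refl) (simp add: norm_mult flip: left_diff_distrib)
  ultimately have "(\<integral>z. norm (?s n z - ?s m z) \<partial>lborel)\<^sup>2 \<le> sqn (\<lambda>z. of_real (cmod (f n z - f m z))) * sqn (\<lambda>z. of_real (wt z))"
   using ip_cauchy_schwarz[OF s1 wsq] by simp
  also have "sqn (\<lambda>z. of_real (cmod (f n z - f m z))) = sqn (\<lambda>z. f n z - f m z)" by (simp add: sqn_def)
  finally show ?thesis unfolding real_sqrt_mult[symmetric] by (rule real_le_rsqrt)
 qed
 let ?W = "sqrt (sqn (\<lambda>z. of_real (wt z)))"
 have W: "?W \<ge> 0" by simp
 have "\<exists>N. \<forall>i\<ge>N. \<forall>j\<ge>N. (\<integral>z. norm (?s i z - ?s j z) \<partial>lborel) < e" if e: "e > 0" for e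
 proof -
  obtain N :: nat where N: "4 * (?W + 1)\<^sup>2 / e\<^sup>2 < real N" using reals_Archimedean2 by blast
  show ?thesis
  proof (intro exI[of _ N] allI impI)
   fix i j assume ij: "N \<le> i" "N \<le> j"
   have N0: "real N > 0" using N e W by (smt (verit) divide_nonneg_nonneg zero_le_power2)
   have "1 / real (Suc i) \<le> 1 / real N" "1 / real (Suc j) \<le> 1 / real N"
    using ij N0 by (auto intro!: divide_left_mono)
   then have "sqn (\<lambda>z. f i z - f j z) \<le> 4 / real N" using cauchy[of i j] by simp
   also have "\<dots> < (e / (?W + 1))\<^sup>2"
   proof -
    define c where "c = (?W + 1)\<^sup>2"
    have "?W + 1 > 0" using W by linarith
    then have c: "c > 0" unfolding c_def by (rule zero_less_power)
    have "4 / real N < e\<^sup>2 / c" using N N0 e c unfolding c_def[symmetric] by (simp add: field_simps)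
    then show ?thesis by (simp add: power_divide c_def)
   qed
   finally have "sqrt (sqn (\<lambda>z. f i z - f j z)) < e / (?W + 1)"
    using e W by (intro real_less_lsqrt) auto
   then have "sqrt (sqn (\<lambda>z. f i z - f j z)) * ?W \<le> e / (?W + 1) * ?W"
    using W by (intro mult_right_mono) auto
   also have "\<dots> < e"
   proof -
    have "e / (w + 1) * w < e" if "w \<ge> 0" for w using e that by (simp add: field_simps)
    from this[OF W] show ?thesis .
   qed
   finally show "(\<integral>z. norm (?s i z - ?s j z) \<partial>lborel) < e" using dist[of i j] by linarith
  qed
 qed
 from cauchy_L1_AE_cauchy_subseq[OF int this]
 obtain r where r: "strict_mono r" "AE z in lborel. Cauchy (\<lambda>i. ?s (r i) z)" by blast
 define u where "u z = lim (\<lambda>i. f (r i) z)" for z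
 have um [measurable]: "u \<in> borel_measurable borel"
  unfolding u_def[abs_def] by (rule borel_measurable_lim_metric) simp
 have lim: "AE z in lborel. (\<lambda>i. f (r i) z) \<longlonglongrightarrow> u z"
  using r(2)
 proof eventually_elim
  case (elim z)
  then have "convergent (\<lambda>i. ?s (r i) z)" by (simp add: Cauchy_convergent_iff)
  then have "convergent (\<lambda>i. f (r i) z)"
   using wt(2)[of z] convergent_mult_const_right_iff[of "complex_of_real (wt z)" "\<lambda>i. f (r i) z"] by auto
  then show ?case unfolding u_def by (simp add: convergent_LIMSEQ_iff)
 qed
 have b: "integrable lborel (\<lambda>z. (cmod (f n z - u z))\<^sup>2) \<and> sqn (\<lambda>z. f n z - u z) \<le> 4 / real (Suc n)" for n
 proof -
  have *: "(\<integral>z. (cmod (f n z - f (r i) z))\<^sup>2 \<partial>lborel) \<le> 4 / real (Suc n)" if "i \<ge> n" for i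
  proof -
   have "r i \<ge> n" using seq_suble[OF r(1), of i] that by linarith
   then have "1 / real (Suc (r i)) \<le> 1 / real (Suc n)" by (intro divide_left_mono) auto
   then show ?thesis using cauchy[of n "r i"] unfolding sqn_def by simp
  qed
  have i: "integrable lborel (\<lambda>z. (cmod (f n z - f (r i) z))\<^sup>2)" for i
   using fd[of n "r i"] by (simp add: sqi_def)
  have l: "AE z in lborel. (\<lambda>i. (cmod (f n z - f (r i) z))\<^sup>2) \<longlonglongrightarrow> (cmod (f n z - u z))\<^sup>2"
   using lim by eventually_elim (intro tendsto_intros)
  show ?thesis unfolding sqn_def
   using fatou_bound[where M=lborel and f="\<lambda>i z. (cmod (f n z - f (r i) z))\<^sup>2" and g="\<lambda>z. (cmod (f n z - u z))\<^sup>2" and B="4 / real (Suc n)",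
     OF i _ * _ l] by simp
 qed
 have "sqi (\<lambda>z. f 0 z - u z)" using b by (simp add: sqi_def)
 from sqi_add_mult(1)[OF f[of 0] this, of "-1"] have "sqi u" by simp
 moreover have "(\<lambda>n. sqn (\<lambda>z. f n z - u z)) \<longlonglongrightarrow> 0"
 proof (rule tendsto_sandwich[of "\<lambda>_. 0" _ _ "\<lambda>n. 4 * (1 / real (Suc n))"])
  show "(\<lambda>n. 4 * (1 / real (Suc n))) \<longlonglongrightarrow> 0"
   using tendsto_mult_right_zero[OF LIMSEQ_inverse_real_of_nat, of 4] by (simp add: inverse_eq_divide)
 qed (use b in auto)
 ultimately show ?thesis by blast
qed

text \<open>The functional ||D v||^2 - 2 Re (l v) is minimized over \<open>V\<close>; the
  parallelogram law makes a minimizing sequence Cauchy. \<open>V\<close> is a bare index set with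
  closure under \<open>v + c * w\<close> stated through \<open>D\<close> and \<open>l\<close>, since
  it is used both for triples of a function with its partial derivatives and for the Fock space. The
  sequence \<open>f\<close> is returned so that the limit can be located in a closed
  subspace.\<close>

theorem riesz_L2:
 fixes V :: "'v set" and D :: "'v \<Rightarrow> complex \<Rightarrow> complex" and l :: "'v \<Rightarrow> complex"
 assumes ne: "V \<noteq> {}" and D: "\<And>v. v \<in> V ==> sqi (D v)"
  and lin: "\<And>v w c. v \<in> V ==> w \<in> V ==> \<exists>x\<in>V. D x = (\<lambda>z. D v z + c * D w z) \<and> l x = l v + c * l w"
  and bd: "\<And>v. v \<in> V ==> (cmod (l v))\<^sup>2 \<le> K * sqn (D v)" and K: "K \<ge> 0"
 shows "\<exists>u f. sqi u \<and> sqn u \<le> K \<and> (\<forall>v\<in>V. ip (D v) u = l v) \<and>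
   (\<forall>n. f n \<in> V) \<and> (\<lambda>n. sqn (\<lambda>z. D (f n) z - u z)) \<longlonglongrightarrow> 0"
proof -
 define J where "J v = sqn (D v) - 2 * Re (l v)" for v
 have Jb: "J v \<ge> - K" if "v \<in> V" for v
 proof -
  have "\<bar>Re (l v)\<bar> \<le> sqrt K * sqrt (sqn (D v))"
   using abs_Re_le_cmod[of "l v"] real_le_rsqrt[OF bd[OF that]] by (simp add: real_sqrt_mult)
  moreover have "2 * (sqrt K * sqrt (sqn (D v))) \<le> K + sqn (D v)"
   using two_mult_le[of "sqrt K" "sqrt (sqn (D v))"] K by simp
  ultimately show ?thesis unfolding J_def by linarith
 qed
 define I where "I = Inf (J ` V)"
 have bdd: "bdd_below (J ` V)" using Jb by (intro bdd_belowI2)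
 have Ile: "I \<le> J v" if "v \<in> V" for v unfolding I_def using bdd that by (intro cInf_lower) auto
 have "\<exists>v\<in>V. J v < I + 1 / real (Suc n)" for n
 proof -
  have "Inf (J ` V) < I + 1 / real (Suc n)" by (simp add: I_def)
  from cInf_lessD[OF _ this] ne show ?thesis by auto
 qed
 then obtain f where f: "\<And>n. f n \<in> V" "\<And>n. J (f n) < I + 1 / real (Suc n)" by metis
 have cauchy: "sqn (\<lambda>z. D (f n) z - D (f m) z) \<le> 2 * (1 / real (Suc n) + 1 / real (Suc m))" for n m
 proof -
  have s: "sqi (D (f n))" "sqi (D (f m))" using f D by auto
  \<comment> \<open>The midpoint of \<open>f n\<close> and \<open>f m\<close>, reached in two steps
    because \<open>lin\<close> only provides sums \<open>v + c * w\<close>.\<close>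
  obtain y where y: "y \<in> V" "D y = (\<lambda>z. D (f m) z + (-1) * D (f n) z)" "l y = l (f m) + (-1) * l (f n)"
   using lin[OF f(1) f(1)] by meson
  obtain x where x: "x \<in> V" "D x = (\<lambda>z. D (f n) z + (1/2) * D y z)" "l x = l (f n) + (1/2) * l y"
   using lin[OF f(1) y(1)] by meson
  have Dx: "D x = (\<lambda>z. (1/2) * (D (f n) z + 1 * D (f m) z))" by (auto simp: x(2) y(2) fun_eq_iff field_simps)
  have "sqn (D x) = (1/4) * sqn (\<lambda>z. D (f n) z + 1 * D (f m) z)"
   unfolding Dx sqn_def by (simp add: norm_mult power_mult_distrib power_divide)
  then have nx: "4 * sqn (D x) = sqn (D (f n)) + 2 * Re (ip (D (f n)) (D (f m))) + sqn (D (f m))"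
   using sqi_add_mult(2)[OF s, of 1] by simp
  have "sqn (\<lambda>z. D (f n) z - D (f m) z) = sqn (D (f n)) - 2 * Re (ip (D (f n)) (D (f m))) + sqn (D (f m))"
   using sqi_add_mult(2)[OF s, of "-1"] by simp
  then have nd: "sqn (\<lambda>z. D (f n) z - D (f m) z) = sqn (D (f n)) - 2 * Re (ip (D (f n)) (D (f m))) + sqn (D (f m))" .
  have "sqn (\<lambda>z. D (f n) z - D (f m) z) = 2 * J (f n) + 2 * J (f m) - 4 * J x"
  proof -
   have "2 * l x = l (f n) + l (f m)" by (simp add: x(3) y(3) field_simps)
   then have "Re (2 * l x) = Re (l (f n) + l (f m))" by (rule arg_cong)
   then have "2 * Re (l x) = Re (l (f n)) + Re (l (f m))" by simp
   with nx nd show ?thesis unfolding J_def right_diff_distrib mult.assoc[symmetric]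
    by (argo | (simp add: algebra_simps; fail) | (smt (verit)))
  qed
  also have "\<dots> \<le> 2 * (1 / real (Suc n) + 1 / real (Suc m))"
   using f(2)[of n] f(2)[of m] Ile[OF x(1)] by (simp add: algebra_simps)
  finally show ?thesis .
 qed
 obtain u where u: "sqi u" "(\<lambda>n. sqn (\<lambda>z. D (f n) z - u z)) \<longlonglongrightarrow> 0"
  using L2_complete[of "\<lambda>n. D (f n)", OF D[OF f(1)] cauchy] by blast
 \<comment> \<open>Near-minimality forces near-stationarity: a step of size \<open>s\<close> against
   the residual \<open>a\<close> lowers \<open>J\<close> by at least s * |a|^2, which cannot exceed
   1/(n+1). The \<open>+ 1\<close> keeps \<open>s\<close> finite when \<open>D w\<close> is
   null.\<close>
 have stat: "(cmod (ip (D w) (D (f n)) - l w))\<^sup>2 \<le> (1 / real (Suc n)) * (sqn (D w) + 1)" if w: "w \<in> V" for w n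
 proof -
  define a where "a = ip (D w) (D (f n)) - l w"
  define s where "s = 1 / (sqn (D w) + 1)"
  have s1: "sqn (D w) + 1 > 0" using sqn_nonneg[of "D w"] by linarith
  have s: "s > 0" "s * sqn (D w) \<le> 1" using s1 by (auto simp: s_def)
  let ?c = "- of_real s * cnj a"
  obtain x where x: "x \<in> V" "D x = (\<lambda>z. D (f n) z + ?c * D w z)" "l x = l (f n) + ?c * l w"
   using lin[OF f(1) w] by meson
  have j1: "J x = J (f n) + 2 * Re (?c * a) + (cmod ?c)\<^sup>2 * sqn (D w)"
  proof -
   have "Re (cnj ?c * ip (D (f n)) (D w)) = Re (?c * ip (D w) (D (f n)))"
    unfolding ip_cnj[of "D (f n)" "D w"] by simp
   then show ?thesis
    unfolding J_def x sqi_add_mult(2)[OF D[OF f(1)] D[OF w]] a_def by (simp add: algebra_simps)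
  qed
  have j2: "Re (?c * a) = - s * (cmod a)\<^sup>2"
   unfolding cmod_power2 by (simp add: power2_eq_square algebra_simps)
  have j3: "(cmod ?c)\<^sup>2 = s\<^sup>2 * (cmod a)\<^sup>2" by (simp add: norm_mult power_mult_distrib)
  have "J x = J (f n) - 2 * s * (cmod a)\<^sup>2 + s * (s * sqn (D w)) * (cmod a)\<^sup>2"
   unfolding j1 j2 j3 by (simp add: power2_eq_square mult_ac)
  moreover have "s * (s * sqn (D w)) * (cmod a)\<^sup>2 \<le> s * 1 * (cmod a)\<^sup>2"
   using s by (intro mult_right_mono mult_left_mono) auto
  ultimately have "s * (cmod a)\<^sup>2 \<le> 1 / real (Suc n)"
   using Ile[OF x(1)] f(2)[of n] by simp
  then show ?thesis unfolding a_def[symmetric] s_def using s1 by (simp add: pos_divide_le_eq)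
 qed
 have lz: "(\<lambda>n. 1 / real (Suc n)) \<longlonglongrightarrow> 0"
  using LIMSEQ_inverse_real_of_nat by (simp add: inverse_eq_divide)
 have repr: "ip (D w) u = l w" if w: "w \<in> V" for w
 proof -
  have "(\<lambda>n. ip (D w) (D (f n)) - l w) \<longlonglongrightarrow> 0"
  proof (rule tendsto_norm_zero_cancel, rule tendsto_sandwich[of "\<lambda>_. 0" _ _ "\<lambda>n. sqrt (1 / real (Suc n) * (sqn (D w) + 1))"])
   show "\<forall>\<^sub>F n in sequentially. norm (ip (D w) (D (f n)) - l w) \<le> sqrt (1 / real (Suc n) * (sqn (D w) + 1))"
    by (intro always_eventually allI real_le_rsqrt stat w)
   have "(\<lambda>n. sqrt (1 / real (Suc n) * (sqn (D w) + 1))) \<longlonglongrightarrow> sqrt (0 * (sqn (D w) + 1))"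
    by (intro tendsto_intros lz)
   then show "(\<lambda>n. sqrt (1 / real (Suc n) * (sqn (D w) + 1))) \<longlonglongrightarrow> 0" by simp
  qed auto
  moreover have "(\<lambda>n. ip (D w) (D (f n)) - ip (D w) u) \<longlonglongrightarrow> 0"
  proof (rule tendsto_norm_zero_cancel, rule tendsto_sandwich[of "\<lambda>_. 0" _ _ "\<lambda>n. sqrt (sqn (D w) * sqn (\<lambda>z. D (f n) z - u z))"])
   show "\<forall>\<^sub>F n in sequentially. norm (ip (D w) (D (f n)) - ip (D w) u) \<le> sqrt (sqn (D w) * sqn (\<lambda>z. D (f n) z - u z))"
   proof (intro always_eventually allI real_le_rsqrt)
    fix n
    have d: "sqi (\<lambda>z. D (f n) z - u z)" using sqi_add_mult(1)[OF D[OF f(1)] u(1), of _ "-1"] by simp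
    have "ip (\<lambda>z. D (f n) z + (-1) * u z) (D w) = ip (D (f n)) (D w) + (-1) * ip u (D w)"
     by (rule ip_linear[OF D[OF f(1)] u(1) D[OF w]])
    then have "cnj (ip (\<lambda>z. D (f n) z - u z) (D w)) = cnj (ip (D (f n)) (D w)) - cnj (ip u (D w))" by simp
    then have "ip (D w) (D (f n)) - ip (D w) u = ip (D w) (\<lambda>z. D (f n) z - u z)"
     by (simp only: ip_cnj[symmetric])
    then show "(norm (ip (D w) (D (f n)) - ip (D w) u))\<^sup>2 \<le> sqn (D w) * sqn (\<lambda>z. D (f n) z - u z)"
     using ip_cauchy_schwarz[OF D[OF w] d] by simp
   qed
   have "(\<lambda>n. sqrt (sqn (D w) * sqn (\<lambda>z. D (f n) z - u z))) \<longlonglongrightarrow> sqrt (sqn (D w) * 0)"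
    by (intro tendsto_intros u)
   then show "(\<lambda>n. sqrt (sqn (D w) * sqn (\<lambda>z. D (f n) z - u z))) \<longlonglongrightarrow> 0" by simp
  qed auto
  ultimately have "(\<lambda>n. (ip (D w) (D (f n)) - l w) - (ip (D w) (D (f n)) - ip (D w) u)) \<longlonglongrightarrow> 0 - 0"
   by (rule tendsto_diff)
  then have "(\<lambda>n::nat. ip (D w) u - l w) \<longlonglongrightarrow> 0" by simp
  then show ?thesis by (simp add: LIMSEQ_const_iff)
 qed
 have "sqn u \<le> K"
 proof -
  have 1: "sqn (D (f n)) - 2 * Re (l (f n)) + sqn u = sqn (\<lambda>z. D (f n) z - u z)" for n
   using sqi_add_mult(2)[OF D[OF f(1)] u(1), of _ "-1"] repr[OF f(1)[of n]] by simp
  have "0 \<le> (sqn (\<lambda>z. D (f n) z - u z) + K) - sqn u" for n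
   using Jb[OF f(1)[of n]] 1[of n] unfolding J_def by simp
  moreover have "(\<lambda>n. (sqn (\<lambda>z. D (f n) z - u z) + K) - sqn u) \<longlonglongrightarrow> (0 + K) - sqn u"
   by (intro tendsto_intros u)
  ultimately have "0 \<le> (0 + K) - sqn u" by (intro LIMSEQ_le_const) auto
  then show ?thesis by simp
 qed
 with u repr f(1) show ?thesis by blast
qed

section \<open>Hoermander's weighted estimate: the a priori inequality and the weak solution\<close>

definition weight :: "(complex \<Rightarrow> real) \<Rightarrow> (complex \<Rightarrow> real) \<Rightarrow> (complex \<Rightarrow> real) \<Rightarrow> (complex \<Rightarrow> real) \<Rightarrow> (complex \<Rightarrow> real) \<Rightarrow> bool" where
 "weight \<psi> p q pp qq \<longleftrightarrow> C1c \<psi> p q \<and> has_pd 1 p pp \<and> has_pd \<i> q qq \<and> continuous_on UNIV pp \<and> continuous_on UNIV qq"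

lemma integrable_cc:
 fixes f :: "complex \<Rightarrow> 'a::{real_normed_field,banach,second_countable_topology}"
 assumes "continuous_on UNIV f" "csupp f"
 shows "integrable lborel f"
 using integrable_csupp_mult[of lborel "\<lambda>_. 1" f 0] assms by (simp add: loc_int_continuous)

lemma pd_at_cmod_sq:
 assumes "pd_at e b d z"
 shows "pd_at e (\<lambda>w. (cmod (b w))\<^sup>2) (2 * Re (d * cnj (b z))) z"
proof -
 have r: "pd_at e (\<lambda>w. Re (b w)) (Re d) z" "pd_at e (\<lambda>w. Im (b w)) (Im d) z"
  by (rule pd_at_linear[OF bounded_linear_Re assms] pd_at_linear[OF bounded_linear_Im assms])+
 have "pd_at e (\<lambda>w. Re (b w) * Re (b w) + Im (b w) * Im (b w))
   ((Re (b z) * Re d + Re d * Re (b z)) + (Im (b z) * Im d + Im d * Im (b z))) z"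
  by (intro pd_at_add pd_at_mult r)
 moreover have "(cmod (b w))\<^sup>2 = Re (b w) * Re (b w) + Im (b w) * Im (b w)" for w
  unfolding cmod_power2 by (simp add: power2_eq_square)
 ultimately show ?thesis by (simp add: algebra_simps)
qed

text \<open>This is exp \<psi> times (d/dx - \<i> d/dy) applied to exp(-\<psi>) b: up to sign, the
  formal adjoint of d/dx + \<i> d/dy after conjugation by exp \<psi>.\<close>

definition Dop :: "(complex \<Rightarrow> real) \<Rightarrow> (complex \<Rightarrow> real) \<Rightarrow> (complex \<Rightarrow> complex) \<Rightarrow> (complex \<Rightarrow> complex) \<Rightarrow> (complex \<Rightarrow> complex) \<Rightarrow> complex \<Rightarrow> complex" where
 "Dop p q b bx by' z = (bx z - of_real (p z) * b z) - \<i> * (by' z - of_real (q z) * b z)"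

text \<open>The commutator method. The squared modulus of \<open>Dop\<close> differs from that of
  the opposite operator (called \<open>E\<close> in the proof) by twice the Laplacian of \<psi>
  times |b|^2, by two divergences and by a Jacobian. The last three integrate to zero, and the
  integral of \<open>E\<close> is nonnegative and dropped.\<close>

lemma hormander_ineq:
 assumes w: "weight \<psi> p q pp qq" and b: "C1c b bx by'" "csupp b"
 shows "integrable lborel (\<lambda>z. (pp z + qq z) * (cmod (b z))\<^sup>2)"
  and "2 * (\<integral>z. (pp z + qq z) * (cmod (b z))\<^sup>2 \<partial>lborel) \<le> sqn (Dop p q b bx by')"
  and "sqi (Dop p q b bx by')"
proof -
 note W = w[unfolded weight_def C1c_def] and B = b(1)[unfolded C1c_def]
 have cs: "csupp bx" "csupp by'" using csupp_pd B b(2) by blast+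
 obtain r where r: "\<And>z. norm z > r ==> b z = 0 \<and> bx z = 0 \<and> by' z = 0"
 proof -
  obtain r0 r1 r2 where "\<And>z. b z \<noteq> 0 ==> norm z \<le> r0" "\<And>z. bx z \<noteq> 0 ==> norm z \<le> r1" "\<And>z. by' z \<noteq> 0 ==> norm z \<le> r2"
   using b(2) cs unfolding csupp_def by auto
  then show ?thesis by (intro that[of "max r0 (max r1 r2)"]) (meson max.bounded_iff not_le max_less_iff_conj)
 qed
 have csI: "csupp f" if "\<And>z. b z = 0 ==> bx z = 0 ==> by' z = 0 ==> f z = 0" for f :: "complex \<Rightarrow> 'b::zero"
  unfolding csupp_def using r that by (intro exI[of _ r]) (meson not_le)
 have cont: "continuous_on UNIV p" "continuous_on UNIV q" "continuous_on UNIV pp" "continuous_on UNIV qq"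
  "continuous_on UNIV b" "continuous_on UNIV bx" "continuous_on UNIV by'"
  using W B by auto
 note ci = integrable_cc[OF _ csI]
 have div: "(\<integral>z. s z * (2 * Re (be z * cnj (b z))) + s' z * (cmod (b z))\<^sup>2 \<partial>lborel) = 0"
  if "has_pd e s s'" "has_pd e b be" "continuous_on UNIV s" "continuous_on UNIV s'" "continuous_on UNIV be"
  for e s s' be
 proof (rule integral_pd_0)
  show "has_pd e (\<lambda>z. s z * (cmod (b z))\<^sup>2) (\<lambda>z. s z * (2 * Re (be z * cnj (b z))) + s' z * (cmod (b z))\<^sup>2)"
   unfolding has_pd_def
  proof
   fix z
   show "pd_at e (\<lambda>z. s z * (cmod (b z))\<^sup>2) (s z * (2 * Re (be z * cnj (b z))) + s' z * (cmod (b z))\<^sup>2) z"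
    using that by (intro pd_at_mult pd_at_cmod_sq) (simp_all only: has_pd_def)
  qed
  show "csupp (\<lambda>z. s z * (cmod (b z))\<^sup>2)" by (rule csI) simp
 qed (use that cont in \<open>auto intro!: continuous_intros\<close>)
 have d1: "(\<integral>z. p z * (2 * Re (bx z * cnj (b z))) + pp z * (cmod (b z))\<^sup>2 \<partial>lborel) = 0"
  using W B by (intro div) auto
 have d2: "(\<integral>z. q z * (2 * Re (by' z * cnj (b z))) + qq z * (cmod (b z))\<^sup>2 \<partial>lborel) = 0"
  using W B by (intro div) auto
 \<comment> \<open>The mixed terms. They are removed by the C^1 Jacobian identity, so no second
   derivative of \<open>b\<close> and no mixed derivative of \<psi> occurs.\<close>
 have d3: "(\<integral>z. Im (bx z * cnj (by' z)) \<partial>lborel) = 0"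
 proof -
  have "C1c (\<lambda>z. cnj (b z)) (\<lambda>z. cnj (bx z)) (\<lambda>z. cnj (by' z))"
   using B unfolding C1c_def has_pd_def by (auto intro!: pd_at_cnj continuous_intros)
  from integral_jacobian_C1c[OF b this] csI[of "\<lambda>z. cnj (b z)"]
  have "(\<integral>z. bx z * cnj (by' z) \<partial>lborel) = (\<integral>z. by' z * cnj (bx z) \<partial>lborel)" by simp
  also have "\<dots> = (\<integral>z. cnj (bx z * cnj (by' z)) \<partial>lborel)" by (simp add: mult.commute)
  also have "\<dots> = cnj (\<integral>z. bx z * cnj (by' z) \<partial>lborel)" by (rule Bochner_Integration.integral_cnj)
  finally have "Im (\<integral>z. bx z * cnj (by' z) \<partial>lborel) = 0" by (simp add: complex_eq_iff)
  moreover have "integrable lborel (\<lambda>z. bx z * cnj (by' z))"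
   by (rule ci) (use cont in \<open>auto intro!: continuous_intros\<close>)
  ultimately show ?thesis using integral_Im by metis
 qed
 show i0: "integrable lborel (\<lambda>z. (pp z + qq z) * (cmod (b z))\<^sup>2)"
  by (rule ci) (use cont in \<open>auto intro!: continuous_intros\<close>)
 define E where "E z = (cmod ((bx z + of_real (p z) * b z) + \<i> * (by' z + of_real (q z) * b z)))\<^sup>2" for z
 have iE: "integrable lborel E" unfolding E_def
  by (rule ci) (use cont in \<open>auto intro!: continuous_intros\<close>)
 have i1: "integrable lborel (\<lambda>z. p z * (2 * Re (bx z * cnj (b z))) + pp z * (cmod (b z))\<^sup>2)"
  "integrable lborel (\<lambda>z. q z * (2 * Re (by' z * cnj (b z))) + qq z * (cmod (b z))\<^sup>2)"
  "integrable lborel (\<lambda>z. Im (bx z * cnj (by' z)))"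
  by (rule ci; (use cont in \<open>auto intro!: continuous_intros\<close>))+
 have pt: "(cmod (Dop p q b bx by' z))\<^sup>2 = E z + (2 * ((pp z + qq z) * (cmod (b z))\<^sup>2)
   - 2 * (p z * (2 * Re (bx z * cnj (b z))) + pp z * (cmod (b z))\<^sup>2)
   - 2 * (q z * (2 * Re (by' z * cnj (b z))) + qq z * (cmod (b z))\<^sup>2) - 4 * Im (bx z * cnj (by' z)))" for z
  unfolding E_def Dop_def cmod_power2 by (simp add: power2_eq_square algebra_simps)
 show "sqi (Dop p q b bx by')"
  unfolding sqi_def
 proof
  have "continuous_on UNIV (Dop p q b bx by')"
   unfolding Dop_def[abs_def] using cont by (auto intro!: continuous_intros)
  then show "Dop p q b bx by' \<in> borel_measurable borel" by (rule borel_measurable_continuous_onI)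
  show "integrable lborel (\<lambda>z. (cmod (Dop p q b bx by' z))\<^sup>2)"
   unfolding Dop_def by (rule ci) (use cont in \<open>auto intro!: continuous_intros\<close>)
 qed
 have "sqn (Dop p q b bx by') = (\<integral>z. E z \<partial>lborel) + 2 * (\<integral>z. (pp z + qq z) * (cmod (b z))\<^sup>2 \<partial>lborel)"
 proof -
  have gen: "(\<integral>z. e z + (2 * g0 z - 2 * g1 z - 2 * g2 z - 4 * g3 z) \<partial>lborel) = (\<integral>z. e z \<partial>lborel) + 2 * (\<integral>z. g0 z \<partial>lborel)"
   if "integrable lborel e" "integrable lborel g0" "integrable lborel g1" "integrable lborel g2" "integrable lborel g3"
    "(\<integral>z. g1 z \<partial>lborel) = 0" "(\<integral>z. g2 z \<partial>lborel) = 0" "(\<integral>z. g3 z \<partial>lborel) = 0"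
   for e g0 g1 g2 g3 :: "complex \<Rightarrow> real"
   using that by simp
  show ?thesis unfolding sqn_def pt by (rule gen[OF iE i0 i1 d1 d2 d3])
 qed
 moreover have "(\<integral>z. E z \<partial>lborel) \<ge> 0" unfolding E_def by simp
 ultimately show "2 * (\<integral>z. (pp z + qq z) * (cmod (b z))\<^sup>2 \<partial>lborel) \<le> sqn (Dop p q b bx by')" by simp
qed

lemma C1c_exp:
 fixes c :: real
 assumes "C1c \<psi> p q"
 shows "C1c (\<lambda>z. exp (c * \<psi> z)) (\<lambda>z. exp (c * \<psi> z) * (c * p z)) (\<lambda>z. exp (c * \<psi> z) * (c * q z))"
proof -
 have "pd_at e (\<lambda>z. exp (c * \<psi> z)) (exp (c * \<psi> z) * (c * d)) z" if "pd_at e \<psi> d z" for e d z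
  by (rule pd_at_chain[where g=exp and f="\<lambda>z. c * \<psi> z"], rule pd_at_cmult[OF that], rule DERIV_exp)
 then show ?thesis using assms unfolding C1c_def has_pd_def by (auto intro!: continuous_intros)
qed

text \<open>Duality: pairing \<open>b\<close> with \<open>F\<close> is bounded by ||Dop b|| thanks
  to \<open>hormander_ineq\<close>, and the Riesz vector u satisfies (d/dx + \<i> d/dy)(u exp
  \<psi>) = F in the weak sense. The 2 in front of the Laplacian there is the source of
  \<open>B / 2\<close>.\<close>

lemma hormander_weak:
 fixes F :: "complex \<Rightarrow> complex"
 assumes w: "weight \<psi> p q pp qq" and lap: "\<And>z. pp z + qq z > 0"
  and F: "continuous_on UNIV F"
  and I: "integrable lborel (\<lambda>z. (cmod (F z))\<^sup>2 * exp (- 2 * \<psi> z) / (pp z + qq z))"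
  and B: "(\<integral>z. (cmod (F z))\<^sup>2 * exp (- 2 * \<psi> z) / (pp z + qq z) \<partial>lborel) \<le> B"
 shows "\<exists>u. sqi u \<and> sqn u \<le> B / 2 \<and>
  (\<forall>\<gamma> \<gamma>x \<gamma>y. C1c \<gamma> \<gamma>x \<gamma>y \<longrightarrow> csupp \<gamma> \<longrightarrow>
   (\<integral>z. (\<gamma>x z + \<i> * \<gamma>y z) * (u z * of_real (exp (\<psi> z))) \<partial>lborel) = - (\<integral>z. \<gamma> z * F z \<partial>lborel))"
proof -
 note W = w[unfolded weight_def C1c_def]
 have cont: "continuous_on UNIV \<psi>" "continuous_on UNIV p" "continuous_on UNIV q" "continuous_on UNIV pp" "continuous_on UNIV qq"
  using W by auto
 let ?L = "\<lambda>z. pp z + qq z"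
 have L0: "?L z \<noteq> 0" for z using lap[of z] by simp
 define V where "V = {(b, bx, by'). C1c b bx by' \<and> csupp (b :: complex \<Rightarrow> complex)}"
 define D where "D = (\<lambda>(b, bx, by'). Dop p q b bx by')"
 define l where "l = (\<lambda>(b, bx :: complex \<Rightarrow> complex, by' :: complex \<Rightarrow> complex). - (\<integral>z. b z * cnj (F z) * of_real (exp (- \<psi> z)) \<partial>lborel))"
 \<comment> \<open>The square root of the Laplacian is given to \<open>b\<close> and its inverse to
   \<open>F\<close>; the Cauchy-Schwarz inequality then meets exactly the two integrals that are
   controlled.\<close>
 define F1 where "F1 z = F z * of_real (exp (- \<psi> z) / sqrt (?L z))" for z
 have F1c: "continuous_on UNIV F1" unfolding F1_def
  using cont F L0 by (auto intro!: continuous_intros)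
 have F1eq: "(cmod (F1 z))\<^sup>2 = (cmod (F z))\<^sup>2 * exp (- 2 * \<psi> z) / ?L z" for z
  using lap[of z] by (simp add: F1_def norm_mult power_mult_distrib power_divide norm_divide exp_double[symmetric] flip: exp_of_nat_mult)
 have F1: "sqi F1" "sqn F1 \<le> B"
  using I B F1c by (auto simp: sqi_def sqn_def F1eq intro: borel_measurable_continuous_onI)
 have B0: "B \<ge> 0" using F1(2) sqn_nonneg[of F1] by linarith
 have cs: "integrable lborel (\<lambda>z. b z * cnj (F z) * of_real (exp (- \<psi> z)))" if "(b, bx, by') \<in> V" for b bx by'
  using that cont F unfolding V_def C1c_def
  by (intro integrable_cc) (auto intro!: continuous_intros simp: csupp_def)
 obtain u f where u: "sqi u" "sqn u \<le> B / 2" "\<And>v. v \<in> V ==> ip (D v) u = l v"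
 proof -
  have "\<exists>u f. sqi u \<and> sqn u \<le> B / 2 \<and> (\<forall>v\<in>V. ip (D v) u = l v) \<and>
   (\<forall>n. f n \<in> V) \<and> (\<lambda>n. sqn (\<lambda>z. D (f n) z - u z)) \<longlonglongrightarrow> 0"
  proof (rule riesz_L2)
   have "((\<lambda>_. 0), (\<lambda>_. 0), (\<lambda>_. 0)) \<in> V" by (auto simp: V_def C1c_def has_pd_def csupp_def)
   then show "V \<noteq> {}" by blast
   show "sqi (D v)" if "v \<in> V" for v
    using that hormander_ineq(3)[OF w] by (auto simp: V_def D_def)
   show "0 \<le> B / 2" using B0 by simp
  next
   fix v w and c :: complex assume "v \<in> V" "w \<in> V"
   then obtain b bx by' d dx' dy' where v: "v = (b, bx, by')" "C1c b bx by'" "csupp b"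
    and w': "w = (d, dx', dy')" "C1c d dx' dy'" "csupp d"
    by (auto simp: V_def)
   let ?x = "(\<lambda>z. b z + c * d z, \<lambda>z. bx z + c * dx' z, \<lambda>z. by' z + c * dy' z)"
   have "csupp (\<lambda>z. b z + c * d z)"
   proof -
    obtain r s where "\<And>z. b z \<noteq> 0 ==> norm z \<le> r" "\<And>z. d z \<noteq> 0 ==> norm z \<le> s"
     using v(3) w'(3) unfolding csupp_def by auto
    then show ?thesis unfolding csupp_def
     by (intro exI[of _ "max r s"]) (metis add.right_neutral le_max_iff_disj mult_zero_right)
   qed
   then have x: "?x \<in> V"
    using v w' unfolding V_def C1c_def has_pd_def
    by (auto intro!: pd_at_add pd_at_cmult continuous_intros)
   have "D ?x = (\<lambda>z. D v z + c * D w z)"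
    unfolding D_def v(1) w'(1) by (simp add: Dop_def algebra_simps fun_eq_iff)
   moreover have "l ?x = l v + c * l w"
   proof -
    have iv: "integrable lborel (\<lambda>z. b z * cnj (F z) * of_real (exp (- \<psi> z)))"
     "integrable lborel (\<lambda>z. d z * cnj (F z) * of_real (exp (- \<psi> z)))"
     using cs[of b bx by'] cs[of d dx' dy'] v w' by (auto simp: V_def)
    have "(\<integral>z. (b z + c * d z) * cnj (F z) * of_real (exp (- \<psi> z)) \<partial>lborel)
     = (\<integral>z. b z * cnj (F z) * of_real (exp (- \<psi> z)) + c * (d z * cnj (F z) * of_real (exp (- \<psi> z))) \<partial>lborel)"
     by (simp add: algebra_simps)
    also have "\<dots> = (\<integral>z. b z * cnj (F z) * of_real (exp (- \<psi> z)) \<partial>lborel) + c * (\<integral>z. d z * cnj (F z) * of_real (exp (- \<psi> z)) \<partial>lborel)"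
     by (subst Bochner_Integration.integral_add[OF iv(1) integrable_mult_right[OF iv(2)]]) (simp only: integral_mult_right_zero)
    finally show ?thesis unfolding l_def v(1) w'(1) by simp
   qed
   ultimately show "\<exists>x\<in>V. D x = (\<lambda>z. D v z + c * D w z) \<and> l x = l v + c * l w" using x by blast
  next
   fix v assume "v \<in> V"
   then obtain b bx by' where v: "v = (b, bx, by')" "C1c b bx by'" "csupp b" by (auto simp: V_def)
   define b1 where "b1 z = b z * of_real (sqrt (?L z))" for z
   have b1eq: "(cmod (b1 z))\<^sup>2 = ?L z * (cmod (b z))\<^sup>2" for z
    using lap[of z] by (simp add: b1_def norm_mult power_mult_distrib)
   have "continuous_on UNIV b1" unfolding b1_def using cont v(2) by (auto intro!: continuous_intros simp: C1c_def)
   then have b1: "sqi b1" "sqn b1 = (\<integral>z. ?L z * (cmod (b z))\<^sup>2 \<partial>lborel)"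
    using hormander_ineq(1)[OF w v(2,3)] by (auto simp: sqi_def sqn_def b1eq intro: borel_measurable_continuous_onI)
   have "b1 z * cnj (F1 z) = b z * cnj (F z) * of_real (exp (- \<psi> z))" for z
    using L0[of z] lap[of z] by (simp add: b1_def F1_def)
   then have "l v = - ip b1 F1" unfolding l_def v(1) ip_def by simp
   then have "(cmod (l v))\<^sup>2 \<le> sqn b1 * sqn F1" using ip_cauchy_schwarz[OF b1(1) F1(1)] by simp
   also have "\<dots> \<le> (sqn (D v) / 2) * B"
    using hormander_ineq(2)[OF w v(2,3)] b1(2) F1(2) B0 sqn_nonneg[of F1]
    by (intro mult_mono) (auto simp: D_def v(1))
   finally show "(cmod (l v))\<^sup>2 \<le> B / 2 * sqn (D v)" by (simp add: mult.commute)
  qed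
  then show ?thesis using that by blast
 qed
 have "(\<integral>z. (\<gamma>x z + \<i> * \<gamma>y z) * (u z * of_real (exp (\<psi> z))) \<partial>lborel) = - (\<integral>z. \<gamma> z * F z \<partial>lborel)"
  if g: "C1c \<gamma> \<gamma>x \<gamma>y" "csupp \<gamma>" for \<gamma> \<gamma>x \<gamma>y
 proof -
  let ?e = "\<lambda>z. complex_of_real (exp (\<psi> z))"
  \<comment> \<open>For this \<open>b\<close> the derivatives of \<psi> cancel in
    \<open>Dop\<close>, which leaves exp \<psi> times the conjugate of the dbar derivative of
    \<gamma>.\<close>
  let ?b = "\<lambda>z. ?e z * cnj (\<gamma> z)"
  let ?bx = "\<lambda>z. ?e z * cnj (\<gamma>x z) + of_real (exp (\<psi> z) * p z) * cnj (\<gamma> z)"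
  let ?by = "\<lambda>z. ?e z * cnj (\<gamma>y z) + of_real (exp (\<psi> z) * q z) * cnj (\<gamma> z)"
  have "C1c ?e (\<lambda>z. of_real (exp (\<psi> z) * p z)) (\<lambda>z. of_real (exp (\<psi> z) * q z))"
   using C1c_of_real[OF C1c_exp[of \<psi> p q 1]] w by (simp add: weight_def)
  moreover have "C1c (\<lambda>z. cnj (\<gamma> z)) (\<lambda>z. cnj (\<gamma>x z)) (\<lambda>z. cnj (\<gamma>y z))"
   using g(1) unfolding C1c_def has_pd_def by (auto intro!: pd_at_cnj continuous_intros)
  ultimately have "C1c ?b ?bx ?by" by (rule C1c_mult)
  moreover have "csupp ?b" using g(2) by (auto simp: csupp_def)
  ultimately have v: "(?b, ?bx, ?by) \<in> V" by (simp add: V_def)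
  have "ip (D (?b, ?bx, ?by)) u = l (?b, ?bx, ?by)" by (rule u(3)[OF v])
  then have "cnj (ip (D (?b, ?bx, ?by)) u) = cnj (l (?b, ?bx, ?by))" by simp
  moreover have "cnj (ip (D (?b, ?bx, ?by)) u) = (\<integral>z. (\<gamma>x z + \<i> * \<gamma>y z) * (u z * of_real (exp (\<psi> z))) \<partial>lborel)"
   unfolding ip_cnj[symmetric] unfolding ip_def D_def Dop_def
   by (intro Bochner_Integration.integral_cong refl) (simp add: algebra_simps)
  moreover have "cnj (l (?b, ?bx, ?by)) = - (\<integral>z. \<gamma> z * F z \<partial>lborel)"
  proof -
   have "cnj (l (?b, ?bx, ?by)) = - (\<integral>z. cnj (?b z * cnj (F z) * of_real (exp (- \<psi> z))) \<partial>lborel)"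
    unfolding l_def by (simp only: Bochner_Integration.integral_cnj complex_cnj_minus prod.case)
   also have "(\<lambda>z. cnj (?b z * cnj (F z) * of_real (exp (- \<psi> z)))) = (\<lambda>z. \<gamma> z * F z)"
   proof
    fix z
    have "exp (\<psi> z) * exp (- \<psi> z) = 1" by (simp flip: exp_add)
    then have "?e z * of_real (exp (- \<psi> z)) = 1" by (metis of_real_1 of_real_mult)
    then have "(?e z * of_real (exp (- \<psi> z))) * (\<gamma> z * F z) = \<gamma> z * F z" by simp
    then show "cnj (?b z * cnj (F z) * of_real (exp (- \<psi> z))) = \<gamma> z * F z" by (simp add: mult_ac)
   qed
   finally show ?thesis .
  qed
  ultimately show ?thesis by simp
 qed
 with u show ?thesis by blast
qed

section \<open>Mollifiers and the weighted estimate for an entire correction\<close>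

definition kap :: "real \<Rightarrow> complex \<Rightarrow> real" where
 "kap t w = bp 3 t w / (J3 * t\<^sup>2)"

lemma kap_nonneg [simp]: "kap t w \<ge> 0"
 using J3_pos by (simp add: kap_def)

lemma kap_eq_0: "t > 0 ==> cmod w \<ge> t ==> kap t w = 0"
 by (simp add: kap_def bp_eq_0)

lemma kap_cont [continuous_intros]: "t > 0 ==> continuous_on S (kap t)"
 unfolding kap_def[abs_def] using J3_pos by (intro continuous_intros) auto

lemma kap_csupp: "t > 0 ==> csupp (kap t)"
 unfolding csupp_def using kap_eq_0 by (metis nle_le)

lemma kap_minus: "kap t (w - z) = kap t (z - w)"
 by (simp add: kap_def bp_def norm_minus_commute)

lemma integral_kap: "t > 0 ==> (\<integral>w. kap t (w - z) \<partial>lborel) = 1"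
 unfolding kap_def using integral_bp3[of t z] J3_pos by simp

lemma integrable_kap:
 fixes f :: "complex \<Rightarrow> 'a::{real_normed_field,banach,second_countable_topology}"
 assumes "t > 0" "loc_int lborel f"
 shows "integrable lborel (\<lambda>w. of_real (kap t (w - z)) * f w)"
 using assms kap_csupp[of t] integrable_csupp_mult[of lborel f "\<lambda>w. of_real (kap t w)" z]
 by (auto simp: csupp_def intro!: continuous_intros)

lemma integrable_kap_real: "t > 0 ==> integrable lborel (\<lambda>w. kap t (w - z))"
 using integrable_kap[of t "\<lambda>_. 1::real" z] by (simp add: loc_int_continuous)

lemma kap_avg_close:
 fixes v :: "complex \<Rightarrow> complex"
 assumes v: "loc_int lborel v" and t: "t > 0" and e: "\<And>w. cmod (w - z) < t ==> cmod (v w - a) \<le> e"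
 shows "cmod ((\<integral>w. of_real (kap t (w - z)) * v w \<partial>lborel) - a) \<le> e"
proof -
 have i: "integrable lborel (\<lambda>w. of_real (kap t (w - z)) * v w)" by (rule integrable_kap[OF t v])
 have i2: "integrable lborel (\<lambda>w. of_real (kap t (w - z)) * a)"
  by (rule integrable_kap[OF t]) (simp add: loc_int_continuous)
 have "(\<integral>w. of_real (kap t (w - z)) * a \<partial>lborel) = of_real (\<integral>w. kap t (w - z) \<partial>lborel) * a"
  by (simp only: integral_mult_left_zero integral_complex_of_real)
 then have a: "(\<integral>w. of_real (kap t (w - z)) * a \<partial>lborel) = a" using integral_kap[OF t] by simp
 have "(\<integral>w. of_real (kap t (w - z)) * v w \<partial>lborel) - a = (\<integral>w. of_real (kap t (w - z)) * v w - of_real (kap t (w - z)) * a \<partial>lborel)"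
  using i i2 a by simp
 also have "cmod \<dots> \<le> (\<integral>w. kap t (w - z) * e \<partial>lborel)"
 proof (rule Bochner_Integration.integral_norm_bound_integral)
  show "integrable lborel (\<lambda>w. kap t (w - z) * e)"
   by (intro integrable_mult_left integrable_kap_real t)
  show "norm (of_real (kap t (w - z)) * v w - of_real (kap t (w - z)) * a) \<le> kap t (w - z) * e" for w
  proof -
   have "norm (of_real (kap t (w - z)) * v w - of_real (kap t (w - z)) * a) = kap t (w - z) * cmod (v w - a)"
    by (simp add: norm_mult flip: right_diff_distrib)
   also have "\<dots> \<le> kap t (w - z) * e"
    using e[of w] kap_eq_0[OF t, of "w - z"] by (cases "cmod (w - z) < t") (auto intro: mult_left_mono)
   finally show ?thesis .
  qed
 qed (use i i2 in auto)
 also have "\<dots> = e" using integral_kap[OF t, of z] by simp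
 finally show ?thesis .
qed

lemma kap_avg_limit:
 fixes v :: "complex \<Rightarrow> complex"
 assumes v: "continuous_on UNIV v" and t: "\<And>n. t n > 0" "t \<longlonglongrightarrow> 0"
 shows "(\<lambda>n. \<integral>w. of_real (kap (t n) (w - z)) * v w \<partial>lborel) \<longlonglongrightarrow> v z"
proof (rule LIMSEQ_I)
 fix e :: real assume e: "e > 0"
 have "isCont v z" using v by (simp add: continuous_on_eq_continuous_at)
 then obtain d where d: "d > 0" "\<And>w. dist w z < d ==> dist (v w) (v z) < e/2"
  unfolding continuous_at_eps_delta using e by (metis half_gt_zero)
 obtain N where N: "\<And>n. n \<ge> N ==> \<bar>t n\<bar> < d" using LIMSEQ_D[OF t(2) d(1)] by auto
 show "\<exists>N. \<forall>n\<ge>N. norm ((\<integral>w. of_real (kap (t n) (w - z)) * v w \<partial>lborel) - v z) < e"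
 proof (intro exI[of _ N] allI impI)
  fix n assume "n \<ge> N"
  have "cmod ((\<integral>w. of_real (kap (t n) (w - z)) * v w \<partial>lborel) - v z) \<le> e/2"
  proof (rule kap_avg_close[OF loc_int_continuous[OF v] t(1)])
   fix w assume "cmod (w - z) < t n"
   then have "dist w z < d" using N[OF \<open>n \<ge> N\<close>] by (simp add: dist_norm)
   then show "cmod (v w - v z) \<le> e/2" using d(2)[of w] by (simp add: dist_norm)
  qed
  then show "norm ((\<integral>w. of_real (kap (t n) (w - z)) * v w \<partial>lborel) - v z) < e" using e by simp
 qed
qed

text \<open>Tonelli: the kernel is symmetric in its two arguments, so integrating the outer variable
  first again gives mass one.\<close>

lemma kap_conv_mass:
 fixes f :: "complex \<Rightarrow> real"
 assumes t: "t > 0" and f: "integrable lborel f" "\<And>z. f z \<ge> 0" and fb: "f \<in> borel_measurable borel"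
 defines "G \<equiv> \<lambda>z. \<integral>w. kap t (w - z) * f w \<partial>lborel"
 shows "integrable lborel G" "(\<integral>z. G z \<partial>lborel) = (\<integral>z. f z \<partial>lborel)" "\<And>z. G z \<ge> 0"
proof -
 have li: "loc_int lborel f"
  unfolding loc_int_def set_integrable_def using f(1) by (intro allI integrable_mult_indicator) auto
 have [measurable]: "kap t \<in> borel_measurable borel" using t by (intro borel_measurable_continuous_onI continuous_intros)
 note [measurable] = fb
 have i: "integrable lborel (\<lambda>w. kap t (w - z) * f w)" for z
  using integrable_kap[OF t li, of z] by simp
 show G0: "G z \<ge> 0" for z unfolding G_def using f(2) by (intro integral_nonneg_AE) auto
 have Gc: "continuous_on UNIV G" unfolding G_def
  by (rule cont_conv) (use t li kap_csupp in \<open>auto intro!: continuous_intros\<close>)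
 then have [measurable]: "G \<in> borel_measurable borel" by (rule borel_measurable_continuous_onI)
 have "(\<integral>\<^sup>+z. ennreal (G z) \<partial>lborel) = (\<integral>\<^sup>+z. (\<integral>\<^sup>+w. ennreal (kap t (w - z) * f w) \<partial>lborel) \<partial>lborel)"
  unfolding G_def using f(2) by (subst nn_integral_eq_integral[OF i]) auto
 also have "\<dots> = (\<integral>\<^sup>+w. (\<integral>\<^sup>+z. ennreal (kap t (w - z) * f w) \<partial>lborel) \<partial>lborel)"
  by (rule lborel_pair.Fubini') measurable
 also have "\<dots> = (\<integral>\<^sup>+w. ennreal (f w) \<partial>lborel)"
 proof (rule nn_integral_cong)
  fix w
  have "(\<integral>\<^sup>+z. ennreal (kap t (w - z) * f w) \<partial>lborel) = (\<integral>\<^sup>+z. ennreal (kap t (z - w) * f w) \<partial>lborel)"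
   by (simp add: kap_minus[of t w])
  also have "\<dots> = ennreal (\<integral>z. kap t (z - w) * f w \<partial>lborel)"
   using f(2) by (intro nn_integral_eq_integral integrable_mult_left integrable_kap_real t) auto
  also have "\<dots> = ennreal (f w)" using integral_kap[OF t, of w] by simp
  finally show "(\<integral>\<^sup>+z. ennreal (kap t (w - z) * f w) \<partial>lborel) = ennreal (f w)" .
 qed
 also have "\<dots> = ennreal (\<integral>w. f w \<partial>lborel)" using f by (intro nn_integral_eq_integral) auto
 finally have nn: "(\<integral>\<^sup>+z. ennreal (G z) \<partial>lborel) = ennreal (\<integral>w. f w \<partial>lborel)" .
 show "integrable lborel G"
  by (rule integrableI_nn_integral_finite[OF _ _ nn]) (use G0 f(2) in \<open>auto intro: integral_nonneg_AE\<close>)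
 show "(\<integral>z. G z \<partial>lborel) = (\<integral>z. f z \<partial>lborel)"
  using integral_eq_nn_integral[of G lborel] nn G0 f(2) by (simp add: integral_nonneg_AE)
qed

lemma loc_int_sqi:
 assumes u: "sqi u" and c: "continuous_on UNIV c"
 shows "loc_int lborel (\<lambda>z. u z * c z)"
 unfolding loc_int_def set_integrable_def
proof
 fix R
 have m: "u \<in> borel_measurable borel" "c \<in> borel_measurable borel"
  using u c by (auto simp: sqi_def intro: borel_measurable_continuous_onI)
 have "set_integrable lborel (ball 0 R) (\<lambda>z. (cmod (c z))\<^sup>2)"
 proof -
  have "loc_int lborel (\<lambda>z. (cmod (c z))\<^sup>2)" by (rule loc_int_continuous) (intro continuous_intros c)
  then show ?thesis by (simp add: loc_int_def)
 qed
 then have i: "integrable lborel (\<lambda>z. (cmod (u z))\<^sup>2 + indicator (ball 0 R) z *\<^sub>R (cmod (c z))\<^sup>2)"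
  using u unfolding sqi_def set_integrable_def by (intro Bochner_Integration.integrable_add) auto
 show "integrable lborel (\<lambda>z. indicator (ball 0 R) z *\<^sub>R (u z * c z))"
 proof (rule Bochner_Integration.integrable_bound[OF i])
  show "AE z in lborel. norm (indicator (ball 0 R) z *\<^sub>R (u z * c z)) \<le> norm ((cmod (u z))\<^sup>2 + indicator (ball 0 R) z *\<^sub>R (cmod (c z))\<^sup>2)"
  proof (intro AE_I2)
   fix z
   have "cmod (u z) * cmod (c z) \<le> (cmod (u z))\<^sup>2 + (cmod (c z))\<^sup>2"
    by (rule order_trans[OF _ two_mult_le]) simp
   then show "norm (indicator (ball 0 R) z *\<^sub>R (u z * c z)) \<le> norm ((cmod (u z))\<^sup>2 + indicator (ball 0 R) z *\<^sub>R (cmod (c z))\<^sup>2)"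
    by (auto simp: indicator_def norm_mult)
  qed
  show "(\<lambda>z. indicator (ball 0 R) z *\<^sub>R (u z * c z)) \<in> borel_measurable lborel"
   using m by (intro borel_measurable_scaleR borel_measurable_indicator borel_measurable_times) auto
 qed
qed

lemma loc_int_add_mult:
 fixes f g :: "complex \<Rightarrow> complex"
 assumes "loc_int M f" "loc_int M g"
 shows "loc_int M (\<lambda>z. f z + c * g z)"
proof -
 have "integrable M (\<lambda>z. indicator (ball 0 R) z *\<^sub>R f z + c * (indicator (ball 0 R) z *\<^sub>R g z))" for R
  using assms unfolding loc_int_def set_integrable_def
  by (intro Bochner_Integration.integrable_add integrable_mult_right) auto
 then show ?thesis unfolding loc_int_def set_integrable_def by (simp add: scaleR_add_right)
qed

text \<open>The holomorphic factor \<open>P\<close> is the point of this form. For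
  \<open>P = 1\<close> it corrects \<open>v\<close> to an entire function in the usual weighted
  norm; for \<open>P z = z - l\<close> the quotient by |P|^2 acts like a weight with a logarithmic
  pole although \<psi> stays C^2. With U = u exp(\<psi>) P from \<open>hormander_weak\<close>, the
  difference \<open>v - U\<close> is weakly holomorphic; \<open>weyl_dbar\<close> identifies its
  averages with \<open>h\<close>, and the bound is proved for averages of \<open>U\<close> and
  carried to \<open>v - h\<close> by Fatou's lemma.\<close>

theorem hormander:
 fixes P F v :: "complex \<Rightarrow> complex"
 assumes w: "weight \<psi> p q pp qq" and lap: "\<And>z. pp z + qq z > 0"
  and P: "C1c P P' (\<lambda>z. \<i> * P' z)"
  and v: "C1c v vx vy" and vF: "\<And>z. vx z + \<i> * vy z = P z * F z" and F: "continuous_on UNIV F"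
  and I: "integrable lborel (\<lambda>z. (cmod (F z))\<^sup>2 * exp (- 2 * \<psi> z) / (pp z + qq z))"
  and B: "(\<integral>z. (cmod (F z))\<^sup>2 * exp (- 2 * \<psi> z) / (pp z + qq z) \<partial>lborel) \<le> B"
 shows "\<exists>h. h holomorphic_on UNIV \<and>
   integrable lborel (\<lambda>z. (cmod (v z - h z))\<^sup>2 / ((cmod (P z))\<^sup>2 * exp (2 * \<psi> z))) \<and>
   (\<integral>z. (cmod (v z - h z))\<^sup>2 / ((cmod (P z))\<^sup>2 * exp (2 * \<psi> z)) \<partial>lborel) \<le> B"
proof -
 have psic: "continuous_on UNIV \<psi>" using w by (simp add: weight_def C1c_def)
 have Pc: "continuous_on UNIV P" and vc: "continuous_on UNIV v" using P v by (auto simp: C1c_def)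
 obtain u where u: "sqi u" "sqn u \<le> B / 2"
  and weak: "\<And>\<gamma> \<gamma>x \<gamma>y. C1c \<gamma> \<gamma>x \<gamma>y ==> csupp \<gamma> ==>
   (\<integral>z. (\<gamma>x z + \<i> * \<gamma>y z) * (u z * of_real (exp (\<psi> z))) \<partial>lborel) = - (\<integral>z. \<gamma> z * F z \<partial>lborel)"
  using hormander_weak[OF w lap F I B] by blast
 have [measurable]: "u \<in> borel_measurable borel" using u by (simp add: sqi_def)
 let ?c = "\<lambda>z. P z * of_real (exp (\<psi> z))"
 have cc: "continuous_on UNIV ?c" using psic Pc by (intro continuous_intros)
 define U where "U z = u z * ?c z" for z
 have Ul: "loc_int lborel U" unfolding U_def[abs_def] by (rule loc_int_sqi[OF u(1) cc])
 have Um [measurable]: "U \<in> borel_measurable borel"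
  using loc_int_borel[OF Ul] by simp
 define Q where "Q z = v z + (-1) * U z" for z
 have Ql: "loc_int lborel Q" unfolding Q_def[abs_def]
  by (rule loc_int_add_mult[OF loc_int_continuous[OF vc] Ul])
 have "\<exists>h. h holomorphic_on UNIV \<and> (\<forall>t>0. \<forall>z. (\<integral>w. of_real (bp 3 t (w - z) / t\<^sup>2) * Q w \<partial>lborel) = h z)"
 proof (rule weyl_dbar[OF Ql])
  fix \<gamma> \<gamma>x \<gamma>y :: "complex \<Rightarrow> complex" assume g: "C1c \<gamma> \<gamma>x \<gamma>y" "csupp \<gamma>"
  have gs: "csupp \<gamma>x" "csupp \<gamma>y" using g csupp_pd unfolding C1c_def by blast+
  have gc: "continuous_on UNIV \<gamma>" "continuous_on UNIV \<gamma>x" "continuous_on UNIV \<gamma>y" using g by (auto simp: C1c_def)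
  have "csupp (\<lambda>z. \<gamma>x z + \<i> * \<gamma>y z)"
  proof -
   obtain r s where "\<And>z. \<gamma>x z \<noteq> 0 ==> norm z \<le> r" "\<And>z. \<gamma>y z \<noteq> 0 ==> norm z \<le> s"
    using gs unfolding csupp_def by auto
   then show ?thesis unfolding csupp_def
    by (intro exI[of _ "max r s"]) (metis add.right_neutral le_max_iff_disj mult_zero_right)
  qed
  then have ig: "integrable lborel (\<lambda>z. (\<gamma>x z + \<i> * \<gamma>y z) * f z)" if "loc_int lborel f" for f
  proof -
   have "continuous_on UNIV (\<lambda>z. \<gamma>x z + \<i> * \<gamma>y z)" using gc by (intro continuous_intros)
   from integrable_csupp_mult[OF that _ this, of 0] show ?thesis using \<open>csupp (\<lambda>z. \<gamma>x z + \<i> * \<gamma>y z)\<close> by simp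
  qed
  have "C1c (\<lambda>z. \<gamma> z * P z) (\<lambda>z. \<gamma> z * P' z + \<gamma>x z * P z) (\<lambda>z. \<gamma> z * (\<i> * P' z) + \<gamma>y z * P z)"
   by (rule C1c_mult[OF g(1) P])
  moreover have "csupp (\<lambda>z. \<gamma> z * P z)" using g(2) by (auto simp: csupp_def)
  ultimately have "(\<integral>z. ((\<gamma> z * P' z + \<gamma>x z * P z) + \<i> * (\<gamma> z * (\<i> * P' z) + \<gamma>y z * P z)) * (u z * of_real (exp (\<psi> z))) \<partial>lborel)
   = - (\<integral>z. (\<gamma> z * P z) * F z \<partial>lborel)" by (rule weak)
  moreover have "((\<gamma> z * P' z + \<gamma>x z * P z) + \<i> * (\<gamma> z * (\<i> * P' z) + \<gamma>y z * P z)) * (u z * of_real (exp (\<psi> z)))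
   = (\<gamma>x z + \<i> * \<gamma>y z) * U z" for z
   by (simp add: U_def algebra_simps)
  ultimately have 1: "(\<integral>z. (\<gamma>x z + \<i> * \<gamma>y z) * U z \<partial>lborel) = - (\<integral>z. \<gamma> z * (P z * F z) \<partial>lborel)"
   by (simp add: mult.assoc)
  have gv: "C1c (\<lambda>z. \<gamma> z * v z) (\<lambda>z. \<gamma> z * vx z + \<gamma>x z * v z) (\<lambda>z. \<gamma> z * vy z + \<gamma>y z * v z)"
   by (rule C1c_mult[OF g(1) v])
  have csgv: "csupp (\<lambda>z. \<gamma> z * v z)" using g(2) by (auto simp: csupp_def)
  have z1: "(\<integral>z. \<gamma> z * vx z + \<gamma>x z * v z \<partial>lborel) = 0" and z2: "(\<integral>z. \<gamma> z * vy z + \<gamma>y z * v z \<partial>lborel) = 0"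
   using integral_pd_0[OF _ _ _ csgv] gv unfolding C1c_def by blast+
  have i1: "integrable lborel (\<lambda>z. \<gamma> z * vx z + \<gamma>x z * v z)" and i2: "integrable lborel (\<lambda>z. \<gamma> z * vy z + \<gamma>y z * v z)"
   using gv csupp_pd[OF _ csgv] unfolding C1c_def by (blast intro: integrable_cc)+
  have ip: "integrable lborel (\<lambda>z. \<gamma> z * (P z * F z))"
   using gc Pc F g(2) by (intro integrable_cc) (auto intro!: continuous_intros simp: csupp_def)
  have "0 = (\<integral>z. (\<gamma> z * vx z + \<gamma>x z * v z) + \<i> * (\<gamma> z * vy z + \<gamma>y z * v z) \<partial>lborel)"
   by (subst Bochner_Integration.integral_add[OF i1 integrable_mult_right[OF i2]]) (simp only: integral_mult_right_zero z1 z2 mult_zero_right add_0_right)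
  also have "\<dots> = (\<integral>z. \<gamma> z * (P z * F z) + (\<gamma>x z + \<i> * \<gamma>y z) * v z \<partial>lborel)"
   by (simp only: vF[symmetric]) (simp add: algebra_simps)
  also have "\<dots> = (\<integral>z. \<gamma> z * (P z * F z) \<partial>lborel) + (\<integral>z. (\<gamma>x z + \<i> * \<gamma>y z) * v z \<partial>lborel)"
   by (rule Bochner_Integration.integral_add[OF ip ig[OF loc_int_continuous[OF vc]]])
  finally have 2: "(\<integral>z. (\<gamma>x z + \<i> * \<gamma>y z) * v z \<partial>lborel) = - (\<integral>z. \<gamma> z * (P z * F z) \<partial>lborel)"
   by (simp add: eq_neg_iff_add_eq_0 add.commute)
  have "(\<integral>w. (\<gamma>x w + \<i> * \<gamma>y w) * Q w \<partial>lborel) = (\<integral>w. (\<gamma>x w + \<i> * \<gamma>y w) * v w - (\<gamma>x w + \<i> * \<gamma>y w) * U w \<partial>lborel)"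
   unfolding Q_def by (simp only: mult_minus1 right_diff_distrib[symmetric] add_uminus_conv_diff)
  also have "\<dots> = 0"
   unfolding Bochner_Integration.integral_diff[OF ig[OF loc_int_continuous[OF vc]] ig[OF Ul]] 1 2 by (rule diff_self)
  finally show "(\<integral>w. (\<gamma>x w + \<i> * \<gamma>y w) * Q w \<partial>lborel) = 0" .
 qed
 then obtain h1 where h1: "h1 holomorphic_on UNIV"
  "\<And>t z. t > 0 ==> (\<integral>w. of_real (bp 3 t (w - z) / t\<^sup>2) * Q w \<partial>lborel) = h1 z" by blast
 define h where "h z = h1 z / of_real J3" for z
 have hh: "h holomorphic_on UNIV" unfolding h_def[abs_def] using h1(1) J3_pos by (intro holomorphic_intros) auto
 have hk: "(\<integral>w. of_real (kap t (w - z)) * Q w \<partial>lborel) = h z" if "t > 0" for t z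
 proof -
  have "(\<integral>w. of_real (kap t (w - z)) * Q w \<partial>lborel) = (\<integral>w. (of_real (bp 3 t (w - z) / t\<^sup>2) * Q w) / of_real J3 \<partial>lborel)"
   by (intro Bochner_Integration.integral_cong refl) (simp add: kap_def)
  also have "\<dots> = h z" by (simp only: integral_divide_zero h1(2)[OF that] h_def)
  finally show ?thesis .
 qed
 define \<sigma> where "\<sigma> z = (cmod (P z))\<^sup>2 * exp (2 * \<psi> z)" for z
 have sc: "continuous_on UNIV \<sigma>" unfolding \<sigma>_def using Pc psic by (intro continuous_intros)
 have s0: "\<sigma> z \<ge> 0" for z by (simp add: \<sigma>_def)
 have Usq: "(cmod (U z))\<^sup>2 = (cmod (u z))\<^sup>2 * \<sigma> z" for z
  by (simp add: U_def \<sigma>_def norm_mult power_mult_distrib exp_double)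
 define m where "m t z = (\<integral>w. of_real (kap t (w - z)) * U w \<partial>lborel)" for t z
 define V where "V t z = (\<integral>w. of_real (kap t (w - z)) * v w \<partial>lborel)" for t z
 have mV: "V t z - h z = m t z" if t: "t > 0" for t z
 proof -
  have "h z = (\<integral>w. of_real (kap t (w - z)) * v w - of_real (kap t (w - z)) * U w \<partial>lborel)"
   unfolding hk[OF t, symmetric] Q_def by (simp only: mult_minus1 right_diff_distrib[symmetric] add_uminus_conv_diff)
  also have "\<dots> = V t z - m t z" unfolding V_def m_def
   by (rule Bochner_Integration.integral_diff[OF integrable_kap[OF t loc_int_continuous[OF vc]] integrable_kap[OF t Ul]])
  finally show ?thesis by simp
 qed
 have ub: "integrable lborel (\<lambda>z. (cmod (u z))\<^sup>2)" using u by (simp add: sqi_def)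
 define G where "G t z = (\<integral>w. kap t (w - z) * (cmod (u w))\<^sup>2 \<partial>lborel)" for t z
 have G: "integrable lborel (G t)" "(\<integral>z. G t z \<partial>lborel) = sqn u" "\<And>z. G t z \<ge> 0" if "t > 0" for t
  using kap_conv_mass[OF that ub] unfolding G_def sqn_def by auto
 have ul: "loc_int lborel (\<lambda>z. (cmod (u z))\<^sup>2)"
  unfolding loc_int_def set_integrable_def using integrable_mult_indicator[OF _ ub] by auto
 \<comment> \<open>Cauchy-Schwarz with the square root of the mollifier on both sides. The 2, from
   replacing \<sigma> by its value at the centre, is compensated by the 1/2 gained in
   \<open>hormander_weak\<close>.\<close>
 have mb: "(cmod (m t z))\<^sup>2 \<le> 2 * \<sigma> z * G t z" if t: "t > 0" and s: "\<And>w. cmod (w - z) < t ==> \<sigma> w \<le> 2 * \<sigma> z" for t z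
 proof -
  let ?a = "\<lambda>w. U w * of_real (sqrt (kap t (w - z)))" and ?b = "\<lambda>w. complex_of_real (sqrt (kap t (w - z)))"
  have [measurable]: "kap t \<in> borel_measurable borel" using t by (intro borel_measurable_continuous_onI continuous_intros)
  have asq: "(cmod (?a w))\<^sup>2 = kap t (w - z) * ((cmod (u w))\<^sup>2 * \<sigma> w)" for w
   by (simp add: norm_mult power_mult_distrib Usq)
  have ale: "kap t (w - z) * ((cmod (u w))\<^sup>2 * \<sigma> w) \<le> 2 * \<sigma> z * (kap t (w - z) * (cmod (u w))\<^sup>2)" for w
  proof (cases "cmod (w - z) < t")
   case True
   have "(kap t (w - z) * (cmod (u w))\<^sup>2) * \<sigma> w \<le> (kap t (w - z) * (cmod (u w))\<^sup>2) * (2 * \<sigma> z)"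
    by (rule mult_left_mono[OF s[OF True]]) simp
   then show ?thesis by (simp only: mult_ac)
  qed (use kap_eq_0[OF t, of "w - z"] in simp)
  have iG: "integrable lborel (\<lambda>w. 2 * \<sigma> z * (kap t (w - z) * (cmod (u w))\<^sup>2))"
   using integrable_kap[OF t ul, of z] by (intro integrable_mult_right) simp
  have "integrable lborel (\<lambda>w. (cmod (?a w))\<^sup>2)"
  proof (rule Bochner_Integration.integrable_bound[OF iG])
   show "AE w in lborel. norm ((cmod (?a w))\<^sup>2) \<le> norm (2 * \<sigma> z * (kap t (w - z) * (cmod (u w))\<^sup>2))"
    unfolding asq using ale s0 by (intro AE_I2) (simp add: abs_mult)
  qed measurable
  then have a: "sqi ?a" by (simp add: sqi_def)
  have bsq: "(cmod (?b w))\<^sup>2 = kap t (w - z)" for w by simp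
  have b: "sqi ?b" unfolding sqi_def bsq using integrable_kap_real[OF t] by (auto simp del: norm_of_real)
  have "ip ?a ?b = m t z" unfolding ip_def m_def
  proof (intro Bochner_Integration.integral_cong refl)
   fix w
   have "complex_of_real (sqrt (kap t (w - z))) * of_real (sqrt (kap t (w - z))) = of_real (kap t (w - z))"
    by (simp only: of_real_mult[symmetric] real_sqrt_mult_self kap_nonneg abs_of_nonneg)
   then show "?a w * cnj (?b w) = of_real (kap t (w - z)) * U w" by (simp add: mult.assoc mult.commute)
  qed
  moreover have "sqn ?b = 1" unfolding sqn_def bsq by (rule integral_kap[OF t])
  ultimately have "(cmod (m t z))\<^sup>2 \<le> sqn ?a" using ip_cauchy_schwarz[OF a b] by simp
  also have "\<dots> \<le> (\<integral>w. 2 * \<sigma> z * (kap t (w - z) * (cmod (u w))\<^sup>2) \<partial>lborel)"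
   unfolding sqn_def by (rule integral_mono) (use a iG ale asq in \<open>auto simp: sqi_def\<close>)
  also have "\<dots> = 2 * \<sigma> z * G t z" unfolding G_def by (rule integral_mult_right_zero)
  finally show ?thesis .
 qed
 \<comment> \<open>An exhaustion of the set where \<sigma> is positive: on \<open>K n\<close> it is
   bounded below, so uniform continuity yields one radius within which \<sigma> at most
   doubles.\<close>
 define K where "K n = {z. cmod z \<le> real (Suc n) \<and> \<sigma> z \<ge> 1 / real (Suc n)}" for n
 have "\<exists>t. 0 < t \<and> t < 1 / real (Suc n) \<and> (\<forall>z\<in>K n. \<forall>w. cmod (w - z) < t \<longrightarrow> \<sigma> w \<le> 2 * \<sigma> z)" for n
 proof -
  have "uniformly_continuous_on (cball 0 (real (Suc n) + 1)) \<sigma>"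
   by (rule compact_uniformly_continuous) (use sc continuous_on_subset in auto)
  moreover have "1 / real (Suc n) > 0" by simp
  ultimately obtain d where d: "d > 0" "\<And>w z. w \<in> cball 0 (real (Suc n) + 1) ==> z \<in> cball 0 (real (Suc n) + 1) ==> dist w z < d ==> dist (\<sigma> w) (\<sigma> z) < 1 / real (Suc n)"
   unfolding uniformly_continuous_on_def by metis
  let ?t = "min (min d 1) (1 / real (Suc n)) / 2"
  show ?thesis
  proof (intro exI[of _ ?t] conjI ballI allI impI)
   fix z w assume z: "z \<in> K n" and w: "cmod (w - z) < ?t"
   have "cmod w \<le> cmod z + cmod (w - z)" using norm_triangle_sub by blast
   moreover have "cmod (w - z) < 1" "cmod (w - z) < d"
   proof -
    define m where "m = min (min d 1) (1 / real (Suc n))"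
    have "m \<le> d" "m \<le> 1" "m > 0" using d(1) by (auto simp: m_def)
    then show "cmod (w - z) < 1" "cmod (w - z) < d" using w unfolding m_def[symmetric] by linarith+
   qed
   ultimately have "dist (\<sigma> w) (\<sigma> z) < 1 / real (Suc n)"
    using z by (intro d(2)) (auto simp: K_def dist_norm)
   then show "\<sigma> w \<le> 2 * \<sigma> z" using z unfolding K_def dist_real_def by auto
  next
   define m where "m = min (min d 1) (1 / real (Suc n))"
   have m: "m \<le> 1 / real (Suc n)" "m > 0" using d(1) by (auto simp: m_def)
   then show "0 < ?t" "?t < 1 / real (Suc n)" unfolding m_def[symmetric] by linarith+
  qed
 qed
 then obtain t where t: "\<And>n. t n > 0" "\<And>n. t n < 1 / real (Suc n)"
  "\<And>n z w. z \<in> K n ==> cmod (w - z) < t n ==> \<sigma> w \<le> 2 * \<sigma> z" by metis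
 have t0: "t \<longlonglongrightarrow> 0"
 proof (rule tendsto_sandwich[of "\<lambda>_. 0" _ _ "\<lambda>n. 1 / real (Suc n)"])
  show "(\<lambda>n. 1 / real (Suc n)) \<longlonglongrightarrow> 0" using LIMSEQ_inverse_real_of_nat by (simp add: inverse_eq_divide)
  show "\<forall>\<^sub>F n in sequentially. 0 \<le> t n" "\<forall>\<^sub>F n in sequentially. t n \<le> 1 / real (Suc n)"
   by (intro always_eventually allI less_imp_le t)+
 qed simp
 define f where "f n z = indicator (K n) z * ((cmod (V (t n) z - h z))\<^sup>2 / \<sigma> z)" for n z
 have hm [measurable]: "h \<in> borel_measurable borel"
  using hh holomorphic_on_imp_continuous_on by (blast intro: borel_measurable_continuous_onI)
 have sm [measurable]: "\<sigma> \<in> borel_measurable borel" "v \<in> borel_measurable borel" using sc vc by (auto intro: borel_measurable_continuous_onI)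
 have Vm [measurable]: "V (t n) \<in> borel_measurable borel" for n
 proof -
  have "continuous_on UNIV (\<lambda>z. \<integral>w. complex_of_real (kap (t n) (w - z)) * v w \<partial>lborel)"
   by (rule cont_conv[where k="\<lambda>w. complex_of_real (kap (t n) w)"])
    (use t(1)[of n] loc_int_continuous[OF vc] kap_csupp[of "t n"] in \<open>auto intro!: continuous_intros simp: csupp_def\<close>)
  then show ?thesis unfolding V_def[abs_def] by (rule borel_measurable_continuous_onI)
 qed
 have Km [measurable]: "K n \<in> sets borel" for n unfolding K_def by measurable
 have fle: "f n z \<le> 2 * G (t n) z" for n z
 proof (cases "z \<in> K n")
  case True
  then have "\<sigma> z > 0" unfolding K_def by (auto intro: less_le_trans[rotated])
  moreover have "(cmod (V (t n) z - h z))\<^sup>2 \<le> 2 * \<sigma> z * G (t n) z"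
   unfolding mV[OF t(1)] by (rule mb[OF t(1)]) (rule t(3)[OF True])
  ultimately show ?thesis using True by (simp add: f_def pos_divide_le_eq mult_ac)
 next
  case False
  then show ?thesis using G(3)[OF t(1)] by (simp add: f_def)
 qed
 have f0: "0 \<le> f n z" for n z using s0 by (simp add: f_def)
 have fi: "integrable lborel (f n)" for n
 proof (rule Bochner_Integration.integrable_bound)
  show "integrable lborel (\<lambda>z. 2 * G (t n) z)" using G(1)[OF t(1)] by simp
  show "f n \<in> borel_measurable lborel" unfolding f_def by measurable
  show "AE z in lborel. norm (f n z) \<le> norm (2 * G (t n) z)"
   using fle f0 G(3)[OF t(1)] by (intro AE_I2) (simp del: times_divide_eq_right)
 qed
 have fB: "(\<integral>z. f n z \<partial>lborel) \<le> B" for n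
 proof -
  have "(\<integral>z. f n z \<partial>lborel) \<le> (\<integral>z. 2 * G (t n) z \<partial>lborel)"
   by (rule integral_mono[OF fi _ fle]) (use G(1)[OF t(1)] in simp)
  also have "\<dots> = 2 * sqn u" using G(2)[OF t(1)] by simp
  finally show ?thesis using u(2) by simp
 qed
 have lim: "(\<lambda>n. f n z) \<longlonglongrightarrow> (cmod (v z - h z))\<^sup>2 / \<sigma> z" for z
 proof (cases "\<sigma> z = 0")
  \<comment> \<open>At zeros of \<open>P\<close> both quotients are 0 by the convention for division
    by zero.\<close>
  case True
  then have "f n z = 0" for n by (simp add: f_def)
  then show ?thesis using True by simp
 next
  case False
  then have sp: "\<sigma> z > 0" using s0[of z] by simp
  obtain N :: nat where N: "cmod z + 1 / \<sigma> z < real N" using reals_Archimedean2 by blast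
  have "z \<in> K n" if "n \<ge> N" for n
  proof -
   have "1 / \<sigma> z \<le> real (Suc n)" "cmod z \<le> real (Suc n)"
    using N that sp by (smt (verit) divide_pos_pos norm_ge_zero of_nat_Suc of_nat_le_iff)+
   then show ?thesis using sp unfolding K_def by (auto simp: field_simps)
  qed
  then have "\<forall>\<^sub>F n in sequentially. (cmod (V (t n) z - h z))\<^sup>2 / \<sigma> z = f n z"
   by (intro eventually_sequentiallyI[of N]) (simp add: f_def)
  moreover have "(\<lambda>n. (cmod (V (t n) z - h z))\<^sup>2 / \<sigma> z) \<longlonglongrightarrow> (cmod (v z - h z))\<^sup>2 / \<sigma> z"
   unfolding V_def using False by (intro tendsto_intros kap_avg_limit[OF vc t(1) t0]) auto
  ultimately show ?thesis by (rule Lim_transform_eventually[rotated])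
 qed
 have gm: "(\<lambda>z. (cmod (v z - h z))\<^sup>2 / \<sigma> z) \<in> borel_measurable lborel" by measurable
 have "integrable lborel (\<lambda>z. (cmod (v z - h z))\<^sup>2 / \<sigma> z)" "(\<integral>z. (cmod (v z - h z))\<^sup>2 / \<sigma> z \<partial>lborel) \<le> B"
  using fatou_bound[OF fi f0 fB gm AE_I2[OF lim]] by auto
 then show ?thesis using hh unfolding \<sigma>_def by blast
qed

section \<open>Rotations of the plane and mean values of subharmonic functions\<close>

lemma cis_borel_measurable [measurable]: "cis \<in> borel_measurable borel"
 by (intro borel_measurable_continuous_onI continuous_intros)

lemma nn_integral_translate:
 fixes f :: "complex \<Rightarrow> ennreal"
 assumes [measurable]: "f \<in> borel_measurable borel"
 shows "(\<integral>\<^sup>+w. f (c + w) \<partial>lborel) = (\<integral>\<^sup>+w. f w \<partial>lborel)"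
proof -
 have "(\<integral>\<^sup>+w. f w \<partial>lborel) = (\<integral>\<^sup>+w. f w \<partial>(distr lborel borel ((+) c)))"
  by (simp add: lborel_distr_plus)
 also have "\<dots> = (\<integral>\<^sup>+w. f (c + w) \<partial>lborel)"
  by (rule nn_integral_distr) auto
 finally show ?thesis ..
qed

text \<open>Both measures are translation invariant and agree on the unit disc; comparing them through
 a double integral of indicator functions shows that they agree everywhere.\<close>

lemma lborel_rotate:
 fixes c :: complex
 assumes c: "cmod c = 1"
 shows "distr lborel borel ((*) c) = lborel"
proof (rule measure_eqI)
 have c0: "c \<noteq> 0" using c by auto
 have mc [measurable]: "(*) c \<in> borel_measurable borel" by (intro borel_measurable_continuous_onI continuous_intros)
 fix A assume "A \<in> sets (distr lborel borel ((*) c))"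
 then have A [measurable]: "A \<in> sets borel" by simp
 let ?B = "ball (0::complex) 1"
 let ?iA = "\<lambda>x. indicator A x :: ennreal" and ?iB = "\<lambda>x. indicator ?B x :: ennreal"
 have mB [simp]: "?iB \<in> borel_measurable borel" "?iB \<in> borel_measurable lborel" and mA [simp]: "?iA \<in> borel_measurable borel" "?iA \<in> borel_measurable lborel"
  using A by (auto intro!: borel_measurable_indicator)
 have ball: "(\<integral>\<^sup>+x. ?iB (y - c * x) \<partial>lborel) = emeasure lborel ?B" for y
 proof -
  have "(y - c * x \<in> ?B) = (- (y / c) + x \<in> ?B)" for x
  proof -
   have "cmod (y - c * x) = cmod c * cmod (- (y / c) + x)"
    unfolding norm_mult[symmetric] using c0 by (simp add: algebra_simps norm_minus_commute)
   then show ?thesis using c by simp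
  qed
  then have "(\<integral>\<^sup>+x. ?iB (y - c * x) \<partial>lborel) = (\<integral>\<^sup>+x. ?iB (- (y / c) + x) \<partial>lborel)"
   by (simp add: indicator_def)
  also have "\<dots> = (\<integral>\<^sup>+x. ?iB x \<partial>lborel)" by (rule nn_integral_translate) (rule mB)
  finally show ?thesis by simp
 qed
 have cx: "(\<lambda>x. a + c * x) \<in> borel_measurable borel" "(\<lambda>x. a - c * x) \<in> borel_measurable borel" for a
  by (intro borel_measurable_continuous_onI continuous_intros)+
 have m2: "(\<lambda>x. ?iA (c * x)) \<in> borel_measurable borel" by measurable
 have pm: "(\<lambda>p::complex\<times>complex. c * fst p + snd p) \<in> borel_measurable borel"
  "(\<lambda>p::complex\<times>complex. snd p - c * fst p) \<in> borel_measurable borel"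
  and s2: "(snd :: complex\<times>complex \<Rightarrow> complex) \<in> borel_measurable borel"
  by (intro borel_measurable_continuous_onI continuous_intros)+
 have "emeasure lborel ?B * emeasure (distr lborel borel ((*) c)) A = (\<integral>\<^sup>+y. ?iB y * (\<integral>\<^sup>+x. ?iA (c * x) \<partial>lborel) \<partial>lborel)"
 proof -
  have "emeasure (distr lborel borel ((*) c)) A = (\<integral>\<^sup>+x. ?iA x \<partial>(distr lborel borel ((*) c)))" by simp
  also have "\<dots> = (\<integral>\<^sup>+x. ?iA (c * x) \<partial>lborel)" by (rule nn_integral_distr) auto
  finally show ?thesis by (subst nn_integral_multc) auto
 qed
 also have "\<dots> = (\<integral>\<^sup>+y. (\<integral>\<^sup>+x. ?iB y * ?iA (c * x + y) \<partial>lborel) \<partial>lborel)"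
 proof (rule nn_integral_cong)
  fix y
  have "(\<integral>\<^sup>+x. ?iA (c * x) \<partial>lborel) = (\<integral>\<^sup>+x. ?iA (c * (y / c + x)) \<partial>lborel)"
   using nn_integral_translate[OF m2, of "y / c"] by simp
  also have "\<dots> = (\<integral>\<^sup>+x. ?iA (c * x + y) \<partial>lborel)" using c0 by (simp add: algebra_simps)
  finally have e: "(\<integral>\<^sup>+x. ?iA (c * x) \<partial>lborel) = (\<integral>\<^sup>+x. ?iA (c * x + y) \<partial>lborel)" .
  have "(\<lambda>x. ?iA (c * x + y)) \<in> borel_measurable lborel"
   using measurable_compose[OF cx(1)[of y] mA(1)] by (simp only: measurable_lborel2 add.commute)
  then show "?iB y * (\<integral>\<^sup>+x. ?iA (c * x) \<partial>lborel) = (\<integral>\<^sup>+x. ?iB y * ?iA (c * x + y) \<partial>lborel)"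
   unfolding e by (subst nn_integral_cmult) auto
 qed
 also have "\<dots> = (\<integral>\<^sup>+x. (\<integral>\<^sup>+y. ?iB y * ?iA (c * x + y) \<partial>lborel) \<partial>lborel)"
 proof (rule lborel_pair.Fubini')
  have "(\<lambda>p::complex\<times>complex. ?iB (snd p) * ?iA (c * fst p + snd p)) \<in> borel_measurable borel"
   by (rule borel_measurable_times_ennreal[OF measurable_compose[OF s2 mB(1)] measurable_compose[OF pm(1) mA(1)]])
  then show "(\<lambda>(x, y). ?iB y * ?iA (c * x + y)) \<in> borel_measurable (lborel \<Otimes>\<^sub>M lborel)"
   by (simp add: lborel_prod split_beta')
 qed
 also have "\<dots> = (\<integral>\<^sup>+x. (\<integral>\<^sup>+y. ?iA y * ?iB (y - c * x) \<partial>lborel) \<partial>lborel)"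
 proof (rule nn_integral_cong)
  fix x
  have "(\<lambda>y. y - c * x) \<in> borel_measurable borel" by (intro borel_measurable_continuous_onI continuous_intros)
  then have "(\<lambda>y. ?iA y * ?iB (y - c * x)) \<in> borel_measurable borel"
   by (intro borel_measurable_times_ennreal[OF mA(1)] measurable_compose[OF _ mB(1)])
  from nn_integral_translate[OF this, of "c * x"]
  show "(\<integral>\<^sup>+y. ?iB y * ?iA (c * x + y) \<partial>lborel) = (\<integral>\<^sup>+y. ?iA y * ?iB (y - c * x) \<partial>lborel)"
   by (simp add: mult.commute)
 qed
 also have "\<dots> = (\<integral>\<^sup>+y. (\<integral>\<^sup>+x. ?iA y * ?iB (y - c * x) \<partial>lborel) \<partial>lborel)"
 proof (rule lborel_pair.Fubini'[symmetric])
  have "(\<lambda>p::complex\<times>complex. ?iA (snd p) * ?iB (snd p - c * fst p)) \<in> borel_measurable borel"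
   by (rule borel_measurable_times_ennreal[OF measurable_compose[OF s2 mA(1)] measurable_compose[OF pm(2) mB(1)]])
  then show "(\<lambda>(x, y). ?iA y * ?iB (y - c * x)) \<in> borel_measurable (lborel \<Otimes>\<^sub>M lborel)"
   by (simp add: lborel_prod split_beta')
 qed
 also have "\<dots> = (\<integral>\<^sup>+y. ?iA y * emeasure lborel ?B \<partial>lborel)"
 proof (rule nn_integral_cong)
  fix y
  have "(\<lambda>x. ?iB (y - c * x)) \<in> borel_measurable lborel"
   using measurable_compose[OF cx(2)[of y] mB(1)] by (simp only: measurable_lborel2)
  then show "(\<integral>\<^sup>+x. ?iA y * ?iB (y - c * x) \<partial>lborel) = ?iA y * emeasure lborel ?B"
   by (subst nn_integral_cmult) (auto simp: ball)
 qed
 also have "\<dots> = emeasure lborel ?B * emeasure lborel A" by (subst nn_integral_multc) (auto simp: mult.commute)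
 finally have eq: "emeasure lborel ?B * emeasure (distr lborel borel ((*) c)) A = emeasure lborel ?B * emeasure lborel A" .
 have "measure lborel ?B > 0" by (rule content_ball_pos) simp
 then have "emeasure lborel ?B \<noteq> 0" by (auto simp: measure_def)
 moreover have "emeasure lborel ?B \<noteq> top" using emeasure_lborel_ball_finite[of "0::complex" 1] by auto
 ultimately show "emeasure (distr lborel borel ((*) c)) A = emeasure lborel A"
  using eq by (simp add: ennreal_mult_cancel_left)
qed simp

lemma integrable_rotate:
 fixes f :: "complex \<Rightarrow> 'a::{banach,second_countable_topology}"
 assumes "cmod c = 1" "integrable lborel f"
 shows "integrable lborel (\<lambda>w. f (c * w))" "(\<integral>w. f (c * w) \<partial>lborel) = (\<integral>w. f w \<partial>lborel)"
proof -
 have "(*) c \<in> borel \<rightarrow>\<^sub>M borel" by (intro borel_measurable_continuous_onI continuous_intros)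
 then have m: "(*) c \<in> lborel \<rightarrow>\<^sub>M borel" by simp
 have "integrable (distr lborel borel ((*) c)) f" using assms lborel_rotate by simp
 then show "integrable lborel (\<lambda>w. f (c * w))" using integrable_distr[OF m] by blast
 have "(\<integral>w. f w \<partial>lborel) = (\<integral>w. f w \<partial>(distr lborel borel ((*) c)))" using assms lborel_rotate by simp
 also have "\<dots> = (\<integral>w. f (c * w) \<partial>lborel)" by (rule integral_distr[OF m]) (use assms(2) in auto)
 finally show "(\<integral>w. f (c * w) \<partial>lborel) = (\<integral>w. f w \<partial>lborel)" by simp
qed

lemma integral_periodic_shift:
 fixes f :: "real \<Rightarrow> real"
 assumes per: "\<And>x. f (x + T) = f x" and T: "T > 0" and i: "set_integrable lborel {0..<T} f" and a: "0 \<le> a" "a \<le> T"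
 shows "(\<integral>x. indicator {0..<T} x * f (x + a) \<partial>lborel) = (\<integral>x. indicator {0..<T} x * f x \<partial>lborel)"
proof -
 have i1: "set_integrable lborel {0..<a} f" "set_integrable lborel {a..<T} f"
  using a by (auto intro: set_integrable_subset[OF i])
 let ?g = "\<lambda>x. indicator {0..<a} x * f x" and ?h = "\<lambda>x. indicator {a..<T} x * f x"
 have ig: "integrable lborel ?g" "integrable lborel ?h" using i1 by (auto simp: set_integrable_def)
 have ig2: "integrable lborel (\<lambda>x. ?g (- T + 1 * x))"
  using lborel_integrable_real_affine[OF ig(1), of 1 "-T"] by simp
 have "(\<integral>x. indicator {0..<T} x * f (x + a) \<partial>lborel) = (\<integral>x. indicator {a..<T+a} x * f x \<partial>lborel)"
  using lborel_integral_real_affine[of 1 "\<lambda>x. indicator {a..<T+a} x * f x" a]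
  by (simp add: indicator_def add.commute)
 also have "(\<lambda>x. indicator {a..<T+a} x * f x) = (\<lambda>x. ?h x + ?g (- T + 1 * x))"
 proof
  fix x
  have "f (x - T) = f x" using per[of "x - T"] by simp
  then show "indicator {a..<T+a} x * f x = ?h x + ?g (- T + 1 * x)"
   using a by (auto simp: indicator_def algebra_simps)
 qed
 also have "(\<integral>x. ?h x + ?g (- T + 1 * x) \<partial>lborel) = (\<integral>x. ?h x \<partial>lborel) + (\<integral>x. ?g (- T + 1 * x) \<partial>lborel)"
  using ig ig2 by simp
 also have "(\<integral>x. ?g (- T + 1 * x) \<partial>lborel) = (\<integral>x. ?g x \<partial>lborel)"
  using lborel_integral_real_affine[of 1 ?g "-T"] by simp
 also have "(\<integral>x. ?h x \<partial>lborel) + (\<integral>x. ?g x \<partial>lborel) = (\<integral>x. ?h x + ?g x \<partial>lborel)"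
  using ig by simp
 also have "(\<lambda>x. ?h x + ?g x) = (\<lambda>x. indicator {0..<T} x * f x)"
  using a by (auto simp: indicator_def fun_eq_iff)
 finally show ?thesis .
qed

lemma usc_borel:
 assumes "usc f"
 shows "f \<in> borel_measurable borel"
proof (rule borel_measurableI_less)
 fix y
 have "open {x. f x < y}"
  unfolding open_contains_ball
 proof (intro ballI)
  fix x assume "x \<in> {x. f x < y}"
  then have p: "y - f x > 0" by simp
  with assms have "eventually (\<lambda>w. f w < f x + (y - f x)) (at x)" unfolding usc_def by blast
  then obtain d where "d > 0" "\<And>w. w \<noteq> x ==> dist w x < d ==> f w < y"
   by (auto simp: eventually_at)
  moreover from this have "f w < y" if "dist w x < d" for w
   using that p by (cases "w = x") auto
  ultimately show "\<exists>e>0. ball x e \<subseteq> {x. f x < y}"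
   by (intro exI[of _ d]) (auto simp: dist_commute)
 qed
 then show "{x \<in> space borel. f x < y} \<in> sets borel" by simp
qed

text \<open>A complex \<open>w\<close> in place of a radius permits integrating the inequality over
  the plane in \<open>w\<close>, with no polar coordinates. The argument of \<open>w\<close> is only
  a shift of a periodic integrand.\<close>

lemma subharmonic_circle:
 assumes s: "subharmonic f"
 shows "set_integrable lborel {0..<2*pi} (\<lambda>t. f (z + w * cis t))"
  and "f z * (2 * pi) \<le> (\<integral>t. indicator {0..<2*pi} t * f (z + w * cis t) \<partial>lborel)"
proof -
 have fm [measurable]: "f \<in> borel_measurable borel" using s usc_borel by (auto simp: subharmonic_def)
 have main: "set_integrable lborel {0..<2*pi} (\<lambda>t. f (z + of_real r * cis t)) \<and>
   f z * (2 * pi) \<le> (\<integral>t. indicator {0..<2*pi} t * f (z + of_real r * cis t) \<partial>lborel)" if r: "r > 0" for r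
 proof -
  let ?g = "\<lambda>t. f (z + of_real r * cis t)"
  have gm: "?g \<in> borel_measurable borel"
   by (rule measurable_compose[OF _ fm]) (intro borel_measurable_continuous_onI continuous_intros)
  have im: "(\<lambda>t. indicator S t *\<^sub>R ?g t) \<in> borel_measurable lborel" if "S \<in> sets borel" for S :: "real set"
   using gm that by (intro borel_measurable_scaleR borel_measurable_indicator) auto
  have 1: "interval_lebesgue_integrable lborel 0 (2*pi) ?g" "f z \<le> (1 / (2*pi)) * (LBINT t=0..2*pi. ?g t)"
   using s r by (auto simp: subharmonic_def)
  have e: "einterval 0 (ereal (2*pi)) = {0<..<2*pi}" by (simp add: einterval_eq_Icc zero_ereal_def einterval_def set_eq_iff)
  have 2: "set_integrable lborel {0<..<2*pi} ?g" using 1(1) e unfolding interval_lebesgue_integrable_def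
   by (simp add: zero_ereal_def)
  have ae: "AE t in lborel. indicator {0<..<2*pi} t *\<^sub>R ?g t = indicator {0..<2*pi} t *\<^sub>R ?g t"
  proof -
   have "AE t in lborel. t \<noteq> (0::real)" by (rule AE_lborel_singleton)
   then show ?thesis by eventually_elim (auto simp: indicator_def)
  qed
  have 3: "set_integrable lborel {0..<2*pi} ?g"
   using 2 unfolding set_integrable_def by (rule integrable_cong_AE_imp) (use ae im in auto)
  have "(LBINT t=0..2*pi. ?g t) = (\<integral>t. indicator {0<..<2*pi} t *\<^sub>R ?g t \<partial>lborel)"
   unfolding interval_lebesgue_integral_def set_lebesgue_integral_def using e by (simp add: zero_ereal_def)
  also have "\<dots> = (\<integral>t. indicator {0..<2*pi} t *\<^sub>R ?g t \<partial>lborel)"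
   by (rule integral_cong_AE) (use ae im in auto)
  finally have 4: "(LBINT t=0..2*pi. ?g t) = (\<integral>t. indicator {0..<2*pi} t * ?g t \<partial>lborel)" by simp
  then show ?thesis using 1(2) 3 by (simp add: field_simps)
 qed
 have "set_integrable lborel {0..<2*pi} (\<lambda>t. f (z + w * cis t)) \<and>
   f z * (2 * pi) \<le> (\<integral>t. indicator {0..<2*pi} t * f (z + w * cis t) \<partial>lborel)"
 proof (cases "w = 0")
  case True
  have "set_integrable lborel {0..<2*pi} (\<lambda>t. f z)" unfolding set_integrable_def by simp
  then show ?thesis using True by simp
 next
  case False
  define a where "a = Arg2pi w"
  define g where "g t = f (z + of_real (cmod w) * cis t)" for t
  have a: "0 \<le> a" "a \<le> 2 * pi" unfolding a_def using Arg2pi_ge_0 Arg2pi_lt_2pi by (auto intro: less_imp_le)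
  have w: "w = of_real (cmod w) * cis a" unfolding a_def using Arg2pi_eq[of w] by (simp add: cis_conv_exp)
  have eq: "f (z + w * cis t) = g (t + a)" for t
   unfolding g_def by (subst w) (simp add: cis_mult mult.assoc add.commute del: of_real_mult)
  have g: "set_integrable lborel {0..<2*pi} g" "f z * (2 * pi) \<le> (\<integral>t. indicator {0..<2*pi} t * g t \<partial>lborel)"
   using main[of "cmod w"] False unfolding g_def by auto
  have per: "g (x + 2 * pi) = g x" for x by (simp add: g_def cis_mult[symmetric])
  have 1: "(\<integral>t. indicator {0..<2*pi} t * g (t + a) \<partial>lborel) = (\<integral>t. indicator {0..<2*pi} t * g t \<partial>lborel)"
   by (rule integral_periodic_shift[OF per _ g(1) a]) simp
  have ig: "integrable lborel (\<lambda>t. indicator {0..<2*pi} t * g (t + a))"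
  proof -
   have "set_integrable lborel {0..<a} g" "set_integrable lborel {a..<2*pi} g"
    using a by (auto intro: set_integrable_subset[OF g(1)])
   then have i: "integrable lborel (\<lambda>x. indicator {0..<a} x * g x)" "integrable lborel (\<lambda>x. indicator {a..<2*pi} x * g x)"
    by (auto simp: set_integrable_def)
   have "integrable lborel (\<lambda>t. (\<lambda>x. indicator {a..<2*pi} x * g x) (a + 1 * t) + (\<lambda>x. indicator {0..<a} x * g x) ((a - 2 * pi) + 1 * t))"
    by (intro Bochner_Integration.integrable_add lborel_integrable_real_affine i) auto
   moreover have "indicator {0..<2*pi} t * g (t + a) = (\<lambda>x. indicator {a..<2*pi} x * g x) (a + 1 * t) + (\<lambda>x. indicator {0..<a} x * g x) ((a - 2 * pi) + 1 * t)" for t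
    using a per[of "a - 2 * pi + t"] by (auto simp: indicator_def algebra_simps)
   ultimately show ?thesis by simp
  qed
  show ?thesis unfolding eq using 1 g(2) ig by (simp add: set_integrable_def)
 qed
 then show "set_integrable lborel {0..<2*pi} (\<lambda>t. f (z + w * cis t))"
  and "f z * (2 * pi) \<le> (\<integral>t. indicator {0..<2*pi} t * f (z + w * cis t) \<partial>lborel)" by auto
qed

lemma integrable_translate:
 fixes f :: "complex \<Rightarrow> 'a::{banach,second_countable_topology}"
 assumes "integrable lborel f"
 shows "integrable lborel (\<lambda>w. f (w + c))"
proof -
 have "integrable (distr lborel borel ((+) c)) f" using assms by (simp add: lborel_distr_plus)
 then have "integrable lborel (\<lambda>w. f (c + w))" by (subst (asm) integrable_distr_eq) (use assms in auto)
 then show ?thesis by (simp add: add.commute)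
qed

text \<open>The circle inequality is integrated in \<open>w\<close> against the mollifier. After
  exchanging the integrals, each angle contributes a rotated copy of the same average, and rotations
  preserve both the mollifier and Lebesgue measure.\<close>

lemma subharmonic_le_avg:
 assumes s: "subharmonic f" and l: "loc_int lborel f" and t: "t > 0"
 shows "f z \<le> (\<integral>w. kap t (w - z) * f w \<partial>lborel)"
proof -
 have fm [measurable]: "f \<in> borel_measurable borel" using s usc_borel by (auto simp: subharmonic_def)
 have km [measurable]: "kap t \<in> borel_measurable borel" using t by (intro borel_measurable_continuous_onI continuous_intros)
 define A where "A = (\<integral>w. kap t (w - z) * f w \<partial>lborel)"
 have i0: "integrable lborel (\<lambda>w. kap t (w - z) * f w)" using integrable_kap[OF t l, of z] by simp
 have i1: "integrable lborel (\<lambda>w. kap t w * f (z + w))"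
  using integrable_translate[OF i0, of z] by (simp add: add.commute)
 have A1: "(\<integral>w. kap t w * f (z + w) \<partial>lborel) = A"
  unfolding A_def using integral_lborel_translate[of "\<lambda>w. kap t (w - z) * f w" z] by (simp add: add.commute)
 have kr: "kap t (cis \<theta> * w) = kap t w" "kap t (w * cis \<theta>) = kap t w" for \<theta> w
  by (simp_all add: kap_def bp_def norm_mult)
 have i2: "integrable lborel (\<lambda>w. kap t w * f (z + w * cis \<theta>))" and A2: "(\<integral>w. kap t w * f (z + w * cis \<theta>) \<partial>lborel) = A" for \<theta>
  using integrable_rotate[of "cis \<theta>", OF _ i1] A1 by (simp_all add: kr mult.commute)
 have A3: "(\<integral>w. norm (kap t w * f (z + w * cis \<theta>)) \<partial>lborel) = (\<integral>w. norm (kap t w * f (z + w)) \<partial>lborel)" for \<theta>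
  using integrable_rotate(2)[of "cis \<theta>", OF _ integrable_norm[OF i1]] by (simp add: kr mult.commute)
 let ?I = "{0..<2*pi}"
 let ?F = "\<lambda>\<theta> w. indicator ?I \<theta> * (kap t w * f (z + w * cis \<theta>))"
 have meas: "(\<lambda>(\<theta>, w). ?F \<theta> w) \<in> borel_measurable (lborel \<Otimes>\<^sub>M lborel)"
 proof -
  have "(\<lambda>x::real\<times>complex. z + snd x * cis (fst x)) \<in> borel_measurable borel"
   by (intro borel_measurable_continuous_onI continuous_intros)
  then have [measurable]: "(\<lambda>x::real\<times>complex. z + snd x * cis (fst x)) \<in> borel_measurable (lborel \<Otimes>\<^sub>M lborel)"
   by (simp add: lborel_prod)
  show ?thesis unfolding split_beta' by measurable
 qed
 have int: "integrable (lborel \<Otimes>\<^sub>M lborel) (\<lambda>(\<theta>, w). ?F \<theta> w)"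
 proof (rule lborel_pair.Fubini_integrable[OF meas])
  have "(\<integral>w. norm (case (\<theta>, w) of (\<theta>, w) \<Rightarrow> ?F \<theta> w) \<partial>lborel) = indicator ?I \<theta> * (\<integral>w. norm (kap t w * f (z + w)) \<partial>lborel)" for \<theta>
   using A3[of \<theta>] by (simp add: indicator_def abs_mult)
  then show "integrable lborel (\<lambda>\<theta>. \<integral>w. norm (case (\<theta>, w) of (\<theta>, w) \<Rightarrow> ?F \<theta> w) \<partial>lborel)" by simp
  show "AE \<theta> in lborel. integrable lborel (\<lambda>w. case (\<theta>, w) of (\<theta>, w) \<Rightarrow> ?F \<theta> w)"
   using i2 by (intro AE_I2) simp
 qed
 have fub: "(\<integral>w. (\<integral>\<theta>. ?F \<theta> w \<partial>lborel) \<partial>lborel) = (\<integral>\<theta>. (\<integral>w. ?F \<theta> w \<partial>lborel) \<partial>lborel)"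
  by (rule lborel_pair.Fubini_integral[OF int])
 have rhs: "(\<integral>\<theta>. (\<integral>w. ?F \<theta> w \<partial>lborel) \<partial>lborel) = 2 * pi * A"
  using A2 by simp
 have iw: "integrable lborel (\<lambda>w. (\<integral>\<theta>. ?F \<theta> w \<partial>lborel))"
  using lborel_pair.integrable_snd[OF int] by simp
 have eqF: "(\<integral>\<theta>. ?F \<theta> w \<partial>lborel) = kap t w * (\<integral>\<theta>. indicator ?I \<theta> * f (z + w * cis \<theta>) \<partial>lborel)" for w
  by (subst integral_mult_right_zero[symmetric]) (simp add: mult_ac)
 have "(\<integral>w. kap t w * (f z * (2 * pi)) \<partial>lborel) \<le> (\<integral>w. (\<integral>\<theta>. ?F \<theta> w \<partial>lborel) \<partial>lborel)"
 proof (rule integral_mono[OF _ iw])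
  show "integrable lborel (\<lambda>w. kap t w * (f z * (2 * pi)))"
   using integrable_kap_real[OF t, of 0] by (intro integrable_mult_left) simp
  show "kap t w * (f z * (2 * pi)) \<le> (\<integral>\<theta>. ?F \<theta> w \<partial>lborel)" for w
   unfolding eqF by (intro mult_left_mono subharmonic_circle(2)[OF s]) simp
 qed
 also have "\<dots> = 2 * pi * A" using fub rhs by simp
 finally have "f z * (2 * pi) \<le> A * (2 * pi)" using integral_kap[OF t, of 0] by (simp add: mult.commute)
 then show ?thesis unfolding A_def[symmetric] by (rule mult_right_le_imp_le) simp
qed

section \<open>The potential and its measure: averages, smoothed masses, positivity\<close>

locale doubling_potential =
 fixes \<phi> :: "complex \<Rightarrow> real" and \<mu> :: "complex measure"
 assumes sub: "subharmonic \<phi>" and nh: "\<not> harmonic \<phi>" and lapl: "is_laplacian \<phi> \<mu>" and dbl: "doubling \<mu>"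
begin

lemma sets_mu [simp, measurable_cong]: "sets \<mu> = sets borel" and space_mu [simp]: "space \<mu> = UNIV"
 using lapl sets_eq_imp_space_eq[of \<mu> borel] by (auto simp: is_laplacian_def)

lemma phi_borel [measurable]: "\<phi> \<in> borel_measurable borel"
 using sub usc_borel by (auto simp: subharmonic_def)

lemma bp_test:
 assumes "k \<ge> 3" "t > 0"
 shows "integrable lborel (\<lambda>w. \<phi> w * lap (\<lambda>w. bp k t (w - z)) w)" "integrable \<mu> (\<lambda>w. bp k t (w - z))"
  "(\<integral>w. \<phi> w * lap (\<lambda>w. bp k t (w - z)) w \<partial>lborel) = (\<integral>w. bp k t (w - z) \<partial>\<mu>)"
 using lapl bp_test_fn(1)[OF assms, of z] unfolding is_laplacian_def by auto

text \<open>Local integrability is read off from the pairing with one test function. On the disc of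
  radius \<open>R\<close>, well inside \<open>t / 3\<close>, the base of the bump is at least 8/9,
  beyond the zero 2/3 of the Laplacian of \<open>bp 3 t\<close>, so this Laplacian is bounded away
  from 0 there.\<close>

lemma phi_loc: "loc_int lborel \<phi>"
 unfolding loc_int_def set_integrable_def
proof
 fix R :: real
 define t where "t = 3 * (\<bar>R\<bar> + 1)"
 have t: "t > 0" by (simp add: t_def)
 let ?l = "lap (\<lambda>w. bp 3 t (w - 0))"
 have i: "integrable lborel (\<lambda>w. (t\<^sup>2 / 6) * (\<phi> w * ?l w))"
  using bp_test(1)[of 3 t 0] t by (intro integrable_mult_right) auto
 show "integrable lborel (\<lambda>w. indicator (ball 0 R) w *\<^sub>R \<phi> w)"
 proof (rule Bochner_Integration.integrable_bound[OF i])
  show "(\<lambda>w. indicator (ball 0 R) w *\<^sub>R \<phi> w) \<in> borel_measurable lborel"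
   by (intro borel_measurable_scaleR borel_measurable_indicator) auto
  show "AE w in lborel. norm (indicator (ball 0 R) w *\<^sub>R \<phi> w) \<le> norm ((t\<^sup>2 / 6) * (\<phi> w * ?l w))"
  proof (rule AE_I2)
   fix w
   show "norm (indicator (ball 0 R) w *\<^sub>R \<phi> w) \<le> norm ((t\<^sup>2 / 6) * (\<phi> w * ?l w))"
   proof (cases "w \<in> ball 0 R")
    case True
    have "(cmod w)\<^sup>2 \<le> (t / 3)\<^sup>2" using True by (intro power_mono) (auto simp: t_def)
    then have "(cmod w)\<^sup>2 / t\<^sup>2 \<le> 1 / 9" using t by (simp add: power_divide divide_simps)
    define s where "s = 1 - (cmod w)\<^sup>2 / t\<^sup>2"
    have s: "s \<ge> 8/9" using \<open>(cmod w)\<^sup>2 / t\<^sup>2 \<le> 1 / 9\<close> by (simp add: s_def)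
    have "?l w = (12 / t\<^sup>2) * (2 * s - 3 * s\<^sup>2)"
     using bp_test_fn(2)[of 3 t 0 w] t s by (simp add: bp_def s_def[symmetric])
    then have l: "(t\<^sup>2 / 6) * ?l w = - (2 * (s * (3 * s - 2)))" using t by (simp add: field_simps power2_eq_square)
    have "(8/9) * (2/3) \<le> s * (3 * s - 2)" using s by (intro mult_mono) auto
    then have "1 \<le> \<bar>(t\<^sup>2 / 6) * ?l w\<bar>" unfolding l by simp
    then have "1 * \<bar>\<phi> w\<bar> \<le> \<bar>(t\<^sup>2 / 6) * ?l w\<bar> * \<bar>\<phi> w\<bar>" by (rule mult_right_mono) simp
    also have "\<dots> = \<bar>(t\<^sup>2 / 6) * (\<phi> w * ?l w)\<bar>" unfolding abs_mult by (simp only: mult_ac)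
    finally show ?thesis using True by simp
   qed simp
  qed
 qed
qed

lemma mu_ball_finite: "emeasure \<mu> (ball z r) < \<infinity>"
proof -
 have "emeasure \<mu> (ball z r) \<le> emeasure \<mu> (cball z r)" by (intro emeasure_mono) auto
 also have "\<dots> < \<infinity>" using lapl by (auto simp: is_laplacian_def)
 finally show ?thesis .
qed

definition m :: "complex \<Rightarrow> real \<Rightarrow> real" where "m z r = measure \<mu> (ball z r)"

lemma emeasure_m: "emeasure \<mu> (ball z r) = ennreal (m z r)"
 unfolding m_def using mu_ball_finite[of z r] by (intro emeasure_eq_ennreal_measure) auto

lemma m_nonneg [simp]: "m z r \<ge> 0" by (simp add: m_def)

lemma m_mono: "ball z r \<subseteq> ball w s ==> m z r \<le> m w s"
 using emeasure_mono[of "ball z r" "ball w s" \<mu>] unfolding emeasure_m by (simp add: ennreal_le_iff)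

lemma m_mono_r: "r \<le> s ==> m z r \<le> m z s"
 by (rule m_mono) auto

lemma loc_mu: "loc_int \<mu> (\<lambda>_. 1 :: real)"
 unfolding loc_int_def set_integrable_def using mu_ball_finite by simp

text \<open>A smoothed mass, differentiable in the centre and comparable to \<open>m\<close> by
  \<open>M_le\<close> and \<open>M_ge\<close>. Exponent 3 appears in the Laplacian of averages
  (\<open>Add_sum\<close>), exponent 4 in their scale derivative (\<open>A_deriv_t\<close>).\<close>

definition M :: "nat \<Rightarrow> complex \<Rightarrow> real \<Rightarrow> real" where "M k z t = (\<integral>w. bp k t (w - z) \<partial>\<mu>)"

lemma M_eq:
 assumes "k \<ge> 3" "t > 0"
 shows "M k z t = (\<integral>w. (4 * real k / t\<^sup>2) * (real (k - 1) * bp (k - 2) t (w - z) - real k * bp (k - 1) t (w - z)) * \<phi> w \<partial>lborel)"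
 unfolding M_def bp_test(3)[OF assms, symmetric] bp_test_fn(2)[OF assms] by (simp add: mult.commute)

lemma integral_mu_bound:
 assumes f: "\<And>w. \<bar>f w\<bar> \<le> B" "\<And>w. cmod (w - z) \<ge> t ==> f w = 0"
 shows "\<bar>\<integral>w. f w \<partial>\<mu>\<bar> \<le> B * m z t"
proof (cases "integrable \<mu> f")
 case True
 have i: "integrable \<mu> (\<lambda>w. B * indicator (ball z t) w)" using mu_ball_finite by (intro integrable_mult_right) simp
 have "norm (\<integral>w. f w \<partial>\<mu>) \<le> (\<integral>w. B * indicator (ball z t) w \<partial>\<mu>)"
 proof (rule Bochner_Integration.integral_norm_bound_integral[OF True i])
  show "norm (f w) \<le> B * indicator (ball z t) w" for w
   using f(1)[of w] f(2)[of w] by (cases "w \<in> ball z t") (auto simp: dist_norm norm_minus_commute)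
 qed
 then show ?thesis by (simp add: m_def)
next
 case False
 have "B \<ge> 0" using f(1)[of z] by linarith
 then show ?thesis using False by (simp add: not_integrable_integral_eq)
qed

lemma M_nonneg [simp]: "M k z t \<ge> 0" unfolding M_def by simp

lemma M_le: "k \<ge> 1 ==> t > 0 ==> M k z t \<le> m z t"
 using integral_mu_bound[where f="\<lambda>w. bp k t (w - z)" and B=1 and z=z and t=t] bp_eq_0[of k t] unfolding M_def by (simp add: abs_le_iff)

lemma M_ge:
 assumes "k \<ge> 1" "t > 0"
 shows "(3/4) ^ k * m z (t/2) \<le> M k z t"
proof -
 have "(\<integral>w. (3/4) ^ k * indicator (ball z (t/2)) w \<partial>\<mu>) \<le> (\<integral>w. bp k t (w - z) \<partial>\<mu>)"
 proof (rule integral_mono)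
  show "integrable \<mu> (\<lambda>w. (3/4) ^ k * indicator (ball z (t/2)) w :: real)" using mu_ball_finite by (intro integrable_mult_right) simp
  show "integrable \<mu> (\<lambda>w. bp k t (w - z))"
   using integrable_bp[OF loc_mu _ assms, of z] by simp
  fix w
  show "(3/4) ^ k * indicator (ball z (t/2)) w \<le> bp k t (w - z)"
  proof (cases "w \<in> ball z (t/2)")
   case True
   then have "(cmod (w - z))\<^sup>2 \<le> (t/2)\<^sup>2" by (intro power_mono) (auto simp: dist_norm norm_minus_commute)
   then have "(cmod (w - z))\<^sup>2 / t\<^sup>2 \<le> 1/4" using assms(2) by (simp add: power_divide pos_divide_le_eq)
   then have x: "3/4 \<le> max 0 (1 - (cmod (w - z))\<^sup>2 / t\<^sup>2)" by (intro max.coboundedI2) linarith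
   have "(3/4) ^ k \<le> bp k t (w - z)" unfolding bp_def by (rule power_mono[OF x]) simp
   then show ?thesis using True by simp
  qed simp
 qed
 then show ?thesis unfolding M_def by (simp add: m_def)
qed

text \<open>\<open>Ad\<close> and \<open>Add\<close> are the first and second derivatives of this
  average in direction \<open>e\<close>, with all differentiation moved onto the kernel.\<close>

definition A :: "complex \<Rightarrow> real \<Rightarrow> real" where "A z t = (\<integral>w. kap t (w - z) * \<phi> w \<partial>lborel)"
definition Ad :: "complex \<Rightarrow> complex \<Rightarrow> real \<Rightarrow> real" where "Ad e z t = - (\<integral>w. (dbp e 3 t (w - z) / (J3 * t\<^sup>2)) * \<phi> w \<partial>lborel)"
definition Add :: "complex \<Rightarrow> complex \<Rightarrow> real \<Rightarrow> real" where "Add e z t = (\<integral>w. (ddbp e 3 t (w - z) / (J3 * t\<^sup>2)) * \<phi> w \<partial>lborel)"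

text \<open>By \<open>bp3_avg_deriv\<close> the scale derivative pairs \<phi> with the Laplacian of
  \<open>bp 4 t\<close>, and the defining property of \<mu> turns this into a mass. Averages of
  \<phi> therefore increase with the scale, at the speed of mass over radius.\<close>

lemma A_deriv_t:
 assumes t: "t > 0"
 shows "(A z has_real_derivative M 4 z t / (8 * J3 * t)) (at t)"
proof -
 let ?G = "\<lambda>t. \<integral>w. (bp 3 t (w - z) / t\<^sup>2) * \<phi> w \<partial>lborel"
 have 1: "(?G has_real_derivative (\<integral>w. ((2 / t^3) * (3 * bp 2 t (w - z) - 4 * bp 3 t (w - z))) * \<phi> w \<partial>lborel)) (at t)"
  using bp3_avg_deriv[OF phi_loc _ t, of z] unfolding has_real_derivative_iff_has_vector_derivative by simp
 have "M 4 z t / (8 * t) = (\<integral>w. (1 / (8 * t)) * ((16 / t\<^sup>2) * (3 * bp 2 t (w - z) - 4 * bp 3 t (w - z)) * \<phi> w) \<partial>lborel)"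
  by (subst integral_mult_right_zero) (simp add: M_eq[OF _ t, of 4])
 also have "\<dots> = (\<integral>w. ((2 / t^3) * (3 * bp 2 t (w - z) - 4 * bp 3 t (w - z))) * \<phi> w \<partial>lborel)"
 proof -
  have c: "(1 / (8 * t)) * (16 / t\<^sup>2) = 2 / t^3" using t by (simp add: power2_eq_square power3_eq_cube)
  show ?thesis by (simp only: mult.assoc[symmetric] c)
 qed
 finally have 2: "(?G has_real_derivative M 4 z t / (8 * t)) (at t)" using 1 by simp
 have "A z = (\<lambda>t. ?G t / J3)"
  unfolding A_def kap_def by (auto simp: fun_eq_iff mult.commute simp flip: integral_divide_zero)
 then show ?thesis using DERIV_cdivide[OF 2, of J3] by (simp add: mult_ac)
qed

lemma A_pd:
 assumes t: "t > 0"
 shows "has_pd e (\<lambda>z. A z t) (\<lambda>z. Ad e z t)" "has_pd e (\<lambda>z. Ad e z t) (\<lambda>z. Add e z t)"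
  "continuous_on UNIV (\<lambda>z. A z t)" "continuous_on UNIV (\<lambda>z. Ad e z t)" "continuous_on UNIV (\<lambda>z. Add e z t)"
proof -
 let ?c = "1 / (J3 * t\<^sup>2)"
 have J: "J3 \<noteq> 0" "t \<noteq> 0" using J3_pos t by auto
 have k: "kap t = (\<lambda>w. ?c * bp 3 t w)" by (simp add: kap_def fun_eq_iff)
 have p1: "has_pd e (kap t) (\<lambda>w. dbp e 3 t w / (J3 * t\<^sup>2))"
  unfolding k using bp_pd[of 3 e t] pd_at_cmult[where c="?c"] unfolding has_pd_def by fastforce
 have p2: "has_pd e (\<lambda>w. dbp e 3 t w / (J3 * t\<^sup>2)) (\<lambda>w. ddbp e 3 t w / (J3 * t\<^sup>2))"
  using dbp_pd[of 3 e t] pd_at_cmult[where c="?c"] unfolding has_pd_def by fastforce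
 have c: "continuous_on UNIV (kap t)" "continuous_on UNIV (\<lambda>w. dbp e 3 t w / (J3 * t\<^sup>2))" "continuous_on UNIV (\<lambda>w. ddbp e 3 t w / (J3 * t\<^sup>2))"
  using t J by (auto intro!: continuous_intros)
 have s: "csupp (kap t)" "csupp (\<lambda>w. dbp e 3 t w / (J3 * t\<^sup>2))" "csupp (\<lambda>w. ddbp e 3 t w / (J3 * t\<^sup>2))"
  using kap_csupp[OF t] csupp_pd[OF p1] csupp_pd[OF p2] by auto
 show "has_pd e (\<lambda>z. A z t) (\<lambda>z. Ad e z t)"
  unfolding A_def Ad_def by (rule pd_conv[OF p1 c(1,2) s(1) _ phi_loc]) simp
 have "has_pd e (\<lambda>z. \<integral>w. dbp e 3 t (w - z) / (J3 * t\<^sup>2) * \<phi> w \<partial>lborel) (\<lambda>z. - (\<integral>w. ddbp e 3 t (w - z) / (J3 * t\<^sup>2) * \<phi> w \<partial>lborel))"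
  by (rule pd_conv[OF p2 c(2,3) s(2) _ phi_loc]) simp
 then show "has_pd e (\<lambda>z. Ad e z t) (\<lambda>z. Add e z t)"
  unfolding Ad_def Add_def has_pd_def using pd_at_minus by fastforce
 show "continuous_on UNIV (\<lambda>z. A z t)" unfolding A_def by (rule cont_conv[OF c(1) s(1) _ phi_loc]) simp
 show "continuous_on UNIV (\<lambda>z. Ad e z t)" unfolding Ad_def
  by (intro continuous_on_minus cont_conv[OF c(2) s(2) _ phi_loc]) simp
 show "continuous_on UNIV (\<lambda>z. Add e z t)" unfolding Add_def
  by (intro cont_conv[OF c(3) s(3) _ phi_loc]) simp
qed

lemma A_mixed:
 assumes t: "t > 0"
 shows "\<exists>f'. has_pd c (\<lambda>z. Ad e z t) f' \<and> continuous_on UNIV f'"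
proof -
 let ?c = "1 / (J3 * t\<^sup>2)"
 have J: "J3 \<noteq> 0" "t \<noteq> 0" using J3_pos t by auto
 define k' where "k' w = - (2 * real 3 / t\<^sup>2) * ((w \<bullet> e) * dbp c (3 - 1) t w + (c \<bullet> e) * bp (3 - 1) t w)" for w
 have p: "has_pd c (\<lambda>w. dbp e 3 t w / (J3 * t\<^sup>2)) (\<lambda>w. k' w / (J3 * t\<^sup>2))"
  using dbp_pd_mixed[of 3 c e t] pd_at_cmult[where c="?c"] unfolding has_pd_def k'_def[symmetric] by fastforce
 have cs: "csupp (\<lambda>w. dbp e 3 t w / (J3 * t\<^sup>2))" using dbp_csupp[of 3 t e] t by (auto simp: csupp_def)
 have c: "continuous_on UNIV (\<lambda>w. dbp e 3 t w / (J3 * t\<^sup>2))" "continuous_on UNIV (\<lambda>w. k' w / (J3 * t\<^sup>2))"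
  unfolding k'_def using t J by (auto intro!: continuous_intros)
 have "has_pd c (\<lambda>z. \<integral>w. dbp e 3 t (w - z) / (J3 * t\<^sup>2) * \<phi> w \<partial>lborel) (\<lambda>z. - (\<integral>w. k' (w - z) / (J3 * t\<^sup>2) * \<phi> w \<partial>lborel))"
  by (rule pd_conv[OF p c cs _ phi_loc]) simp
 then have "has_pd c (\<lambda>z. Ad e z t) (\<lambda>z. - (- (\<integral>w. k' (w - z) / (J3 * t\<^sup>2) * \<phi> w \<partial>lborel)))"
  unfolding Ad_def has_pd_def using pd_at_minus by blast
 moreover have "continuous_on UNIV (\<lambda>z. - (- (\<integral>w. k' (w - z) / (J3 * t\<^sup>2) * \<phi> w \<partial>lborel)))"
  by (intro continuous_on_minus cont_conv[OF c(2) csupp_pd[OF p cs] _ phi_loc]) simp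
 ultimately show ?thesis by blast
qed

lemma Add_sum:
 assumes t: "t > 0"
 shows "Add 1 z t + Add \<i> z t = M 3 z t / (J3 * t\<^sup>2)"
proof -
 have i: "integrable lborel (\<lambda>w. ddbp e 3 t (w - z) / (J3 * t\<^sup>2) * \<phi> w)" for e
 proof -
  have "csupp (\<lambda>w. ddbp e 3 t w / (J3 * t\<^sup>2))" using csupp_pd[OF dbp_pd[of 3 e t] dbp_csupp[of 3 t e]] t by (auto simp: csupp_def)
  moreover have "continuous_on UNIV (\<lambda>w. ddbp e 3 t w / (J3 * t\<^sup>2))" using t J3_pos by (intro continuous_intros) auto
  ultimately show ?thesis
   using integrable_csupp_mult[OF phi_loc, of "\<lambda>w. ddbp e 3 t w / (J3 * t\<^sup>2)" z] by simp
 qed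
 have "Add 1 z t + Add \<i> z t = (\<integral>w. ddbp 1 3 t (w - z) / (J3 * t\<^sup>2) * \<phi> w + ddbp \<i> 3 t (w - z) / (J3 * t\<^sup>2) * \<phi> w \<partial>lborel)"
  unfolding Add_def using i by simp
 also have "\<dots> = (\<integral>w. ((ddbp 1 3 t (w - z) + ddbp \<i> 3 t (w - z)) * \<phi> w) / (J3 * t\<^sup>2) \<partial>lborel)"
  by (simp add: add_divide_distrib distrib_right)
 also have "\<dots> = M 3 z t / (J3 * t\<^sup>2)"
  unfolding integral_divide_zero M_eq[OF order_refl t] ddbp_lap[OF order_refl] by simp
 finally show ?thesis .
qed

definition Nd :: "complex \<Rightarrow> complex \<Rightarrow> real \<Rightarrow> real" where "Nd e z t = - (\<integral>w. dbp e 4 t (w - z) \<partial>\<mu>)"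
definition Ndd :: "complex \<Rightarrow> complex \<Rightarrow> real \<Rightarrow> real" where "Ndd e z t = (\<integral>w. ddbp e 4 t (w - z) \<partial>\<mu>)"

lemma N_pd:
 assumes t: "t > 0"
 shows "has_pd e (\<lambda>z. M 4 z t) (\<lambda>z. Nd e z t)" "has_pd e (\<lambda>z. Nd e z t) (\<lambda>z. Ndd e z t)"
  "continuous_on UNIV (\<lambda>z. M 4 z t)" "continuous_on UNIV (\<lambda>z. Nd e z t)" "continuous_on UNIV (\<lambda>z. Ndd e z t)"
proof -
 have p: "has_pd e (bp 4 t) (dbp e 4 t)" "has_pd e (dbp e 4 t) (ddbp e 4 t)" using bp_pd dbp_pd by auto
 have c: "continuous_on UNIV (bp 4 t)" "continuous_on UNIV (dbp e 4 t)" "continuous_on UNIV (ddbp e 4 t)"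
  using t by auto
 have s: "csupp (bp 4 t)" using bp_csupp t by auto
 note s2 = csupp_pd[OF p(1) s] and s3 = csupp_pd[OF p(2) csupp_pd[OF p(1) s]]
 show "has_pd e (\<lambda>z. M 4 z t) (\<lambda>z. Nd e z t)"
  using pd_conv[OF p(1) c(1,2) s sets_mu loc_mu] by (simp add: M_def[abs_def] Nd_def[abs_def])
 have "has_pd e (\<lambda>z. \<integral>w. dbp e 4 t (w - z) \<partial>\<mu>) (\<lambda>z. - (\<integral>w. ddbp e 4 t (w - z) \<partial>\<mu>))"
  using pd_conv[OF p(2) c(2,3) s2 sets_mu loc_mu] by simp
 then show "has_pd e (\<lambda>z. Nd e z t) (\<lambda>z. Ndd e z t)"
  unfolding Nd_def Ndd_def has_pd_def using pd_at_minus by fastforce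
 show "continuous_on UNIV (\<lambda>z. M 4 z t)" using cont_conv[OF c(1) s sets_mu loc_mu] by (simp add: M_def)
 show "continuous_on UNIV (\<lambda>z. Nd e z t)" using cont_conv[OF c(2) s2 sets_mu loc_mu]
  by (auto simp: Nd_def intro: continuous_on_minus)
 show "continuous_on UNIV (\<lambda>z. Ndd e z t)" using cont_conv[OF c(3) s3 sets_mu loc_mu] by (simp add: Ndd_def)
qed

lemma dbp_bound:
 assumes "t > 0" "cmod e = 1" "k \<ge> 2"
 shows "\<bar>dbp e k t w\<bar> \<le> 2 * real k / t"
proof (cases "cmod w < t")
 case True
 have "\<bar>w \<bullet> e\<bar> \<le> cmod w * cmod e" by (rule Cauchy_Schwarz_ineq2)
 then have "\<bar>w \<bullet> e\<bar> * bp (k - 1) t w \<le> t * 1" using assms True by (intro mult_mono) auto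
 then have "(2 * real k / t\<^sup>2) * (\<bar>w \<bullet> e\<bar> * bp (k - 1) t w) \<le> (2 * real k / t\<^sup>2) * (t * 1)" by (intro mult_left_mono) auto
 then show ?thesis using assms(1) unfolding dbp_def by (simp add: abs_mult power2_eq_square)
next
 case False
 then show ?thesis using assms by (simp add: dbp_def bp_eq_0)
qed

lemma ddbp_bound:
 assumes "t > 0" "cmod e = 1" "k \<ge> 3"
 shows "\<bar>ddbp e k t w\<bar> \<le> (2 * real k / t\<^sup>2) * (2 * real k)"
proof (cases "cmod w < t")
 case True
 have e: "e \<bullet> e = 1" using assms(2) by (simp add: dot_square_norm)
 have "\<bar>w \<bullet> e\<bar> \<le> cmod w * cmod e" by (rule Cauchy_Schwarz_ineq2)
 then have "\<bar>w \<bullet> e\<bar> * \<bar>dbp e (k - 1) t w\<bar> \<le> t * (2 * real (k - 1) / t)"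
  using assms True dbp_bound[of t e "k - 1" w] by (intro mult_mono) auto
 then have "\<bar>(w \<bullet> e) * dbp e (k - 1) t w\<bar> \<le> 2 * real (k - 1)" using assms(1) by (simp add: abs_mult)
 then have "\<bar>(w \<bullet> e) * dbp e (k - 1) t w + (e \<bullet> e) * bp (k - 1) t w\<bar> \<le> 2 * real k"
  unfolding e using abs_triangle_ineq[of "(w \<bullet> e) * dbp e (k - 1) t w" "1 * bp (k - 1) t w"] bp_le_1[of "k - 1" t w] assms(3)
  by (simp add: of_nat_diff del: bp_le_1)
 then have "(2 * real k / t\<^sup>2) * \<bar>(w \<bullet> e) * dbp e (k - 1) t w + (e \<bullet> e) * bp (k - 1) t w\<bar> \<le> (2 * real k / t\<^sup>2) * (2 * real k)"
  by (rule mult_left_mono) simp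
 moreover have "\<bar>ddbp e k t w\<bar> = (2 * real k / t\<^sup>2) * \<bar>(w \<bullet> e) * dbp e (k - 1) t w + (e \<bullet> e) * bp (k - 1) t w\<bar>"
  unfolding ddbp_def abs_mult by simp
 ultimately show ?thesis by (simp only:)
next
 case False
 then show ?thesis using assms by (simp add: dbp_def ddbp_def bp_eq_0)
qed

lemma N_bounds:
 assumes t: "t > 0" and e: "cmod e = 1"
 shows "\<bar>Nd e z t\<bar> \<le> (8 / t) * m z t" "\<bar>Ndd e z t\<bar> \<le> (64 / t\<^sup>2) * m z t"
proof -
 show "\<bar>Nd e z t\<bar> \<le> (8 / t) * m z t" unfolding Nd_def abs_minus_cancel
  using dbp_bound[OF t e, of 4] t by (intro integral_mu_bound) (auto simp: dbp_def bp_eq_0)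
 show "\<bar>Ndd e z t\<bar> \<le> (64 / t\<^sup>2) * m z t" unfolding Ndd_def
  using ddbp_bound[OF t e, of 4] t by (intro integral_mu_bound) (auto simp: ddbp_def dbp_def bp_eq_0)
qed

lemma phi_le_A: "t > 0 ==> \<phi> z \<le> A z t"
 unfolding A_def by (rule subharmonic_le_avg[OF sub phi_loc])

text \<open>Convergence holds at every point: semicontinuity bounds the averages from above, and the
  sub-mean value inequality \<open>phi_le_A\<close> from below.\<close>

lemma A_limit:
 assumes s: "\<And>n. s n > 0" "s \<longlonglongrightarrow> 0"
 shows "(\<lambda>n. A z (s n)) \<longlonglongrightarrow> \<phi> z"
proof (rule LIMSEQ_I)
 fix e :: real assume e: "e > 0"
 have "eventually (\<lambda>w. \<phi> w < \<phi> z + e/2) (at z)" using sub e unfolding subharmonic_def usc_def by simp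
 then obtain d where d: "d > 0" "\<And>w. w \<noteq> z ==> dist w z < d ==> \<phi> w < \<phi> z + e/2"
  by (auto simp: eventually_at)
 have d': "\<phi> w \<le> \<phi> z + e/2" if "dist w z < d" for w using d(2)[of w] that e by (cases "w = z") auto
 obtain N where N: "\<And>n. n \<ge> N ==> \<bar>s n\<bar> < d" using LIMSEQ_D[OF s(2) d(1)] by auto
 show "\<exists>N. \<forall>n\<ge>N. norm (A z (s n) - \<phi> z) < e"
 proof (intro exI[of _ N] allI impI)
  fix n assume n: "n \<ge> N"
  have "A z (s n) \<le> (\<integral>w. kap (s n) (w - z) * (\<phi> z + e/2) \<partial>lborel)"
   unfolding A_def
  proof (rule integral_mono)
   show "integrable lborel (\<lambda>w. kap (s n) (w - z) * \<phi> w)" using integrable_kap[OF s(1) phi_loc, of n z] by simp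
   show "integrable lborel (\<lambda>w. kap (s n) (w - z) * (\<phi> z + e/2))" by (intro integrable_mult_left integrable_kap_real s)
   fix w
   show "kap (s n) (w - z) * \<phi> w \<le> kap (s n) (w - z) * (\<phi> z + e/2)"
   proof (cases "cmod (w - z) < s n")
    case True
    then have "\<phi> w \<le> \<phi> z + e/2" using N[OF n] by (intro d') (simp add: dist_norm)
    then show ?thesis by (rule mult_left_mono) simp
   qed (use kap_eq_0[OF s(1), of n "w - z"] in simp)
  qed
  then have "A z (s n) \<le> \<phi> z + e/2" using integral_kap[OF s(1), of n z] by simp
  then show "norm (A z (s n) - \<phi> z) < e" using phi_le_A[OF s(1), of z n] e by simp
 qed
qed

text \<open>One null disc would force \<mu> = 0 by repeated doubling. Then the averages do not
  depend on the scale, so \<phi> equals its average at scale 1, which is C^2 with zero Laplacian,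
  against the assumption that \<phi> is not harmonic.\<close>

lemma m_pos:
 assumes r: "r > 0"
 shows "m z r > 0"
proof (rule ccontr)
 assume "\<not> m z r > 0"
 then have m0: "m z r = 0" using m_nonneg[of z r] by linarith
 obtain C where C: "\<And>z r. r > 0 ==> emeasure \<mu> (ball z (2*r)) \<le> ennreal C * emeasure \<mu> (ball z r)"
  using dbl unfolding doubling_def by blast
 have *: "m z (2^n * r) = 0" for n
 proof (induction n)
  case (Suc n)
  have "ennreal (m z (2 * (2^n * r))) \<le> ennreal C * ennreal (m z (2^n * r))"
   using C[of "2^n * r" z] r unfolding emeasure_m by simp
  then have "ennreal (m z (2 * (2^n * r))) = 0" using Suc by simp
  then have "m z (2 * (2^n * r)) \<le> 0" by (simp add: ennreal_eq_0_iff)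
  then show ?case using m_nonneg[of z "2 * (2^n * r)"] by (simp add: mult.assoc)
 qed (simp add: m0)
 have all0: "m w t = 0" for w t
 proof -
  obtain n :: nat where "(cmod (w - z) + \<bar>t\<bar>) / r < 2 ^ n" using real_arch_pow[of 2] by auto
  then have n: "cmod (w - z) + \<bar>t\<bar> < 2 ^ n * r" using r by (simp add: field_simps)
  have "ball w t \<subseteq> ball z (2 ^ n * r)"
  proof
   fix x assume x: "x \<in> ball w t"
   have "dist z x \<le> dist z w + dist w x" by (rule dist_triangle)
   then show "x \<in> ball z (2 ^ n * r)" using n x by (simp add: dist_norm norm_minus_commute)
  qed
  then show ?thesis using m_mono *[of n] m_nonneg[of w t] by (metis order_antisym)
 qed
 have M0: "M k w t = 0" if "k \<ge> 1" "t > 0" for k w t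
  using M_le[OF that, of w] M_nonneg[of k w t] by (simp add: all0)
 have "A w s = A w t" if "s > 0" "t > 0" for w s t
 proof (rule const_pos_reals[OF _ that])
  show "(A w has_vector_derivative 0) (at t)" if "t > 0" for t
   using A_deriv_t[OF that, of w] M0[of 4 t w] that by (simp add: has_real_derivative_iff_has_vector_derivative)
 qed
 then have "A w (1 / real (Suc n)) = A w 1" for w n by simp
 moreover have "(\<lambda>n. A w (1 / real (Suc n))) \<longlonglongrightarrow> \<phi> w" for w
  by (rule A_limit) (use LIMSEQ_inverse_real_of_nat in \<open>auto simp: inverse_eq_divide\<close>)
 ultimately have "(\<lambda>n::nat. A w 1) \<longlonglongrightarrow> \<phi> w" for w by simp
 then have phiA: "\<phi> = (\<lambda>w. A w 1)" by (auto simp: LIMSEQ_const_iff fun_eq_iff)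
 note p = A_pd[of 1, OF zero_less_one, folded phiA]
 have dphi: "dx \<phi> = (\<lambda>z. Ad 1 z 1)" "dy \<phi> = (\<lambda>z. Ad \<i> z 1)" by (rule dx_eq dy_eq p)+
 have "C1p \<phi>" by (rule C1pI[OF p(1) p(1) p(4) p(4)])
 moreover have "C1p (\<lambda>z. Ad e z 1)" for e
  using A_mixed[of 1 1 e] A_mixed[of 1 \<i> e] by (auto intro: C1pI)
 ultimately have "C2 \<phi>" by (simp add: C2_def dphi)
 moreover have "lap \<phi> z = 0" for z
  using dx_eq[OF p(2)] dy_eq[OF p(2)] Add_sum[of 1 z] M0[of 3 1 z] unfolding lap_def dphi by simp
 ultimately show False using nh by (simp add: harmonic_def)
qed

end

section \<open>Doubling and reverse doubling; growth of averages; the radius function\<close>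

lemma hvd_bound_of_lipschitz:
 fixes f :: "real \<Rightarrow> real"
 assumes d: "(f has_vector_derivative d) (at 0)" and \<delta>: "\<delta> > 0" "\<And>h. \<bar>h\<bar> < \<delta> ==> \<bar>f h - f 0\<bar> \<le> K * \<bar>h\<bar>"
 shows "\<bar>d\<bar> \<le> K"
proof -
 have "((\<lambda>y. \<bar>(f y - f 0) /\<^sub>R (y - 0)\<bar>) \<longlongrightarrow> \<bar>d\<bar>) (at 0)"
  using d unfolding hvd_iff_tendsto by (intro tendsto_rabs)
 moreover have "\<forall>\<^sub>F y in at 0. \<bar>(f y - f 0) /\<^sub>R (y - 0)\<bar> \<le> K"
  unfolding eventually_at
 proof (intro exI[of _ \<delta>] conjI ballI impI)
  fix y :: real assume y: "y \<noteq> 0 \<and> dist y 0 < \<delta>"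
  then have "\<bar>f y - f 0\<bar> \<le> K * \<bar>y\<bar>" by (intro \<delta>(2)) (simp add: dist_real_def)
  then have "\<bar>f y - f 0\<bar> / \<bar>y\<bar> \<le> K" using y by (simp add: pos_divide_le_eq)
  then show "\<bar>(f y - f 0) /\<^sub>R (y - 0)\<bar> \<le> K" by (simp add: abs_mult divide_inverse mult.commute)
 qed (fact \<delta>)
 ultimately show ?thesis by (rule tendsto_upperbound) simp
qed

context doubling_potential
begin

lemma doubling_const: "\<exists>D\<ge>1. \<forall>z r. r > 0 \<longrightarrow> m z (2 * r) \<le> D * m z r"
proof -
 obtain C where C: "C > 0" "\<And>z r. r > 0 ==> emeasure \<mu> (ball z (2*r)) \<le> ennreal C * emeasure \<mu> (ball z r)"
  using dbl unfolding doubling_def by blast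
 have "m z (2 * r) \<le> max C 1 * m z r" if "r > 0" for z r
 proof -
  have "ennreal (m z (2 * r)) \<le> ennreal (C * m z r)"
   using C(2)[OF that, of z] C(1) unfolding emeasure_m by (simp add: ennreal_mult)
  then have "m z (2 * r) \<le> C * m z r" using C(1) by (simp add: ennreal_le_iff)
  also have "\<dots> \<le> max C 1 * m z r" by (intro mult_right_mono) auto
  finally show ?thesis .
 qed
 then show ?thesis by (intro exI[of _ "max C 1"]) auto
qed

definition D :: real where "D = (SOME D. D \<ge> 1 \<and> (\<forall>z r. r > 0 \<longrightarrow> m z (2 * r) \<le> D * m z r))"

lemma D_ge1: "D \<ge> 1" and m_double: "r > 0 ==> m z (2 * r) \<le> D * m z r"
 using someI_ex[OF doubling_const[unfolded Bex_def]] unfolding D_def by auto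

lemma m_double_pow: "r > 0 ==> m z (2 ^ n * r) \<le> D ^ n * m z r"
proof (induction n)
 case (Suc n)
 have "m z (2 * (2 ^ n * r)) \<le> D * m z (2 ^ n * r)" using Suc.prems by (intro m_double) simp
 also have "\<dots> \<le> D * (D ^ n * m z r)" using Suc D_ge1 by (intro mult_left_mono) auto
 finally show ?case by (simp add: mult.assoc)
qed simp

definition \<theta> :: real where "\<theta> = 1 / (1 + 1 / D\<^sup>2)"

lemma theta: "0 < \<theta>" "\<theta> < 1"
proof -
 have "1 / D\<^sup>2 > 0" using D_ge1 by simp
 then have "1 + 1 / D\<^sup>2 > 1" by linarith
 then show "0 < \<theta>" "\<theta> < 1" unfolding \<theta>_def
  by (simp_all only: zero_less_divide_1_iff divide_less_eq_1_pos less_trans[OF zero_less_one])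
qed

text \<open>Reverse doubling: the disc of radius r/4 and its translate by r/2 are disjoint and lie
  in the large disc, while two doublings around the translate cover the first. So the first has at
  most D^2 times the mass of the second, which is where \<theta> comes from.\<close>

lemma m_quarter:
 assumes r: "r > 0"
 shows "m z (r / 4) \<le> \<theta> * m z r"
proof -
 let ?r = "r / 4" and ?w = "z + of_real (r / 2)"
 have "ball z ?r \<inter> ball ?w ?r = {}"
 proof (rule ccontr)
  assume "ball z ?r \<inter> ball ?w ?r \<noteq> {}"
  then obtain x where "dist z x < ?r" "dist ?w x < ?r" by auto
  then have "dist z ?w < r / 2" using dist_triangle2[of z ?w x] by simp
  then show False using r by (simp add: dist_norm)
 qed
 then have "measure \<mu> (ball z ?r \<union> ball ?w ?r) = m z ?r + m ?w ?r"
  unfolding m_def using mu_ball_finite by (intro measure_Union) (auto simp: less_top)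
 moreover have "measure \<mu> (ball z ?r \<union> ball ?w ?r) \<le> m z r"
  unfolding m_def
 proof (rule measure_mono_fmeasurable)
  have "ball ?w ?r \<subseteq> ball z r"
  proof
   fix x assume "x \<in> ball ?w ?r"
   then have "dist z x < r / 2 + r / 4" using dist_triangle[of z x ?w] r by (simp add: dist_norm)
   then show "x \<in> ball z r" using r by simp
  qed
  then show "ball z ?r \<union> ball ?w ?r \<subseteq> ball z r" using r by auto
  show "ball z r \<in> fmeasurable \<mu>" using mu_ball_finite by (auto simp: fmeasurable_def)
 qed simp
 moreover have "m z ?r / D\<^sup>2 \<le> m ?w ?r"
 proof -
  have "ball z ?r \<subseteq> ball ?w (2 ^ 2 * ?r)"
  proof
   fix x assume "x \<in> ball z ?r"
   then show "x \<in> ball ?w (2 ^ 2 * ?r)" using dist_triangle[of ?w x z] r by (simp add: dist_norm)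
  qed
  then have "m z ?r \<le> m ?w (2 ^ 2 * ?r)" by (rule m_mono)
  also have "\<dots> \<le> D\<^sup>2 * m ?w ?r" using r by (intro m_double_pow) simp
  finally show ?thesis using D_ge1 by (simp add: pos_divide_le_eq mult.commute)
 qed
 ultimately have 1: "m z ?r + m z ?r / D\<^sup>2 \<le> m z r" by linarith
 have "1 / D\<^sup>2 > 0" using D_ge1 by simp
 then have "1 + 1 / D\<^sup>2 > 0" by linarith
 moreover have "m z ?r * (1 + 1 / D\<^sup>2) \<le> m z r" using 1 by (simp add: distrib_left)
 ultimately show ?thesis unfolding \<theta>_def by (simp add: pos_le_divide_eq)
qed

lemma m_quarter_pow: "r > 0 ==> m z (r / 4 ^ n) \<le> \<theta> ^ n * m z r"
proof (induction n)
 case (Suc n)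
 have "m z (r / 4 ^ n / 4) \<le> \<theta> * m z (r / 4 ^ n)" using Suc.prems by (intro m_quarter) simp
 also have "\<dots> \<le> \<theta> * (\<theta> ^ n * m z r)" using Suc theta by (intro mult_left_mono) auto
 finally show ?case by (simp add: mult_ac)
qed simp

lemma m_grow: "r > 0 ==> m z r / \<theta> ^ n \<le> m z (4 ^ n * r)"
 using m_quarter_pow[of "4 ^ n * r" z n] theta by (simp add: pos_divide_le_eq mult.commute)

lemma A_step:
 assumes "0 < s" "s \<le> t"
 shows "A z s \<le> A z t" "A z t - A z s \<le> m z t / (8 * J3 * s) * (t - s)"
proof -
 show "A z s \<le> A z t"
 proof (rule DERIV_nonneg_imp_nondecreasing[OF assms(2)])
  fix x assume "s \<le> x" "x \<le> t"
  then have x: "x > 0" using assms by linarith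
  have "0 \<le> M 4 z x / (8 * J3 * x)" using x J3_pos by (intro divide_nonneg_pos) auto
  then show "\<exists>y. (A z has_real_derivative y) (at x) \<and> 0 \<le> y" using A_deriv_t[OF x] by blast
 qed
 have "norm (A z t - A z s) \<le> m z t / (8 * J3 * s) * \<bar>t - s\<bar>"
 proof (rule mvt_bound)
  fix u assume "u \<in> closed_segment s t"
  then have u: "s \<le> u" "u \<le> t" using assms by (auto simp: closed_segment_eq_real_ivl)
  then have u0: "u > 0" using assms by simp
  show "(A z has_vector_derivative M 4 z u / (8 * J3 * u)) (at u)"
   using A_deriv_t[OF u0] by (simp add: has_real_derivative_iff_has_vector_derivative)
  have "M 4 z u \<le> m z t" using M_le[of 4 u z] m_mono_r[OF u(2), of z] u0 by simp
  then have "M 4 z u / (8 * J3 * u) \<le> m z t / (8 * J3 * s)"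
   using u assms J3_pos by (intro frac_le) auto
  then show "norm (M 4 z u / (8 * J3 * u)) \<le> m z t / (8 * J3 * s)" using u0 J3_pos by simp
 qed
 then show "A z t - A z s \<le> m z t / (8 * J3 * s) * (t - s)" using assms by simp
qed

definition CA :: real where "CA = 3 / (8 * J3 * (1 - \<theta>))"

lemma CA_pos: "CA > 0" using J3_pos theta by (simp add: CA_def)

text \<open>The increments over the scales t / 4^n are at most 3 / (8 * J3) times the mass there,
  and reverse doubling makes these masses decay geometrically; \<open>CA\<close> is the sum of the
  series.\<close>

lemma A_upper:
 assumes t: "t > 0"
 shows "A z t \<le> \<phi> z + CA * m z t"
proof -
 have step: "A z t - A z (t / 4 ^ n) \<le> (\<Sum>i<n. (3 / (8 * J3)) * m z t * \<theta> ^ i)" for n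
 proof (induction n)
  case (Suc n)
  have "A z (t / 4 ^ n) - A z (t / 4 ^ Suc n) \<le> m z (t / 4 ^ n) / (8 * J3 * (t / 4 ^ Suc n)) * (t / 4 ^ n - t / 4 ^ Suc n)"
   using t by (intro A_step) (auto simp: field_simps)
  also have "\<dots> = 3 / (8 * J3) * m z (t / 4 ^ n)" using t J3_pos by (simp add: field_simps)
  also have "\<dots> \<le> 3 / (8 * J3) * (\<theta> ^ n * m z t)" using J3_pos by (intro mult_left_mono m_quarter_pow t) auto
  finally show ?case using Suc by (simp add: mult_ac)
 qed simp
 have "A z t - CA * m z t \<le> A z (t / 4 ^ n)" for n
 proof -
  have "(\<Sum>i<n. (3 / (8 * J3)) * m z t * \<theta> ^ i) = (3 / (8 * J3)) * m z t * (\<Sum>i<n. \<theta> ^ i)"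
   by (simp add: sum_distrib_left)
  also have "(\<Sum>i<n. \<theta> ^ i) \<le> 1 / (1 - \<theta>)"
   using theta sum_le_suminf[of "\<lambda>i. \<theta> ^ i" "{..<n}"] suminf_geometric[of \<theta>] summable_geometric[of \<theta>] by simp
  then have "(3 / (8 * J3)) * m z t * (\<Sum>i<n. \<theta> ^ i) \<le> (3 / (8 * J3)) * m z t * (1 / (1 - \<theta>))"
   using J3_pos by (intro mult_left_mono) auto
  also have "\<dots> = CA * m z t" by (simp add: CA_def)
  finally show ?thesis using step[of n] by linarith
 qed
 moreover have "(\<lambda>n. A z (t / 4 ^ n)) \<longlonglongrightarrow> \<phi> z"
 proof (rule A_limit)
  have "(\<lambda>n. (1/4::real) ^ n) \<longlonglongrightarrow> 0" by (rule LIMSEQ_realpow_zero) auto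
  from tendsto_mult_right_zero[OF this, of t] show "(\<lambda>n. t / 4 ^ n) \<longlonglongrightarrow> 0" by (simp add: power_divide)
 qed (use t in simp)
 ultimately have "A z t - CA * m z t \<le> \<phi> z" by (intro LIMSEQ_le_const) auto
 then show ?thesis by linarith
qed

text \<open>The gradient of one average sees \<phi> itself, but the difference of averages at
  adjacent scales is an integral of \<open>M 4\<close> over the scales between, and
  \<open>M 4\<close> is Lipschitz in the centre by its mass bound. A Lipschitz bound for the
  difference then bounds its derivative, so derivatives in centre and scale need not be
  exchanged.\<close>

lemma Ad_diff_bound:
 assumes t: "t > 0" and e: "cmod e = 1"
 shows "\<bar>Ad e z t - Ad e z (t / 2)\<bar> \<le> 2 * m z (2 * t) / (J3 * t)"
proof (rule hvd_bound_of_lipschitz)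
 let ?f = "\<lambda>h. A (z + e * of_real h) t - A (z + e * of_real h) (t / 2)"
 have "pd_at e (\<lambda>z. A z t - A z (t / 2)) (Ad e z t - Ad e z (t / 2)) z"
  using A_pd(1)[OF t, of e] A_pd(1)[of "t/2" e] t unfolding has_pd_def by (intro pd_at_diff) auto
 then show "(?f has_vector_derivative Ad e z t - Ad e z (t / 2)) (at 0)" by (simp add: pd_at_def)
 fix h :: real assume h: "\<bar>h\<bar> < t"
 let ?G = "\<lambda>s. A (z + e * of_real h) s - A z s"
 have Mb: "\<bar>M 4 (z + e * of_real h) s - M 4 z s\<bar> \<le> (8 / s * m z (2 * t)) * \<bar>h\<bar>" if s: "s > 0" "s \<le> t" for s
 proof -
  have "norm (M 4 (z + e * of_real h) s - M 4 (z + e * of_real 0) s) \<le> (8 / s * m z (2 * t)) * \<bar>h - 0\<bar>"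
  proof (rule mvt_bound)
   fix u assume "u \<in> closed_segment 0 h"
   then have u: "\<bar>u\<bar> \<le> \<bar>h\<bar>" by (auto simp: closed_segment_eq_real_ivl split: if_splits)
   show "((\<lambda>u. M 4 (z + e * of_real u) s) has_vector_derivative Nd e (z + e * of_real u) s) (at u)"
    by (rule pd_at_line[OF N_pd(1)[OF s(1)]])
   have "ball (z + e * of_real u) s \<subseteq> ball z (2 * t)"
   proof
    fix x assume x: "x \<in> ball (z + e * of_real u) s"
    have "dist z (z + e * of_real u) = \<bar>u\<bar>" by (simp add: dist_norm norm_mult e)
    then show "x \<in> ball z (2 * t)" using dist_triangle[of z x "z + e * of_real u"] x u h s by simp
   qed
   then have "8 / s * m (z + e * of_real u) s \<le> 8 / s * m z (2 * t)" using s by (intro mult_left_mono m_mono) auto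
   then show "norm (Nd e (z + e * of_real u) s) \<le> 8 / s * m z (2 * t)"
    using N_bounds(1)[OF s(1) e, of "z + e * of_real u"] by simp
  qed
  then show ?thesis by simp
 qed
 have "norm (?G t - ?G (t/2)) \<le> (4 * m z (2 * t) * \<bar>h\<bar> / (J3 * t\<^sup>2)) * \<bar>t - t / 2\<bar>"
 proof (rule mvt_bound)
  fix s assume "s \<in> closed_segment (t/2) t"
  then have s: "t / 2 \<le> s" "s \<le> t" "s > 0" using t by (auto simp: closed_segment_eq_real_ivl)
  show "(?G has_vector_derivative M 4 (z + e * of_real h) s / (8 * J3 * s) - M 4 z s / (8 * J3 * s)) (at s)"
   using A_deriv_t[OF s(3)] by (intro has_vector_derivative_diff) (simp_all add: has_real_derivative_iff_has_vector_derivative)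
  have "norm (M 4 (z + e * of_real h) s / (8 * J3 * s) - M 4 z s / (8 * J3 * s)) = \<bar>M 4 (z + e * of_real h) s - M 4 z s\<bar> / (8 * J3 * s)"
   using s J3_pos by (simp flip: diff_divide_distrib)
  also have "\<dots> \<le> (8 / s * m z (2 * t)) * \<bar>h\<bar> / (8 * J3 * s)"
   using Mb[OF s(3,2)] s J3_pos by (intro divide_right_mono) auto
  also have "\<dots> = (m z (2 * t) * \<bar>h\<bar> / J3) / (s * s)" using s J3_pos by (simp add: field_simps)
  also have "\<dots> \<le> (m z (2 * t) * \<bar>h\<bar> / J3) / ((t/2) * (t/2))"
   using s t J3_pos by (intro divide_left_mono mult_mono) auto
  also have "\<dots> = 4 * m z (2 * t) * \<bar>h\<bar> / (J3 * t\<^sup>2)" using t J3_pos by (simp add: field_simps power2_eq_square)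
  finally show "norm (M 4 (z + e * of_real h) s / (8 * J3 * s) - M 4 z s / (8 * J3 * s)) \<le> 4 * m z (2 * t) * \<bar>h\<bar> / (J3 * t\<^sup>2)" .
 qed
 also have "(4 * m z (2 * t) * \<bar>h\<bar> / (J3 * t\<^sup>2)) * \<bar>t - t / 2\<bar> = 2 * m z (2 * t) / (J3 * t) * \<bar>h\<bar>"
  using t J3_pos by (simp add: field_simps power2_eq_square)
 finally show "\<bar>?f h - ?f 0\<bar> \<le> 2 * m z (2 * t) / (J3 * t) * \<bar>h\<bar>" by (simp add: algebra_simps)
qed (fact t)

abbreviation \<rho> :: "complex \<Rightarrow> real" where "\<rho> \<equiv> rho \<mu>"

lemma rho_set: "{r. r > 0 \<and> emeasure \<mu> (ball z r) \<le> 1} = {r. r > 0 \<and> m z r \<le> 1}"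
 unfolding emeasure_m by (simp add: ennreal_le_1)

lemma m_large: "\<exists>n. B < m z (4 ^ n * r)" if r: "r > 0"
proof -
 have "1 < 1 / \<theta>" using theta by simp
 then obtain n where "B / m z r < (1 / \<theta>) ^ n" using real_arch_pow by blast
 then have "B < (1 / \<theta>) ^ n * m z r" using m_pos[OF r, of z] by (simp add: pos_divide_less_eq)
 then have "B < m z r / \<theta> ^ n" by (simp add: power_one_over)
 then show ?thesis using m_grow[OF r, of z n] by (intro exI[of _ n]) linarith
qed

lemma m_small: "\<exists>n. \<theta> ^ n * B < c" if c: "c > 0"
proof -
 have "(\<lambda>n. \<theta> ^ n * B) \<longlonglongrightarrow> 0 * B" using theta by (intro tendsto_intros LIMSEQ_realpow_zero) auto
 from order_tendstoD(2)[OF this, of c] c show ?thesis by (auto simp: eventually_sequentially)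
qed

text \<open>The supremum defining the radius enters afterwards only through its positivity and these
  two one-sided inequalities, so masses are compared at radii such as \<rho> z / 2 and 2 * \<rho> z
  instead of at \<rho> z.\<close>

lemma rho_bounds:
 shows rho_pos: "\<rho> z > 0" and m_le_1: "r < \<rho> z ==> m z r \<le> 1" and m_gt_1: "r > \<rho> z ==> m z r > 1"
proof -
 let ?S = "{r. r > 0 \<and> m z r \<le> 1}"
 have r: "\<rho> z = Sup ?S" by (simp add: rho_def rho_set)
 obtain n where n: "\<theta> ^ n * m z 1 < 1" using m_small[of 1] by auto
 have in_S: "1 / 4 ^ n \<in> ?S" using m_quarter_pow[of 1 z n] n by simp
 obtain k where k: "1 < m z (4 ^ k * 1)" using m_large[of 1 1 z] by auto
 have bdd: "bdd_above ?S"
 proof (rule bdd_aboveI[of _ "4 ^ k"])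
  fix x assume "x \<in> ?S"
  then have "m z x \<le> 1" by simp
  then show "x \<le> 4 ^ k" using m_mono_r[of "4 ^ k" x z] k by (cases "x \<le> 4 ^ k") simp_all
 qed
 have "1 / 4 ^ n \<le> \<rho> z" unfolding r by (rule cSup_upper[OF in_S bdd])
 then show p: "\<rho> z > 0" by (meson less_le_trans zero_less_divide_1_iff zero_less_numeral zero_less_power)
 show "m z r \<le> 1" if "r < \<rho> z" for r
 proof -
  have "?S \<noteq> {}" using in_S by blast
  from less_cSupD[OF this that[unfolded r]] obtain s where "s \<in> ?S" "r < s" by blast
  then show ?thesis using m_mono_r[of r s z] by simp
 qed
 show "m z r > 1" if "r > \<rho> z" for r
 proof (rule ccontr)
  assume "\<not> m z r > 1"
  then have "r \<in> ?S" using that p by simp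
  then show False using cSup_upper[OF _ bdd, of r] that unfolding r by simp
 qed
qed

lemma rho_leI: "m z r > 1 ==> \<rho> z \<le> r"
 using m_le_1[of r z] by (cases "\<rho> z \<le> r") simp_all

lemma rho_lipschitz: "\<rho> w \<le> \<rho> z + dist z w"
proof (rule field_le_epsilon)
 fix e :: real assume e: "e > 0"
 have "ball z (\<rho> z + e) \<subseteq> ball w (\<rho> z + dist z w + e)"
 proof
  fix x assume "x \<in> ball z (\<rho> z + e)"
  then show "x \<in> ball w (\<rho> z + dist z w + e)" using dist_triangle3[of w x z] by (simp add: dist_commute)
 qed
 from m_mono[OF this] have "m w (\<rho> z + dist z w + e) > 1" using m_gt_1[of z "\<rho> z + e"] e by simp
 then show "\<rho> w \<le> \<rho> z + dist z w + e" by (rule rho_leI)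
qed

text \<open>When \<open>t\<close> is a large multiple of \<rho> w, the disc of radius
  \<open>t\<close> at \<open>w\<close> has large mass by reverse doubling. A fixed number n of
  doublings of the radius e * t at \<open>z\<close> covers it, and j is chosen so that the growth
  1/\<theta>^j beats the loss D^n. This smallness of \<rho> at a distance is what
  \<open>log_weight\<close> lives on.\<close>

lemma rho_sublinear:
 assumes e: "e > 0"
 shows "\<exists>K\<ge>1. \<forall>z w t. t \<ge> K * \<rho> w \<longrightarrow> dist w z \<le> t \<longrightarrow> \<rho> z \<le> e * t"
proof -
 obtain n :: nat where n: "2 / e < 2 ^ n" using real_arch_pow[of 2] by auto
 obtain j where j: "\<theta> ^ j * D ^ n < 1" using m_small[of 1] by auto
 show ?thesis
 proof (intro exI[of _ "2 * 4 ^ j"] conjI allI impI)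
  show "(1::real) \<le> 2 * 4 ^ j" using one_le_power[of "4::real" j] by linarith
  fix z w t assume t: "2 * 4 ^ j * \<rho> w \<le> t" and d: "dist w z \<le> t"
  have t0: "t > 0" by (rule less_le_trans[OF _ t]) (simp add: rho_pos)
  have "D ^ n < 1 / \<theta> ^ j" using j theta by (simp add: pos_less_divide_eq mult.commute)
  also have "\<dots> \<le> m w (2 * \<rho> w) / \<theta> ^ j"
   using m_gt_1[of w "2 * \<rho> w"] rho_pos[of w] theta by (intro divide_right_mono) auto
  also have "\<dots> \<le> m w (4 ^ j * (2 * \<rho> w))" by (rule m_grow) (use rho_pos in simp)
  also have "\<dots> \<le> m w t" by (rule m_mono_r) (use t in \<open>simp add: mult_ac\<close>)
  also have "\<dots> \<le> m z (2 ^ n * (e * t))"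
  proof (rule m_mono, rule subsetI)
   fix x assume "x \<in> ball w t"
   then have "dist z x < 2 * t" using dist_triangle3[of z x w] d by simp
   also have "2 * t \<le> 2 ^ n * (e * t)"
   proof -
    have "2 \<le> 2 ^ n * e" using n e by (simp add: pos_divide_less_eq)
    then have "2 * t \<le> (2 ^ n * e) * t" using t0 by (intro mult_right_mono) auto
    then show ?thesis by (simp add: mult.assoc)
   qed
   finally show "x \<in> ball z (2 ^ n * (e * t))" by simp
  qed
  also have "\<dots> \<le> D ^ n * m z (e * t)" using e t0 by (intro m_double_pow) simp
  finally have "D ^ n * 1 < D ^ n * m z (e * t)" by simp
  then have "m z (e * t) > 1" using D_ge1 by (subst (asm) mult_less_cancel_left_pos) auto
  then show "\<rho> z \<le> e * t" by (rule rho_leI)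
 qed
qed

end

section \<open>Construction of the regularized potential from dyadic increments\<close>

lemma weight_glue:
 assumes ex: "\<And>R::real. \<exists>f p q pp qq. weight f p q pp qq \<and> (\<forall>z. cmod z < R \<longrightarrow> \<psi> z = f z \<and> Q z (pp z + qq z))"
 shows "\<exists>p q pp qq. weight \<psi> p q pp qq \<and> (\<forall>z. Q z (pp z + qq z))"
proof -
 define R where "R n x \<longleftrightarrow> (case x of (f, p, q, pp, qq) \<Rightarrow> weight f p q pp qq \<and> (\<forall>z. cmod z < real n \<longrightarrow> \<psi> z = f z \<and> Q z (pp z + qq z)))" for n x
 have "\<forall>n. \<exists>x. R n x"
 proof
  fix n :: nat
  from ex[of "real n"] obtain f p q pp qq
   where "weight f p q pp qq \<and> (\<forall>z. cmod z < real n \<longrightarrow> \<psi> z = f z \<and> Q z (pp z + qq z))" by blast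
  then have "R n (f, p, q, pp, qq)" unfolding R_def prod.case .
  then show "\<exists>x. R n x" by blast
 qed
 then have "\<exists>X. \<forall>n. R n (X n)" by (rule choice)
 then obtain X where X: "\<And>n. R n (X n)" by blast
 define f p q pp qq where "f n = fst (X n)" and "p n = fst (snd (X n))" and "q n = fst (snd (snd (X n)))"
  and "pp n = fst (snd (snd (snd (X n))))" and "qq n = snd (snd (snd (snd (X n))))" for n
 have w: "weight (f n) (p n) (q n) (pp n) (qq n)" and eQ: "cmod z < real n \<longrightarrow> \<psi> z = f n z \<and> Q z (pp n z + qq n z)" for n z
  using X[of n] unfolding R_def f_def p_def q_def pp_def qq_def by (auto simp: split_beta)
 have e: "cmod z < real n ==> \<psi> z = f n z" and Q: "cmod z < real n ==> Q z (pp n z + qq n z)" for n z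
  using eQ by auto
 define ix where "ix z = Suc (nat \<lceil>cmod z\<rceil>)" for z
 have ix: "cmod z < real (ix z)" for z unfolding ix_def by linarith
 have nb: "\<forall>\<^sub>F v in nhds z. cmod v < real n" if "cmod z < real n" for z n
 proof -
  have "open {v::complex. cmod v < real n}" by (intro open_Collect_less continuous_intros)
  then show ?thesis using that by (auto intro: eventually_nhds_in_open[of "{v. cmod v < real n}", simplified])
 qed
 \<comment> \<open>The local witnesses are unrelated a priori; where the functions agree on an open
   set, uniqueness of derivatives makes their derivatives agree too, so they glue along the index
   \<open>ix z\<close>.\<close>
 have uniq: "d n z = d k z"
  if "cmod z < real n" "cmod z < real k" "\<And>n. has_pd x (g n) (d n)"
   "\<And>n k z. cmod z < real n ==> cmod z < real k ==> g n z = g k z" for d g :: "nat \<Rightarrow> complex \<Rightarrow> real" and x n k z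
 proof -
  have "\<forall>\<^sub>F v in nhds z. g n v = g k v" using nb[OF that(1)] nb[OF that(2)] by eventually_elim (rule that(4))
  then have "pd_at x (g k) (d n z) z" using that(3)[of n] pd_at_cong unfolding has_pd_def by blast
  then show ?thesis using that(3)[of k] has_pd_unique unfolding has_pd_def by blast
 qed
 have W: "has_pd 1 (f n) (p n)" "has_pd \<i> (f n) (q n)" "has_pd 1 (p n) (pp n)" "has_pd \<i> (q n) (qq n)"
  "continuous_on UNIV (f n)" "continuous_on UNIV (p n)" "continuous_on UNIV (q n)" "continuous_on UNIV (pp n)" "continuous_on UNIV (qq n)" for n
  using w[of n] by (auto simp: weight_def C1c_def)
 have ef: "f n z = f k z" if "cmod z < real n" "cmod z < real k" for n k z using e that by metis
 have ep: "p n z = p k z" and eq: "q n z = q k z" if "cmod z < real n" "cmod z < real k" for n k z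
  using uniq[OF that W(1) ef] uniq[OF that W(2) ef] by auto
 have epp: "pp n z = pp k z" and eqq: "qq n z = qq k z" if "cmod z < real n" "cmod z < real k" for n k z
  using uniq[OF that W(3) ep] uniq[OF that W(4) eq] by auto
 have near: "\<forall>\<^sub>F v in nhds z. g (ix z) v = g (ix v) v"
  if "\<And>n k z. cmod z < real n ==> cmod z < real k ==> g n z = g k z" for g :: "nat \<Rightarrow> complex \<Rightarrow> real" and z
  using nb[OF ix[of z]] by eventually_elim (rule that[OF _ ix])
 have pdI: "has_pd x (\<lambda>z. g (ix z) z) (\<lambda>z. d (ix z) z)"
  if "\<And>n. has_pd x (g n) (d n)" "\<And>n k z. cmod z < real n ==> cmod z < real k ==> g n z = g k z" for d g :: "nat \<Rightarrow> complex \<Rightarrow> real" and x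
  unfolding has_pd_def
 proof
  fix z
  have "pd_at x (g (ix z)) (d (ix z) z) z" using that(1)[of "ix z"] by (simp add: has_pd_def)
  then show "pd_at x (\<lambda>z. g (ix z) z) (d (ix z) z) z" by (rule pd_at_cong) (rule near[OF that(2)])
 qed
 have cI: "continuous_on UNIV (\<lambda>z. g (ix z) z)"
  if "\<And>n. continuous_on UNIV (g n)" "\<And>n k z. cmod z < real n ==> cmod z < real k ==> g n z = g k z" for g :: "nat \<Rightarrow> complex \<Rightarrow> real"
  unfolding continuous_on_eq_continuous_at[OF open_UNIV]
 proof
  fix z
  have "isCont (g (ix z)) z" using that(1)[of "ix z"] by (simp add: continuous_on_eq_continuous_at)
  moreover have "isCont (g (ix z)) z = isCont (\<lambda>z. g (ix z) z) z"
   by (rule isCont_cong[OF near[OF that(2)]])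
  ultimately show "isCont (\<lambda>z. g (ix z) z) z" by simp
 qed
 have psi: "\<psi> = (\<lambda>z. f (ix z) z)" using e[OF ix] by auto
 have "weight \<psi> (\<lambda>z. p (ix z) z) (\<lambda>z. q (ix z) z) (\<lambda>z. pp (ix z) z) (\<lambda>z. qq (ix z) z)"
  unfolding weight_def C1c_def psi
 proof (intro conjI)
  show "has_pd 1 (\<lambda>z. f (ix z) z) (\<lambda>z. p (ix z) z)" by (rule pdI[where g=f and d=p, OF W(1)]) (rule ef)
  show "has_pd \<i> (\<lambda>z. f (ix z) z) (\<lambda>z. q (ix z) z)" by (rule pdI[where g=f and d=q, OF W(2)]) (rule ef)
  show "has_pd 1 (\<lambda>z. p (ix z) z) (\<lambda>z. pp (ix z) z)" by (rule pdI[where g=p and d=pp, OF W(3)]) (rule ep)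
  show "has_pd \<i> (\<lambda>z. q (ix z) z) (\<lambda>z. qq (ix z) z)" by (rule pdI[where g=q and d=qq, OF W(4)]) (rule eq)
  show "continuous_on UNIV (\<lambda>z. f (ix z) z)" by (rule cI[where g=f, OF W(5)]) (rule ef)
  show "continuous_on UNIV (\<lambda>z. p (ix z) z)" by (rule cI[where g=p, OF W(6)]) (rule ep)
  show "continuous_on UNIV (\<lambda>z. q (ix z) z)" by (rule cI[where g=q, OF W(7)]) (rule eq)
  show "continuous_on UNIV (\<lambda>z. pp (ix z) z)" by (rule cI[where g=pp, OF W(8)]) (rule epp)
  show "continuous_on UNIV (\<lambda>z. qq (ix z) z)" by (rule cI[where g=qq, OF W(9)]) (rule eqq)
 qed
 then show ?thesis using Q[OF ix] by blast
qed

text \<open>Summation by parts with the value of \<open>F\<close> at 0 replaced by 1. Once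
  \<open>F N\<close> vanishes with N > 0, the weights on the right add up to 1, so the expression is
  a weighted mean of the \<open>L k\<close> if \<open>F\<close> also decreases.\<close>

lemma abel_sum:
 fixes F L :: "nat \<Rightarrow> real"
 shows "L 0 + (\<Sum>k<N. F (Suc k) * (L (Suc k) - L k)) = (\<Sum>k<N. ((if k = 0 then 1 else F k) - F (Suc k)) * L k) + (if N = 0 then 1 else F N) * L N"
 by (induction N) (auto simp: algebra_simps)

context doubling_potential
begin

lemma M_mono:
 assumes "0 < s" "s \<le> t" "k \<ge> 1"
 shows "M k z s \<le> M k z t"
 unfolding M_def
proof (rule integral_mono)
 show "integrable \<mu> (\<lambda>w. bp k s (w - z))" "integrable \<mu> (\<lambda>w. bp k t (w - z))"
  using integrable_bp[OF loc_mu, of k s z] integrable_bp[OF loc_mu, of k t z] assms by auto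
 fix w
 have "(cmod (w - z))\<^sup>2 / t\<^sup>2 \<le> (cmod (w - z))\<^sup>2 / s\<^sup>2"
  using assms by (intro divide_left_mono power_mono) auto
 then show "bp k s (w - z) \<le> bp k t (w - z)" unfolding bp_def by (intro power_mono) auto
qed

text \<open>Dyadic scales from 2^-n to 2^n, with the exponent shifted by \<open>n\<close> so that
  the index is a natural number.\<close>

definition tt :: "nat \<Rightarrow> nat \<Rightarrow> real" where "tt n i = 2 ^ i / 2 ^ n"

lemma tt_pos [simp]: "tt n i > 0" by (simp add: tt_def)
lemma tt_Suc_Suc: "tt (Suc n) (Suc i) = tt n i" by (simp add: tt_def)
lemma tt_Suc: "tt n (Suc i) = 2 * tt n i" by (simp add: tt_def)

text \<open>\<open>FF\<close> is 1 on scales well below \<rho> z and 0 well above it, smoothly in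
  \<open>z\<close>; \<open>BB\<close> is the increment of the average over one dyadic step, taken at
  scales shrunk by the factor \<open>s\<close>. The suffixes \<open>d\<close> and \<open>dd\<close>
  mark their derivatives in direction \<open>e\<close>.\<close>

definition FF :: "nat \<Rightarrow> nat \<Rightarrow> complex \<Rightarrow> real" where "FF n i z = cutF (M 4 z (tt n i))"
definition FFd :: "nat \<Rightarrow> nat \<Rightarrow> complex \<Rightarrow> complex \<Rightarrow> real" where "FFd n i e z = cutF' (M 4 z (tt n i)) * Nd e z (tt n i)"
definition FFdd :: "nat \<Rightarrow> nat \<Rightarrow> complex \<Rightarrow> complex \<Rightarrow> real" where
 "FFdd n i e z = cutF' (M 4 z (tt n i)) * Ndd e z (tt n i) + (cutF'' (M 4 z (tt n i)) * Nd e z (tt n i)) * Nd e z (tt n i)"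
definition BB :: "real \<Rightarrow> nat \<Rightarrow> nat \<Rightarrow> complex \<Rightarrow> real" where "BB s n i z = A z (s * tt n i) - A z (s * tt n i / 2)"
definition BBd :: "real \<Rightarrow> nat \<Rightarrow> nat \<Rightarrow> complex \<Rightarrow> complex \<Rightarrow> real" where "BBd s n i e z = Ad e z (s * tt n i) - Ad e z (s * tt n i / 2)"
definition BBdd :: "real \<Rightarrow> nat \<Rightarrow> nat \<Rightarrow> complex \<Rightarrow> complex \<Rightarrow> real" where "BBdd s n i e z = Add e z (s * tt n i) - Add e z (s * tt n i / 2)"

text \<open>With every \<open>FF\<close> equal to 1 the sum telescopes to the average at the largest
  scale. The cutoffs stop it near \<rho> z, so this is a smooth substitute for the average of \<phi>
  at scale s * \<rho> z.\<close>

definition Psi :: "real \<Rightarrow> nat \<Rightarrow> complex \<Rightarrow> real" where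
 "Psi s n z = A z (s * tt n 0) + (\<Sum>k<2*n. FF n (Suc k) z * BB s n (Suc k) z)"
definition Psid :: "real \<Rightarrow> nat \<Rightarrow> complex \<Rightarrow> complex \<Rightarrow> real" where
 "Psid s n e z = Ad e z (s * tt n 0) + (\<Sum>k<2*n. FF n (Suc k) z * BBd s n (Suc k) e z + FFd n (Suc k) e z * BB s n (Suc k) z)"
definition Psidd :: "real \<Rightarrow> nat \<Rightarrow> complex \<Rightarrow> complex \<Rightarrow> real" where
 "Psidd s n e z = Add e z (s * tt n 0) + (\<Sum>k<2*n. (FF n (Suc k) z * BBdd s n (Suc k) e z + FFd n (Suc k) e z * BBd s n (Suc k) e z)
   + (FFd n (Suc k) e z * BBd s n (Suc k) e z + FFdd n (Suc k) e z * BB s n (Suc k) z))"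

lemma weight_Psi:
 assumes s: "s > 0"
 shows "weight (Psi s n) (Psid s n 1) (Psid s n \<i>) (Psidd s n 1) (Psidd s n \<i>)"
proof -
 have a: "pd_at e (\<lambda>z. A z t) (Ad e z t) z" "pd_at e (\<lambda>z. Ad e z t) (Add e z t) z"
  "pd_at e (\<lambda>z. M 4 z t) (Nd e z t) z" "pd_at e (\<lambda>z. Nd e z t) (Ndd e z t) z" if "t > 0" for e t z
  using A_pd[OF that] N_pd[OF that] unfolding has_pd_def by auto
 have st: "s * tt n i > 0" "s * tt n i / 2 > 0" for i using s by auto
 have F: "pd_at e (FF n i) (FFd n i e z) z" "pd_at e (FFd n i e) (FFdd n i e z) z" for i e z
  unfolding FF_def[abs_def] FFd_def[abs_def] FFdd_def
  by (rule pd_at_chain[OF _ cutF_deriv] pd_at_mult pd_at_chain[OF _ cutF'_deriv] a tt_pos)+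
 have B: "pd_at e (BB s n i) (BBd s n i e z) z" "pd_at e (BBd s n i e) (BBdd s n i e z) z" for i e z
  unfolding BB_def[abs_def] BBd_def[abs_def] BBdd_def by (intro pd_at_diff a st)+
 have P: "pd_at e (Psi s n) (Psid s n e z) z" "pd_at e (Psid s n e) (Psidd s n e z) z" for e z
  unfolding Psi_def[abs_def] Psid_def[abs_def] Psidd_def by (intro pd_at_add pd_at_sum pd_at_mult a st F B)+
 have c: "continuous_on UNIV (FF n i)" "continuous_on UNIV (FFd n i e)" "continuous_on UNIV (FFdd n i e)"
  "continuous_on UNIV (BB s n i)" "continuous_on UNIV (BBd s n i e)" "continuous_on UNIV (BBdd s n i e)" for i e
  unfolding FF_def[abs_def] FFd_def[abs_def] FFdd_def[abs_def] BB_def[abs_def] BBd_def[abs_def] BBdd_def[abs_def]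
  using A_pd(3-5) N_pd(3-5) st by (auto intro!: continuous_intros)
 have "continuous_on UNIV (Psi s n)" "continuous_on UNIV (Psid s n e)" "continuous_on UNIV (Psidd s n e)" for e
  unfolding Psi_def[abs_def] Psid_def[abs_def] Psidd_def[abs_def]
  using A_pd(3-5) st c by (auto intro!: continuous_intros)
 then show ?thesis using P unfolding weight_def C1c_def has_pd_def by auto
qed

text \<open>The window of scales contains the transition at \<open>z\<close>: the mass is still
  small at the bottom and already large at half the top. The value 256/81 is (4/3)^4, which by
  \<open>M_ge\<close> pushes \<open>M 4\<close> to at least 1.\<close>

definition good :: "nat \<Rightarrow> complex \<Rightarrow> bool" where
 "good n z \<longleftrightarrow> m z (1 / 2 ^ n) \<le> 1/2 \<and> 256/81 \<le> m z (2 ^ n / 2)"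

lemma good_Suc: "good n z ==> good (Suc n) z"
proof -
 have "(1::real) / 2 ^ Suc n \<le> 1 / 2 ^ n" "(2::real) ^ n / 2 \<le> 2 ^ Suc n / 2" by (auto intro!: divide_left_mono)
 then show "good n z ==> good (Suc n) z"
  using m_mono_r[of "1 / 2 ^ Suc n" "1 / 2 ^ n" z] m_mono_r[of "2 ^ n / 2" "2 ^ Suc n / 2" z]
  unfolding good_def by linarith
qed

lemma good_mono:
 assumes "good n z" "n \<le> k"
 shows "good k z"
 using assms(2) by (induction k rule: dec_induct) (auto intro: good_Suc assms(1))

lemma M4_large: "t > 0 ==> 256/81 \<le> m z (t/2) ==> M 4 z t \<ge> 1"
 using M_ge[of 4 t z] by (simp add: power_divide)

lemma good_pos: "good n z ==> n > 0"
 using m_mono_r[of "1/2" 1 z] unfolding good_def by (cases n) auto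

text \<open>Enlarging the window shifts the index by one and adds two terms. The new smallest scale
  has cutoff 1 and is absorbed by the initial average; the new largest has cutoff 0.\<close>

lemma Psi_Suc:
 assumes g: "good n z"
 shows "Psi s (Suc n) z = Psi s n z"
proof -
 have F1: "FF (Suc n) (Suc 0) z = 1"
  using M_le[of 4 "1 / 2 ^ n" z] g unfolding FF_def tt_Suc_Suc tt_def good_def by (intro cutF_1) auto
 have F2: "FF (Suc n) (Suc (Suc (2 * n))) z = 0"
 proof -
  have "256/81 \<le> m z (2 * 2 ^ n / 2)" using g m_mono_r[of "2 ^ n / 2" "2 * 2 ^ n / 2" z] unfolding good_def by auto
  then have "M 4 z (2 * 2 ^ n) \<ge> 1" by (intro M4_large) auto
  moreover have "tt (Suc n) (Suc (Suc (2 * n))) = 2 * 2 ^ n"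
  proof -
   have "(2::real) ^ (2 * n) = 2 ^ n * 2 ^ n" unfolding power_add[symmetric] mult_2 ..
   then show ?thesis unfolding tt_Suc_Suc tt_def power_Suc by simp
  qed
  ultimately show ?thesis unfolding FF_def by (simp add: cutF_0)
 qed
 have F3: "FF (Suc n) (Suc k) z = FF n k z" "BB s (Suc n) (Suc k) z = BB s n k z" for k
  by (simp_all add: FF_def BB_def tt_Suc_Suc)
 have B0: "BB s n 0 z = A z (s * tt n 0) - A z (s * tt (Suc n) 0)"
  unfolding BB_def by (simp add: tt_def mult.commute)
 have "Psi s (Suc n) z = A z (s * tt (Suc n) 0) + (\<Sum>k<Suc (Suc (2 * n)). FF (Suc n) (Suc k) z * BB s (Suc n) (Suc k) z)"
  by (simp add: Psi_def)
 also have "\<dots> = A z (s * tt (Suc n) 0) + (FF (Suc n) (Suc 0) z * BB s (Suc n) (Suc 0) z + (\<Sum>k<Suc (2 * n). FF (Suc n) (Suc (Suc k)) z * BB s (Suc n) (Suc (Suc k)) z))"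
  by (simp only: sum.lessThan_Suc_shift)
 also have "\<dots> = Psi s n z" unfolding sum.lessThan_Suc F1 F2 unfolding F3 B0 Psi_def by simp
 finally show ?thesis .
qed

lemma Psi_stable:
 assumes "good n z" "n \<le> k"
 shows "Psi s k z = Psi s n z"
 using assms(2) by (induction k rule: dec_induct) (auto simp: Psi_Suc good_mono[OF assms(1)])

text \<open>Discs around points of a bounded set are compared with discs around 0, so one window
  serves all of them. Locally, therefore, the final function is a single finite sum.\<close>

lemma good_uniform: "\<exists>n. \<forall>z. cmod z \<le> R \<longrightarrow> good n z"
proof -
 have ballsub: "ball z r \<subseteq> ball w (r + dist w z)" for z w :: complex and r
 proof
  fix x assume "x \<in> ball z r"
  then show "x \<in> ball w (r + dist w z)" using dist_triangle[of w x z] by simp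
 qed
 obtain k where k: "\<theta> ^ k * m 0 (1 + R) < 1/2" using m_small[of "1/2"] by auto
 obtain j where j: "256/81 < m 0 (4 ^ j * 1)" using m_large[where r=1 and B="256/81" and z=0] by auto
 obtain i :: nat where i: "4 ^ j + R < 2 ^ i" using real_arch_pow[of 2] by auto
 let ?n = "max (2 * k) (Suc i)"
 show ?thesis
 proof (intro exI[of _ ?n] allI impI)
  fix z assume z: "cmod z \<le> R"
  have "m z (1 / 2 ^ ?n) \<le> m z (1 / 4 ^ k)"
  proof (rule m_mono_r)
   have "(4::real) ^ k = 2 ^ (2 * k)" by (simp add: power_mult)
   then have "(4::real) ^ k \<le> 2 ^ ?n" by (simp only:) (rule power_increasing, auto)
   then show "1 / 2 ^ ?n \<le> 1 / (4::real) ^ k" by (intro divide_left_mono) auto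
  qed
  also have "\<dots> \<le> \<theta> ^ k * m z 1" by (rule m_quarter_pow) simp
  also have "\<dots> \<le> \<theta> ^ k * m 0 (1 + R)"
   using theta z by (intro mult_left_mono m_mono order_trans[OF ballsub[of z 1 0]]) (auto intro: subset_ball)
  finally have 1: "m z (1 / 2 ^ ?n) \<le> 1/2" using k by simp
  have "m 0 (4 ^ j) \<le> m z (4 ^ j + cmod z)" using ballsub[of 0 "4 ^ j" z] by (intro m_mono) (simp add: dist_norm)
  also have "\<dots> \<le> m z (2 ^ ?n / 2)"
  proof (rule m_mono_r)
   have "4 ^ j + cmod z \<le> 2 ^ Suc i / 2" using i z by simp
   also have "\<dots> \<le> 2 ^ ?n / 2" by (intro divide_right_mono power_increasing) auto
   finally show "4 ^ j + cmod z \<le> 2 ^ ?n / 2" .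
  qed
  finally show "good ?n z" using 1 j unfolding good_def by simp
 qed
qed

text \<open>The number of quarterings after which the mass has dropped below a quarter. The exponent
  \<open>qx\<close> converts this into a ratio of radii, 2^qx = 8 * 4^aa, where the 8 leaves room
  for the factors 2 lost below.\<close>

definition aa :: nat where "aa = (SOME a. \<theta> ^ a < 1/4)"
definition qx :: nat where "qx = 2 * aa + 3"

lemma theta_aa: "\<theta> ^ aa < 1/4"
proof -
 have "\<exists>a. \<theta> ^ a < 1/4" using m_small[of "1/4" 1] by auto
 then show ?thesis unfolding aa_def by (rule someI_ex)
qed

lemma two_qx: "(2::real) ^ qx = 8 * 4 ^ aa"
 unfolding qx_def by (simp add: power_add power_mult)

text \<open>At twice \<rho> z the mass exceeds 1, and \<open>aa\<close> quadruplings of the radius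
  multiply it by more than 4, hence beyond the 256/81 of \<open>M4_large\<close>.\<close>

lemma range_upper:
 assumes "M 4 z t < 1" "t > 0"
 shows "2 * t < 2 ^ qx * \<rho> z"
proof (rule ccontr)
 assume "\<not> 2 * t < 2 ^ qx * \<rho> z"
 then have t: "4 ^ aa * (2 * \<rho> z) \<le> t / 2" unfolding two_qx by (simp add: algebra_simps)
 have "1 / \<theta> ^ aa \<le> m z (2 * \<rho> z) / \<theta> ^ aa"
  using m_gt_1[of z "2 * \<rho> z"] rho_pos[of z] theta by (intro divide_right_mono) auto
 also have "\<dots> \<le> m z (4 ^ aa * (2 * \<rho> z))" by (rule m_grow) (simp add: rho_pos)
 also have "\<dots> \<le> m z (t / 2)" by (rule m_mono_r[OF t])
 finally have "1 / \<theta> ^ aa \<le> m z (t / 2)" .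
 moreover have "4 < 1 / \<theta> ^ aa" using theta_aa theta by (simp add: pos_less_divide_eq)
 ultimately show False using M4_large[of t z] assms by simp
qed

text \<open>Below \<rho> z the mass is at most 1, and \<open>aa\<close> quarterings leave less than
  1/4 of it.\<close>

lemma range_lower:
 assumes "m z t > 1/2" "t > 0"
 shows "\<rho> z < 2 ^ qx * t / 2"
proof (rule ccontr)
 assume "\<not> \<rho> z < 2 ^ qx * t / 2"
 then have "t \<le> (\<rho> z / 4) / 4 ^ aa" unfolding two_qx by (simp add: field_simps)
 then have "m z t \<le> m z ((\<rho> z / 4) / 4 ^ aa)" by (rule m_mono_r)
 also have "\<dots> \<le> \<theta> ^ aa * m z (\<rho> z / 4)" by (rule m_quarter_pow) (simp add: rho_pos)
 also have "\<dots> \<le> \<theta> ^ aa * 1" using theta m_le_1[of "\<rho> z / 4" z] rho_pos[of z] by (intro mult_left_mono) auto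
 finally show False using theta_aa assms by simp
qed

end

section \<open>Estimates for the regularized potential and its Laplacian\<close>

context doubling_potential
begin

text \<open>\<open>Q\<close> bounds the ratio between \<rho> z and the scales that matter
  (\<open>inr\<close>); \<open>E\<close> is the price in mass of passing between radii in such a
  ratio (\<open>m_scaled_le\<close>).\<close>

definition Q :: real where "Q = 2 ^ qx"
definition E :: real where "E = D ^ Suc qx"

lemma Q_ge: "Q \<ge> 8" unfolding Q_def two_qx using one_le_power[of "4::real" aa] by simp
lemma E_ge: "E \<ge> 1" unfolding E_def using D_ge1 by (rule one_le_power)

definition inr :: "complex \<Rightarrow> real \<Rightarrow> bool" where "inr z t \<longleftrightarrow> t > 0 \<and> t < Q * \<rho> z \<and> \<rho> z < Q * t"

lemma inr_transition: "t > 0 ==> 1/2 < M 4 z t ==> M 4 z t < 1 ==> inr z t"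
proof -
 assume t: "t > 0" and M: "1/2 < M 4 z t" "M 4 z t < 1"
 have "m z t > 1/2" using M(1) M_le[of 4 t z] t by simp
 then have "\<rho> z < Q * t / 2" using range_lower t unfolding Q_def by blast
 moreover have "Q * t > 0" using Q_ge t by simp
 ultimately show ?thesis using range_upper[OF M(2) t] t unfolding inr_def Q_def[symmetric] by linarith
qed

lemma m_scaled_le: "r > 0 ==> k \<le> Suc qx ==> u \<le> 2 ^ k * r ==> m z u \<le> E * m z r"
proof -
 assume r: "r > 0" and k: "k \<le> Suc qx" and u: "u \<le> 2 ^ k * r"
 have "m z u \<le> m z (2 ^ k * r)" by (rule m_mono_r[OF u])
 also have "\<dots> \<le> D ^ k * m z r" by (rule m_double_pow[OF r])
 also have "\<dots> \<le> E * m z r" unfolding E_def by (intro mult_right_mono power_increasing k D_ge1) simp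
 finally show ?thesis .
qed

lemma m_inr: "inr z t ==> m z t \<le> E"
proof -
 assume t: "inr z t"
 have "m z t \<le> E * m z (\<rho> z / 2)"
  by (rule m_scaled_le[of _ "Suc qx"]) (use t rho_pos in \<open>auto simp: inr_def Q_def\<close>)
 also have "\<dots> \<le> E * 1" using E_ge m_le_1[of "\<rho> z / 2" z] rho_pos[of z] by (intro mult_left_mono) auto
 finally show ?thesis by simp
qed

text \<open>The natural size of the Laplacian of the average at scale s * \<rho> z. Main and error
  terms are both measured against it, because their powers of \<open>s\<close> must be compared
  before \<open>s\<close> is fixed.\<close>

definition WW :: "real \<Rightarrow> complex \<Rightarrow> real" where "WW s z = m z (s * \<rho> z) / (s * \<rho> z)\<^sup>2"
definition LL :: "real \<Rightarrow> real \<Rightarrow> complex \<Rightarrow> real" where "LL s t z = M 3 z (s * t) / (J3 * (s * t)\<^sup>2)"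
text \<open>\<open>ZZ\<close> and \<open>UU\<close> are the lower and upper constants of the main
  term, \<open>XX\<close> that of the errors. The 27/64 is (3/4)^3 from \<open>M_ge\<close>; the
  20160 is 288 + 288 + 19584, the three contributions in \<open>RR_bound\<close>.\<close>

definition ZZ :: real where "ZZ = 27 / (64 * E * J3 * Q\<^sup>2)"
definition UU :: real where "UU = E * Q\<^sup>2 / J3"
definition XX :: real where "XX = 20160 * Q\<^sup>2 * E ^ 3 / J3"

lemma consts_pos: "ZZ > 0" "UU > 0" "XX > 0"
 unfolding ZZ_def UU_def XX_def using E_ge Q_ge J3_pos by (auto intro!: divide_pos_pos mult_pos_pos)

lemma LL_bounds:
 assumes t: "inr z t" and s: "s > 0"
 shows "ZZ * WW s z \<le> LL s t z" "LL s t z \<le> UU * WW s z"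
proof -
 have r: "\<rho> z > 0" by (rule rho_pos)
 have t': "t > 0" "t < Q * \<rho> z" "\<rho> z < Q * t" using t by (auto simp: inr_def)
 have st: "s * t > 0" "s * \<rho> z > 0" using s t' r by auto
 define a b where "a = s * t" and "b = s * \<rho> z"
 have ab: "a > 0" "b > 0" "a \<le> Q * b" "b \<le> Q * a"
  using st t' s mult_left_mono[of t "Q * \<rho> z" s] mult_left_mono[of "\<rho> z" "Q * t" s] by (auto simp: a_def b_def mult_ac)
 have 1: "m z b \<le> E * m z (a / 2)"
  by (rule m_scaled_le[of _ "Suc qx"]) (use ab in \<open>auto simp: Q_def\<close>)
 have 2: "m z a \<le> E * m z b"
  by (rule m_scaled_le[of _ qx]) (use ab in \<open>auto simp: Q_def\<close>)
 have 3: "27/64 * m z (a / 2) \<le> M 3 z a" "M 3 z a \<le> m z a"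
  using M_ge[of 3 a z] M_le[of 3 a z] ab by (auto simp: power_divide)
 have sq: "a\<^sup>2 \<le> Q\<^sup>2 * b\<^sup>2" "b\<^sup>2 \<le> Q\<^sup>2 * a\<^sup>2"
  using ab power_mono[of a "Q * b" 2] power_mono[of b "Q * a" 2] by (auto simp: power_mult_distrib)
 have "ZZ * WW s z = (27/64 * (m z b / E)) / (J3 * (Q\<^sup>2 * b\<^sup>2))"
  unfolding ZZ_def WW_def b_def[symmetric] by simp
 also have "\<dots> \<le> (27/64 * m z (a / 2)) / (J3 * a\<^sup>2)"
 proof (intro frac_le)
  show "27/64 * (m z b / E) \<le> 27/64 * m z (a / 2)" using 1 E_ge by (simp add: pos_divide_le_eq mult.commute)
 qed (use ab J3_pos sq in auto)
 also have "\<dots> \<le> LL s t z" unfolding LL_def a_def[symmetric] using 3 J3_pos by (intro divide_right_mono) auto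
 finally show "ZZ * WW s z \<le> LL s t z" .
 have "LL s t z \<le> (E * m z b) / (J3 * (b\<^sup>2 / Q\<^sup>2))"
  unfolding LL_def a_def[symmetric]
 proof (intro frac_le)
  show "M 3 z a \<le> E * m z b" using 2 3 by linarith
  show "J3 * (b\<^sup>2 / Q\<^sup>2) \<le> J3 * a\<^sup>2" using sq J3_pos Q_ge by (intro mult_left_mono) (auto simp: pos_divide_le_eq mult.commute)
 qed (use ab J3_pos E_ge Q_ge in auto)
 also have "\<dots> = UU * WW s z" unfolding UU_def WW_def b_def[symmetric] using Q_ge by simp
 finally show "LL s t z \<le> UU * WW s z" .
qed

text \<open>The terms of the second derivative in which the cutoff is differentiated at least
  once.\<close>

definition RR :: "real \<Rightarrow> nat \<Rightarrow> complex \<Rightarrow> complex \<Rightarrow> nat \<Rightarrow> real" where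
 "RR s n z e k = FFd n (Suc k) e z * BBd s n (Suc k) e z + (FFd n (Suc k) e z * BBd s n (Suc k) e z + FFdd n (Suc k) e z * BB s n (Suc k) z)"

lemma lap_decomp:
 assumes s: "s > 0"
 shows "Psidd s n 1 z + Psidd s n \<i> z = (LL s (tt n 0) z + (\<Sum>k<2*n. FF n (Suc k) z * (LL s (tt n (Suc k)) z - LL s (tt n k) z)))
   + (\<Sum>k<2*n. RR s n z 1 k + RR s n z \<i> k)"
proof -
 have L: "Add 1 z (s * tt n k) + Add \<i> z (s * tt n k) = LL s (tt n k) z" for k
  unfolding LL_def by (rule Add_sum) (use s in simp)
 have h: "s * tt n (Suc k) / 2 = s * tt n k" for k by (simp add: tt_Suc)
 have BL: "BBdd s n (Suc k) 1 z + BBdd s n (Suc k) \<i> z = LL s (tt n (Suc k)) z - LL s (tt n k) z" for k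
  unfolding BBdd_def h using L[of k] L[of "Suc k"] by simp
 have "Psidd s n e z = Add e z (s * tt n 0) + (\<Sum>k<2*n. FF n (Suc k) z * BBdd s n (Suc k) e z) + (\<Sum>k<2*n. RR s n z e k)" for e
  unfolding Psidd_def RR_def by (simp add: sum.distrib add_ac)
 then have "Psidd s n 1 z + Psidd s n \<i> z = (Add 1 z (s * tt n 0) + Add \<i> z (s * tt n 0))
   + (\<Sum>k<2*n. FF n (Suc k) z * BBdd s n (Suc k) 1 z + FF n (Suc k) z * BBdd s n (Suc k) \<i> z) + (\<Sum>k<2*n. RR s n z 1 k + RR s n z \<i> k)"
  by (simp add: sum.distrib)
 then show ?thesis unfolding L BL[symmetric] distrib_left by simp
qed

text \<open>Summation by parts turns the undifferentiated part into a mean of the Laplacians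
  \<open>LL\<close> with nonnegative weights of sum 1. A weight is nonzero only where the cutoff
  changes, hence at scales comparable to \<rho> z, where \<open>LL_bounds\<close> applies.\<close>

lemma main_bounds:
 assumes s: "s > 0" and g: "good n z"
 defines "V \<equiv> LL s (tt n 0) z + (\<Sum>k<2*n. FF n (Suc k) z * (LL s (tt n (Suc k)) z - LL s (tt n k) z))"
 shows "ZZ * WW s z \<le> V" "V \<le> UU * WW s z"
proof -
 let ?G = "\<lambda>k. if k = 0 then 1 else FF n k z"
 have n0: "n > 0" by (rule good_pos[OF g])
 have last: "FF n (2 * n) z = 0"
 proof -
  have "(2::real) ^ (2 * n) = 2 ^ n * 2 ^ n" unfolding power_add[symmetric] mult_2 ..
  then have "tt n (2 * n) = 2 ^ n" unfolding tt_def by simp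
  moreover have "M 4 z (2 ^ n) \<ge> 1" using g by (intro M4_large) (auto simp: good_def)
  ultimately show ?thesis unfolding FF_def by (simp add: cutF_0)
 qed
 have mono: "M 4 z (tt n k) \<le> M 4 z (tt n (Suc k))" for k by (rule M_mono) (auto simp: tt_Suc less_imp_le)
 have G0: "?G k - FF n (Suc k) z \<ge> 0" for k
  using cutF_range[of "M 4 z (tt n (Suc k))"] cutF_antimono[OF mono[of k]] by (cases k) (auto simp: FF_def)
 have rg: "inr z (tt n k)" if nz: "?G k - FF n (Suc k) z \<noteq> 0" for k
 proof -
  have "M 4 z (tt n (Suc k)) > 1/2"
  proof (rule ccontr)
   assume "\<not> M 4 z (tt n (Suc k)) > 1/2"
   then show False using nz mono[of k] by (auto simp: FF_def cutF_1 split: if_splits)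
  qed
  \<comment> \<open>The cutoff gives information at \<open>tt n (Suc k)\<close>, twice the scale of
    index \<open>k\<close>; the factor 1/2 in \<open>range_lower\<close> absorbs the shift.\<close>
  then have "m z (2 * tt n k) > 1/2" using M_le[of 4 "tt n (Suc k)" z] unfolding tt_Suc by simp
  then have lo: "\<rho> z < Q * tt n k" using range_lower[of z "2 * tt n k"] unfolding Q_def[symmetric] by simp
  have hi: "tt n k < Q * \<rho> z"
  proof (cases "k = 0")
   case True
   have "m z (tt n 0) \<le> 1/2" using g by (simp add: good_def tt_def)
   then have "tt n 0 \<le> \<rho> z" using m_gt_1[of z "tt n 0"] by (cases "tt n 0 \<le> \<rho> z") auto
   moreover have "\<rho> z < Q * \<rho> z" using Q_ge rho_pos[of z] by simp
   ultimately show ?thesis using True by simp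
  next
   case False
   have "M 4 z (tt n k) < 1"
   proof (rule ccontr)
    assume "\<not> M 4 z (tt n k) < 1"
    then show False using nz mono[of k] False by (simp add: FF_def cutF_0)
   qed
   then show ?thesis using range_upper[of z "tt n k"] tt_pos[of n k] unfolding Q_def[symmetric] by linarith
  qed
  show ?thesis using lo hi by (simp add: inr_def)
 qed
 have ab: "l 0 + (\<Sum>k<2*n. FF n (Suc k) z * (l (Suc k) - l k)) = (\<Sum>k<2*n. (?G k - FF n (Suc k) z) * l k)" for l :: "nat \<Rightarrow> real"
  unfolding abel_sum[of l "\<lambda>k. FF n k z" "2 * n"] using n0 last by simp
 have V: "V = (\<Sum>k<2*n. (?G k - FF n (Suc k) z) * LL s (tt n k) z)"
  unfolding V_def by (rule ab)
 have one: "(\<Sum>k<2*n. (?G k - FF n (Suc k) z) * c) = c" for c :: real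
  using ab[of "\<lambda>_. c"] by simp
 have "(\<Sum>k<2*n. (?G k - FF n (Suc k) z) * (ZZ * WW s z)) \<le> V"
  unfolding V
 proof (rule sum_mono)
  fix k
  show "(?G k - FF n (Suc k) z) * (ZZ * WW s z) \<le> (?G k - FF n (Suc k) z) * LL s (tt n k) z"
  proof (cases "?G k - FF n (Suc k) z = 0")
   case False
   then show ?thesis by (intro mult_left_mono G0 LL_bounds(1) rg s)
  qed (simp only: mult_zero_left order_refl)
 qed
 then show "ZZ * WW s z \<le> V" unfolding one .
 have "V \<le> (\<Sum>k<2*n. (?G k - FF n (Suc k) z) * (UU * WW s z))"
  unfolding V
 proof (rule sum_mono)
  fix k
  show "(?G k - FF n (Suc k) z) * LL s (tt n k) z \<le> (?G k - FF n (Suc k) z) * (UU * WW s z)"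
  proof (cases "?G k - FF n (Suc k) z = 0")
   case False
   then show ?thesis by (intro mult_left_mono G0 LL_bounds(2) rg s)
  qed (simp only: mult_zero_left order_refl)
 qed
 then show "V \<le> UU * WW s z" unfolding one .
qed

text \<open>A derivative of the cutoff costs 1 / \<rho> z and one of \<open>BB\<close> costs 1 / (s
  * \<rho> z), while \<open>WW\<close> is of order 1 / (s * \<rho> z)^2 times the same mass: that is
  the extra factor \<open>s\<close>. Outside the transition the derivatives of the cutoff
  vanish.\<close>

lemma RR_bound:
 assumes s: "0 < s" "s \<le> 1" and e: "cmod e = 1"
 shows "\<bar>RR s n z e k\<bar> \<le> (if inr z (tt n (Suc k)) then XX * s * WW s z else 0)"
proof -
 define t where "t = tt n (Suc k)"
 have t0: "t > 0" by (simp add: t_def)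
 show ?thesis
 proof (cases "inr z t")
  case False
  then have "M 4 z t \<le> 1/2 \<or> M 4 z t \<ge> 1" by (intro ccontr[of "_ \<or> _"]) (use inr_transition[OF t0, of z] in auto)
  then have "cutF' (M 4 z t) = 0" "cutF'' (M 4 z t) = 0" by (auto simp: cutF'_1 cutF''_1 cutF'_0 cutF''_0)
  then have "RR s n z e k = 0" by (simp add: RR_def FFd_def FFdd_def t_def)
  then show ?thesis using False by (simp add: t_def)
 next
  case True
  define r b where "r = \<rho> z" and "b = m z (s * \<rho> z)"
  have r: "r > 0" by (simp add: r_def rho_pos)
  have b: "b \<ge> 0" by (simp add: b_def)
  have t: "t < Q * r" "r < Q * t" using True by (auto simp: inr_def r_def)
  have it: "1 / t \<le> Q / r" using t t0 r by (simp add: field_simps)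
  have mt: "m z t \<le> E" by (rule m_inr[OF True])
  have srt: "s * t \<le> Q * (s * r)" using t s mult_left_mono[of t "Q * r" s] by (simp add: mult_ac)
  have mst: "m z (s * t) \<le> E * b" "m z (2 * (s * t)) \<le> E * b"
  proof -
   show "m z (s * t) \<le> E * b" unfolding b_def
    by (rule m_scaled_le[of _ qx]) (use srt s r in \<open>auto simp: Q_def r_def\<close>)
   show "m z (2 * (s * t)) \<le> E * b" unfolding b_def
    by (rule m_scaled_le[of _ "Suc qx"]) (use srt s r in \<open>auto simp: Q_def r_def\<close>)
  qed
  have Nd1: "\<bar>Nd e z t\<bar> \<le> 8 * (Q / r) * E"
  proof -
   have "8 / t * m z t \<le> 8 * (Q / r) * E" using mult_mono[of "8 * (1 / t)" "8 * (Q / r)" "m z t" E] it mt Q_ge r by simp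
   then show ?thesis using N_bounds(1)[OF t0 e, of z] by linarith
  qed
  have Ndd1: "\<bar>Ndd e z t\<bar> \<le> 64 * (Q / r)\<^sup>2 * E"
  proof -
   have "(1 / t)\<^sup>2 \<le> (Q / r)\<^sup>2" using it t0 by (intro power_mono) auto
   then have "64 * (1 / t)\<^sup>2 * m z t \<le> 64 * (Q / r)\<^sup>2 * E" using mt by (intro mult_mono) auto
   then show ?thesis using N_bounds(2)[OF t0 e, of z] by (simp add: power_divide)
  qed
  have B1: "\<bar>BB s n (Suc k) z\<bar> \<le> E * b / J3"
  proof -
   have st: "0 < s * t / 2" "s * t / 2 \<le> s * t" using s t0 by auto
   have "A z (s * t) - A z (s * t / 2) \<le> m z (s * t) / (8 * J3 * (s * t / 2)) * (s * t - s * t / 2)" by (rule A_step(2)[OF st])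
   also have "\<dots> = m z (s * t) / (8 * J3)" using s t0 J3_pos by (simp add: field_simps)
   also have "\<dots> \<le> m z (s * t) / J3" using J3_pos by (intro divide_left_mono) auto
   also have "\<dots> \<le> E * b / J3" using mst J3_pos by (intro divide_right_mono) auto
   finally show ?thesis using A_step(1)[OF st, of z] unfolding BB_def t_def[symmetric] by simp
  qed
  have Bd1: "\<bar>BBd s n (Suc k) e z\<bar> \<le> (2 * E * b / (J3 * s)) * (Q / r)"
  proof -
   have "\<bar>BBd s n (Suc k) e z\<bar> \<le> 2 * m z (2 * (s * t)) / (J3 * (s * t))"
    unfolding BBd_def t_def[symmetric] by (rule Ad_diff_bound) (use s t0 e in auto)
   also have "\<dots> = (2 * m z (2 * (s * t)) / (J3 * s)) * (1 / t)" by simp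
   also have "\<dots> \<le> (2 * (E * b) / (J3 * s)) * (Q / r)"
    using mst(2) it s J3_pos t0 b E_ge by (intro mult_mono divide_right_mono mult_left_mono) auto
   finally show ?thesis by (simp add: mult.assoc)
  qed
  define p where "p = Q / r"
  have p: "p > 0" using Q_ge r by (simp add: p_def)
  have Fd: "\<bar>FFd n (Suc k) e z\<bar> \<le> 18 * (8 * p * E)"
   unfolding FFd_def t_def[symmetric] abs_mult using Nd1 cutF'_bound unfolding p_def by (intro mult_mono) auto
  have Fdd: "\<bar>FFdd n (Suc k) e z\<bar> \<le> 18 * (64 * p\<^sup>2 * E) + (288 * (8 * p * E)) * (8 * p * E)"
  proof -
   have F1: "\<bar>cutF' (M 4 z t) * Ndd e z t\<bar> \<le> 18 * (64 * p\<^sup>2 * E)"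
    unfolding abs_mult p_def using Ndd1 cutF'_bound by (intro mult_mono) auto
   have F2: "\<bar>(cutF'' (M 4 z t) * Nd e z t) * Nd e z t\<bar> \<le> (288 * (8 * p * E)) * (8 * p * E)"
    unfolding abs_mult using Nd1 cutF''_bound E_ge p unfolding p_def[symmetric] by (intro mult_mono) auto
   show ?thesis unfolding FFdd_def t_def[symmetric]
    by (rule order_trans[OF abs_triangle_ineq add_mono[OF F1 F2]])
  qed
  have T1: "\<bar>FFd n (Suc k) e z * BBd s n (Suc k) e z\<bar> \<le> (18 * (8 * p * E)) * ((2 * E * b / (J3 * s)) * p)"
   unfolding abs_mult using Fd Bd1 p E_ge unfolding p_def[symmetric] by (intro mult_mono) auto
  have T2: "\<bar>FFdd n (Suc k) e z * BB s n (Suc k) z\<bar> \<le> (18 * (64 * p\<^sup>2 * E) + (288 * (8 * p * E)) * (8 * p * E)) * (E * b / J3)"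
   unfolding abs_mult using Fdd B1 p E_ge by (intro mult_mono) auto
  define y where "y = p\<^sup>2 * b / (J3 * s)"
  have y: "y \<ge> 0" using p b J3_pos s by (simp add: y_def)
  have E23: "E\<^sup>2 \<le> E ^ 3" using E_ge by (intro power_increasing) auto
  have "(18 * (8 * p * E)) * ((2 * E * b / (J3 * s)) * p) = 288 * E\<^sup>2 * y"
   unfolding y_def by (simp add: power2_eq_square)
  also have "\<dots> \<le> 288 * E ^ 3 * y" using E23 y by (intro mult_right_mono) auto
  finally have T1': "\<bar>FFd n (Suc k) e z * BBd s n (Suc k) e z\<bar> \<le> 288 * E ^ 3 * y" using T1 by linarith
  have "(18 * (64 * p\<^sup>2 * E) + (288 * (8 * p * E)) * (8 * p * E)) * (E * b / J3) = (1152 * E\<^sup>2 + 18432 * E ^ 3) * (s * y)"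
   unfolding y_def using s J3_pos by (simp add: power2_eq_square power3_eq_cube field_simps)
  also have "\<dots> \<le> (1152 * E ^ 3 + 18432 * E ^ 3) * (1 * y)"
   using E23 E_ge y s by (intro mult_mono add_mono mult_right_mono) auto
  also have "\<dots> = 19584 * E ^ 3 * y" by (simp add: algebra_simps)
  finally have T2': "\<bar>FFdd n (Suc k) e z * BB s n (Suc k) z\<bar> \<le> 19584 * E ^ 3 * y" using T2 by linarith
  have "\<bar>RR s n z e k\<bar> \<le> 20160 * E ^ 3 * y" unfolding RR_def using T1' T2' by linarith
  also have "\<dots> = XX * s * WW s z"
  proof -
   have "WW s z = b / (s * r)\<^sup>2" by (simp add: WW_def b_def r_def)
   then show ?thesis unfolding XX_def y_def p_def using s r J3_pos
    by (simp add: power_divide power_mult_distrib power2_eq_square field_simps)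
  qed
  finally show ?thesis using True by (simp add: t_def)
 qed
qed

text \<open>Active scales lie between \<rho> z / Q and Q * \<rho> z, and a dyadic sequence meets
  this range at most 2 * qx times, whatever the window \<open>n\<close>.\<close>

lemma card_inr: "card {k. k < N \<and> inr z (tt n (Suc k))} \<le> 2 * qx"
proof (cases "{k. k < N \<and> inr z (tt n (Suc k))} = {}")
 case False
 define I where "I = {k. k < N \<and> inr z (tt n (Suc k))}"
 have fin: "finite I" unfolding I_def by simp
 define i where "i = Min I"
 have i: "i \<in> I" "\<And>k. k \<in> I ==> i \<le> k" using fin False unfolding i_def I_def[symmetric] by auto
 have "I \<subseteq> {i..<i + 2 * qx}"
 proof
  fix k assume k: "k \<in> I"
  have "tt n (Suc k) < Q * \<rho> z" "\<rho> z < Q * tt n (Suc i)" using k i(1) by (auto simp: I_def inr_def)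
  moreover from this(2) have "Q * \<rho> z < Q * (Q * tt n (Suc i))" using Q_ge by simp
  ultimately have "tt n (Suc k) < Q * (Q * tt n (Suc i))" by linarith
  then have "2 ^ Suc k / 2 ^ n < (2 ^ qx * (2 ^ qx * 2 ^ Suc i)) / (2::real) ^ n" unfolding tt_def Q_def by (simp only: times_divide_eq_right)
  then have "(2::real) ^ Suc k < 2 ^ qx * (2 ^ qx * 2 ^ Suc i)" by (simp add: divide_less_cancel del: power_Suc)
  then have "(2::real) ^ Suc k < 2 ^ (qx + (qx + Suc i))" by (simp add: power_add)
  then have "Suc k < qx + (qx + Suc i)" by (subst (asm) power_strict_increasing_iff) auto
  then show "k \<in> {i..<i + 2 * qx}" using i(2)[OF k] by auto
 qed
 then have "card I \<le> card {i..<i + 2 * qx}" by (rule card_mono[rotated]) simp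
 then show ?thesis unfolding I_def by simp
next
 case True
 show ?thesis unfolding True by simp
qed

lemma RR_sum:
 assumes s: "0 < s" "s \<le> 1"
 shows "\<bar>\<Sum>k<2*n. RR s n z 1 k + RR s n z \<i> k\<bar> \<le> 4 * real qx * (XX * s * WW s z)"
proof -
 let ?c = "XX * s * WW s z"
 have c0: "?c \<ge> 0" using consts_pos s by (simp add: WW_def)
 have "\<bar>\<Sum>k<2*n. RR s n z 1 k + RR s n z \<i> k\<bar> \<le> (\<Sum>k<2*n. \<bar>RR s n z 1 k + RR s n z \<i> k\<bar>)" by (rule sum_abs)
 also have "\<dots> \<le> (\<Sum>k<2*n. if inr z (tt n (Suc k)) then 2 * ?c else 0)"
 proof (rule sum_mono)
  fix k
  show "\<bar>RR s n z 1 k + RR s n z \<i> k\<bar> \<le> (if inr z (tt n (Suc k)) then 2 * ?c else 0)"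
   using RR_bound[OF s, of 1 n z k] RR_bound[OF s, of \<i> n z k] by (auto split: if_splits)
 qed
 also have "\<dots> = (\<Sum>k | k < 2*n \<and> inr z (tt n (Suc k)). 2 * ?c)"
  by (subst sum.inter_filter[symmetric]) (auto simp: lessThan_def)
 also have "\<dots> = real (card {k. k < 2*n \<and> inr z (tt n (Suc k))}) * (2 * ?c)" by simp
 also have "\<dots> \<le> real (2 * qx) * (2 * ?c)" using card_inr[of "2*n" z n] c0 by (intro mult_right_mono) auto
 finally show ?thesis by simp
qed

text \<open>The scale factor, chosen so that the total error 4 * qx * XX * s (at most 2 * qx active
  scales, two directions) is at most half of the lower constant \<open>ZZ\<close>.\<close>

definition ss :: real where "ss = min 1 (ZZ / (8 * real qx * XX))"

lemma ss: "0 < ss" "ss \<le> 1" "4 * real qx * (XX * ss) \<le> ZZ / 2"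
proof -
 have q: "real qx > 0" by (simp add: qx_def)
 have p: "8 * real qx * XX > 0" using q consts_pos by simp
 show "0 < ss" "ss \<le> 1" unfolding ss_def using p consts_pos by auto
 have "ss \<le> ZZ / (8 * real qx * XX)" unfolding ss_def by simp
 then have "ss * (8 * real qx * XX) \<le> ZZ" using p by (simp add: pos_le_divide_eq)
 then show "4 * real qx * (XX * ss) \<le> ZZ / 2" by (simp add: mult_ac)
qed

lemma lap_bounds:
 assumes g: "good n z"
 shows "ZZ / 2 * WW ss z \<le> Psidd ss n 1 z + Psidd ss n \<i> z" "Psidd ss n 1 z + Psidd ss n \<i> z \<le> (UU + ZZ / 2) * WW ss z"
proof -
 have W: "WW ss z \<ge> 0" by (simp add: WW_def)
 have "4 * real qx * (XX * ss * WW ss z) \<le> ZZ / 2 * WW ss z" using mult_right_mono[OF ss(3) W] by (simp add: mult_ac)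
 then have "\<bar>\<Sum>k<2*n. RR ss n z 1 k + RR ss n z \<i> k\<bar> \<le> ZZ / 2 * WW ss z" using RR_sum[OF ss(1,2), of n z] by linarith
 then show "ZZ / 2 * WW ss z \<le> Psidd ss n 1 z + Psidd ss n \<i> z" "Psidd ss n 1 z + Psidd ss n \<i> z \<le> (UU + ZZ / 2) * WW ss z"
  unfolding lap_decomp[OF ss(1)] using main_bounds[OF ss(1) g] by (auto simp: distrib_right abs_le_iff)
qed

text \<open>From below, all cutoffs and increments are nonnegative. From above, two bounds run
  through one induction on partial sums: the telescoping bound by the average at the current scale,
  and the final bound. While the cutoff is active the mass is at most \<open>E\<close> and
  \<open>A_upper\<close> gives the latter; afterwards the terms are 0.\<close>

lemma Psi_bounds:
 assumes g: "good n z"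
 shows "\<phi> z \<le> Psi ss n z" "Psi ss n z \<le> \<phi> z + CA * E"
proof -
 have B0: "BB ss n i z \<ge> 0" for i
  using A_step(1)[of "ss * tt n i / 2" "ss * tt n i" z] ss(1) by (simp add: BB_def)
 have F0: "FF n i z \<ge> 0" "FF n i z \<le> 1" for i by (auto simp: FF_def cutF_range)
 have "\<phi> z \<le> A z (ss * tt n 0)" by (rule phi_le_A) (use ss in simp)
 also have "\<dots> \<le> Psi ss n z" unfolding Psi_def using B0 F0 by (simp add: sum_nonneg)
 finally show "\<phi> z \<le> Psi ss n z" .
 have h: "ss * tt n (Suc k) / 2 = ss * tt n k" for k by (simp add: tt_Suc)
 let ?S = "\<lambda>N. A z (ss * tt n 0) + (\<Sum>k<N. FF n (Suc k) z * BB ss n (Suc k) z)"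
 have up: "A z (ss * t) \<le> \<phi> z + CA * E" if t: "t > 0" "m z t \<le> E" for t
 proof -
  have "m z (ss * t) \<le> E" using m_mono_r[of "ss * t" t z] ss t by (simp add: mult_left_le_one_le)
  then have "CA * m z (ss * t) \<le> CA * E" using CA_pos by simp
  then show ?thesis using A_upper[of "ss * t" z] ss t by simp
 qed
 have "?S N \<le> A z (ss * tt n N) \<and> ?S N \<le> \<phi> z + CA * E" for N
 proof (induction N)
  case 0
  have "m z (tt n 0) \<le> E" using g E_ge by (simp add: good_def tt_def)
  from up[OF _ this] show ?case by simp
 next
  case (Suc N)
  have "FF n (Suc N) z * BB ss n (Suc N) z \<le> 1 * BB ss n (Suc N) z" using F0 B0 by (intro mult_right_mono) auto
  also have "\<dots> = A z (ss * tt n (Suc N)) - A z (ss * tt n N)" by (simp add: BB_def h)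
  finally have 1: "?S (Suc N) \<le> A z (ss * tt n (Suc N))" using Suc by simp
  show ?case
  proof (cases "M 4 z (tt n (Suc N)) < 1")
   case True
   have "m z (tt n (Suc N)) \<le> E * m z (\<rho> z / 2)"
    by (rule m_scaled_le[of _ qx]) (use range_upper[OF True tt_pos] rho_pos in \<open>auto\<close>)
   also have "\<dots> \<le> E * 1" using E_ge m_le_1[of "\<rho> z / 2" z] rho_pos[of z] by (intro mult_left_mono) auto
   finally have "A z (ss * tt n (Suc N)) \<le> \<phi> z + CA * E" by (intro up) auto
   then show ?thesis using 1 by linarith
  next
   case False
   then have "FF n (Suc N) z = 0" by (simp add: FF_def cutF_0)
   then show ?thesis using 1 Suc by simp
  qed
 qed
 from this[of "2 * n"] show "Psi ss n z \<le> \<phi> z + CA * E" by (simp add: Psi_def)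
qed

text \<open>The mass at radius ss * \<rho> z is comparable to 1: one doubling from \<rho> z / 2
  bounds it above, and a fixed number of doublings carries it past 2 * \<rho> z.\<close>

lemma WW_bounds: "\<exists>c>0. \<forall>z. c \<le> WW ss z * (\<rho> z)\<^sup>2 \<and> WW ss z * (\<rho> z)\<^sup>2 \<le> D / ss\<^sup>2"
proof -
 obtain p :: nat where p: "2 / ss < 2 ^ p" using real_arch_pow[of 2] by auto
 have p': "2 \<le> 2 ^ p * ss" using p ss(1) by (simp add: pos_divide_less_eq)
 have eq: "WW ss z * (\<rho> z)\<^sup>2 = m z (ss * \<rho> z) / ss\<^sup>2" for z
  using rho_pos[of z] by (simp add: WW_def power_mult_distrib)
 have "1 / D ^ p / ss\<^sup>2 \<le> WW ss z * (\<rho> z)\<^sup>2" for z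
 proof -
  have "1 \<le> m z (2 * \<rho> z)" using m_gt_1[of z "2 * \<rho> z"] rho_pos[of z] by simp
  also have "\<dots> \<le> m z (2 ^ p * (ss * \<rho> z))"
   using mult_right_mono[OF p', of "\<rho> z"] rho_pos[of z] by (intro m_mono_r) (simp add: mult.assoc)
  also have "\<dots> \<le> D ^ p * m z (ss * \<rho> z)" using ss(1) rho_pos[of z] by (intro m_double_pow) simp
  finally have "1 / D ^ p \<le> m z (ss * \<rho> z)" using D_ge1 by (simp add: pos_divide_le_eq mult.commute)
  then show ?thesis unfolding eq by (rule divide_right_mono) simp
 qed
 moreover have "WW ss z * (\<rho> z)\<^sup>2 \<le> D / ss\<^sup>2" for z
 proof -
  have "m z (ss * \<rho> z) \<le> m z (2 * (\<rho> z / 2))" using ss rho_pos[of z] by (intro m_mono_r) (simp add: mult_left_le_one_le)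
  also have "\<dots> \<le> D * m z (\<rho> z / 2)" using rho_pos[of z] by (intro m_double) simp
  also have "\<dots> \<le> D * 1" using D_ge1 m_le_1[of "\<rho> z / 2" z] rho_pos[of z] by (intro mult_left_mono) auto
  finally show ?thesis unfolding eq by (intro divide_right_mono) auto
 qed
 moreover have "1 / D ^ p / ss\<^sup>2 > 0" using D_ge1 ss(1) by simp
 ultimately show ?thesis by blast
qed

theorem regular_weight:
 "\<exists>\<psi> p q pp qq c C. weight \<psi> p q pp qq \<and> c > 0 \<and> (\<forall>z. \<phi> z \<le> \<psi> z \<and> \<psi> z \<le> \<phi> z + C) \<and>
   (\<forall>z. c \<le> (pp z + qq z) * (\<rho> z)\<^sup>2 \<and> (pp z + qq z) * (\<rho> z)\<^sup>2 \<le> C)"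
proof -
 define gn where "gn R = (SOME n. \<forall>z. cmod z \<le> R \<longrightarrow> good n z)" for R
 have gn: "good (gn R) z" if "cmod z \<le> R" for R z
  using someI_ex[OF good_uniform[of R]] that unfolding gn_def by blast
 define \<psi> where "\<psi> z = Psi ss (gn (cmod z)) z" for z
 \<comment> \<open>By \<open>Psi_stable\<close> the value is the same for every good window, so on a
   bounded disc \<psi> coincides with one \<open>Psi ss n\<close>.\<close>
 have psi: "\<psi> z = Psi ss n z" if "good n z" for n z
 proof -
  have "Psi ss (max n (gn (cmod z))) z = Psi ss n z" by (rule Psi_stable[OF that]) simp
  moreover have "Psi ss (max n (gn (cmod z))) z = Psi ss (gn (cmod z)) z" by (rule Psi_stable[OF gn]) auto
  ultimately show ?thesis unfolding \<psi>_def by simp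
 qed
 have "\<exists>p q pp qq. weight \<psi> p q pp qq \<and> (\<forall>z. ZZ / 2 * WW ss z \<le> pp z + qq z \<and> pp z + qq z \<le> (UU + ZZ / 2) * WW ss z)"
 proof (rule weight_glue[where Q="\<lambda>z d. ZZ / 2 * WW ss z \<le> d \<and> d \<le> (UU + ZZ / 2) * WW ss z"])
  fix R :: real
  have "weight (Psi ss (gn R)) (Psid ss (gn R) 1) (Psid ss (gn R) \<i>) (Psidd ss (gn R) 1) (Psidd ss (gn R) \<i>)"
   by (rule weight_Psi[OF ss(1)])
  moreover have "\<psi> z = Psi ss (gn R) z \<and> ZZ / 2 * WW ss z \<le> Psidd ss (gn R) 1 z + Psidd ss (gn R) \<i> z
    \<and> Psidd ss (gn R) 1 z + Psidd ss (gn R) \<i> z \<le> (UU + ZZ / 2) * WW ss z" if "cmod z < R" for z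
  proof -
   have g: "good (gn R) z" by (rule gn) (use that in simp)
   show ?thesis using psi[OF g] lap_bounds[OF g] by simp
  qed
  ultimately show "\<exists>f p q pp qq. weight f p q pp qq \<and> (\<forall>z. cmod z < R \<longrightarrow> \<psi> z = f z \<and> ZZ / 2 * WW ss z \<le> pp z + qq z \<and> pp z + qq z \<le> (UU + ZZ / 2) * WW ss z)"
   by blast
 qed
 then obtain p q pp qq where w: "weight \<psi> p q pp qq"
  and l: "\<And>z. ZZ / 2 * WW ss z \<le> pp z + qq z" "\<And>z. pp z + qq z \<le> (UU + ZZ / 2) * WW ss z" by blast
 obtain c where c: "c > 0" "\<And>z. c \<le> WW ss z * (\<rho> z)\<^sup>2" "\<And>z. WW ss z * (\<rho> z)\<^sup>2 \<le> D / ss\<^sup>2" using WW_bounds by blast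
 let ?C = "max (CA * E) ((UU + ZZ / 2) * (D / ss\<^sup>2))"
 have "ZZ / 2 * c \<le> (pp z + qq z) * (\<rho> z)\<^sup>2" for z
 proof -
  have "ZZ / 2 * c \<le> ZZ / 2 * (WW ss z * (\<rho> z)\<^sup>2)" using c(2) consts_pos by (intro mult_left_mono) auto
  also have "\<dots> = (ZZ / 2 * WW ss z) * (\<rho> z)\<^sup>2" by simp
  also have "\<dots> \<le> (pp z + qq z) * (\<rho> z)\<^sup>2" by (rule mult_right_mono[OF l(1)]) simp
  finally show ?thesis .
 qed
 moreover have "(pp z + qq z) * (\<rho> z)\<^sup>2 \<le> ?C" for z
 proof -
  have "(pp z + qq z) * (\<rho> z)\<^sup>2 \<le> ((UU + ZZ / 2) * WW ss z) * (\<rho> z)\<^sup>2" by (rule mult_right_mono[OF l(2)]) simp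
  also have "\<dots> = (UU + ZZ / 2) * (WW ss z * (\<rho> z)\<^sup>2)" by simp
  also have "\<dots> \<le> (UU + ZZ / 2) * (D / ss\<^sup>2)" using c(3) consts_pos by (intro mult_left_mono) auto
  finally show ?thesis by simp
 qed
 moreover have "\<phi> z \<le> \<psi> z \<and> \<psi> z \<le> \<phi> z + ?C" for z
 proof -
  have g: "good (gn (cmod z)) z" by (rule gn) simp
  show ?thesis using Psi_bounds[OF g] psi[OF g] by (simp add: max.coboundedI1 add_left_mono)
 qed
 moreover have "ZZ / 2 * c > 0" using consts_pos c by simp
 ultimately show ?thesis using w by blast
qed

end

section \<open>A smoothed Cauchy kernel and local holomorphic gauges for the weight\<close>

definition cker :: "real \<Rightarrow> complex \<Rightarrow> complex" where
 "cker d u = inverse u * of_real (1 - bp 4 d u)"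

definition ckerA :: "complex \<Rightarrow> real \<Rightarrow> complex \<Rightarrow> complex" where
 "ckerA e d u = inverse u * of_real (- dbp e 4 d u) + (- (e * (inverse u)\<^sup>2)) * of_real (1 - bp 4 d u)"

definition ckerB :: "complex \<Rightarrow> real \<Rightarrow> complex \<Rightarrow> complex" where
 "ckerB e d u = cnj u * of_real ((1 / d\<^sup>2) * ((- 6 + 8 * ((cmod u)\<^sup>2 / d\<^sup>2) - 3 * ((cmod u)\<^sup>2 / d\<^sup>2)\<^sup>2) * (2 * (u \<bullet> e) / d\<^sup>2)))
   + cnj e * of_real ((1 / d\<^sup>2) * (4 - 6 * ((cmod u)\<^sup>2 / d\<^sup>2) + 4 * ((cmod u)\<^sup>2 / d\<^sup>2)\<^sup>2 - ((cmod u)\<^sup>2 / d\<^sup>2)^3))"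

text \<open>Two formulas for one derivative: \<open>ckerB\<close> is polynomial and valid in the
  disc including 0, \<open>ckerA\<close> is the quotient rule and valid off 0. They agree on the
  overlap by uniqueness of derivatives, which gives continuity everywhere.\<close>

definition ckerd :: "complex \<Rightarrow> real \<Rightarrow> complex \<Rightarrow> complex" where
 "ckerd e d u = (if cmod u < d then ckerB e d u else ckerA e d u)"

text \<open>The factor 1 - \<open>bp 4 d u\<close> is divisible by |u|^2 inside the disc, so the
  pole of 1/u cancels and leaves \<open>cnj u\<close> times a polynomial in |u|^2.\<close>

lemma cker_poly:
 assumes "cmod u < d"
 shows "cker d u = cnj u * of_real ((1 / d\<^sup>2) * (4 - 6 * ((cmod u)\<^sup>2 / d\<^sup>2) + 4 * ((cmod u)\<^sup>2 / d\<^sup>2)\<^sup>2 - ((cmod u)\<^sup>2 / d\<^sup>2)^3))"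
proof (cases "u = 0")
 case False
 have d: "d > 0" using assms norm_ge_zero[of u] by linarith
 have "(cmod u)\<^sup>2 \<le> d\<^sup>2" using assms by (intro power_mono) auto
 then have x1: "(cmod u)\<^sup>2 / d\<^sup>2 \<le> 1" using d by simp
 define x where "x = (cmod u)\<^sup>2 / d\<^sup>2"
 have mx: "max 0 (1 - x) = 1 - x" using x1 by (simp add: x_def)
 have i: "inverse u = cnj u / of_real ((cmod u)\<^sup>2)"
  using False by (simp add: complex_norm_square[symmetric] divide_simps mult.commute del: of_real_power)
 have "1 - bp 4 d u = x * (4 - 6 * x + 4 * x\<^sup>2 - x^3)"
  unfolding bp_def x_def[symmetric] mx by (simp add: power2_eq_square power3_eq_cube power4_eq_xxxx algebra_simps)
 then have "(1 - bp 4 d u) / (cmod u)\<^sup>2 = (1 / d\<^sup>2) * (4 - 6 * x + 4 * x\<^sup>2 - x^3)"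
  using False d unfolding x_def by simp
 then have "of_real ((1 - bp 4 d u) / (cmod u)\<^sup>2) = complex_of_real ((1 / d\<^sup>2) * (4 - 6 * x + 4 * x\<^sup>2 - x^3))" by simp
 then have "cnj u * of_real ((1 - bp 4 d u) / (cmod u)\<^sup>2) = cnj u * complex_of_real ((1 / d\<^sup>2) * (4 - 6 * x + 4 * x\<^sup>2 - x^3))" by (rule arg_cong)
 moreover have "cker d u = cnj u * of_real ((1 - bp 4 d u) / (cmod u)\<^sup>2)" unfolding cker_def i by simp
 ultimately show ?thesis unfolding x_def by simp
qed (simp add: cker_def)

lemma cker_pdA: "u \<noteq> 0 ==> pd_at e (cker d) (ckerA e d u) u"
proof -
 assume u: "u \<noteq> 0"
 have "(inverse has_field_derivative - (inverse u)\<^sup>2) (at u)" using DERIV_inverse[OF u] by (simp add: power2_eq_square)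
 from pd_at_field[OF this] have "pd_at e inverse (- (e * (inverse u)\<^sup>2)) u" by simp
 moreover have "pd_at e (\<lambda>u. complex_of_real (1 - bp 4 d u)) (of_real (0 - dbp e 4 d u)) u"
  by (intro pd_at_of_real pd_at_diff pd_at_const bp_pd[unfolded has_pd_def, rule_format]) simp
 ultimately have "pd_at e (\<lambda>u. inverse u * of_real (1 - bp 4 d u)) (inverse u * of_real (0 - dbp e 4 d u) + (- (e * (inverse u)\<^sup>2)) * of_real (1 - bp 4 d u)) u"
  by (rule pd_at_mult)
 then show ?thesis unfolding cker_def[abs_def] ckerA_def by simp
qed

lemma cker_pdB:
 assumes "cmod u < d"
 shows "pd_at e (cker d) (ckerB e d u) u"
proof -
 have s: "pd_at e (\<lambda>u. (cmod u)\<^sup>2 / d\<^sup>2) (2 * (u \<bullet> e) / d\<^sup>2) u"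
  using pd_at_cmult[OF pd_at_norm2, of e "1 / d\<^sup>2" u] by simp
 have "((\<lambda>x::real. 4 - 6 * x + 4 * x\<^sup>2 - x^3) has_real_derivative (- 6 + 8 * x - 3 * x\<^sup>2)) (at x)" for x
  by (auto intro!: derivative_eq_intros)
 from pd_at_chain[OF s this]
 have "pd_at e (\<lambda>u. cnj u * of_real ((1 / d\<^sup>2) * (4 - 6 * ((cmod u)\<^sup>2 / d\<^sup>2) + 4 * ((cmod u)\<^sup>2 / d\<^sup>2)\<^sup>2 - ((cmod u)\<^sup>2 / d\<^sup>2)^3))) (ckerB e d u) u"
  unfolding ckerB_def by (intro pd_at_mult pd_at_of_real pd_at_cmult pd_at_cnj pd_at_id)
 then show ?thesis
 proof (rule pd_at_cong)
  have "\<forall>\<^sub>F v in nhds u. v \<in> ball 0 d" using assms by (intro eventually_nhds_in_open) auto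
  then show "\<forall>\<^sub>F v in nhds u. cnj v * of_real ((1 / d\<^sup>2) * (4 - 6 * ((cmod v)\<^sup>2 / d\<^sup>2) + 4 * ((cmod v)\<^sup>2 / d\<^sup>2)\<^sup>2 - ((cmod v)\<^sup>2 / d\<^sup>2)^3)) = cker d v"
   by eventually_elim (simp add: cker_poly)
 qed
qed

lemma cker_AB: "u \<noteq> 0 ==> ckerd e d u = ckerA e d u"
 using has_pd_unique[OF cker_pdA[of u e d] cker_pdB[of u d e]] by (auto simp: ckerd_def)

lemma cker_C1:
 assumes d: "d > 0"
 shows "C1c (cker d) (ckerd 1 d) (ckerd \<i> d)"
proof -
 have ne: "\<forall>\<^sub>F v in nhds u. v \<noteq> 0" if "u \<noteq> 0" for u :: complex
  using eventually_nhds_in_open[OF open_Compl[OF closed_singleton[of "0::complex"]], of u] that by simp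
 have nb: "\<forall>\<^sub>F v in nhds u. cmod v < d" if "cmod u < d" for u :: complex
  using eventually_nhds_in_open[of "ball 0 d" u] that by simp
 have cb: "isCont (\<lambda>u. bp 4 d u) u" "isCont (\<lambda>u. dbp e 4 d u) u" for e u
  using d bp_cont_eta[of d UNIV] by (auto simp: continuous_on_eq_continuous_at)
 have p: "has_pd e (cker d) (ckerd e d)" for e
  unfolding has_pd_def
 proof
  fix u
  show "pd_at e (cker d) (ckerd e d u) u"
  proof (cases "cmod u < d")
   case True
   then show ?thesis using cker_pdB[OF True] by (simp add: ckerd_def)
  next
   case False
   then have "u \<noteq> 0" using d by auto
   then show ?thesis using cker_pdA[of u e d] False by (simp add: ckerd_def)
  qed
 qed
 have c: "continuous_on UNIV (ckerd e d)" for e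
  unfolding continuous_on_eq_continuous_at[OF open_UNIV]
 proof
  fix u
  show "isCont (ckerd e d) u"
  proof (cases "cmod u < d")
   case True
   have "isCont (ckerB e d) u" unfolding ckerB_def[abs_def] using d by (intro continuous_intros) auto
   moreover have "\<forall>\<^sub>F v in nhds u. ckerB e d v = ckerd e d v" using nb[OF True] by eventually_elim (simp add: ckerd_def)
   ultimately show ?thesis using isCont_cong by blast
  next
   case False
   then have u: "u \<noteq> 0" using d by auto
   have "isCont (ckerA e d) u" unfolding ckerA_def[abs_def] using u cb by (intro continuous_intros) auto
   moreover have "\<forall>\<^sub>F v in nhds u. ckerA e d v = ckerd e d v" using ne[OF u] by eventually_elim (simp add: cker_AB)
   ultimately show ?thesis using isCont_cong by blast
  qed
 qed
 have "continuous_on UNIV (cker d)"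
  unfolding continuous_on_eq_continuous_at[OF open_UNIV]
 proof
  fix u
  show "isCont (cker d) u"
  proof (cases "u = 0")
   case True
   let ?f = "\<lambda>u. cnj u * complex_of_real ((1 / d\<^sup>2) * (4 - 6 * ((cmod u)\<^sup>2 / d\<^sup>2) + 4 * ((cmod u)\<^sup>2 / d\<^sup>2)\<^sup>2 - ((cmod u)\<^sup>2 / d\<^sup>2)^3))"
   have "isCont ?f u" using d by (intro continuous_intros) auto
   moreover have "\<forall>\<^sub>F v in nhds u. ?f v = cker d v" using nb[of u] True d by (auto elim!: eventually_mono simp: cker_poly)
   ultimately show ?thesis using isCont_cong[of ?f "cker d" u] by simp
  next
   case False
   then show ?thesis unfolding cker_def[abs_def] using cb by (intro continuous_intros) auto
  qed
 qed
 then show ?thesis using p c by (simp add: C1c_def)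
qed

text \<open>A smoothed form of the fact that d/dx + \<i> d/dy of 1/u is 2 * pi times a point mass at
  0; \<open>8 * J3\<close> stands for 2 * pi.\<close>

lemma cker_dbar:
 assumes d: "d > 0"
 shows "ckerd 1 d u + \<i> * ckerd \<i> d u = of_real (8 * J3 * kap d u)"
proof (cases "u = 0")
 case True
 show ?thesis unfolding True using d J3_pos by (simp add: ckerd_def ckerB_def kap_def bp_def complex_eq_iff)
next
 case False
 have "ckerd 1 d u + \<i> * ckerd \<i> d u = - inverse u * (of_real (dbp 1 4 d u) + \<i> * of_real (dbp \<i> 4 d u))"
  unfolding cker_AB[OF False] ckerA_def by (simp add: algebra_simps)
 also have "of_real (dbp 1 4 d u) + \<i> * of_real (dbp \<i> 4 d u) = - (u * of_real ((8 / d\<^sup>2) * bp 3 d u))"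
  by (simp add: dbp_def complex_eq_iff inner_complex_def)
 also have "- inverse u * - (u * of_real ((8 / d\<^sup>2) * bp 3 d u)) = of_real ((8 / d\<^sup>2) * bp 3 d u)"
  using False by simp
 also have "(8 / d\<^sup>2) * bp 3 d u = 8 * J3 * kap d u" using J3_pos by (simp add: kap_def)
 finally show ?thesis .
qed

lemma cker_bound: "cmod (cker d u) \<le> 1 / cmod u"
proof -
 have "cmod (cker d u) = (1 / cmod u) * (1 - bp 4 d u)"
  unfolding cker_def norm_mult norm_inverse norm_of_real by (simp add: divide_inverse)
 also have "\<dots> \<le> (1 / cmod u) * 1" by (intro mult_left_mono) auto
 finally show ?thesis by simp
qed

lemma cker_far: "d > 0 ==> cmod u \<ge> d ==> cker d u = inverse u"
 by (simp add: cker_def bp_eq_0)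

text \<open>Each nonzero point lies in a dyadic layer, on which 1/|u| is at most 2^(n+1)/R; summing
  these constants times the areas of the discs of radius R/2^n is a geometric series.\<close>

lemma nn_integral_inverse_norm:
 assumes R: "R > 0"
 shows "(\<integral>\<^sup>+u. indicator (ball 0 R) u * ennreal (1 / cmod u) \<partial>lborel) \<le> ennreal (4 * unit_ball_vol 2 * R)"
proof -
 have b: "emeasure lborel (ball (0::complex) r) = ennreal (unit_ball_vol 2 * r\<^sup>2)" if "r \<ge> 0" for r
  using emeasure_ball[OF that, of "0::complex"] by simp
 have pt: "indicator (ball 0 R) u * ennreal (1 / cmod u) \<le> (\<Sum>n. ennreal (2 ^ Suc n / R) * indicator (ball 0 (R / 2 ^ n)) u)" for u :: complex
 proof (cases "u \<in> ball 0 R \<and> u \<noteq> 0")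
  case True
  then have u: "cmod u > 0" "cmod u < R" by auto
  obtain N :: nat where "R / cmod u < 2 ^ N" using real_arch_pow[of 2] by auto
  then have N: "R / 2 ^ N \<le> cmod u" using u by (simp add: field_simps)
  define n where "n = (LEAST n. R / 2 ^ n \<le> cmod u)"
  have n: "R / 2 ^ n \<le> cmod u" unfolding n_def by (rule LeastI[of "\<lambda>n. R / 2 ^ n \<le> cmod u", OF N])
  have "n \<noteq> 0" using n u by (cases n) auto
  then obtain k where k: "n = Suc k" by (cases n) auto
  have "\<not> R / 2 ^ k \<le> cmod u" using not_less_Least[of k "\<lambda>n. R / 2 ^ n \<le> cmod u"] k unfolding n_def by simp
  then have in_k: "u \<in> ball 0 (R / 2 ^ k)" by simp
  have "1 / cmod u \<le> 1 / (R / 2 ^ Suc k)" using n u R unfolding k by (intro divide_left_mono) auto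
  then have "ennreal (1 / cmod u) \<le> ennreal (2 ^ Suc k / R)" by (intro ennreal_leI) simp
  then have "indicator (ball 0 R) u * ennreal (1 / cmod u) \<le> ennreal (2 ^ Suc k / R) * indicator (ball 0 (R / 2 ^ k)) u"
   using True in_k by simp
  also have "\<dots> \<le> (\<Sum>n. ennreal (2 ^ Suc n / R) * indicator (ball 0 (R / 2 ^ n)) u)"
  proof -
   have "g k \<le> (\<Sum>n. g n)" for g :: "nat \<Rightarrow> ennreal" using sum_le_suminf[of g "{k}"] by simp
   then show ?thesis .
  qed
  finally show ?thesis .
 qed auto
 have "(\<integral>\<^sup>+u. indicator (ball 0 R) u * ennreal (1 / cmod u) \<partial>lborel) \<le> (\<integral>\<^sup>+u. (\<Sum>n. ennreal (2 ^ Suc n / R) * indicator (ball 0 (R / 2 ^ n)) u) \<partial>(lborel :: complex measure))"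
  by (rule nn_integral_mono) (rule pt)
 also have "\<dots> = (\<Sum>n. (\<integral>\<^sup>+u. ennreal (2 ^ Suc n / R) * indicator (ball 0 (R / 2 ^ n)) u \<partial>(lborel :: complex measure)))"
  by (rule nn_integral_suminf) (intro borel_measurable_times_ennreal borel_measurable_indicator borel_measurable_const; simp)
 also have "\<dots> = (\<Sum>n. ennreal ((2 * unit_ball_vol 2 * R) * (1/2) ^ n))"
 proof (rule suminf_cong)
  fix n
  have "(\<integral>\<^sup>+u. ennreal (2 ^ Suc n / R) * indicator (ball 0 (R / 2 ^ n)) u \<partial>(lborel :: complex measure)) = ennreal (2 ^ Suc n / R) * ennreal (unit_ball_vol 2 * (R / 2 ^ n)\<^sup>2)"
   using R by (subst nn_integral_cmult_indicator) (auto simp: b)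
  also have "\<dots> = ennreal ((2 ^ Suc n / R) * (unit_ball_vol 2 * (R / 2 ^ n)\<^sup>2))"
   using R by (subst ennreal_mult[symmetric]) auto
  also have "(2 ^ Suc n / R) * (unit_ball_vol 2 * (R / 2 ^ n)\<^sup>2) = (2 * unit_ball_vol 2 * R) * (1/2) ^ n"
   using R by (simp add: power_divide power2_eq_square)
  finally show "(\<integral>\<^sup>+u. ennreal (2 ^ Suc n / R) * indicator (ball 0 (R / 2 ^ n)) u \<partial>(lborel :: complex measure)) = ennreal ((2 * unit_ball_vol 2 * R) * (1/2) ^ n)" .
 qed
 also have "\<dots> = ennreal (4 * unit_ball_vol 2 * R)"
 proof (rule suminf_ennreal_eq)
  show "0 \<le> 2 * unit_ball_vol 2 * R * (1 / 2) ^ n" for n using R by simp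
  have "(\<lambda>n. (2 * unit_ball_vol 2 * R) * (1/2::real) ^ n) sums ((2 * unit_ball_vol 2 * R) * (1 / (1 - 1/2)))"
   by (intro sums_mult geometric_sums) simp
  moreover have "(2 * unit_ball_vol 2 * R) * (1 / (1 - 1/2)) = 4 * unit_ball_vol 2 * R" by simp
  ultimately show "(\<lambda>n. 2 * unit_ball_vol 2 * R * (1 / 2) ^ n) sums (4 * unit_ball_vol 2 * R)" by (simp only:)
 qed
 finally show ?thesis .
qed

text \<open>The disc around \<open>l\<close> is contained in the disc of radius 2r around the pole
  \<open>z\<close>, whence the 8 = 4 * 2.\<close>

lemma inv_norm_bound:
 fixes f :: "complex \<Rightarrow> complex"
 assumes f: "integrable lborel f" and r: "r > 0" and z: "cmod (z - l) < r"
  and b: "\<And>w. cmod (w - l) < r ==> cmod (f w) \<le> B / cmod (w - z)" "\<And>w. cmod (w - l) \<ge> r ==> f w = 0" and B: "B \<ge> 0"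
 shows "cmod (\<integral>w. f w \<partial>lborel) \<le> B * (8 * unit_ball_vol 2 * r)"
proof -
 have n1: "(\<lambda>u::complex. ennreal (1 / cmod u)) \<in> borel_measurable borel" by measurable
 have mm: "(\<lambda>u::complex. indicator (ball 0 (2 * r)) u * ennreal (1 / cmod u)) \<in> borel_measurable borel"
  by (rule borel_measurable_times_ennreal[OF borel_measurable_indicator n1]) simp
 have "(\<lambda>w. -z + w) \<in> borel_measurable borel" by measurable
 from measurable_compose[OF this mm]
 have mz: "(\<lambda>w. indicator (ball 0 (2 * r)) (-z + w) * ennreal (1 / cmod (-z + w))) \<in> borel_measurable lborel" by simp
 have "ennreal (cmod (\<integral>w. f w \<partial>lborel)) \<le> (\<integral>\<^sup>+w. ennreal (norm (f w)) \<partial>lborel)"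
  by (rule integral_norm_bound_ennreal[OF f])
 also have "\<dots> \<le> (\<integral>\<^sup>+w. ennreal B * (indicator (ball 0 (2 * r)) (-z + w) * ennreal (1 / cmod (-z + w))) \<partial>lborel)"
 proof (rule nn_integral_mono)
  fix w
  show "ennreal (norm (f w)) \<le> ennreal B * (indicator (ball 0 (2 * r)) (-z + w) * ennreal (1 / cmod (-z + w)))"
  proof (cases "cmod (w - l) < r")
   case True
   have "cmod (w - z) < 2 * r" using norm_triangle_ineq4[of "w - l" "z - l"] True z by simp
   moreover have "ennreal (norm (f w)) \<le> ennreal (B * (1 / cmod (w - z)))" using b(1)[OF True] by (intro ennreal_leI) simp
   moreover have "ennreal (B * (1 / cmod (w - z))) = ennreal B * ennreal (1 / cmod (w - z))" using B by (intro ennreal_mult) auto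
   ultimately show ?thesis by simp
  next
   case False
   then show ?thesis using b(2)[of w] by simp
  qed
 qed
 also have "\<dots> = ennreal B * (\<integral>\<^sup>+w. indicator (ball 0 (2 * r)) (-z + w) * ennreal (1 / cmod (-z + w)) \<partial>lborel)"
  by (rule nn_integral_cmult[OF mz])
 also have "(\<integral>\<^sup>+w. indicator (ball 0 (2 * r)) (-z + w) * ennreal (1 / cmod (-z + w)) \<partial>lborel) = (\<integral>\<^sup>+u. indicator (ball 0 (2 * r)) u * ennreal (1 / cmod u) \<partial>lborel)"
  by (rule nn_integral_translate[OF mm])
 also have "\<dots> \<le> ennreal (4 * unit_ball_vol 2 * (2 * r))" by (rule nn_integral_inverse_norm) (use r in simp)
 finally have "ennreal (cmod (\<integral>w. f w \<partial>lborel)) \<le> ennreal B * ennreal (4 * unit_ball_vol 2 * (2 * r))"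
  by (simp add: mult_left_mono)
 then have "ennreal (cmod (\<integral>w. f w \<partial>lborel)) \<le> ennreal (B * (8 * unit_ball_vol 2 * r))"
  using B r by (simp add: ennreal_mult[symmetric] mult_ac)
 then show ?thesis using B r by (subst (asm) ennreal_le_iff) auto
qed

text \<open>The 8 of \<open>inv_norm_bound\<close> cancels against that of \<open>8 * J3\<close> in
  \<open>cker_dbar\<close>.\<close>

definition C3 :: real where "C3 = unit_ball_vol 2 / J3"

lemma C1c_translate: "C1c f fx fy ==> C1c (\<lambda>w. f (w - c)) (\<lambda>w. fx (w - c)) (\<lambda>w. fy (w - c))"
proof -
 assume f: "C1c f fx fy"
 have c: "continuous_on UNIV (\<lambda>w. h (w - c))" if "continuous_on UNIV h" for h :: "complex \<Rightarrow> 'a"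
  by (rule continuous_on_compose2[OF that]) (auto intro!: continuous_intros)
 show ?thesis using f c has_pd_translate[of 1 f fx "-c"] has_pd_translate[of \<i> f fy "-c"] unfolding C1c_def by simp
qed

lemma integral_add_i_diff:
 fixes a b c d :: "'a \<Rightarrow> complex"
 assumes "integrable M a" "integrable M b" "integrable M c" "integrable M d"
 shows "(\<integral>v. (a v + b v) + \<i> * (c v - d v) \<partial>M) = ((\<integral>v. a v \<partial>M) + (\<integral>v. b v \<partial>M)) + \<i> * ((\<integral>v. c v \<partial>M) - (\<integral>v. d v \<partial>M))"
 using assms by simp

text \<open>The holomorphic function \<open>2 \<partial>\<psi>\<close> would be if \<open>\<psi>\<close> were harmonic, up to an error controlled by the Laplacian:
 cut off, and keep from the Cauchy--Pompeiu formula only the part generated by the cutoff.\<close>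

lemma holomorphic_gradient:
 assumes w: "weight \<psi> p q pp qq" and r: "r > 0" and B: "\<And>v. cmod (v - l) < r ==> \<bar>pp v + qq v\<bar> \<le> B"
 shows "\<exists>g. g holomorphic_on ball l (r/4) \<and> (\<forall>z\<in>ball l (r/4). cmod (g z - (of_real (p z) - \<i> * of_real (q z))) \<le> C3 * B * r)"
proof -
 note W = w[unfolded weight_def C1c_def]
 have cont: "continuous_on UNIV \<psi>" "continuous_on UNIV p" "continuous_on UNIV q" "continuous_on UNIV pp" "continuous_on UNIV qq" using W by auto
 have B0: "B \<ge> 0" using B[of l] r by simp
 define \<omega> where "\<omega> z = complex_of_real (p z) - \<i> * of_real (q z)" for z
 have oc: "continuous_on UNIV \<omega>" unfolding \<omega>_def using cont by (intro continuous_intros)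
 let ?x = "\<lambda>v. complex_of_real (cutoff r (v - l))"
 let ?xx = "\<lambda>e v. complex_of_real (dcutoff e r (v - l))"
 have X: "C1c ?x (?xx 1) (?xx \<i>)"
  by (rule C1c_translate[OF C1c_of_real[OF cutoff_C1c[OF r]]])
 have Xs: "csupp ?x"
  unfolding csupp_def
 proof (intro exI[of _ "r + cmod l"] allI impI)
  fix v assume "?x v \<noteq> 0"
  then have "cmod (v - l) < r" using cutoff_0(1)[OF r, of "v - l"] by (cases "cmod (v - l) < r") auto
  then show "cmod v \<le> r + cmod l" using norm_triangle_sub[of v l] by simp
 qed
 \<comment> \<open>Supported in the annulus between r/2 and r, away from the points \<open>z\<close>
   with |z - l| < r/4 at which the holomorphic part is evaluated.\<close>
 define \<Phi> where "\<Phi> v = \<omega> v * (?xx 1 v + \<i> * ?xx \<i> v)" for v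
 have Xc: "continuous_on UNIV ?x" "continuous_on UNIV (?xx 1)" "continuous_on UNIV (?xx \<i>)" using X by (auto simp: C1c_def)
 have Pc: "continuous_on UNIV \<Phi>" unfolding \<Phi>_def
  by (rule continuous_on_mult[OF oc continuous_on_add[OF Xc(2) continuous_on_mult[OF continuous_on_const Xc(3)]]])
 have P0: "\<Phi> v = 0" if "cmod (v - l) \<le> r/2 \<or> cmod (v - l) \<ge> r" for v
  using that cutoff_0(2)[OF r] cutoff_1(2)[OF r] unfolding \<Phi>_def by auto
 \<comment> \<open>On that annulus |v - z| lies between r/4 and 4r, so smoothing below r/8 and
   cutting off at 8r leave the Cauchy kernel untouched where it is used, while making it C^1 with
   compact support as \<open>pd_conv\<close> requires.\<close>
 let ?d = "r / 8" and ?R = "8 * r"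
 define N where "N u = cker ?d u * of_real (cutoff ?R u)" for u
 have d0: "?d > 0" and R0: "?R > 0" using r by auto
 have NC: "C1c N (\<lambda>u. cker ?d u * of_real (dcutoff 1 ?R u) + ckerd 1 ?d u * of_real (cutoff ?R u))
   (\<lambda>u. cker ?d u * of_real (dcutoff \<i> ?R u) + ckerd \<i> ?d u * of_real (cutoff ?R u))" (is "C1c N ?Nx ?Ny")
  unfolding N_def[abs_def] by (rule C1c_mult[OF cker_C1[OF d0] C1c_of_real[OF cutoff_C1c[OF R0]]])
 have Ns: "csupp N" using cutoff_csupp[OF R0] unfolding N_def[abs_def] csupp_def by auto
 define f where "f z = (\<integral>v. N (v - z) * \<Phi> v \<partial>lborel)" for z
 define fx fy where "fx z = - (\<integral>v. ?Nx (v - z) * \<Phi> v \<partial>lborel)" and "fy z = - (\<integral>v. ?Ny (v - z) * \<Phi> v \<partial>lborel)" for z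
 have Pl: "loc_int lborel \<Phi>" by (rule loc_int_continuous[OF Pc])
 note N' = NC[unfolded C1c_def]
 have nxy: "has_pd 1 N ?Nx" "has_pd \<i> N ?Ny" "continuous_on UNIV N" "continuous_on UNIV ?Nx" "continuous_on UNIV ?Ny" using N' by blast+
 have cs2: "csupp ?Nx" "csupp ?Ny" using csupp_pd nxy Ns by blast+
 have fC: "C1c f fx fy"
  unfolding C1c_def
 proof (intro conjI)
  show "has_pd 1 f fx" unfolding f_def[abs_def] fx_def[abs_def] by (rule pd_conv[OF nxy(1,3,4) Ns _ Pl]) simp
  show "has_pd \<i> f fy" unfolding f_def[abs_def] fy_def[abs_def] by (rule pd_conv[OF nxy(2,3,5) Ns _ Pl]) simp
  show "continuous_on UNIV f" unfolding f_def[abs_def] by (rule cont_conv[OF nxy(3) Ns _ Pl]) simp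
  show "continuous_on UNIV fx" unfolding fx_def[abs_def] by (intro continuous_on_minus cont_conv[OF nxy(4) cs2(1) _ Pl]) simp
  show "continuous_on UNIV fy" unfolding fy_def[abs_def] by (intro continuous_on_minus cont_conv[OF nxy(5) cs2(2) _ Pl]) simp
 qed
 have far: "r/4 \<le> cmod (v - z)" "cmod (v - z) \<le> ?R / 2" if "\<Phi> v \<noteq> 0" "cmod (z - l) < r/4" for v z
 proof -
  have v: "r/2 < cmod (v - l)" "cmod (v - l) < r" using P0[of v] that(1) by (meson not_le)+
  show "r/4 \<le> cmod (v - z)" using norm_triangle_ineq2[of "v - l" "z - l"] v that(2) by simp
  show "cmod (v - z) \<le> ?R / 2" using norm_triangle_ineq4[of "v - l" "z - l"] v that(2) by simp
 qed
 have cr: "fx z + \<i> * fy z = 0" if z: "cmod (z - l) < r/4" for z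
 proof -
  have i: "integrable lborel (\<lambda>v. ?Nx (v - z) * \<Phi> v)" "integrable lborel (\<lambda>v. ?Ny (v - z) * \<Phi> v)"
   by (rule integrable_csupp_mult[OF Pl _ nxy(4) cs2(1)] integrable_csupp_mult[OF Pl _ nxy(5) cs2(2)]; simp)+
  have pt: "?Nx (v - z) * \<Phi> v + \<i> * (?Ny (v - z) * \<Phi> v) = 0" for v
  proof (cases "\<Phi> v = 0")
   case False
   note fr = far[OF False z]
   have "dcutoff e ?R (v - z) = 0" "cutoff ?R (v - z) = 1" for e using cutoff_1[OF R0] fr(2) by auto
   then have "?Nx (v - z) * \<Phi> v + \<i> * (?Ny (v - z) * \<Phi> v) = (ckerd 1 ?d (v - z) + \<i> * ckerd \<i> ?d (v - z)) * \<Phi> v"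
    by (simp add: algebra_simps)
   also have "\<dots> = 0" unfolding cker_dbar[OF d0] using kap_eq_0[OF d0, of "v - z"] fr(1) r by simp
   finally show ?thesis .
  qed simp
  have "(\<integral>v. ?Nx (v - z) * \<Phi> v \<partial>lborel) + \<i> * (\<integral>v. ?Ny (v - z) * \<Phi> v \<partial>lborel) = (\<integral>v. ?Nx (v - z) * \<Phi> v + \<i> * (?Ny (v - z) * \<Phi> v) \<partial>lborel)"
   by (subst Bochner_Integration.integral_add[OF i(1) integrable_mult_right[OF i(2)]]) (simp only: integral_mult_right_zero)
  also have "\<dots> = 0" unfolding pt by simp
  finally have s: "(\<integral>v. ?Nx (v - z) * \<Phi> v \<partial>lborel) + \<i> * (\<integral>v. ?Ny (v - z) * \<Phi> v \<partial>lborel) = 0" .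
  have neg: "- a + \<i> * - b = - (a + \<i> * b)" for a b by simp
  show ?thesis unfolding fx_def fy_def neg s by simp
 qed
 have fhol: "f holomorphic_on ball l (r/4)"
  unfolding holomorphic_on_def
 proof
  fix z assume "z \<in> ball l (r/4)"
  then have "cmod (z - l) < r/4" by (simp add: dist_norm norm_minus_commute)
  from cauchy_riemann_has_field_derivative[OF fC cr[OF this]] show "f field_differentiable at z within ball l (r/4)"
   using field_differentiable_at_within field_differentiable_def by blast
 qed
 have key: "cmod (f z + of_real (8 * J3) * \<omega> z) \<le> B * (8 * unit_ball_vol 2 * r)" if z: "cmod (z - l) < r/4" for z
 proof -
  define t where "t n = ?d / real (Suc n)" for n
  have t: "t n > 0" "t n \<le> ?d" for n using r by (auto simp: t_def field_simps)
  have t0: "t \<longlonglongrightarrow> 0" unfolding t_def unfolding divide_inverse by (rule tendsto_mult_right_zero[OF LIMSEQ_inverse_real_of_nat])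
  \<comment> \<open>The Cauchy-Pompeiu formula at smoothing radius \<open>t n\<close>: the average
    of the gradient plus the part generated by the cutoff equals an integral of the Laplacian
    against the kernel, which \<open>bd\<close> controls uniformly in \<open>n\<close>.\<close>
  have eq: "(\<integral>v. of_real (8 * J3) * (of_real (kap (t n) (v - z)) * \<omega> v) \<partial>lborel) + f z = - (\<integral>v. of_real (pp v + qq v) * (?x v * cker (t n) (v - z)) \<partial>lborel)" for n
  proof -
   let ?k = "\<lambda>v. cker (t n) (v - z)" and ?ke = "\<lambda>e v. ckerd e (t n) (v - z)"
   have K: "C1c ?k (?ke 1) (?ke \<i>)" by (rule C1c_translate[OF cker_C1[OF t(1)]])
   let ?G = "\<lambda>v. ?x v * ?k v"
   let ?Gx = "\<lambda>v. ?x v * ?ke 1 v + ?xx 1 v * ?k v" and ?Gy = "\<lambda>v. ?x v * ?ke \<i> v + ?xx \<i> v * ?k v"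
   have G: "C1c ?G ?Gx ?Gy" by (rule C1c_mult[OF X K])
   have Gs: "csupp ?G" using Xs by (auto simp: csupp_def)
   note G' = G[unfolded C1c_def]
   have gg: "has_pd 1 ?G ?Gx" "has_pd \<i> ?G ?Gy" "continuous_on UNIV ?G" "continuous_on UNIV ?Gx" "continuous_on UNIV ?Gy" using G' by blast+
   have Gs2: "csupp ?Gx" "csupp ?Gy" using csupp_pd gg Gs by blast+
   have ibp: "(\<integral>v. of_real (s v) * g' v \<partial>lborel) = - (\<integral>v. of_real (s' v) * ?G v \<partial>lborel)"
    if s: "has_pd e s s'" "continuous_on UNIV s" "continuous_on UNIV s'" and g: "has_pd e ?G g'" "continuous_on UNIV g'" for e s s' g'
   proof -
    have gs: "csupp g'" by (rule csupp_pd[OF g(1) Gs])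
    have sc: "continuous_on UNIV (\<lambda>v. complex_of_real (s v))" "continuous_on UNIV (\<lambda>v. complex_of_real (s' v))"
     using s by (auto intro: continuous_on_of_real)
    have "(\<integral>v. of_real (s v) * g' v + of_real (s' v) * ?G v \<partial>lborel) = 0"
    proof (rule integral_pd_0[where p="\<lambda>v. of_real (s v) * ?G v"])
     show "has_pd e (\<lambda>v. of_real (s v) * ?G v) (\<lambda>v. of_real (s v) * g' v + of_real (s' v) * ?G v)"
      unfolding has_pd_def
     proof
      fix v
      have "pd_at e s (s' v) v" "pd_at e ?G (g' v) v" using s g unfolding has_pd_def by blast+
      then show "pd_at e (\<lambda>v. of_real (s v) * ?G v) (of_real (s v) * g' v + of_real (s' v) * ?G v) v"
       by (intro pd_at_mult pd_at_of_real)
     qed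
     obtain R where "\<forall>z. ?G z \<noteq> 0 \<longrightarrow> cmod z \<le> R" using Gs unfolding csupp_def by blast
     then show "csupp (\<lambda>v. of_real (s v) * ?G v)" unfolding csupp_def by (intro exI[of _ R]) simp
    qed (rule continuous_on_mult[OF sc(1) gg(3)] continuous_on_add[OF continuous_on_mult[OF sc(1) g(2)] continuous_on_mult[OF sc(2) gg(3)]])+
    moreover have "integrable lborel (\<lambda>v. of_real (s v) * g' v)" "integrable lborel (\<lambda>v. of_real (s' v) * ?G v)"
         proof -
     obtain R where "\<forall>z. g' z \<noteq> 0 \<longrightarrow> cmod z \<le> R" using gs unfolding csupp_def by blast
     then have "csupp (\<lambda>v. of_real (s v) * g' v)" unfolding csupp_def by (intro exI[of _ R]) simp
     then show "integrable lborel (\<lambda>v. of_real (s v) * g' v)" by (rule integrable_cc[OF continuous_on_mult[OF sc(1) g(2)]])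
     obtain R where "\<forall>z. ?G z \<noteq> 0 \<longrightarrow> cmod z \<le> R" using Gs unfolding csupp_def by blast
     then have "csupp (\<lambda>v. of_real (s' v) * ?G v)" unfolding csupp_def by (intro exI[of _ R]) simp
     then show "integrable lborel (\<lambda>v. of_real (s' v) * ?G v)" by (rule integrable_cc[OF continuous_on_mult[OF sc(2) gg(3)]])
    qed
    ultimately show ?thesis by (simp add: eq_neg_iff_add_eq_0)
   qed
   have c1: "C1c (\<lambda>v. complex_of_real (\<psi> v)) (\<lambda>v. of_real (p v)) (\<lambda>v. of_real (q v))"
    by (rule C1c_of_real) (use w in \<open>simp add: weight_def\<close>)
   \<comment> \<open>The gradient of \<psi> is curl free; stated as a Jacobian identity this
     involves no mixed second derivative.\<close>
   have jac: "(\<integral>v. of_real (p v) * ?Gy v \<partial>lborel) = (\<integral>v. of_real (q v) * ?Gx v \<partial>lborel)"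
    by (rule integral_jacobian[OF c1 G Gs])
   have b1: "(\<integral>v. of_real (p v) * ?Gx v \<partial>lborel) = - (\<integral>v. of_real (pp v) * ?G v \<partial>lborel)"
    by (rule ibp[OF _ _ _ gg(1,4)]) (use W in auto)
   have b2: "(\<integral>v. of_real (q v) * ?Gy v \<partial>lborel) = - (\<integral>v. of_real (qq v) * ?G v \<partial>lborel)"
    by (rule ibp[OF _ _ _ gg(2,5)]) (use W in auto)
   have ii: "integrable lborel (\<lambda>v. of_real (p v) * ?Gx v)" "integrable lborel (\<lambda>v. of_real (q v) * ?Gy v)"
     "integrable lborel (\<lambda>v. of_real (p v) * ?Gy v)" "integrable lborel (\<lambda>v. of_real (q v) * ?Gx v)"
     "integrable lborel (\<lambda>v. of_real (pp v) * ?G v)" "integrable lborel (\<lambda>v. of_real (qq v) * ?G v)"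
    using integrable_csupp_mult[where c=0, OF loc_int_continuous[OF continuous_on_of_real[OF cont(2)]] _ gg(4) Gs2(1)]
     integrable_csupp_mult[where c=0, OF loc_int_continuous[OF continuous_on_of_real[OF cont(3)]] _ gg(5) Gs2(2)]
     integrable_csupp_mult[where c=0, OF loc_int_continuous[OF continuous_on_of_real[OF cont(2)]] _ gg(5) Gs2(2)]
     integrable_csupp_mult[where c=0, OF loc_int_continuous[OF continuous_on_of_real[OF cont(3)]] _ gg(4) Gs2(1)]
     integrable_csupp_mult[where c=0, OF loc_int_continuous[OF continuous_on_of_real[OF cont(4)]] _ gg(3) Gs]
     integrable_csupp_mult[where c=0, OF loc_int_continuous[OF continuous_on_of_real[OF cont(5)]] _ gg(3) Gs]
    by (simp_all add: mult.commute)
   have "(\<integral>v. (of_real (p v) * ?Gx v + of_real (q v) * ?Gy v) + \<i> * (of_real (p v) * ?Gy v - of_real (q v) * ?Gx v) \<partial>lborel)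
     = - (\<integral>v. of_real (pp v) * ?G v \<partial>lborel) - (\<integral>v. of_real (qq v) * ?G v \<partial>lborel)"
    unfolding integral_add_i_diff[OF ii(1,2,3,4)] jac b1 b2 by simp
   also have "\<dots> = - (\<integral>v. of_real (pp v + qq v) * ?G v \<partial>lborel)"
    unfolding of_real_add distrib_right Bochner_Integration.integral_add[OF ii(5,6)] by simp
   finally have e1: "(\<integral>v. (of_real (p v) * ?Gx v + of_real (q v) * ?Gy v) + \<i> * (of_real (p v) * ?Gy v - of_real (q v) * ?Gx v) \<partial>lborel) = - (\<integral>v. of_real (pp v + qq v) * ?G v \<partial>lborel)" .
   have pt: "(of_real (p v) * ?Gx v + of_real (q v) * ?Gy v) + \<i> * (of_real (p v) * ?Gy v - of_real (q v) * ?Gx v)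
     = of_real (8 * J3) * (of_real (kap (t n) (v - z)) * \<omega> v) + N (v - z) * \<Phi> v" for v
   proof -
    have "(of_real (p v) * ?Gx v + of_real (q v) * ?Gy v) + \<i> * (of_real (p v) * ?Gy v - of_real (q v) * ?Gx v) = \<omega> v * (?Gx v + \<i> * ?Gy v)"
     unfolding \<omega>_def by (simp add: algebra_simps)
    also have "\<dots> = \<omega> v * ?x v * (?ke 1 v + \<i> * ?ke \<i> v) + ?k v * \<Phi> v"
     unfolding \<Phi>_def by (simp add: algebra_simps)
    also have "?ke 1 v + \<i> * ?ke \<i> v = of_real (8 * J3 * kap (t n) (v - z))" by (rule cker_dbar[OF t(1)])
    also have "\<omega> v * ?x v * of_real (8 * J3 * kap (t n) (v - z)) = of_real (8 * J3) * (of_real (kap (t n) (v - z)) * \<omega> v)"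
    proof (cases "cmod (v - z) < t n")
     case True
     then have "cmod (v - l) \<le> r / 2" using norm_triangle_ineq[of "v - z" "z - l"] z t(2)[of n] r by simp
     then show ?thesis using cutoff_1(1)[OF r, of "v - l"] by (simp add: mult_ac)
    next
     case False
     then show ?thesis using kap_eq_0[OF t(1), of n "v - z"] by simp
    qed
    also have "?k v * \<Phi> v = N (v - z) * \<Phi> v"
    proof (cases "\<Phi> v = 0")
     case False
     note fr = far[OF False z]
     have "cutoff ?R (v - z) = 1" using cutoff_1(1)[OF R0] fr(2) by auto
     moreover have "cker (t n) (v - z) = inverse (v - z)" using fr(1) t(2)[of n] r by (intro cker_far t) linarith
     moreover have "cker ?d (v - z) = inverse (v - z)" using fr(1) r by (intro cker_far) auto
     ultimately show ?thesis by (simp add: N_def)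
    qed simp
    finally show ?thesis .
   qed
   have iN: "integrable lborel (\<lambda>v. N (v - z) * \<Phi> v)" by (rule integrable_csupp_mult[OF Pl _ nxy(3) Ns]) simp
   have ik: "integrable lborel (\<lambda>v. of_real (8 * J3) * (of_real (kap (t n) (v - z)) * \<omega> v))"
    by (rule integrable_mult_right[OF integrable_kap[OF t(1) loc_int_continuous[OF oc]]])
   show ?thesis using e1 unfolding pt f_def by (subst (asm) Bochner_Integration.integral_add[OF ik iN])
  qed
  have bd: "cmod (\<integral>v. of_real (pp v + qq v) * (?x v * cker (t n) (v - z)) \<partial>lborel) \<le> B * (8 * unit_ball_vol 2 * r)" for n
  proof (rule inv_norm_bound[OF _ r _ _ _ B0])
   show "cmod (z - l) < r" using z r by simp
   have "continuous_on UNIV (\<lambda>v. cker (t n) (v - z))" using C1c_translate[OF cker_C1[OF t(1)]] unfolding C1c_def by blast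
   then show "integrable lborel (\<lambda>v. of_real (pp v + qq v) * (?x v * cker (t n) (v - z)))"
    using Xs by (intro integrable_cc continuous_on_mult[OF continuous_on_of_real[OF continuous_on_add[OF cont(4,5)]] continuous_on_mult[OF Xc(1)]])
     (auto simp: csupp_def)
   fix v
   show "of_real (pp v + qq v) * (?x v * cker (t n) (v - z)) = 0" if "r \<le> cmod (v - l)"
    using cutoff_0(1)[OF r that] by simp
   show "cmod (of_real (pp v + qq v) * (?x v * cker (t n) (v - z))) \<le> B / cmod (v - z)" if "cmod (v - l) < r"
   proof -
    have "cmod (of_real (pp v + qq v) * (?x v * cker (t n) (v - z))) = \<bar>pp v + qq v\<bar> * (cutoff r (v - l) * cmod (cker (t n) (v - z)))"
     unfolding norm_mult norm_of_real using cutoff_range by simp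
    also have "\<dots> \<le> B * (1 * (1 / cmod (v - z)))"
     using B[OF that] cutoff_range cker_bound B0 by (intro mult_mono) auto
    finally show ?thesis by simp
   qed
  qed
  have "(\<lambda>n. of_real (8 * J3) * (\<integral>v. of_real (kap (t n) (v - z)) * \<omega> v \<partial>lborel) + f z) \<longlonglongrightarrow> of_real (8 * J3) * \<omega> z + f z"
   by (intro tendsto_intros kap_avg_limit[OF oc t(1) t0])
  then have "(\<lambda>n. cmod (of_real (8 * J3) * (\<integral>v. of_real (kap (t n) (v - z)) * \<omega> v \<partial>lborel) + f z)) \<longlonglongrightarrow> cmod (of_real (8 * J3) * \<omega> z + f z)"
   by (rule tendsto_norm)
  moreover have "cmod (of_real (8 * J3) * (\<integral>v. of_real (kap (t n) (v - z)) * \<omega> v \<partial>lborel) + f z) \<le> B * (8 * unit_ball_vol 2 * r)" for n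
   using eq[of n] bd[of n] unfolding integral_mult_right_zero by simp
  ultimately have "cmod (of_real (8 * J3) * \<omega> z + f z) \<le> B * (8 * unit_ball_vol 2 * r)"
   by (intro LIMSEQ_le_const2) auto
  then show ?thesis by (simp add: add.commute)
 qed
 show ?thesis
 proof (intro exI[of _ "\<lambda>z. - f z / of_real (8 * J3)"] conjI ballI)
  show "(\<lambda>z. - f z / of_real (8 * J3)) holomorphic_on ball l (r/4)" using J3_pos by (intro holomorphic_intros fhol) auto
  fix z assume "z \<in> ball l (r/4)"
  then have "cmod (z - l) < r/4" by (simp add: dist_norm norm_minus_commute)
  note k = key[OF this]
  have "- f z / of_real (8 * J3) - \<omega> z = - ((f z + of_real (8 * J3) * \<omega> z) / of_real (8 * J3))"
   using J3_pos by (simp add: field_simps)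
  then have "cmod (- f z / of_real (8 * J3) - \<omega> z) = cmod (f z + of_real (8 * J3) * \<omega> z) / (8 * J3)"
   using J3_pos by (simp add: norm_divide)
  also have "\<dots> \<le> B * (8 * unit_ball_vol 2 * r) / (8 * J3)" using k J3_pos by (intro divide_right_mono) auto
  also have "\<dots> = C3 * B * r" unfolding C3_def using J3_pos by simp
  finally show "cmod (- f z / of_real (8 * J3) - (of_real (p z) - \<i> * of_real (q z))) \<le> C3 * B * r" unfolding \<omega>_def .
 qed
qed

text \<open>\<open>H\<close> is a primitive of the holomorphic approximation to p - \<i> q, so the
  gradient of \<psi> - Re H is bounded by the error of \<open>holomorphic_gradient\<close>.
  Integrating it horizontally and then vertically from \<open>l\<close>, over lengths below r/4,
  gives the bound of order r^2.\<close>

lemma gauge: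
 assumes w: "weight \<psi> p q pp qq" and r: "r > 0" and B: "\<And>v. cmod (v - l) < r ==> \<bar>pp v + qq v\<bar> \<le> B"
 shows "\<exists>H. H holomorphic_on ball l (r/4) \<and> H l = of_real (\<psi> l) \<and> (\<forall>z\<in>ball l (r/4). \<bar>\<psi> z - Re (H z)\<bar> \<le> C3 * B * r\<^sup>2)"
proof -
 obtain g where g: "g holomorphic_on ball l (r/4)" "\<And>z. z \<in> ball l (r/4) ==> cmod (g z - (of_real (p z) - \<i> * of_real (q z))) \<le> C3 * B * r"
  using holomorphic_gradient[OF assms] by blast
 obtain H0 where H0: "\<And>z. z \<in> ball l (r/4) ==> (H0 has_field_derivative g z) (at z within ball l (r/4))"
  using holomorphic_convex_primitive'[OF convex_ball open_ball g(1)] by auto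
 define H where "H z = H0 z - H0 l + of_real (\<psi> l)" for z
 have H: "(H has_field_derivative g z) (at z)" if "z \<in> ball l (r/4)" for z
 proof -
  have "(H0 has_field_derivative g z) (at z)" using H0[OF that] at_within_open[OF that] by simp
  then show ?thesis unfolding H_def[abs_def] by (auto intro!: derivative_eq_intros)
 qed
 let ?c = "C3 * B * r"
 have c0: "?c \<ge> 0" using g(2)[of l] r by (auto intro: order_trans[OF norm_ge_zero])
 have pdl: "((\<lambda>t. \<psi> (z + e * of_real t) - Re (H (z + e * of_real t))) has_vector_derivative (d (z + e * of_real t) - Re (e * g (z + e * of_real t)))) (at t)"
  if "has_pd e \<psi> d" "z + e * of_real t \<in> ball l (r/4)" for e d z t
 proof (rule has_vector_derivative_diff)
  show "((\<lambda>t. \<psi> (z + e * of_real t)) has_vector_derivative d (z + e * of_real t)) (at t)" by (rule pd_at_line[OF that(1)])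
  have "((H \<circ> (\<lambda>t::real. z + e * of_real t)) has_vector_derivative (e * 1) * g (z + e * of_real t)) (at t)"
  proof (rule field_vector_diff_chain_at)
   show "((\<lambda>t::real. z + e * of_real t) has_vector_derivative e * 1) (at t)" by (auto intro!: derivative_eq_intros)
   show "(H has_field_derivative g (z + e * of_real t)) (at (z + e * of_real t))" by (rule H[OF that(2)])
  qed
  then have "((\<lambda>t. H (z + e * of_real t)) has_vector_derivative e * g (z + e * of_real t)) (at t)" by (simp add: o_def)
  then show "((\<lambda>t. Re (H (z + e * of_real t))) has_vector_derivative Re (e * g (z + e * of_real t))) (at t)"
   by (rule bounded_linear.has_vector_derivative[OF bounded_linear_Re])
 qed
 have W: "has_pd 1 \<psi> p" "has_pd \<i> \<psi> q" using w by (auto simp: weight_def C1c_def)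
 have main: "\<bar>\<psi> z - Re (H z)\<bar> \<le> C3 * B * r\<^sup>2" if z: "z \<in> ball l (r/4)" for z
 proof -
  define a b where "a = Re (z - l)" and "b = Im (z - l)"
  have zz: "z = (l + 1 * of_real a) + \<i> * of_real b" by (simp add: a_def b_def complex_eq_iff)
  have zl: "cmod (z - l) < r/4" using z by (simp add: dist_norm norm_minus_commute)
  have ab: "\<bar>a\<bar> < r/4" "\<bar>b\<bar> < r/4" using abs_Re_le_cmod[of "z - l"] abs_Im_le_cmod[of "z - l"] zl by (auto simp: a_def b_def)
  have in1: "l + 1 * of_real t \<in> ball l (r/4)" if "t \<in> closed_segment 0 a" for t
   using that ab by (auto simp: dist_norm closed_segment_eq_real_ivl split: if_splits)
  have in2: "(l + 1 * of_real a) + \<i> * of_real t \<in> ball l (r/4)" if "t \<in> closed_segment 0 b" for t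
  proof -
   have "\<bar>t\<bar> \<le> \<bar>b\<bar>" using that by (auto simp: closed_segment_eq_real_ivl split: if_splits)
   then have "cmod (of_real a + \<i> * of_real t) \<le> cmod (z - l)" unfolding cmod_def by (auto simp: a_def b_def abs_le_square_iff)
   moreover have "dist l ((l + 1 * of_real a) + \<i> * of_real t) = cmod (of_real a + \<i> * of_real t)"
    unfolding dist_norm by (subst norm_minus_commute) (simp add: algebra_simps)
   ultimately show ?thesis using zl by simp
  qed
  let ?F = "\<lambda>z. \<psi> z - Re (H z)"
  have 1: "norm (?F (l + 1 * of_real a) - ?F (l + 1 * of_real 0)) \<le> ?c * \<bar>a - 0\<bar>"
  proof (rule mvt_bound[OF pdl[OF W(1) in1]])
   fix t assume "t \<in> closed_segment 0 a"
   then have m: "l + 1 * of_real t \<in> ball l (r/4)" by (rule in1)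
   have "\<bar>p (l + 1 * of_real t) - Re (1 * g (l + 1 * of_real t))\<bar> \<le> cmod (g (l + 1 * of_real t) - (of_real (p (l + 1 * of_real t)) - \<i> * of_real (q (l + 1 * of_real t))))"
    by (rule order_trans[OF _ abs_Re_le_cmod]) simp
   then show "norm (p (l + 1 * of_real t) - Re (1 * g (l + 1 * of_real t))) \<le> ?c" using g(2)[OF m] by simp
  qed auto
  have 2: "norm (?F ((l + 1 * of_real a) + \<i> * of_real b) - ?F ((l + 1 * of_real a) + \<i> * of_real 0)) \<le> ?c * \<bar>b - 0\<bar>"
  proof (rule mvt_bound[OF pdl[OF W(2) in2]])
   fix t assume "t \<in> closed_segment 0 b"
   then have m: "(l + 1 * of_real a) + \<i> * of_real t \<in> ball l (r/4)" by (rule in2)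
   let ?v = "(l + 1 * of_real a) + \<i> * of_real t"
   have "\<bar>q ?v - Re (\<i> * g ?v)\<bar> \<le> cmod (g ?v - (of_real (p ?v) - \<i> * of_real (q ?v)))"
    by (rule order_trans[OF _ abs_Im_le_cmod]) simp
   then show "norm (q ?v - Re (\<i> * g ?v)) \<le> ?c" using g(2)[OF m] by simp
  qed auto
  have "?F l = 0" by (simp add: H_def)
  then have "\<bar>?F z\<bar> \<le> ?c * \<bar>a\<bar> + ?c * \<bar>b\<bar>" using 1 2 unfolding zz[symmetric] by simp
  also have "\<dots> \<le> ?c * (r/4) + ?c * (r/4)" using ab c0 by (intro add_mono mult_left_mono) auto
  also have "\<dots> = C3 * B * r\<^sup>2 / 2" by (simp add: power2_eq_square)
  also have "\<dots> \<le> C3 * B * r\<^sup>2" using mult_nonneg_nonneg[OF c0, of r] r by (simp add: power2_eq_square mult_ac)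
  finally show ?thesis .
 qed
 have "H holomorphic_on ball l (r/4)" unfolding holomorphic_on_def
  using H field_differentiable_at_within field_differentiable_def by blast
 then show ?thesis using main by (intro exI[of _ H]) (auto simp: H_def)
qed

section \<open>Cut-off holomorphic functions and their radial moments\<close>

lemma continuous_on_cut_mult:
 fixes a b :: "complex \<Rightarrow> complex"
 assumes a: "continuous_on UNIV a" and z: "\<And>z. cmod (z - l) \<ge> t ==> a z = 0"
  and b: "continuous_on (ball l r) b" and tr: "t < r"
 shows "continuous_on UNIV (\<lambda>z. a z * b z)"
proof -
 have "continuous_on (ball l r \<union> - cball l t) (\<lambda>z. a z * b z)"
 proof (rule continuous_on_open_Un)
  show "continuous_on (ball l r) (\<lambda>z. a z * b z)" by (rule continuous_on_mult[OF continuous_on_subset[OF a] b]) simp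
  have "a z * b z = 0" if "z \<in> - cball l t" for z using z[of z] that by (simp add: dist_norm norm_minus_commute)
  then show "continuous_on (- cball l t) (\<lambda>z. a z * b z)" by (subst continuous_on_cong[OF refl, where g="\<lambda>_. 0"]) auto
 qed auto
 moreover have "ball l r \<union> - cball l t = UNIV" using tr by auto
 ultimately show ?thesis by simp
qed

text \<open>Outside the disc \<open>g\<close> is arbitrary. Since \<open>t < r\<close> strictly, the
  plane is covered by the open disc, where \<open>g\<close> is holomorphic, and an open set on which
  the product vanishes identically.\<close>

lemma C1c_cut_holomorphic:
 fixes X Xx Xy :: "complex \<Rightarrow> real"
 assumes X: "C1c X Xx Xy" and z: "\<And>z. cmod (z - l) \<ge> t ==> X z = 0 \<and> Xx z = 0 \<and> Xy z = 0"
  and g: "g holomorphic_on ball l r" and tr: "t < r"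
 shows "C1c (\<lambda>z. of_real (X z) * g z) (\<lambda>z. of_real (X z) * deriv g z + of_real (Xx z) * g z)
   (\<lambda>z. of_real (X z) * (\<i> * deriv g z) + of_real (Xy z) * g z)"
proof -
 have Xc: "continuous_on UNIV (\<lambda>z. complex_of_real (X z))" "continuous_on UNIV (\<lambda>z. complex_of_real (Xx z))" "continuous_on UNIV (\<lambda>z. complex_of_real (Xy z))"
  using X unfolding C1c_def by (auto intro: continuous_on_of_real)
 have gc: "continuous_on (ball l r) g" by (rule holomorphic_on_imp_continuous_on[OF g])
 have gd: "continuous_on (ball l r) (deriv g)" by (rule holomorphic_on_imp_continuous_on[OF holomorphic_deriv[OF g open_ball]])
 have gid: "continuous_on (ball l r) (\<lambda>z. \<i> * deriv g z)" by (intro continuous_on_mult continuous_on_const gd)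
 have pd: "pd_at e (\<lambda>z. of_real (X z) * g z) (of_real (X w) * (e * deriv g w) + of_real (Y w) * g w) w"
  if p: "has_pd e X Y" and Y: "\<And>z. cmod (z - l) \<ge> t ==> Y z = 0" for e Y w
 proof (cases "w \<in> ball l r")
  case True
  have "(g has_field_derivative deriv g w) (at w)" by (rule holomorphic_derivI[OF g open_ball True])
  moreover have "pd_at e X (Y w) w" using p unfolding has_pd_def by blast
  ultimately show ?thesis by (intro pd_at_mult pd_at_of_real pd_at_field)
 next
  case False
  then have w: "w \<in> - cball l t" "cmod (w - l) \<ge> t" using tr by (auto simp: dist_norm norm_minus_commute)
  have "\<forall>\<^sub>F v in nhds w. v \<in> - cball l t" using w by (intro eventually_nhds_in_open) auto
  then have ev: "\<forall>\<^sub>F v in nhds w. 0 = of_real (X v) * g v"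
  proof eventually_elim
   case (elim v)
   then have "X v = 0" using z[of v] by (simp add: dist_norm norm_minus_commute)
   then show ?case by simp
  qed
  have "pd_at e (\<lambda>z. of_real (X z) * g z) 0 w" by (rule pd_at_cong[OF pd_at_const ev])
  then show ?thesis using z[OF w(2)] Y[OF w(2)] by simp
 qed
 show ?thesis
  unfolding C1c_def
 proof (intro conjI)
  show "has_pd 1 (\<lambda>z. of_real (X z) * g z) (\<lambda>z. of_real (X z) * deriv g z + of_real (Xx z) * g z)"
   unfolding has_pd_def using pd[of 1 Xx] X z by (simp add: C1c_def)
  show "has_pd \<i> (\<lambda>z. of_real (X z) * g z) (\<lambda>z. of_real (X z) * (\<i> * deriv g z) + of_real (Xy z) * g z)"
   unfolding has_pd_def using pd[of \<i> Xy] X z by (simp add: C1c_def)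
  show "continuous_on UNIV (\<lambda>z. of_real (X z) * g z)" by (rule continuous_on_cut_mult[OF Xc(1) _ gc tr]) (use z in simp)
  show "continuous_on UNIV (\<lambda>z. of_real (X z) * deriv g z + of_real (Xx z) * g z)"
   by (rule continuous_on_add[OF continuous_on_cut_mult[OF Xc(1) _ gd tr] continuous_on_cut_mult[OF Xc(2) _ gc tr]]) (use z in simp_all)
  show "continuous_on UNIV (\<lambda>z. of_real (X z) * (\<i> * deriv g z) + of_real (Xy z) * g z)"
   by (rule continuous_on_add[OF continuous_on_cut_mult[OF Xc(1) _ gid tr] continuous_on_cut_mult[OF Xc(3) _ gc tr]]) (use z in simp_all)
 qed
qed

lemma csupp_cut: "(\<And>z. cmod (z - l) \<ge> t ==> f z = 0) ==> csupp f"
 unfolding csupp_def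
proof (intro exI[of _ "t + cmod l"] allI impI)
 fix z assume *: "\<And>z. cmod (z - l) \<ge> t ==> f z = 0" and "f z \<noteq> 0"
 then have "cmod (z - l) < t" using *[of z] by (cases "cmod (z - l) < t") auto
 then show "norm z \<le> t + cmod l" using norm_triangle_sub[of z l] by simp
qed

text \<open>Both identities integrate derivatives of \<open>bp (Suc k) t\<close> times
  \<open>g\<close> to zero. In d/dx + \<i> d/dy the derivative of \<open>g\<close> cancels and the
  bump contributes \<open>w - l\<close>; in d/dx - \<i> d/dy it contributes
  \<open>cnj (w - l)\<close>, and twice \<open>deriv g\<close> remains.\<close>

lemma bp_holomorphic_moments:
 assumes g: "g holomorphic_on ball l r" and t: "0 < t" "t < r" and k: "k \<ge> 1"
 shows "integrable lborel (\<lambda>w. of_real (bp k t (w - l)) * ((w - l) * g w))"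
  and "(\<integral>w. of_real (bp k t (w - l)) * ((w - l) * g w) \<partial>lborel) = 0"
  and "integrable lborel (\<lambda>w. of_real (bp k t (w - l)) * (cnj (w - l) * g w))"
  and "(\<integral>w. of_real (bp k t (w - l)) * (cnj (w - l) * g w) \<partial>lborel)
    = of_real (t\<^sup>2 / real (Suc k)) * (\<integral>w. of_real (bp (Suc k) t (w - l)) * deriv g w \<partial>lborel)"
proof -
 have k2: "Suc k \<ge> 2" using k by simp
 have "C1c (bp (Suc k) t) (dbp 1 (Suc k) t) (dbp \<i> (Suc k) t)"
  unfolding C1c_def using bp_pd[OF k2] t by auto
 from C1c_translate[OF this, of l]
 have X: "C1c (\<lambda>w. bp (Suc k) t (w - l)) (\<lambda>w. dbp 1 (Suc k) t (w - l)) (\<lambda>w. dbp \<i> (Suc k) t (w - l))" .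
 have z: "bp (Suc k) t (w - l) = 0 \<and> dbp 1 (Suc k) t (w - l) = 0 \<and> dbp \<i> (Suc k) t (w - l) = 0" if "cmod (w - l) \<ge> t" for w
  using bp_eq_0[OF _ t(1) that, of "Suc k"] bp_eq_0[OF k t(1) that] by (simp add: dbp_def)
 let ?G = "\<lambda>w. of_real (bp (Suc k) t (w - l)) * g w"
 let ?Gx = "\<lambda>w. of_real (bp (Suc k) t (w - l)) * deriv g w + of_real (dbp 1 (Suc k) t (w - l)) * g w"
 let ?Gy = "\<lambda>w. of_real (bp (Suc k) t (w - l)) * (\<i> * deriv g w) + of_real (dbp \<i> (Suc k) t (w - l)) * g w"
 have G: "C1c ?G ?Gx ?Gy" by (rule C1c_cut_holomorphic[OF X z g t(2)])
 note G' = G[unfolded C1c_def]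
 have gg: "has_pd 1 ?G ?Gx" "has_pd \<i> ?G ?Gy" "continuous_on UNIV ?G" "continuous_on UNIV ?Gx" "continuous_on UNIV ?Gy" using G' by blast+
 have s: "csupp ?G" by (rule csupp_cut[where l=l and t=t]) (use z in simp)
 have s2: "csupp ?Gx" "csupp ?Gy" using csupp_pd gg s by blast+
 have i: "integrable lborel ?Gx" "integrable lborel ?Gy" by (rule integrable_cc gg s2)+
 have i0: "(\<integral>w. ?Gx w \<partial>lborel) = 0" "(\<integral>w. ?Gy w \<partial>lborel) = 0"
  by (rule integral_pd_0[OF gg(1,3,4) s] integral_pd_0[OF gg(2,3,5) s])+
 define c where "c = complex_of_real (- (2 * real (Suc k) / t\<^sup>2))"
 have c0: "c \<noteq> 0" using t k unfolding c_def of_real_eq_0_iff by simp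
 have d: "of_real (dbp 1 (Suc k) t u) = c * of_real (bp k t u * Re u)" "of_real (dbp \<i> (Suc k) t u) = c * of_real (bp k t u * Im u)" for u
  unfolding c_def dbp_def of_real_mult[symmetric] by (simp_all add: inner_complex_def)
 have d1: "of_real (Re u) + \<i> * of_real (Im u) = u" "of_real (Re u) - \<i> * of_real (Im u) = cnj u" for u by (simp_all add: complex_eq_iff)
 have e1: "of_real (bp k t (w - l)) * ((w - l) * g w) = (1/c) * (?Gx w + \<i> * ?Gy w)" for w
 proof -
  have "?Gx w + \<i> * ?Gy w = c * (of_real (bp k t (w - l)) * ((of_real (Re (w - l)) + \<i> * of_real (Im (w - l))) * g w))"
   unfolding d of_real_mult by (simp add: distrib_left distrib_right mult.assoc mult.left_commute del: minus_complex.sel)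
  then show ?thesis unfolding d1 using c0 by simp
 qed
 have e2: "of_real (bp k t (w - l)) * (cnj (w - l) * g w) = (1/c) * (?Gx w - \<i> * ?Gy w) - (2/c) * (of_real (bp (Suc k) t (w - l)) * deriv g w)" for w
 proof -
  have "?Gx w - \<i> * ?Gy w = c * (of_real (bp k t (w - l)) * ((of_real (Re (w - l)) - \<i> * of_real (Im (w - l))) * g w)) + 2 * (of_real (bp (Suc k) t (w - l)) * deriv g w)"
   unfolding d of_real_mult by (simp add: distrib_left distrib_right left_diff_distrib right_diff_distrib mult.assoc mult.left_commute del: minus_complex.sel)
  moreover have "x = (1/c) * a - (2/c) * y" if "a = c * x + 2 * y" for a x y using c0 that by (simp add: field_simps)
  ultimately show ?thesis unfolding d1 by blast
 qed
 show "integrable lborel (\<lambda>w. of_real (bp k t (w - l)) * ((w - l) * g w))"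
  unfolding e1 by (rule integrable_mult_right[OF Bochner_Integration.integrable_add[OF i(1) integrable_mult_right[OF i(2)]]])
 show "(\<integral>w. of_real (bp k t (w - l)) * ((w - l) * g w) \<partial>lborel) = 0"
  unfolding e1 integral_mult_right_zero Bochner_Integration.integral_add[OF i(1) integrable_mult_right[OF i(2)]] i0 by simp
 have bc: "continuous_on UNIV (\<lambda>w. complex_of_real (bp (Suc k) t (w - l)))" using X unfolding C1c_def by (auto intro: continuous_on_of_real)
 have bg: "integrable lborel (\<lambda>w. of_real (bp (Suc k) t (w - l)) * deriv g w)"
 proof (rule integrable_cc)
  show "continuous_on UNIV (\<lambda>w. of_real (bp (Suc k) t (w - l)) * deriv g w)"
   by (rule continuous_on_cut_mult[OF bc _ holomorphic_on_imp_continuous_on[OF holomorphic_deriv[OF g open_ball]] t(2)]) (use z in simp)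
  show "csupp (\<lambda>w. of_real (bp (Suc k) t (w - l)) * deriv g w)" by (rule csupp_cut[where l=l and t=t]) (use z in simp)
 qed
 have i3: "integrable lborel (\<lambda>w. (1/c) * (?Gx w - \<i> * ?Gy w))"
  by (rule integrable_mult_right[OF Bochner_Integration.integrable_diff[OF i(1) integrable_mult_right[OF i(2)]]])
 have i4: "integrable lborel (\<lambda>w. (2/c) * (of_real (bp (Suc k) t (w - l)) * deriv g w))" by (rule integrable_mult_right[OF bg])
 show "integrable lborel (\<lambda>w. of_real (bp k t (w - l)) * (cnj (w - l) * g w))"
  unfolding e2 by (rule Bochner_Integration.integrable_diff[OF i3 i4])
 have "(\<integral>w. of_real (bp k t (w - l)) * (cnj (w - l) * g w) \<partial>lborel) = - (2/c) * (\<integral>w. of_real (bp (Suc k) t (w - l)) * deriv g w \<partial>lborel)"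
  unfolding e2 Bochner_Integration.integral_diff[OF i3 i4] integral_mult_right_zero
   Bochner_Integration.integral_diff[OF i(1) integrable_mult_right[OF i(2)]] i0 by simp
 also have "- (2/c) = of_real (- (2 / - (2 * real (Suc k) / t\<^sup>2)))" unfolding c_def by (simp del: of_nat_Suc)
 also have "- (2 / - (2 * real (Suc k) / t\<^sup>2)) = t\<^sup>2 / real (Suc k)" by (simp del: of_nat_Suc)
 finally show "(\<integral>w. of_real (bp k t (w - l)) * (cnj (w - l) * g w) \<partial>lborel)
    = of_real (t\<^sup>2 / real (Suc k)) * (\<integral>w. of_real (bp (Suc k) t (w - l)) * deriv g w \<partial>lborel)" .
qed

text \<open>Write f as f l plus (w - l) times its difference quotient, holomorphic after filling in
  the derivative at \<open>l\<close>; the vanishing first moment removes the second part.\<close>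

lemma bp3_mean_value:
 assumes f: "f holomorphic_on ball l r" and t: "0 < t" "t < r"
 shows "(\<integral>w. of_real (bp 3 t (w - l)) * f w \<partial>lborel) = of_real (J3 * t\<^sup>2) * f l"
proof -
 define g where "g w = (if w = l then deriv f l else (f w - f l) / (w - l))" for w
 have "g holomorphic_on ball l r" unfolding g_def[abs_def] by (rule pole_lemma[OF f]) (use t in simp)
 note m = bp_holomorphic_moments(1,2)[OF this t, of 3, simplified]
 have e: "of_real (bp 3 t (w - l)) * f w = of_real (bp 3 t (w - l)) * f l + of_real (bp 3 t (w - l)) * ((w - l) * g w)" for w
  by (simp add: g_def distrib_left[symmetric])
 have "integrable lborel (\<lambda>w. bp 3 t (w - l))"
 proof (rule integrable_cc)
  show "continuous_on UNIV (\<lambda>w. bp 3 t (w - l))" using t by (intro continuous_intros) auto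
  show "csupp (\<lambda>w. bp 3 t (w - l))" by (rule csupp_cut[where l=l and t=t]) (rule bp_eq_0[OF _ t(1)]; simp)
 qed
 then have i: "integrable lborel (\<lambda>w. complex_of_real (bp 3 t (w - l)))" by (rule integrable_of_real)
 show ?thesis
  unfolding e Bochner_Integration.integral_add[OF integrable_mult_left[OF i] m(1)] m(2)
  by (simp add: integral_bp3[OF t(1)])
qed

lemma norm_integral_le:
 fixes f :: "'a \<Rightarrow> 'b::{banach,second_countable_topology}"
 assumes "integrable M G" "AE x in M. norm (f x) \<le> G x"
 shows "norm (\<integral>x. f x \<partial>M) \<le> (\<integral>x. G x \<partial>M)"
proof (cases "integrable M f")
 case True
 then show ?thesis using assms by (intro order_trans[OF integral_norm_bound] integral_mono_AE) auto
next
 case False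
 have "AE x in M. 0 \<le> G x" using assms(2) by eventually_elim (rule order_trans[OF norm_ge_zero])
 then show ?thesis using False by (simp add: not_integrable_integral_eq integral_nonneg_AE)
qed

text \<open>The mean value formula for the square of f. The bound by \<open>G\<close> is requested
  off the centre, since the \<open>G\<close> used later has a pole there and takes the value 0 by
  division by zero.\<close>

lemma holomorphic_sq_mean:
 assumes f: "f holomorphic_on ball l r" and t: "0 < t" "t < r"
  and G: "integrable lborel G" and fG: "\<And>w. w \<noteq> l ==> cmod (w - l) < t ==> (cmod (f w))\<^sup>2 \<le> G w" and G0: "\<And>w. 0 \<le> G w"
 shows "J3 * t\<^sup>2 * (cmod (f l))\<^sup>2 \<le> (\<integral>w. G w \<partial>lborel)"
proof -
 have "(\<lambda>w. (f w)\<^sup>2) holomorphic_on ball l r" by (intro holomorphic_intros f)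
 from bp3_mean_value[OF this t] have "cmod (of_real (J3 * t\<^sup>2) * (f l)\<^sup>2) = cmod (\<integral>w. of_real (bp 3 t (w - l)) * (f w)\<^sup>2 \<partial>lborel)" by simp
 also have "\<dots> \<le> (\<integral>w. G w \<partial>lborel)"
 proof (rule norm_integral_le[OF G], rule AE_mp[OF AE_lborel_singleton[of l]], rule AE_I2, rule impI)
  fix w assume wl: "w \<noteq> l"
  show "norm (of_real (bp 3 t (w - l)) * (f w)\<^sup>2) \<le> G w"
  proof (cases "cmod (w - l) < t")
   case True
   have "norm (of_real (bp 3 t (w - l)) * (f w)\<^sup>2) = bp 3 t (w - l) * (cmod (f w))\<^sup>2" by (simp add: norm_mult norm_power)
   also have "\<dots> \<le> 1 * G w" using fG[OF wl True] by (intro mult_mono) auto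
   finally show ?thesis by simp
  next
   case False
   then show ?thesis using bp_eq_0[OF _ t(1), of 3 "w - l"] G0 by simp
  qed
 qed
 also have "cmod (of_real (J3 * t\<^sup>2) * (f l)\<^sup>2) = J3 * t\<^sup>2 * (cmod (f l))\<^sup>2" using J3_pos by (simp add: norm_mult norm_power)
 finally show ?thesis .
qed

section \<open>The weighted Fock space: kernel, projection and Hankel operators\<close>

locale fock_weight =
 fixes \<phi> \<psi> :: "complex \<Rightarrow> real" and C :: real
 assumes phi_meas [measurable]: "\<phi> \<in> borel_measurable borel" and psi_cont: "continuous_on UNIV \<psi>"
  and phi_le: "\<And>z. \<phi> z \<le> \<psi> z" and psi_le: "\<And>z. \<psi> z \<le> \<phi> z + C"
begin

text \<open>Multiplication by exp(-\<phi>) carries the weighted space isometrically to the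
  unweighted one; every weighted notion is read through it (\<open>L2w_wt\<close>,
  \<open>wnorm_wt\<close>, \<open>wip_wt\<close>).\<close>

definition wt :: "(complex \<Rightarrow> complex) \<Rightarrow> complex \<Rightarrow> complex" where
 "wt f z = f z * of_real (exp (- \<phi> z))"

lemma cmod_wt: "(cmod (wt f z))\<^sup>2 = (cmod (f z))\<^sup>2 * exp (- 2 * \<phi> z)"
 by (simp add: wt_def norm_mult power_mult_distrib exp_double[symmetric])

lemma wt_measurable: "wt f \<in> borel_measurable borel \<longleftrightarrow> f \<in> borel_measurable borel"
proof
 assume [measurable]: "wt f \<in> borel_measurable borel"
 have "f = (\<lambda>z. wt f z * of_real (exp (\<phi> z)))"
  by (simp add: wt_def mult.assoc of_real_mult[symmetric] exp_add[symmetric] fun_eq_iff)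
 moreover have "(\<lambda>z. wt f z * of_real (exp (\<phi> z))) \<in> borel_measurable borel" by measurable
 ultimately show "f \<in> borel_measurable borel" by simp
next
 assume [measurable]: "f \<in> borel_measurable borel"
 show "wt f \<in> borel_measurable borel" unfolding wt_def[abs_def] by measurable
qed

lemma L2w_wt: "L2w \<phi> f \<longleftrightarrow> sqi (wt f)"
 unfolding L2w_def sqi_def wt_measurable cmod_wt by simp

lemma wnorm_wt: "wnorm \<phi> f = sqrt (sqn (wt f))"
 unfolding wnorm_def sqn_def cmod_wt ..

lemma wip_wt: "wip \<phi> f h = ip (wt f) (wt h)"
proof -
 have "f z * cnj (h z) * of_real (exp (- 2 * \<phi> z)) = wt f z * cnj (wt h z)" for z
 proof -
  have "exp (- 2 * \<phi> z) = exp (- \<phi> z) * exp (- \<phi> z)" by (simp add: exp_add[symmetric])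
  then show ?thesis by (simp add: wt_def)
 qed
 then show ?thesis by (simp add: wip_def ip_def)
qed

lemma wt_add_mult: "wt (\<lambda>z. f z + c * h z) = (\<lambda>z. wt f z + c * wt h z)"
 by (simp add: wt_def fun_eq_iff algebra_simps)

lemma L2w_add_mult: "L2w \<phi> f ==> L2w \<phi> h ==> L2w \<phi> (\<lambda>z. f z + c * h z)"
 unfolding L2w_wt wt_add_mult by (rule sqi_add_mult)

lemma L2w_diff: "L2w \<phi> f ==> L2w \<phi> h ==> L2w \<phi> (\<lambda>z. f z - h z)"
 using L2w_add_mult[of f h "-1"] by simp

lemma L2w_0: "L2w \<phi> (\<lambda>z. 0)"
 by (simp add: L2w_def)

lemma wip_add_mult: "L2w \<phi> f ==> L2w \<phi> h ==> L2w \<phi> u ==> wip \<phi> (\<lambda>z. f z + c * h z) u = wip \<phi> f u + c * wip \<phi> h u"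
 unfolding L2w_wt wip_wt wt_add_mult by (rule ip_linear)

lemma wip_diff: "L2w \<phi> f ==> L2w \<phi> h ==> L2w \<phi> u ==> wip \<phi> (\<lambda>z. f z - h z) u = wip \<phi> f u - wip \<phi> h u"
 using wip_add_mult[of f h u "-1"] by simp

lemma wip_self: "wip \<phi> f f = of_real (sqn (wt f))"
 unfolding wip_wt ip_def sqn_def complex_norm_square[symmetric] by (simp flip: integral_of_real of_real_power)

lemma sqn_diff_le: "L2w \<phi> f ==> L2w \<phi> h ==> sqn (wt (\<lambda>z. f z - h z)) \<le> 2 * (sqn (wt f) + sqn (wt h))"
proof -
 assume f: "L2w \<phi> f" and h: "L2w \<phi> h"
 have s: "sqi (wt f)" "sqi (wt h)" using f h by (simp_all add: L2w_wt)
 have "wt (\<lambda>z. f z - h z) = (\<lambda>z. wt f z + (-1) * wt h z)" using wt_add_mult[of f "-1" h] by simp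
 then have 1: "sqn (wt (\<lambda>z. f z - h z)) = sqn (wt f) + 2 * Re (cnj (-1) * ip (wt f) (wt h)) + (cmod (-1))\<^sup>2 * sqn (wt h)"
  using sqi_add_mult(2)[OF s, of "-1"] by simp
 have "0 \<le> sqn (\<lambda>z. wt f z + 1 * wt h z)" by simp
 also have "\<dots> = sqn (wt f) + 2 * Re (cnj 1 * ip (wt f) (wt h)) + (cmod 1)\<^sup>2 * sqn (wt h)" by (rule sqi_add_mult(2)[OF s])
 finally show ?thesis unfolding 1 by simp
qed

lemma Fock_add_mult: "f \<in> Fock \<phi> ==> h \<in> Fock \<phi> ==> (\<lambda>z. f z + c * h z) \<in> Fock \<phi>"
 unfolding Fock_def by (auto intro!: holomorphic_intros L2w_add_mult)

lemma Fock_diff: "f \<in> Fock \<phi> ==> h \<in> Fock \<phi> ==> (\<lambda>z. f z - h z) \<in> Fock \<phi>"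
 unfolding Fock_def by (auto intro!: holomorphic_intros L2w_diff)

lemma Fock_0: "(\<lambda>z. 0) \<in> Fock \<phi>"
 unfolding Fock_def using L2w_0 by simp

lemma Fock_L2w: "f \<in> Fock \<phi> ==> L2w \<phi> f" by (simp add: Fock_def)

text \<open>The mean value bound on unit discs, with \<phi> bounded above on compact sets by the
  continuous \<psi>.\<close>

lemma Fock_pointwise: "\<exists>K\<ge>0. \<forall>f\<in>Fock \<phi>. \<forall>z. cmod z \<le> R \<longrightarrow> (cmod (f z))\<^sup>2 \<le> K * sqn (wt f)"
proof -
 have "compact (\<psi> ` cball 0 (R + 1))" by (rule compact_continuous_image[OF continuous_on_subset[OF psi_cont]]) auto
 from compact_imp_bounded[OF this] obtain S where "\<forall>x\<in>\<psi> ` cball 0 (R + 1). norm x \<le> S" unfolding bounded_iff by blast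
 then have "norm (\<psi> w) \<le> S" if "w \<in> cball 0 (R + 1)" for w using that by blast
 then have S: "\<psi> w \<le> S" if "w \<in> cball 0 (R + 1)" for w using that abs_le_D1 unfolding real_norm_def by blast
 have "(cmod (f z))\<^sup>2 \<le> (exp (2 * S) / J3) * sqn (wt f)" if f: "f \<in> Fock \<phi>" and z: "cmod z \<le> R" for f z
 proof -
  have h: "f holomorphic_on ball z 2" using f unfolding Fock_def by (auto intro: holomorphic_on_subset)
  have i: "integrable lborel (\<lambda>w. exp (2 * S) * (cmod (wt f w))\<^sup>2)"
   using Fock_L2w[OF f] unfolding L2w_wt sqi_def by (intro integrable_mult_right) simp
  have "J3 * 1\<^sup>2 * (cmod (f z))\<^sup>2 \<le> (\<integral>w. exp (2 * S) * (cmod (wt f w))\<^sup>2 \<partial>lborel)"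
  proof (rule holomorphic_sq_mean[OF h _ _ i])
   fix w assume "cmod (w - z) < 1"
   then have "cmod w \<le> R + 1" using z norm_triangle_sub[of w z] by simp
   then have "\<phi> w \<le> S" using S[of w] phi_le[of w] by simp
   then have "1 \<le> exp (2 * S) * exp (- 2 * \<phi> w)" unfolding exp_add[symmetric] by simp
   then show "(cmod (f w))\<^sup>2 \<le> exp (2 * S) * (cmod (wt f w))\<^sup>2"
    unfolding cmod_wt using mult_left_mono[of 1 "exp (2 * S) * exp (- 2 * \<phi> w)" "(cmod (f w))\<^sup>2"] by (simp add: mult_ac)
  qed auto
  then show ?thesis using J3_pos unfolding integral_mult_right_zero sqn_def by (simp add: field_simps)
 qed
 then show ?thesis using J3_pos by (intro exI[of _ "exp (2 * S) / J3"]) auto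
qed

lemma Fock_null: "f \<in> Fock \<phi> ==> sqn (wt f) = 0 ==> f = (\<lambda>z. 0)"
proof
 fix z assume f: "f \<in> Fock \<phi>" and n: "sqn (wt f) = 0"
 obtain K where "\<forall>f\<in>Fock \<phi>. \<forall>w. cmod w \<le> cmod z \<longrightarrow> (cmod (f w))\<^sup>2 \<le> K * sqn (wt f)" using Fock_pointwise by blast
 then have "(cmod (f z))\<^sup>2 \<le> K * sqn (wt f)" using f by blast
 then show "f z = 0" using n by simp
qed

text \<open>By \<open>Fock_pointwise\<close> norm convergence is locally uniform, so the pointwise
  limit is entire; Fatou's lemma shows that it represents \<open>u\<close> up to a function of norm
  zero.\<close>

lemma Fock_complete:
 assumes f: "\<And>n. f n \<in> Fock \<phi>" and u: "sqi u" and lim: "(\<lambda>n. sqn (\<lambda>z. wt (f n) z - u z)) \<longlonglongrightarrow> 0"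
 shows "\<exists>F\<in>Fock \<phi>. sqi (\<lambda>z. wt F z + (-1) * u z) \<and> sqn (\<lambda>z. wt F z + (-1) * u z) = 0"
proof -
 define s where "s n = sqn (\<lambda>z. wt (f n) z - u z)" for n
 have s0: "s n \<ge> 0" for n by (simp add: s_def)
 have sf: "sqi (wt (f n))" for n using Fock_L2w[OF f] by (simp add: L2w_wt)
 have sd: "sqi (\<lambda>z. wt (f n) z - u z)" for n using sqi_add_mult(1)[OF sf u, of n "-1"] by simp
 have diff: "sqn (wt (\<lambda>z. f n z - f m z)) \<le> 2 * (s n + s m)" for n m
 proof -
  let ?a = "\<lambda>z. wt (f n) z - u z" and ?b = "\<lambda>z. wt (f m) z - u z"
  have e: "wt (\<lambda>z. f n z - f m z) = (\<lambda>z. ?a z + (-1) * ?b z)" by (simp add: wt_def fun_eq_iff algebra_simps)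
  have 1: "sqn (\<lambda>z. ?a z + (-1) * ?b z) = s n + 2 * Re (cnj (-1) * ip ?a ?b) + (cmod (-1))\<^sup>2 * s m"
   unfolding s_def by (rule sqi_add_mult(2)[OF sd sd])
  have "0 \<le> sqn (\<lambda>z. ?a z + 1 * ?b z)" by simp
  also have "\<dots> = s n + 2 * Re (cnj 1 * ip ?a ?b) + (cmod 1)\<^sup>2 * s m" unfolding s_def by (rule sqi_add_mult(2)[OF sd sd])
  finally show ?thesis unfolding e 1 by simp
 qed
 have fd: "\<exists>K\<ge>0. \<forall>n m z. cmod z \<le> R \<longrightarrow> (cmod (f n z - f m z))\<^sup>2 \<le> K * (s n + s m)" for R
 proof -
  obtain K where K: "K \<ge> 0" "\<And>h z. h \<in> Fock \<phi> ==> cmod z \<le> R ==> (cmod (h z))\<^sup>2 \<le> K * sqn (wt h)" using Fock_pointwise[of R] by blast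
  have "(cmod (f n z - f m z))\<^sup>2 \<le> (2 * K) * (s n + s m)" if "cmod z \<le> R" for n m z
   using K(2)[OF Fock_diff[OF f f] that, of n m] mult_left_mono[OF diff[of n m] K(1)] by (simp add: algebra_simps)
  then show ?thesis using K(1) by (intro exI[of _ "2 * K"]) auto
 qed
 have lim': "s \<longlonglongrightarrow> 0" using lim by (simp add: s_def[abs_def])
 have ex: "\<exists>l. (\<lambda>n. f n z) \<longlonglongrightarrow> l" for z
 proof -
  obtain K where K: "K \<ge> 0" "\<And>n m. (cmod (f n z - f m z))\<^sup>2 \<le> K * (s n + s m)" using fd[of "cmod z"] by blast
  have "Cauchy (\<lambda>n. f n z)"
  proof (rule metric_CauchyI)
   fix e :: real assume e: "e > 0"
   have "(\<lambda>n. K * s n) \<longlonglongrightarrow> K * 0" by (intro tendsto_intros lim')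
   then have "\<forall>\<^sub>F n in sequentially. K * s n < e\<^sup>2 / 2" by (rule order_tendstoD) (use e in simp)
   then obtain N where N: "\<And>n. n \<ge> N ==> K * s n < e\<^sup>2 / 2" unfolding eventually_sequentially by blast
   have "dist (f n z) (f m z) < e" if "n \<ge> N" "m \<ge> N" for n m
   proof -
    have "(cmod (f n z - f m z))\<^sup>2 < e\<^sup>2" using K(2)[of n m] N[OF that(1)] N[OF that(2)] unfolding distrib_left by linarith
    then show ?thesis unfolding dist_norm by (rule power_less_imp_less_base) (use e in simp)
   qed
   then show "\<exists>N. \<forall>n\<ge>N. \<forall>m\<ge>N. dist (f n z) (f m z) < e" by blast
  qed
  then show ?thesis using Cauchy_convergent convergent_def by blast
 qed
 define F where "F z = lim (\<lambda>n. f n z)" for z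
 have F: "(\<lambda>n. f n z) \<longlonglongrightarrow> F z" for z
  using ex[of z] unfolding F_def convergent_def[symmetric] convergent_LIMSEQ_iff .
 have "F holomorphic_on UNIV"
 proof (rule holomorphic_uniform_sequence[where f=f])
  show "f n holomorphic_on UNIV" for n using f by (simp add: Fock_def)
  fix x :: complex
  obtain K where K: "K \<ge> 0" "\<And>n m z. cmod z \<le> cmod x + 1 ==> (cmod (f n z - f m z))\<^sup>2 \<le> K * (s n + s m)" using fd[of "cmod x + 1"] by blast
  have b: "(cmod (f n z - F z))\<^sup>2 \<le> K * s n" if "z \<in> cball x 1" for n z
  proof -
   have z: "cmod z \<le> cmod x + 1" using that norm_triangle_sub[of z x] by (simp add: dist_norm norm_minus_commute)
   have "(\<lambda>m. (cmod (f n z - f m z))\<^sup>2) \<longlonglongrightarrow> (cmod (f n z - F z))\<^sup>2" by (intro tendsto_intros F)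
   moreover have "(\<lambda>m. K * (s n + s m)) \<longlonglongrightarrow> K * (s n + 0)" by (intro tendsto_intros lim')
   ultimately have "(cmod (f n z - F z))\<^sup>2 \<le> K * (s n + 0)" by (rule LIMSEQ_le) (use K(2)[OF z] in blast)
   then show ?thesis by simp
  qed
  have "uniform_limit (cball x 1) f F sequentially"
  proof (rule uniform_limitI)
   fix e :: real assume e: "e > 0"
   have "(\<lambda>n. K * s n) \<longlonglongrightarrow> K * 0" by (intro tendsto_intros lim')
   then have "\<forall>\<^sub>F n in sequentially. K * s n < e\<^sup>2" by (rule order_tendstoD) (use e in simp)
   then show "\<forall>\<^sub>F n in sequentially. \<forall>z\<in>cball x 1. dist (f n z) (F z) < e"
   proof eventually_elim
    case (elim n)
    show ?case
    proof
     fix z assume "z \<in> cball x 1"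
     then have "(cmod (f n z - F z))\<^sup>2 < e\<^sup>2" using b[of z n] elim by linarith
     then show "dist (f n z) (F z) < e" unfolding dist_norm by (rule power_less_imp_less_base) (use e in simp)
    qed
   qed
  qed
  then show "\<exists>d>0. cball x d \<subseteq> UNIV \<and> uniform_limit (cball x d) f F sequentially" by (intro exI[of _ 1]) simp
 qed auto
 have Fm: "F \<in> borel_measurable borel"
  by (rule borel_measurable_continuous_onI[OF holomorphic_on_imp_continuous_on[OF \<open>F holomorphic_on UNIV\<close>]])
 have um [measurable]: "u \<in> borel_measurable borel" using u by (simp add: sqi_def)
 have wF [measurable]: "wt F \<in> borel_measurable borel" using Fm by (simp add: wt_measurable)
 have fat: "integrable lborel (\<lambda>z. (cmod (wt F z - u z))\<^sup>2) \<and> (\<integral>z. (cmod (wt F z - u z))\<^sup>2 \<partial>lborel) \<le> e" if e: "e > 0" for e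
 proof -
  obtain n0 where n0: "\<And>n. n \<ge> n0 ==> s n \<le> e"
   using order_tendstoD(2)[OF lim' e] unfolding eventually_sequentially by (meson less_imp_le)
  have i: "integrable lborel (\<lambda>z. (cmod (wt (f n) z - u z))\<^sup>2)" for n using sd[of n] by (simp add: sqi_def)
  have "(\<lambda>n. (cmod (wt (f n) z - u z))\<^sup>2) \<longlonglongrightarrow> (cmod (wt F z - u z))\<^sup>2" for z unfolding wt_def by (intro tendsto_intros F)
  then have l: "AE z in lborel. (\<lambda>n. (cmod (wt (f n) z - u z))\<^sup>2) \<longlonglongrightarrow> (cmod (wt F z - u z))\<^sup>2" by simp
  have mm: "(\<lambda>z. (cmod (wt F z - u z))\<^sup>2) \<in> borel_measurable lborel" by measurable
  have le: "(\<integral>z. (cmod (wt (f n) z - u z))\<^sup>2 \<partial>lborel) \<le> e" if "n \<ge> n0" for n using n0[OF that] by (simp add: s_def sqn_def)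
  show ?thesis using fatou_bound[where f="\<lambda>n z. (cmod (wt (f n) z - u z))\<^sup>2" and ?n0.0=n0, OF i _ le mm l] by simp
 qed
 have q: "sqi (\<lambda>z. wt F z + (-1) * u z)" using fat[of 1] unfolding sqi_def by simp
 have "sqn (\<lambda>z. wt F z + (-1) * u z) \<le> 0"
 proof (rule field_le_epsilon)
  fix e :: real assume "e > 0"
  then show "sqn (\<lambda>z. wt F z + (-1) * u z) \<le> 0 + e" using fat unfolding sqn_def by simp
 qed
 then have n: "sqn (\<lambda>z. wt F z + (-1) * u z) = 0" using sqn_nonneg[of "\<lambda>z. wt F z + (-1) * u z"] by linarith
 have "sqi (\<lambda>z. (wt F z + (-1) * u z) + 1 * u z)" by (rule sqi_add_mult(1)[OF q u])
 then have "L2w \<phi> F" unfolding L2w_wt by simp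
 then have "F \<in> Fock \<phi>" using \<open>F holomorphic_on UNIV\<close> by (simp add: Fock_def)
 then show ?thesis using q n by blast
qed

text \<open>\<open>riesz_L2\<close> yields a vector of L^2 that is a limit of Fock functions;
  \<open>Fock_complete\<close> replaces it by an entire one without changing inner products.\<close>

lemma Fock_riesz:
 fixes l :: "(complex \<Rightarrow> complex) \<Rightarrow> complex"
 assumes lin: "\<And>f h c. f \<in> Fock \<phi> ==> h \<in> Fock \<phi> ==> l (\<lambda>z. f z + c * h z) = l f + c * l h"
  and bd: "\<And>f. f \<in> Fock \<phi> ==> (cmod (l f))\<^sup>2 \<le> K * sqn (wt f)" and K: "K \<ge> 0"
 shows "\<exists>F\<in>Fock \<phi>. (\<forall>f\<in>Fock \<phi>. wip \<phi> f F = l f) \<and> sqn (wt F) \<le> K"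
proof -
 have "\<exists>u f. sqi u \<and> sqn u \<le> K \<and> (\<forall>v\<in>Fock \<phi>. ip (wt v) u = l v) \<and> (\<forall>n. f n \<in> Fock \<phi>) \<and> (\<lambda>n. sqn (\<lambda>z. wt (f n) z - u z)) \<longlonglongrightarrow> 0"
 proof (rule riesz_L2[where V="Fock \<phi>" and D=wt and l=l, OF _ _ _ bd K])
  show "Fock \<phi> \<noteq> {}" using Fock_0 by blast
  show "sqi (wt v)" if "v \<in> Fock \<phi>" for v using Fock_L2w[OF that] by (simp add: L2w_wt)
  show "\<exists>x\<in>Fock \<phi>. wt x = (\<lambda>z. wt v z + c * wt w z) \<and> l x = l v + c * l w" if "v \<in> Fock \<phi>" "w \<in> Fock \<phi>" for v w c
   using Fock_add_mult[OF that, of c] wt_add_mult[of v c w] lin[OF that, of c] by blast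
 qed
 then obtain u f where u: "sqi u" "sqn u \<le> K" "\<And>v. v \<in> Fock \<phi> ==> ip (wt v) u = l v" "\<And>n. f n \<in> Fock \<phi>" "(\<lambda>n. sqn (\<lambda>z. wt (f n) z - u z)) \<longlonglongrightarrow> 0" by blast
 obtain F where F: "F \<in> Fock \<phi>" "sqi (\<lambda>z. wt F z + (-1) * u z)" "sqn (\<lambda>z. wt F z + (-1) * u z) = 0" using Fock_complete[OF u(4,1,5)] by blast
 let ?d = "\<lambda>z. wt F z + (-1) * u z"
 have ud: "wt F = (\<lambda>z. u z + 1 * ?d z)" by simp
 have z: "ip v ?d = 0" if "sqi v" for v using ip_cauchy_schwarz[OF that F(2)] F(3) by simp
 have "wip \<phi> v F = l v" if v: "v \<in> Fock \<phi>" for v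
 proof -
  have s: "sqi (wt v)" using Fock_L2w[OF v] by (simp add: L2w_wt)
  have "ip (wt F) (wt v) = ip (\<lambda>z. u z + 1 * ?d z) (wt v)" by (subst ud) simp
  also have "\<dots> = ip u (wt v) + 1 * ip ?d (wt v)" by (rule ip_linear[OF u(1) F(2) s])
  also have "ip ?d (wt v) = 0" using z[OF s] ip_cnj[of ?d "wt v"] by simp
  finally have "ip (wt F) (wt v) = ip u (wt v)" by simp
  then have "ip (wt v) (wt F) = ip (wt v) u" using ip_cnj[of "wt v" "wt F"] ip_cnj[of "wt v" u] by simp
  then show ?thesis using u(3)[OF v] by (simp add: wip_wt)
 qed
 moreover have "sqn (wt F) \<le> K"
 proof -
  have "sqn (\<lambda>z. u z + 1 * ?d z) = sqn u + 2 * Re (cnj 1 * ip u ?d) + (cmod 1)\<^sup>2 * sqn ?d" by (rule sqi_add_mult(2)[OF u(1) F(2)])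
  then have "sqn (wt F) = sqn u" unfolding ud[symmetric] using z[OF u(1)] F(3) by simp
  then show ?thesis using u(2) by simp
 qed
 ultimately show ?thesis using F(1) by blast
qed

lemma Fock_perp_0:
 assumes "f \<in> Fock \<phi>" "\<And>v. v \<in> Fock \<phi> ==> wip \<phi> f v = 0"
 shows "f = (\<lambda>z. 0)"
 using Fock_null[OF assms(1)] assms(2)[OF assms(1)] by (simp add: wip_self)

text \<open>The description in \<open>bergman\<close> designates a function: it exists because point
  evaluation is bounded, and it is unique because a Fock function orthogonal to the whole space is
  zero.\<close>

lemma bergman:
 shows "bergman \<phi> w \<in> Fock \<phi>" and "\<And>f. f \<in> Fock \<phi> ==> f w = wip \<phi> f (bergman \<phi> w)"
proof -
 obtain K where K: "K \<ge> 0" "\<And>f z. f \<in> Fock \<phi> ==> cmod z \<le> cmod w ==> (cmod (f z))\<^sup>2 \<le> K * sqn (wt f)" using Fock_pointwise[of "cmod w"] by blast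
 have "\<exists>F\<in>Fock \<phi>. (\<forall>f\<in>Fock \<phi>. wip \<phi> f F = f w) \<and> sqn (wt F) \<le> K"
  by (rule Fock_riesz[OF _ _ K(1)]) (auto intro: K(2))
 then obtain F where F: "F \<in> Fock \<phi>" "\<And>f. f \<in> Fock \<phi> ==> wip \<phi> f F = f w" by blast
 let ?P = "\<lambda>k. k \<in> Fock \<phi> \<and> (\<forall>f\<in>Fock \<phi>. f w = wip \<phi> f k)"
 have "?P F" using F by simp
 moreover have "k = F" if "?P k" for k
 proof -
  have k: "k \<in> Fock \<phi>" "\<And>f. f \<in> Fock \<phi> ==> f w = wip \<phi> f k" using that by blast+
  have "(\<lambda>z. k z - F z) = (\<lambda>z. 0)"
  proof (rule Fock_perp_0[OF Fock_diff[OF k(1) F(1)]])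
   fix v assume v: "v \<in> Fock \<phi>"
   have "wip \<phi> v k = wip \<phi> v F" using k(2)[OF v] F(2)[OF v] by simp
   then have "wip \<phi> k v = wip \<phi> F v" unfolding wip_wt using ip_cnj[of "wt k" "wt v"] ip_cnj[of "wt F" "wt v"] by simp
   then show "wip \<phi> (\<lambda>z. k z - F z) v = 0" using wip_diff[OF Fock_L2w[OF k(1)] Fock_L2w[OF F(1)] Fock_L2w[OF v]] by simp
  qed
  then show ?thesis by (simp add: fun_eq_iff)
 qed
 ultimately have "?P (bergman \<phi> w)" unfolding bergman_def by (rule theI)
 then show "bergman \<phi> w \<in> Fock \<phi>" "\<And>f. f \<in> Fock \<phi> ==> f w = wip \<phi> f (bergman \<phi> w)" by blast+
qed

text \<open>The projection is the Riesz representative of the functional pairing with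
  \<open>h\<close>; the norm bound is that of the functional.\<close>

lemma proj:
 assumes h: "L2w \<phi> h"
 shows "proj \<phi> h \<in> Fock \<phi>" and "\<And>v. v \<in> Fock \<phi> ==> wip \<phi> (\<lambda>z. h z - proj \<phi> h z) v = 0"
  and "sqn (wt (proj \<phi> h)) \<le> sqn (wt h)"
proof -
 have s: "sqi (wt h)" using h by (simp add: L2w_wt)
 have "\<exists>F\<in>Fock \<phi>. (\<forall>f\<in>Fock \<phi>. wip \<phi> f F = wip \<phi> f h) \<and> sqn (wt F) \<le> sqn (wt h)"
 proof (rule Fock_riesz)
  fix f g c assume "f \<in> Fock \<phi>" "g \<in> Fock \<phi>"
  then show "wip \<phi> (\<lambda>z. f z + c * g z) h = wip \<phi> f h + c * wip \<phi> g h" by (intro wip_add_mult h Fock_L2w)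
 next
  fix f assume "f \<in> Fock \<phi>"
  then have "sqi (wt f)" using Fock_L2w by (simp add: L2w_wt)
  then show "(cmod (wip \<phi> f h))\<^sup>2 \<le> sqn (wt h) * sqn (wt f)" unfolding wip_wt using ip_cauchy_schwarz[OF _ s] by (simp add: mult.commute)
 qed simp
 then obtain F where F: "F \<in> Fock \<phi>" "\<And>f. f \<in> Fock \<phi> ==> wip \<phi> f F = wip \<phi> f h" "sqn (wt F) \<le> sqn (wt h)" by blast
 have d: "wip \<phi> (\<lambda>z. h z - k z) v = cnj (wip \<phi> v h) - cnj (wip \<phi> v k)" if "k \<in> Fock \<phi>" "v \<in> Fock \<phi>" for k v
  using wip_diff[OF h Fock_L2w[OF that(1)] Fock_L2w[OF that(2)]] ip_cnj[of "wt h" "wt v"] ip_cnj[of "wt k" "wt v"]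
  unfolding wip_wt by simp
 let ?P = "\<lambda>f. f \<in> Fock \<phi> \<and> (\<forall>u\<in>Fock \<phi>. wip \<phi> (\<lambda>z. h z - f z) u = 0)"
 have P: "?P F" using F d by simp
 moreover have "k = F" if "?P k" for k
 proof -
  have k: "k \<in> Fock \<phi>" "\<And>u. u \<in> Fock \<phi> ==> wip \<phi> (\<lambda>z. h z - k z) u = 0" using that by blast+
  have "(\<lambda>z. k z - F z) = (\<lambda>z. 0)"
  proof (rule Fock_perp_0[OF Fock_diff[OF k(1) F(1)]])
   fix v assume v: "v \<in> Fock \<phi>"
   note dd = wip_diff[OF L2w_diff[OF h Fock_L2w[OF F(1)]] L2w_diff[OF h Fock_L2w[OF k(1)]] Fock_L2w[OF v]]
   have "wip \<phi> (\<lambda>z. (h z - F z) - (h z - k z)) v = 0" unfolding dd using k(2)[OF v] P v by simp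
   then show "wip \<phi> (\<lambda>z. k z - F z) v = 0" by simp
  qed
  then show ?thesis by (simp add: fun_eq_iff)
 qed
 ultimately have e: "proj \<phi> h = F" unfolding proj_def by (rule the_equality)
 show "proj \<phi> h \<in> Fock \<phi>" unfolding e by (rule F(1))
 show "sqn (wt (proj \<phi> h)) \<le> sqn (wt h)" unfolding e by (rule F(3))
 show "wip \<phi> (\<lambda>z. h z - proj \<phi> h z) v = 0" if "v \<in> Fock \<phi>" for v using P that unfolding e by blast
qed

lemma nk_Fock: "nk \<phi> w \<in> Fock \<phi>"
 using Fock_add_mult[OF Fock_0 bergman(1)[of w], of "1 / of_real (sqrt (Re (bergman \<phi> w w)))"]
 unfolding nk_def[abs_def] by simp

lemma kspan_Fock: "f \<in> kspan \<phi> ==> f \<in> Fock \<phi>"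
proof -
 assume "f \<in> kspan \<phi>"
 then obtain A c where "finite A" and f: "f = (\<lambda>z. \<Sum>w\<in>A. c w * nk \<phi> w z)" unfolding kspan_def by blast
 from \<open>finite A\<close> have "(\<lambda>z. \<Sum>w\<in>A. c w * nk \<phi> w z) \<in> Fock \<phi>"
 proof (induction A)
  case empty
  then show ?case using Fock_0 by simp
 next
  case (insert a A)
  have "(\<lambda>z. (\<Sum>w\<in>A. c w * nk \<phi> w z) + c a * nk \<phi> a z) \<in> Fock \<phi>" by (rule Fock_add_mult[OF insert.IH nk_Fock])
  then show ?case using insert.hyps by (simp add: add.commute)
 qed
 then show ?thesis using f by simp
qed

lemma kspan_L2w:
 assumes "\<And>w. L2w \<phi> (\<lambda>z. cnj (g z) * nk \<phi> w z)" "f \<in> kspan \<phi>"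
 shows "L2w \<phi> (\<lambda>z. cnj (g z) * f z)"
proof -
 obtain A c where "finite A" and f: "f = (\<lambda>z. \<Sum>w\<in>A. c w * nk \<phi> w z)" using assms(2) unfolding kspan_def by blast
 from \<open>finite A\<close> have "L2w \<phi> (\<lambda>z. cnj (g z) * (\<Sum>w\<in>A. c w * nk \<phi> w z))"
 proof (induction A)
  case empty
  then show ?case using L2w_0 by simp
 next
  case (insert a A)
  have "L2w \<phi> (\<lambda>z. cnj (g z) * (\<Sum>w\<in>A. c w * nk \<phi> w z) + c a * (cnj (g z) * nk \<phi> a z))" by (rule L2w_add_mult[OF insert.IH assms(1)])
  then show ?case using insert.hyps by (simp add: algebra_simps)
 qed
 then show ?thesis using f by simp
qed

text \<open>A bound modulo entire functions suffices: subtracting the projection removes the ambiguity,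
 and two choices differ by an entire function orthogonal to the Fock space.\<close>

lemma hankel_boundedI:
 assumes k: "\<And>w. L2w \<phi> (\<lambda>z. cnj (g z) * nk \<phi> w z)" and B: "B \<ge> 0"
  and h: "\<And>f. f \<in> Fock \<phi> ==> \<exists>h. h holomorphic_on UNIV \<and> L2w \<phi> (\<lambda>z. cnj (g z) * f z - h z) \<and> sqn (wt (\<lambda>z. cnj (g z) * f z - h z)) \<le> B * sqn (wt f)"
 shows "hankel_bounded \<phi> g"
proof -
 obtain hh where hh: "\<And>f. f \<in> Fock \<phi> ==> hh f holomorphic_on UNIV"
  "\<And>f. f \<in> Fock \<phi> ==> L2w \<phi> (\<lambda>z. cnj (g z) * f z - hh f z)"
  "\<And>f. f \<in> Fock \<phi> ==> sqn (wt (\<lambda>z. cnj (g z) * f z - hh f z)) \<le> B * sqn (wt f)"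
 proof -
  have "\<exists>hh. \<forall>f\<in>Fock \<phi>. hh f holomorphic_on UNIV \<and> L2w \<phi> (\<lambda>z. cnj (g z) * f z - hh f z) \<and> sqn (wt (\<lambda>z. cnj (g z) * f z - hh f z)) \<le> B * sqn (wt f)"
   by (rule bchoice) (use h in blast)
  then show ?thesis using that by blast
 qed
 let ?u = "\<lambda>f z. cnj (g z) * f z - hh f z"
 define T where "T f z = ?u f z - proj \<phi> (?u f) z" for f z
 have TL: "L2w \<phi> (T f)" if "f \<in> Fock \<phi>" for f
  unfolding T_def[abs_def] by (rule L2w_diff[OF hh(2)[OF that] Fock_L2w[OF proj(1)[OF hh(2)[OF that]]]])
 have Tp: "wip \<phi> (T f) v = 0" if "f \<in> Fock \<phi>" "v \<in> Fock \<phi>" for f v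
  unfolding T_def[abs_def] by (rule proj(2)[OF hh(2)[OF that(1)] that(2)])
 have hol: "proj \<phi> (?u f) holomorphic_on UNIV" if "f \<in> Fock \<phi>" for f using proj(1)[OF hh(2)[OF that]] by (simp add: Fock_def)
 have null: "wnorm \<phi> d = 0" if "d holomorphic_on UNIV" "L2w \<phi> d" "\<And>v. v \<in> Fock \<phi> ==> wip \<phi> d v = 0" for d
 proof -
  have "d \<in> Fock \<phi>" using that by (simp add: Fock_def)
  then have "d = (\<lambda>z. 0)" using that(3) by (rule Fock_perp_0)
  then show ?thesis by (simp add: wnorm_def)
 qed
 have 1: "wnorm \<phi> (T f) \<le> (2 * sqrt B) * wnorm \<phi> f" if f: "f \<in> Fock \<phi>" for f
 proof -
  have "sqn (wt (T f)) \<le> 2 * (sqn (wt (?u f)) + sqn (wt (proj \<phi> (?u f))))"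
   unfolding T_def[abs_def] by (rule sqn_diff_le[OF hh(2)[OF f] Fock_L2w[OF proj(1)[OF hh(2)[OF f]]]])
  also have "\<dots> \<le> 4 * (B * sqn (wt f))" using proj(3)[OF hh(2)[OF f]] hh(3)[OF f] by simp
  finally have "sqrt (sqn (wt (T f))) \<le> sqrt (4 * (B * sqn (wt f)))" by (rule real_sqrt_le_mono)
  then show ?thesis unfolding wnorm_wt by (simp add: real_sqrt_mult)
 qed
 have 2: "wnorm \<phi> (\<lambda>z. T (\<lambda>w. a * f w + b * h w) z - (a * T f z + b * T h z)) = 0" if f: "f \<in> Fock \<phi>" and h: "h \<in> Fock \<phi>" for f h a b
 proof -
  have x: "(\<lambda>w. a * f w + b * h w) \<in> Fock \<phi>"
   using Fock_add_mult[OF Fock_add_mult[OF Fock_0 f, of a] h, of b] by simp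
  let ?x = "\<lambda>w. a * f w + b * h w"
  have l: "L2w \<phi> (\<lambda>z. (T ?x z + (-a) * T f z) + (-b) * T h z)"
   by (intro L2w_add_mult TL x f h)
  have w: "wip \<phi> (\<lambda>z. (T ?x z + (-a) * T f z) + (-b) * T h z) v = 0" if v: "v \<in> Fock \<phi>" for v
   unfolding wip_add_mult[OF L2w_add_mult[OF TL[OF x] TL[OF f]] TL[OF h] Fock_L2w[OF v]]
    wip_add_mult[OF TL[OF x] TL[OF f] Fock_L2w[OF v]] Tp[OF x v] Tp[OF f v] Tp[OF h v] by simp
  have e: "(\<lambda>z. (T ?x z + (-a) * T f z) + (-b) * T h z)
    = (\<lambda>z. a * hh f z + b * hh h z - hh ?x z + a * proj \<phi> (?u f) z + b * proj \<phi> (?u h) z - proj \<phi> (?u ?x) z)"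
   by (simp add: T_def fun_eq_iff algebra_simps)
  have "(\<lambda>z. (T ?x z + (-a) * T f z) + (-b) * T h z) holomorphic_on UNIV"
   unfolding e by (intro holomorphic_on_add holomorphic_on_diff holomorphic_on_mult holomorphic_on_const hh(1) hol x f h)
  from null[OF this l w] show ?thesis by (simp add: algebra_simps)
 qed
 have 3: "wnorm \<phi> (\<lambda>z. T f z - hankel \<phi> g f z) = 0" if f: "f \<in> kspan \<phi>" for f
 proof -
  note F = kspan_Fock[OF f] and L = kspan_L2w[OF k f]
  note P = proj[OF L]
  have H: "L2w \<phi> (hankel \<phi> g f)" unfolding hankel_def by (rule L2w_diff[OF L Fock_L2w[OF P(1)]])
  have w: "wip \<phi> (\<lambda>z. T f z - hankel \<phi> g f z) v = 0" if v: "v \<in> Fock \<phi>" for v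
   unfolding wip_diff[OF TL[OF F] H Fock_L2w[OF v]] Tp[OF F v] unfolding hankel_def P(2)[OF v] by simp
  have e: "(\<lambda>z. T f z - hankel \<phi> g f z) = (\<lambda>z. proj \<phi> (\<lambda>w. cnj (g w) * f w) z - hh f z - proj \<phi> (?u f) z)"
   by (simp add: T_def hankel_def fun_eq_iff)
  have "proj \<phi> (\<lambda>w. cnj (g w) * f w) holomorphic_on UNIV" using P(1) by (simp add: Fock_def)
  then have "(\<lambda>z. T f z - hankel \<phi> g f z) holomorphic_on UNIV"
   unfolding e by (intro holomorphic_on_diff hh(1) hol F)
  from null[OF this L2w_diff[OF TL[OF F] H] w] show ?thesis .
 qed
 show ?thesis unfolding hankel_bounded_def using TL 1 2 3 by blast
qed

end

section \<open>Regular weights: sufficiency, and the gauge at the natural scale\<close>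

lemma C1c_entire:
 assumes "f holomorphic_on UNIV"
 shows "C1c f (deriv f) (\<lambda>z. \<i> * deriv f z)"
proof -
 have p: "pd_at e f (e * deriv f z) z" for e z by (rule pd_at_field[OF holomorphic_derivI[OF assms open_UNIV]]) simp
 have c: "continuous_on UNIV f" "continuous_on UNIV (deriv f)"
  by (intro holomorphic_on_imp_continuous_on assms holomorphic_deriv open_UNIV)+
 show ?thesis using p[of 1] p[of \<i>] c continuous_on_mult[OF continuous_on_const c(2), of \<i>] unfolding C1c_def has_pd_def by simp
qed

lemma C1c_cnj:
 assumes "C1c f fx fy"
 shows "C1c (\<lambda>z. cnj (f z)) (\<lambda>z. cnj (fx z)) (\<lambda>z. cnj (fy z))"
 using assms unfolding C1c_def has_pd_def by (auto intro!: pd_at_cnj continuous_intros)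

lemma dcutoff_bound:
 assumes "R > 0" "norm e = 1"
 shows "\<bar>dcutoff e R w\<bar> \<le> 36 / R"
proof (cases "cmod w < R")
 case True
 have "\<bar>dcutoff e R w\<bar> = \<bar>cutF' ((cmod w)\<^sup>2 / R\<^sup>2)\<bar> * (2 * \<bar>w \<bullet> e\<bar> / R\<^sup>2)"
  unfolding dcutoff_def abs_mult abs_divide by simp
 also have "\<dots> \<le> 18 * (2 * R / R\<^sup>2)"
 proof (intro mult_mono cutF'_bound divide_right_mono mult_left_mono)
  show "\<bar>w \<bullet> e\<bar> \<le> R" using Cauchy_Schwarz_ineq2[of w e] True assms by simp
 qed auto
 also have "\<dots> = 36 / R" using assms by (simp add: power2_eq_square)
 finally show ?thesis .
next
 case False
 then show ?thesis using cutoff_0(2)[OF assms(1), of w e] assms by simp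
qed

lemma integrable_indicator_ball:
 assumes "r \<ge> 0"
 shows "integrable lborel (\<lambda>z::complex. indicator (ball l r) z * (M::real))"
  and "(\<integral>z. indicator (ball l r) z * M \<partial>(lborel::complex measure)) = M * unit_ball_vol 2 * r\<^sup>2"
proof -
 have e: "emeasure lborel (ball l r) = ennreal (unit_ball_vol 2 * r\<^sup>2)" using emeasure_ball[OF assms, of l] by simp
 have "integrable lborel (indicator (ball l r) :: complex \<Rightarrow> real)" by (rule integrable_real_indicator) (simp_all add: e)
 then show "integrable lborel (\<lambda>z::complex. indicator (ball l r) z * M)" by (rule integrable_mult_left)
 have "measure lborel (ball l r) = unit_ball_vol 2 * r\<^sup>2" unfolding measure_def e by simp
 then show "(\<integral>z. indicator (ball l r) z * M \<partial>(lborel::complex measure)) = M * unit_ball_vol 2 * r\<^sup>2" by simp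
qed

text \<open>The term is a regularized log |z - l|. Paired with the factor P = z - l in
  \<open>hormander\<close>, the denominator |P|^2 exp(2 * weight) becomes exp(2\<psi>) times |z -
  l|^2 / (R^2 + |z - l|^2): it vanishes at \<open>l\<close> and never exceeds exp(2\<psi>).\<close>

lemma weight_minus_log:
 fixes l :: complex and R :: real
 assumes w: "weight \<psi> p q pp qq" and R: "R > 0"
 defines "D \<equiv> (\<lambda>z. R\<^sup>2 + (cmod (z - l))\<^sup>2)"
 shows "weight (\<lambda>z. \<psi> z - ln (D z) / 2) (\<lambda>z. p z - ((z - l) \<bullet> 1) / D z) (\<lambda>z. q z - ((z - l) \<bullet> \<i>) / D z)
   (\<lambda>z. pp z - (1 / D z - 2 * ((z - l) \<bullet> 1)\<^sup>2 / (D z)\<^sup>2)) (\<lambda>z. qq z - (1 / D z - 2 * ((z - l) \<bullet> \<i>)\<^sup>2 / (D z)\<^sup>2))"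
proof -
 have D0: "D z > 0" for z using R by (simp add: D_def add_pos_nonneg)
 have "has_pd e (\<lambda>w. (cmod w)\<^sup>2) (\<lambda>z. 2 * (z \<bullet> e))" for e unfolding has_pd_def using pd_at_norm2 by blast
 from has_pd_translate[OF this, of _ "-l"] have "pd_at e (\<lambda>z. (cmod (z - l))\<^sup>2) (2 * ((z - l) \<bullet> e)) z" for e z
  unfolding has_pd_def by simp
 from pd_at_add[OF pd_at_const this] have Dd: "pd_at e D (2 * ((z - l) \<bullet> e)) z" for e z unfolding D_def by simp
 have L: "pd_at e (\<lambda>z. ln (D z) / 2) (((z - l) \<bullet> e) / D z) z" for e z
 proof -
  have "((\<lambda>x. ln x / 2) has_real_derivative (1 / D z) / 2) (at (D z))" by (rule DERIV_cdivide[OF DERIV_ln_divide[OF D0]])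
  from pd_at_chain[OF Dd this, of e] show ?thesis by simp
 qed
 have i: "pd_at e (\<lambda>z. (z - l) \<bullet> e) (e \<bullet> e) z" for e z
 proof -
  have "pd_at e (\<lambda>z. z \<bullet> e - l \<bullet> e) (e \<bullet> e - 0) z" by (rule pd_at_diff[OF pd_at_inner pd_at_const])
  then show ?thesis by (simp add: inner_diff_left)
 qed
 have LL: "pd_at e (\<lambda>z. ((z - l) \<bullet> e) / D z) (1 / D z - 2 * ((z - l) \<bullet> e)\<^sup>2 / (D z)\<^sup>2) z" if "e \<bullet> e = 1" for e z
 proof -
  have "((\<lambda>x. inverse x) has_real_derivative - (inverse (D z) ^ 2)) (at (D z))" using DERIV_inverse[of "D z"] D0[of z] by (simp add: power2_eq_square)
  from pd_at_mult[OF i pd_at_chain[OF Dd this, of e]] show ?thesis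
   using that by (simp add: divide_inverse power2_eq_square algebra_simps)
 qed
 have W: "has_pd 1 \<psi> p" "has_pd \<i> \<psi> q" "has_pd 1 p pp" "has_pd \<i> q qq" using w unfolding weight_def C1c_def by blast+
 have c: "continuous_on UNIV \<psi>" "continuous_on UNIV p" "continuous_on UNIV q" "continuous_on UNIV pp" "continuous_on UNIV qq" using w unfolding weight_def C1c_def by blast+
 have Dc: "continuous_on UNIV D" unfolding D_def by (intro continuous_intros)
 have Dn: "D z \<noteq> 0" for z using D0[of z] by simp
 have p: "has_pd e (\<lambda>z. f z - a z) (\<lambda>z. f' z - a' z)" if "has_pd e f f'" "\<And>z. pd_at e a (a' z) z" for e and f f' a a' :: "complex \<Rightarrow> real"
  using that unfolding has_pd_def by (auto intro: pd_at_diff)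
 have i1: "(1::complex) \<bullet> 1 = 1" "\<i> \<bullet> \<i> = 1" by (simp_all add: inner_complex_def)
 show ?thesis
  unfolding weight_def C1c_def
 proof (intro conjI)
  show "has_pd 1 (\<lambda>z. \<psi> z - ln (D z) / 2) (\<lambda>z. p z - ((z - l) \<bullet> 1) / D z)" by (rule p[OF W(1) L])
  show "has_pd \<i> (\<lambda>z. \<psi> z - ln (D z) / 2) (\<lambda>z. q z - ((z - l) \<bullet> \<i>) / D z)" by (rule p[OF W(2) L])
  show "has_pd 1 (\<lambda>z. p z - ((z - l) \<bullet> 1) / D z) (\<lambda>z. pp z - (1 / D z - 2 * ((z - l) \<bullet> 1)\<^sup>2 / (D z)\<^sup>2))" by (rule p[OF W(3) LL[OF i1(1)]])
  show "has_pd \<i> (\<lambda>z. q z - ((z - l) \<bullet> \<i>) / D z) (\<lambda>z. qq z - (1 / D z - 2 * ((z - l) \<bullet> \<i>)\<^sup>2 / (D z)\<^sup>2))" by (rule p[OF W(4) LL[OF i1(2)]])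
  show "continuous_on UNIV (\<lambda>z. \<psi> z - ln (D z) / 2)" by (intro continuous_intros c Dc) (use Dn in auto)
  show "continuous_on UNIV (\<lambda>z. p z - ((z - l) \<bullet> 1) / D z)" by (intro continuous_intros c Dc) (use Dn in auto)
  show "continuous_on UNIV (\<lambda>z. q z - ((z - l) \<bullet> \<i>) / D z)" by (intro continuous_intros c Dc) (use Dn in auto)
  show "continuous_on UNIV (\<lambda>z. pp z - (1 / D z - 2 * ((z - l) \<bullet> 1)\<^sup>2 / (D z)\<^sup>2))" by (intro continuous_intros c Dc) (use Dn in auto)
  show "continuous_on UNIV (\<lambda>z. qq z - (1 / D z - 2 * ((z - l) \<bullet> \<i>)\<^sup>2 / (D z)\<^sup>2))" by (intro continuous_intros c Dc) (use Dn in auto)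
 qed
qed

locale fock_regular = fock_weight +
 fixes p q pp qq \<rho> :: "complex \<Rightarrow> real" and c :: real
 assumes weight: "weight \<psi> p q pp qq" and c_pos: "c > 0"
  and lap_ge: "\<And>z. c \<le> (pp z + qq z) * (\<rho> z)\<^sup>2" and lap_le: "\<And>z. (pp z + qq z) * (\<rho> z)\<^sup>2 \<le> C"
  and rho_pos: "\<And>z. \<rho> z > 0" and rho_lip: "\<And>z w. \<rho> w \<le> \<rho> z + dist z w"
  and rho_sub: "\<And>e. e > 0 ==> \<exists>K\<ge>1. \<forall>z w t. t \<ge> K * \<rho> w \<longrightarrow> dist w z \<le> t \<longrightarrow> \<rho> z \<le> e * t"
begin

lemma lap_lower: "c / (\<rho> z)\<^sup>2 \<le> pp z + qq z"
 using lap_ge[of z] rho_pos[of z] by (simp add: divide_le_eq)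

lemma lap_pos: "pp z + qq z > 0"
 using lap_lower[of z] rho_pos[of z] c_pos by (smt (verit) divide_pos_pos zero_less_power)

lemma cont: "continuous_on UNIV p" "continuous_on UNIV q" "continuous_on UNIV pp" "continuous_on UNIV qq"
 using weight unfolding weight_def C1c_def by blast+

lemma exp_weights: "exp (- 2 * \<psi> z) \<le> exp (- 2 * \<phi> z)" "exp (- 2 * \<phi> z) \<le> exp (2 * C) * exp (- 2 * \<psi> z)"
 using phi_le[of z] psi_le[of z] by (simp_all add: exp_add[symmetric])

text \<open>\<open>hormander\<close> with P = 1, the right-hand side being 2 * cnj (g') * f. The
  hypothesis gives |g'|^2 \<le> B^2 / \<rho>^2, and 1 / \<rho>^2 is at most 1/c times the Laplacian,
  which is the division the estimate asks for. The 4 is the square of that 2; exp(2C) pays for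
  returning from \<psi> to \<phi>.\<close>

lemma dbar_correction:
 assumes g: "g holomorphic_on UNIV" and B: "\<And>z. cmod (deriv g z) * \<rho> z \<le> B" and f: "f \<in> Fock \<phi>"
 shows "\<exists>h. h holomorphic_on UNIV \<and> L2w \<phi> (\<lambda>z. cnj (g z) * f z - h z) \<and>
   sqn (wt (\<lambda>z. cnj (g z) * f z - h z)) \<le> (exp (2 * C) * (4 * B\<^sup>2 / c)) * sqn (wt f)"
proof -
 have fh: "f holomorphic_on UNIV" and fL: "L2w \<phi> f" using f by (simp_all add: Fock_def)
 define F where "F z = 2 * cnj (deriv g z) * f z" for z
 have gc: "continuous_on UNIV g" "continuous_on UNIV (deriv g)" and fc: "continuous_on UNIV f"
  by (intro holomorphic_on_imp_continuous_on fh g holomorphic_deriv open_UNIV)+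
 have Fc: "continuous_on UNIV F" unfolding F_def by (intro continuous_intros gc fc)
 have lc: "continuous_on UNIV (\<lambda>z. (cmod (F z))\<^sup>2 * exp (- 2 * \<psi> z) / (pp z + qq z))"
  by (intro continuous_intros Fc psi_cont cont) (use lap_pos in \<open>simp add: less_imp_neq[symmetric]\<close>)
 have if': "integrable lborel (\<lambda>z. (cmod (wt f z))\<^sup>2)" using fL by (simp add: L2w_wt sqi_def)
 have pt: "(cmod (F z))\<^sup>2 * exp (- 2 * \<psi> z) / (pp z + qq z) \<le> (4 * B\<^sup>2 / c) * (cmod (wt f z))\<^sup>2" for z
 proof -
  have "(cmod (deriv g z) * \<rho> z)\<^sup>2 \<le> B\<^sup>2" using B[of z] rho_pos[of z] by (intro power_mono) auto
  then have 1: "(cmod (deriv g z))\<^sup>2 \<le> B\<^sup>2 / (\<rho> z)\<^sup>2" using rho_pos[of z] by (simp add: power_mult_distrib pos_le_divide_eq)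
  also have "\<dots> = (B\<^sup>2 / c) * (c / (\<rho> z)\<^sup>2)" using c_pos by simp
  also have "\<dots> \<le> (B\<^sup>2 / c) * (pp z + qq z)" using c_pos by (intro mult_left_mono lap_lower) simp
  finally have 2: "(cmod (deriv g z))\<^sup>2 \<le> (B\<^sup>2 / c) * (pp z + qq z)" .
  have "(cmod (F z))\<^sup>2 = 4 * (cmod (deriv g z))\<^sup>2 * (cmod (f z))\<^sup>2" by (simp add: F_def norm_mult power_mult_distrib)
  also have "\<dots> \<le> 4 * ((B\<^sup>2 / c) * (pp z + qq z)) * (cmod (f z))\<^sup>2" using 2 by (intro mult_right_mono mult_left_mono) auto
  finally have "(cmod (F z))\<^sup>2 * exp (- 2 * \<psi> z) / (pp z + qq z) \<le> (4 * ((B\<^sup>2 / c) * (pp z + qq z)) * (cmod (f z))\<^sup>2) * exp (- 2 * \<phi> z) / (pp z + qq z)"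
   using lap_pos[of z] c_pos exp_weights(1)[of z]
   by (intro divide_right_mono mult_mono) (auto intro!: divide_nonneg_nonneg mult_nonneg_nonneg simp: less_imp_le)
  also have "\<dots> = (4 * B\<^sup>2 / c) * (cmod (wt f z))\<^sup>2" using lap_pos[of z] by (simp add: cmod_wt)
  finally show ?thesis .
 qed
 have nn: "0 \<le> (cmod (F z))\<^sup>2 * exp (- 2 * \<psi> z) / (pp z + qq z)" for z using lap_pos[of z] by simp
 have I: "integrable lborel (\<lambda>z. (cmod (F z))\<^sup>2 * exp (- 2 * \<psi> z) / (pp z + qq z))"
 proof (rule Bochner_Integration.integrable_bound[OF integrable_mult_right[OF if', of "4 * B\<^sup>2 / c"]])
  show "(\<lambda>z. (cmod (F z))\<^sup>2 * exp (- 2 * \<psi> z) / (pp z + qq z)) \<in> borel_measurable lborel"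
   using borel_measurable_continuous_onI[OF lc] by simp
  show "AE z in lborel. norm ((cmod (F z))\<^sup>2 * exp (- 2 * \<psi> z) / (pp z + qq z)) \<le> norm (4 * B\<^sup>2 / c * (cmod (wt f z))\<^sup>2)"
   by (rule AE_I2) (use pt nn in \<open>simp only: real_norm_def abs_of_nonneg order_trans[OF nn pt]\<close>)
 qed
 have IB: "(\<integral>z. (cmod (F z))\<^sup>2 * exp (- 2 * \<psi> z) / (pp z + qq z) \<partial>lborel) \<le> (4 * B\<^sup>2 / c) * sqn (wt f)"
  unfolding sqn_def integral_mult_right_zero[symmetric] by (rule integral_mono[OF I integrable_mult_right[OF if'] pt])
 have "C1c (\<lambda>_. 1) (\<lambda>_. 0) (\<lambda>z. \<i> * 0 :: complex)" using C1c_entire[of "\<lambda>_. 1"] by simp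
 from hormander[OF weight lap_pos this C1c_mult[OF C1c_cnj[OF C1c_entire[OF g]] C1c_entire[OF fh]] _ Fc I IB]
 obtain h where h: "h holomorphic_on UNIV"
  "integrable lborel (\<lambda>z. (cmod (cnj (g z) * f z - h z))\<^sup>2 / ((cmod 1)\<^sup>2 * exp (2 * \<psi> z)))"
  "(\<integral>z. (cmod (cnj (g z) * f z - h z))\<^sup>2 / ((cmod 1)\<^sup>2 * exp (2 * \<psi> z)) \<partial>lborel) \<le> (4 * B\<^sup>2 / c) * sqn (wt f)"
  by (auto simp: F_def algebra_simps)
 let ?d = "\<lambda>z. cnj (g z) * f z - h z"
 have hc: "continuous_on UNIV h" by (rule holomorphic_on_imp_continuous_on[OF h(1)])
 have "continuous_on UNIV ?d" by (intro continuous_intros gc fc hc)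
 then have dm: "?d \<in> borel_measurable borel" by (rule borel_measurable_continuous_onI)
 then have wm: "wt ?d \<in> borel_measurable borel" by (simp add: wt_measurable)
 have le: "(cmod (wt ?d z))\<^sup>2 \<le> exp (2 * C) * ((cmod (?d z))\<^sup>2 / ((cmod 1)\<^sup>2 * exp (2 * \<psi> z)))" for z
  using mult_left_mono[OF exp_weights(2)[of z], of "(cmod (?d z))\<^sup>2"] unfolding cmod_wt by (simp add: exp_minus divide_inverse mult_ac)
 have i2: "integrable lborel (\<lambda>z. (cmod (wt ?d z))\<^sup>2)"
 proof (rule Bochner_Integration.integrable_bound[OF integrable_mult_right[OF h(2), of "exp (2 * C)"]])
  show "(\<lambda>z. (cmod (wt ?d z))\<^sup>2) \<in> borel_measurable lborel" using wm by simp
  show "AE z in lborel. norm ((cmod (wt ?d z))\<^sup>2) \<le> norm (exp (2 * C) * ((cmod (?d z))\<^sup>2 / ((cmod 1)\<^sup>2 * exp (2 * \<psi> z))))"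
   by (rule AE_I2) (use order_trans[OF le abs_ge_self] in simp)
 qed
 have "sqn (wt ?d) \<le> exp (2 * C) * (\<integral>z. (cmod (?d z))\<^sup>2 / ((cmod 1)\<^sup>2 * exp (2 * \<psi> z)) \<partial>lborel)"
  unfolding sqn_def integral_mult_right_zero[symmetric] by (rule integral_mono[OF i2 integrable_mult_right[OF h(2)] le])
 also have "\<dots> \<le> exp (2 * C) * ((4 * B\<^sup>2 / c) * sqn (wt f))" using h(3) by (intro mult_left_mono) auto
 finally have "sqn (wt ?d) \<le> (exp (2 * C) * (4 * B\<^sup>2 / c)) * sqn (wt f)" by (simp only: mult.assoc)
 moreover have "L2w \<phi> ?d" unfolding L2w_wt sqi_def using wm i2 by simp
 ultimately show ?thesis using h(1) by blast
qed

text \<open>Within \<rho> l / 2 of \<open>l\<close> the Lipschitz property keeps \<rho> above \<rho>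
  l / 2, so the Laplacian is at most 4C / (\<rho> l)^2 and the error of \<open>gauge\<close> at r =
  \<rho> l / 2 is scale free.\<close>

lemma gauge_at: "\<exists>H. H holomorphic_on ball l (\<rho> l / 8) \<and> H l = of_real (\<psi> l) \<and> (\<forall>z\<in>ball l (\<rho> l / 8). \<bar>\<psi> z - Re (H z)\<bar> \<le> C3 * C)"
proof -
 have "\<bar>pp v + qq v\<bar> \<le> 4 * C / (\<rho> l)\<^sup>2" if "cmod (v - l) < \<rho> l / 2" for v
 proof -
  have "\<rho> l / 2 \<le> \<rho> v" using rho_lip[of l v] that by (simp add: dist_norm)
  then have "(\<rho> l / 2)\<^sup>2 \<le> (\<rho> v)\<^sup>2" using rho_pos[of l] by (intro power_mono) auto
  then have "(pp v + qq v) * (\<rho> l / 2)\<^sup>2 \<le> (pp v + qq v) * (\<rho> v)\<^sup>2" using lap_pos[of v] by (intro mult_left_mono) auto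
  then have "(pp v + qq v) * (\<rho> l)\<^sup>2 \<le> 4 * C" using lap_le[of v] by (simp add: power_divide)
  then show ?thesis using lap_pos[of v] rho_pos[of l] by (simp add: pos_le_divide_eq)
 qed
 from gauge[where r="\<rho> l / 2" and l=l and B="4 * C / (\<rho> l)\<^sup>2", OF weight _ this]
 show ?thesis using rho_pos[of l] by (simp add: power_divide mult.commute mult.left_commute)
qed

end

section \<open>Entire peak functions with prescribed value at a point\<close>

context fock_regular
begin

text \<open>With R = K * \<rho> l and D = R^2 + |z - l|^2, the logarithm costs 2R^2/D^2, at most
  2/D, of the Laplacian. \<open>K\<close> comes from \<open>rho_sub\<close> with e = sqrt c / 2 and
  t = sqrt D: then (\<rho> z)^2 \<le> c D / 4, so at most half of the lower bound c / (\<rho> z)^2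
  is lost.\<close>

lemma log_weight:
 shows "\<exists>K\<ge>1. \<forall>l. \<exists>p' q' pp' qq'. weight (\<lambda>z. \<psi> z - ln ((K * \<rho> l)\<^sup>2 + (cmod (z - l))\<^sup>2) / 2) p' q' pp' qq' \<and> (\<forall>z. c / (2 * (\<rho> z)\<^sup>2) \<le> pp' z + qq' z)"
proof -
 have "sqrt c / 2 > 0" using c_pos by simp
 from rho_sub[OF this] obtain K where K: "K \<ge> 1" "\<And>z w t. t \<ge> K * \<rho> w ==> dist w z \<le> t ==> \<rho> z \<le> (sqrt c / 2) * t" by blast
 show ?thesis
 proof (intro exI[of _ K] conjI K(1) allI)
  fix l
  let ?R = "K * \<rho> l"
  have R: "?R > 0" using K(1) rho_pos[of l] by simp
  let ?D = "\<lambda>z. ?R\<^sup>2 + (cmod (z - l))\<^sup>2"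
  have D0: "?D z > 0" for z by (rule add_pos_nonneg[OF zero_less_power[OF R]]) simp
  have low: "c / (2 * (\<rho> z)\<^sup>2) \<le> (pp z - (1 / ?D z - 2 * ((z - l) \<bullet> 1)\<^sup>2 / (?D z)\<^sup>2)) + (qq z - (1 / ?D z - 2 * ((z - l) \<bullet> \<i>)\<^sup>2 / (?D z)\<^sup>2))" for z
  proof -
   define D where "D = ?D z"
   have Dp: "D > 0" using D0 by (simp add: D_def)
   have N: "((z - l) \<bullet> 1)\<^sup>2 + ((z - l) \<bullet> \<i>)\<^sup>2 = D - ?R\<^sup>2" unfolding D_def cmod_power2 by (simp add: inner_complex_def)
   have "(pp z - (1 / D - 2 * ((z - l) \<bullet> 1)\<^sup>2 / D\<^sup>2)) + (qq z - (1 / D - 2 * ((z - l) \<bullet> \<i>)\<^sup>2 / D\<^sup>2))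
     = (pp z + qq z) - (2 / D - 2 * (((z - l) \<bullet> 1)\<^sup>2 + ((z - l) \<bullet> \<i>)\<^sup>2) / D\<^sup>2)"
   proof -
    have "(a - (1 / D - 2 * x / D\<^sup>2)) + (b - (1 / D - 2 * y / D\<^sup>2)) = (a + b) - (2 / D - 2 * (x + y) / D\<^sup>2)" for a b x y :: real
     using Dp by (simp add: field_simps)
    then show ?thesis .
   qed
   also have "2 / D - 2 * (((z - l) \<bullet> 1)\<^sup>2 + ((z - l) \<bullet> \<i>)\<^sup>2) / D\<^sup>2 = 2 * ?R\<^sup>2 / D\<^sup>2" unfolding N using Dp by (simp add: field_simps power2_eq_square)
   finally have e: "(pp z - (1 / D - 2 * ((z - l) \<bullet> 1)\<^sup>2 / D\<^sup>2)) + (qq z - (1 / D - 2 * ((z - l) \<bullet> \<i>)\<^sup>2 / D\<^sup>2)) = (pp z + qq z) - 2 * ?R\<^sup>2 / D\<^sup>2" .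
   have RD: "?R\<^sup>2 \<le> D" by (simp add: D_def)
   have "\<rho> z \<le> (sqrt c / 2) * sqrt D"
   proof (rule K(2))
    show "K * \<rho> l \<le> sqrt D" by (rule real_le_rsqrt[OF RD])
    show "dist l z \<le> sqrt D" by (rule real_le_rsqrt) (simp add: D_def dist_norm norm_minus_commute)
   qed
   then have "(\<rho> z)\<^sup>2 \<le> ((sqrt c / 2) * sqrt D)\<^sup>2" using rho_pos[of z] by (intro power_mono) auto
   also have "\<dots> = c * D / 4" using c_pos Dp by (simp add: power_mult_distrib power_divide)
   finally have x1: "4 / D \<le> c / (\<rho> z)\<^sup>2" using rho_pos[of z] Dp by (simp add: field_simps)
   have x2: "2 * ?R\<^sup>2 / D\<^sup>2 \<le> 2 * D / D\<^sup>2" using RD by (intro divide_right_mono) auto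
   have x3: "2 * D / D\<^sup>2 = (4 / D) / 2" using Dp by (simp add: power2_eq_square)
   have x4: "c / (2 * (\<rho> z)\<^sup>2) = (c / (\<rho> z)\<^sup>2) / 2" by simp
   have "x / 2 \<le> y - v" if "f \<le> x" "v \<le> u" "u = f / 2" "x \<le> y" for f x y u v :: real using that by linarith
   from this[OF x1 x2 x3 lap_lower[of z]] show ?thesis unfolding D_def[symmetric] e x4 .
  qed
  show "\<exists>p' q' pp' qq'. weight (\<lambda>z. \<psi> z - ln ((K * \<rho> l)\<^sup>2 + (cmod (z - l))\<^sup>2) / 2) p' q' pp' qq' \<and> (\<forall>z. c / (2 * (\<rho> z)\<^sup>2) \<le> pp' z + qq' z)"
   using weight_minus_log[OF weight R, of l] low by blast
 qed
qed

text \<open>The factor \<open>1 / |z - l|\<^sup>2\<close> in the weighted estimate is not integrable at \<open>l\<close>, so the correction vanishes there.\<close>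

lemma vanishing_of_integrable:
 assumes a: "a holomorphic_on ball l r" and r: "r > 0" and R: "R > 0"
  and G: "integrable lborel (\<lambda>z. (cmod (a' z))\<^sup>2 / ((cmod (z - l))\<^sup>2 * exp (2 * (\<psi> z - ln (R\<^sup>2 + (cmod (z - l))\<^sup>2) / 2))))"
  and eq: "\<And>z. z \<in> ball l r ==> a' z = a z"
 shows "a l = 0"
proof -
 let ?G = "\<lambda>z. (cmod (a' z))\<^sup>2 / ((cmod (z - l))\<^sup>2 * exp (2 * (\<psi> z - ln (R\<^sup>2 + (cmod (z - l))\<^sup>2) / 2)))"
 have "compact (\<psi> ` cball l r)" by (rule compact_continuous_image[OF continuous_on_subset[OF psi_cont]]) auto
 from compact_imp_bounded[OF this] obtain S where "\<forall>x\<in>\<psi> ` cball l r. norm x \<le> S" unfolding bounded_iff by blast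
 then have "norm (\<psi> w) \<le> S" if "w \<in> cball l r" for w using that by blast
 then have S: "\<psi> w \<le> S" if "w \<in> cball l r" for w using that abs_le_D1 unfolding real_norm_def by blast
 define Q where "Q = exp (2 * S) / R\<^sup>2"
 have Q: "Q > 0" using R by (simp add: Q_def)
 define t where "t n = (r / 2) / real (Suc n)" for n
 have t: "t n > 0" "t n < r" for n using r by (auto simp: t_def field_simps add_pos_nonneg)
 have t0: "t \<longlonglongrightarrow> 0" unfolding t_def divide_inverse by (rule tendsto_mult_right_zero[OF LIMSEQ_inverse_real_of_nat])
 have iG: "integrable lborel (\<lambda>z. indicator (ball l s) z * ?G z)" for s
  using integrable_mult_indicator[OF _ G, of "ball l s"] by simp
 have G0: "0 \<le> ?G z" for z by simp
 \<comment> \<open>On the disc of radius \<open>t n\<close> the singular density is at least a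
   constant over (t n)^2 times |a|^2, which matches the area in the mean value bound; what is left
   is the integral of \<open>?G\<close> over shrinking discs.\<close>
 have main: "J3 * (cmod (a l))\<^sup>2 \<le> Q * (\<integral>z. indicator (ball l (t n)) z * ?G z \<partial>lborel)" for n
 proof -
  have "J3 * (t n)\<^sup>2 * (cmod (a l))\<^sup>2 \<le> (\<integral>z. (Q * (t n)\<^sup>2) * (indicator (ball l (t n)) z * ?G z) \<partial>lborel)"
  proof (rule holomorphic_sq_mean[OF a t integrable_mult_right[OF iG]])
   fix w assume w: "w \<noteq> l" "cmod (w - l) < t n"
   have wb: "w \<in> ball l (t n)" "w \<in> ball l r" using w t(2)[of n] by (auto simp: dist_norm norm_minus_commute)
   let ?N = "(cmod (w - l))\<^sup>2"
   have N: "0 < ?N" "?N \<le> (t n)\<^sup>2" using w by (auto intro: power_mono)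
   have D0: "R\<^sup>2 + ?N > 0" using R by (simp add: add_pos_nonneg)
   have "exp (2 * (\<psi> w - ln (R\<^sup>2 + ?N) / 2)) = exp (2 * \<psi> w) / (R\<^sup>2 + ?N)"
    using D0 by (simp add: right_diff_distrib exp_diff)
   then have Ge: "?G w = (cmod (a w))\<^sup>2 * ((R\<^sup>2 + ?N) / (?N * exp (2 * \<psi> w)))" using eq[OF wb(2)] by simp
   have "1 = (?N * exp (2 * \<psi> w) / (R\<^sup>2 + ?N)) * ((R\<^sup>2 + ?N) / (?N * exp (2 * \<psi> w)))" using N(1) D0 by simp
   also have "\<dots> \<le> (Q * (t n)\<^sup>2) * ((R\<^sup>2 + ?N) / (?N * exp (2 * \<psi> w)))"
   proof (rule mult_right_mono)
    have "\<psi> w \<le> S" by (rule S) (use wb in auto)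
    then have "?N * exp (2 * \<psi> w) / (R\<^sup>2 + ?N) \<le> (t n)\<^sup>2 * exp (2 * S) / R\<^sup>2"
     using N R by (intro frac_le mult_mono) auto
    then show "?N * exp (2 * \<psi> w) / (R\<^sup>2 + ?N) \<le> Q * (t n)\<^sup>2" by (simp add: Q_def mult.commute)
    show "0 \<le> (R\<^sup>2 + ?N) / (?N * exp (2 * \<psi> w))" using D0 by simp
   qed
   finally have k: "1 \<le> (Q * (t n)\<^sup>2) * ((R\<^sup>2 + ?N) / (?N * exp (2 * \<psi> w)))" .
   have "(cmod (a w))\<^sup>2 * 1 \<le> (cmod (a w))\<^sup>2 * ((Q * (t n)\<^sup>2) * ((R\<^sup>2 + ?N) / (?N * exp (2 * \<psi> w))))" by (rule mult_left_mono[OF k]) simp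
   also have "\<dots> = (Q * (t n)\<^sup>2) * ?G w" unfolding Ge by (simp only: mult_ac)
   finally show "(cmod (a w))\<^sup>2 \<le> (Q * (t n)\<^sup>2) * (indicator (ball l (t n)) w * ?G w)" using wb(1) by simp
  next
   show "0 \<le> (Q * (t n)\<^sup>2) * (indicator (ball l (t n)) w * ?G w)" for w using Q by (intro mult_nonneg_nonneg G0) auto
  qed
  then have "(t n)\<^sup>2 * (J3 * (cmod (a l))\<^sup>2) \<le> (t n)\<^sup>2 * (Q * (\<integral>z. indicator (ball l (t n)) z * ?G z \<partial>lborel))"
   unfolding integral_mult_right_zero by (simp only: mult_ac)
  then show ?thesis by (rule mult_left_le_imp_le) (use t(1)[of n] in simp)
 qed
 have "(\<lambda>n. \<integral>z. indicator (ball l (t n)) z * ?G z \<partial>lborel) \<longlonglongrightarrow> (\<integral>z. 0 \<partial>(lborel::complex measure))"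
 proof (rule integral_dominated_convergence[where w="?G"])
  show "(\<lambda>z. indicator (ball l (t n)) z * ?G z) \<in> borel_measurable lborel" for n using iG[of "t n"] by (rule borel_measurable_integrable)
  show "AE z in lborel. (\<lambda>n. indicator (ball l (t n)) z * ?G z) \<longlonglongrightarrow> 0"
  proof (rule AE_I2)
   fix z
   show "(\<lambda>n. indicator (ball l (t n)) z * ?G z) \<longlonglongrightarrow> 0"
   proof (cases "z = l")
    case False
    then have "cmod (z - l) > 0" by simp
    from order_tendstoD(2)[OF t0 this] have ev: "\<forall>\<^sub>F n in sequentially. indicator (ball l (t n)) z * ?G z = 0"
     by eventually_elim (simp add: dist_norm norm_minus_commute)
    show ?thesis by (rule tendsto_eventually[OF ev])
   qed simp
  qed
  show "AE z in lborel. norm (indicator (ball l (t n)) z * ?G z) \<le> ?G z" for n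
   by (rule AE_I2) (use G0 in \<open>simp add: indicator_def\<close>)
 qed (use G in simp_all)
 then have "(\<lambda>n. Q * (\<integral>z. indicator (ball l (t n)) z * ?G z \<partial>lborel)) \<longlonglongrightarrow> Q * 0" by (intro tendsto_mult tendsto_const) simp
 then have "J3 * (cmod (a l))\<^sup>2 \<le> Q * 0" by (rule LIMSEQ_le_const) (use main in blast)
 then have "(cmod (a l))\<^sup>2 \<le> 0" using J3_pos by (simp add: mult_le_0_iff)
 then show ?thesis by simp
qed

text \<open>The cutoff of exp H has its dbar derivative in an annulus of radius comparable to \<rho>
  l, where division by z - l costs only 1 / \<rho> l. With P = z - l in \<open>hormander\<close>,
  the correction vanishes at \<open>l\<close>, so the entire function keeps the exact value
  exp(\<psi> l) there.\<close>

lemma peak_function: "\<exists>A>0. \<forall>l. \<exists>f\<in>Fock \<phi>. f l = of_real (exp (\<psi> l)) \<and> sqn (wt f) \<le> A * (\<rho> l)\<^sup>2"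
proof -
 obtain K where K: "K \<ge> 1" and K2: "\<And>l. \<exists>p' q' pp' qq'. weight (\<lambda>z. \<psi> z - ln ((K * \<rho> l)\<^sup>2 + (cmod (z - l))\<^sup>2) / 2) p' q' pp' qq' \<and> (\<forall>z. c / (2 * (\<rho> z)\<^sup>2) \<le> pp' z + qq' z)"
  using log_weight by blast
 define S where "S = C3 * C"
 define V where "V = unit_ball_vol 2"
 have V: "V > 0" by (simp add: V_def)
 \<comment> \<open>This bounds the datum pointwise: 144 = 2 * (36 + 36) from 1/|z - l| \<le> 2/r and
   two cutoff derivatives, 16^4 from r = s/16, and 16 = 2 * 8 from the logarithmic factor and the
   halved Laplacian at doubled radius.\<close>
 define M1 where "M1 = 144\<^sup>2 * 16 ^ 4 * 16 * K\<^sup>2 * exp (2 * S) / c"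
 have M1: "M1 > 0" using K c_pos by (simp add: M1_def)
 define A where "A = exp (2 * C) * (2 * (exp (2 * S) * V) + 2 * (M1 * V))"
 have "A > 0" using V M1 unfolding A_def by (intro mult_pos_pos add_pos_pos) auto
 moreover have "\<exists>f\<in>Fock \<phi>. f l = of_real (exp (\<psi> l)) \<and> sqn (wt f) \<le> A * (\<rho> l)\<^sup>2" for l
 proof -
  define s where "s = \<rho> l"
  have s: "s > 0" by (simp add: s_def rho_pos)
  define R where "R = K * s"
  have R: "R > 0" "s \<le> R" using K s by (auto simp: R_def)
  obtain p' q' pp' qq' where w': "weight (\<lambda>z. \<psi> z - ln (R\<^sup>2 + (cmod (z - l))\<^sup>2) / 2) p' q' pp' qq'"
   and lap': "\<And>z. c / (2 * (\<rho> z)\<^sup>2) \<le> pp' z + qq' z" using K2[of l] unfolding R_def s_def by blast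
  let ?\<psi> = "\<lambda>z. \<psi> z - ln (R\<^sup>2 + (cmod (z - l))\<^sup>2) / 2"
  have lap0: "pp' z + qq' z > 0" for z
   using lap'[of z] divide_pos_pos[OF c_pos, of "2 * (\<rho> z)\<^sup>2"] rho_pos[of z] by simp
  obtain H where H: "H holomorphic_on ball l (s / 8)" "H l = of_real (\<psi> l)" "\<And>z. z \<in> ball l (s / 8) ==> \<bar>\<psi> z - Re (H z)\<bar> \<le> S"
   using gauge_at[of l] unfolding s_def S_def by blast
  define r where "r = s / 16"
  have r: "r > 0" "r < s / 8" "r \<le> s" using s by (auto simp: r_def)
  let ?X = "\<lambda>z. cutoff r (z - l)" and ?Xx = "\<lambda>e z. dcutoff e r (z - l)"
  let ?g = "\<lambda>z. exp (H z)"
  have g: "?g holomorphic_on ball l (s / 8)" by (intro holomorphic_intros H(1))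
  have X: "C1c ?X (?Xx 1) (?Xx \<i>)" by (rule C1c_translate[OF cutoff_C1c[OF r(1)]])
  have X0: "?X z = 0 \<and> ?Xx 1 z = 0 \<and> ?Xx \<i> z = 0" if "cmod (z - l) \<ge> r" for z using cutoff_0[OF r(1) that] by simp
  let ?v = "\<lambda>z. of_real (?X z) * ?g z"
  note v = C1c_cut_holomorphic[OF X X0 g r(2)]
  define Y where "Y z = complex_of_real (?Xx 1 z) + \<i> * of_real (?Xx \<i> z)" for z
  \<comment> \<open>The smoothed kernel equals 1/(z - l) wherever \<open>Y\<close> is nonzero, and
    keeps \<open>F\<close> visibly continuous at \<open>l\<close>.\<close>
  define F where "F z = cker (r/2) (z - l) * (Y z * ?g z)" for z
  have Y0: "Y z = 0" if "cmod (z - l) \<ge> r \<or> cmod (z - l) \<le> r/2" for z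
   using that cutoff_0(2)[OF r(1), of "z - l"] cutoff_1(2)[OF r(1), of "z - l"] by (auto simp: Y_def)
  have Yc: "continuous_on UNIV Y" unfolding Y_def
   using X unfolding C1c_def by (intro continuous_on_add continuous_on_mult continuous_on_const continuous_on_of_real) blast+
  have kc: "continuous_on UNIV (\<lambda>z. cker (r/2) (z - l))"
  proof -
   have "r/2 > 0" using r(1) by simp
   from C1c_translate[OF cker_C1[OF this], of l] show ?thesis unfolding C1c_def by blast
  qed
  have Fc: "continuous_on UNIV F" unfolding F_def
   by (rule continuous_on_mult[OF kc continuous_on_cut_mult[OF Yc Y0 holomorphic_on_imp_continuous_on[OF g] r(2)]]) simp
  have vF: "(of_real (?X z) * deriv ?g z + of_real (?Xx 1 z) * ?g z) + \<i> * (of_real (?X z) * (\<i> * deriv ?g z) + of_real (?Xx \<i> z) * ?g z) = (z - l) * F z" for z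
  proof -
   have "(of_real (?X z) * deriv ?g z + of_real (?Xx 1 z) * ?g z) + \<i> * (of_real (?X z) * (\<i> * deriv ?g z) + of_real (?Xx \<i> z) * ?g z) = Y z * ?g z"
   proof -
    have "(x * d + a * e) + \<i> * (x * (\<i> * d) + b * e) = (a + \<i> * b) * e" for x d a b e
     by (simp add: complex_eq_iff algebra_simps)
    then show ?thesis unfolding Y_def .
   qed
   also have "\<dots> = (z - l) * F z"
   proof (cases "cmod (z - l) \<le> r/2")
    case True
    then show ?thesis using Y0[of z] by (simp add: F_def)
   next
    case False
    then have "cker (r/2) (z - l) = inverse (z - l)" "z \<noteq> l" using r(1) by (auto intro: cker_far)
    then show ?thesis by (simp add: F_def)
   qed
   finally show ?thesis .
  qed
  have ex: "exp (- 2 * ?\<psi> z) = exp (- 2 * \<psi> z) * (R\<^sup>2 + (cmod (z - l))\<^sup>2)" for z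
  proof -
   have "R\<^sup>2 + (cmod (z - l))\<^sup>2 > 0" using R by (simp add: add_pos_nonneg)
   moreover have "- 2 * ?\<psi> z = - 2 * \<psi> z + ln (R\<^sup>2 + (cmod (z - l))\<^sup>2)" by simp
   ultimately show ?thesis by (simp only: exp_add exp_ln)
  qed
  have H2: "exp (2 * Re (H z)) * exp (- 2 * \<psi> z) \<le> exp (2 * S)" if "cmod (z - l) < r" for z
  proof -
   have "z \<in> ball l (s/8)" using that r(2) by (simp add: dist_norm norm_minus_commute)
   then have "2 * Re (H z) + - 2 * \<psi> z \<le> 2 * S" using H(3)[of z] by linarith
   then show ?thesis unfolding exp_add[symmetric] exp_le_cancel_iff .
  qed
  have pt: "(cmod (F z))\<^sup>2 * exp (- 2 * ?\<psi> z) / (pp' z + qq' z) \<le> indicator (ball l r) z * M1" for z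
  proof (cases "cmod (z - l) < r \<and> cmod (z - l) > r/2")
   case True
   have "cmod (Y z) \<le> 36 / r + 36 / r"
    unfolding Y_def by (rule norm_triangle_le) (use dcutoff_bound[OF r(1), of 1 "z - l"] dcutoff_bound[OF r(1), of \<i> "z - l"] in \<open>simp add: norm_mult\<close>)
   moreover have "cmod (cker (r/2) (z - l)) \<le> 2 / r"
   proof -
    have zp: "cmod (z - l) > 0" using True r(1) by linarith
    have "1 / cmod (z - l) \<le> 1 / (r/2)" by (rule divide_left_mono[OF _ _ mult_pos_pos[OF zp]]) (use True r(1) in simp_all)
    then show ?thesis using cker_bound[of "r/2" "z - l"] by simp
   qed
   ultimately have "cmod (F z) \<le> (2 / r) * ((72 / r) * exp (Re (H z)))"
    unfolding F_def norm_mult using r(1) by (intro mult_mono) auto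
   also have "(2 / r) * ((72 / r) * exp (Re (H z))) = (144 / r\<^sup>2) * exp (Re (H z))" by (simp add: power2_eq_square)
   finally have "(cmod (F z))\<^sup>2 \<le> ((144 / r\<^sup>2) * exp (Re (H z)))\<^sup>2" by (rule power_mono) simp
   then have 1: "(cmod (F z))\<^sup>2 \<le> (144 / r\<^sup>2)\<^sup>2 * exp (2 * Re (H z))" unfolding power_mult_distrib exp_double .
   have "(cmod (z - l))\<^sup>2 \<le> R\<^sup>2" using True r(3) R by (intro power_mono) auto
   then have 2: "R\<^sup>2 + (cmod (z - l))\<^sup>2 \<le> 2 * R\<^sup>2" by simp
   have "(\<rho> z)\<^sup>2 \<le> (2 * s)\<^sup>2" using rho_lip[of z l] True r rho_pos[of z] by (intro power_mono) (auto simp: s_def dist_norm norm_minus_commute)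
   then have "c / (2 * (2 * s)\<^sup>2) \<le> c / (2 * (\<rho> z)\<^sup>2)" using c_pos rho_pos[of z] s by (intro divide_left_mono) auto
   then have 3: "c / (8 * s\<^sup>2) \<le> pp' z + qq' z" using lap'[of z] by (simp add: power_mult_distrib)
   have "(cmod (F z))\<^sup>2 * exp (- 2 * ?\<psi> z) / (pp' z + qq' z) \<le> ((144 / r\<^sup>2)\<^sup>2 * exp (2 * Re (H z))) * (exp (- 2 * \<psi> z) * (2 * R\<^sup>2)) / (c / (8 * s\<^sup>2))"
    unfolding ex using 1 2 3 c_pos s lap0[of z] by (intro frac_le mult_mono) auto
   also have "\<dots> = ((144 / r\<^sup>2)\<^sup>2 * (2 * R\<^sup>2) / (c / (8 * s\<^sup>2))) * (exp (2 * Re (H z)) * exp (- 2 * \<psi> z))" by (simp only: mult_ac times_divide_eq_left times_divide_eq_right)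
   also have "\<dots> \<le> ((144 / r\<^sup>2)\<^sup>2 * (2 * R\<^sup>2) / (c / (8 * s\<^sup>2))) * exp (2 * S)" using H2[of z] True c_pos by (intro mult_left_mono) auto
   also have "\<dots> = M1" unfolding M1_def r_def R_def using s c_pos by (simp add: field_simps power2_eq_square power4_eq_xxxx)
   finally show ?thesis using True by (simp add: dist_norm norm_minus_commute)
  next
   case False
   then have "F z = 0" using Y0[of z] by (auto simp: F_def)
   then show ?thesis using M1 by (simp add: indicator_def)
  qed
  have wc: "continuous_on UNIV ?\<psi>" "continuous_on UNIV pp'" "continuous_on UNIV qq'" using w' unfolding weight_def C1c_def by blast+
  have lc: "continuous_on UNIV (\<lambda>z. (cmod (F z))\<^sup>2 * exp (- 2 * ?\<psi> z) / (pp' z + qq' z))"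
   by (rule continuous_on_divide[OF continuous_on_mult[OF continuous_on_power[OF continuous_on_norm[OF Fc]] continuous_on_exp[OF continuous_on_mult[OF continuous_on_const wc(1)]]] continuous_on_add[OF wc(2,3)]])
     (use lap0 in \<open>simp add: less_imp_neq[symmetric]\<close>)
  note iM = integrable_indicator_ball[of r l M1, OF less_imp_le[OF r(1)]]
  have I: "integrable lborel (\<lambda>z. (cmod (F z))\<^sup>2 * exp (- 2 * ?\<psi> z) / (pp' z + qq' z))"
  proof (rule Bochner_Integration.integrable_bound[OF iM(1)])
   show "(\<lambda>z. (cmod (F z))\<^sup>2 * exp (- 2 * ?\<psi> z) / (pp' z + qq' z)) \<in> borel_measurable lborel"
    using borel_measurable_continuous_onI[OF lc] by (simp only: measurable_lborel2)
   have "0 \<le> (cmod (F z))\<^sup>2 * exp (- 2 * ?\<psi> z) / (pp' z + qq' z)" for z using lap0[of z] by (intro divide_nonneg_pos mult_nonneg_nonneg) auto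
   then show "AE z in lborel. norm ((cmod (F z))\<^sup>2 * exp (- 2 * ?\<psi> z) / (pp' z + qq' z)) \<le> norm (indicator (ball l r) z * M1)"
    by (intro AE_I2) (unfold real_norm_def, rule order_trans[OF eq_refl[OF abs_of_nonneg] order_trans[OF pt abs_ge_self]])
  qed
  have IB: "(\<integral>z. (cmod (F z))\<^sup>2 * exp (- 2 * ?\<psi> z) / (pp' z + qq' z) \<partial>lborel) \<le> M1 * V * r\<^sup>2"
   using integral_mono[OF I iM(1) pt] unfolding iM(2) V_def .
  have "deriv (\<lambda>z. z - l) = (\<lambda>_. 1)" by (rule ext, rule DERIV_imp_deriv) (auto intro!: derivative_eq_intros)
  moreover have "(\<lambda>z. z - l) holomorphic_on UNIV" by (intro holomorphic_intros)
  ultimately have P: "C1c (\<lambda>z. z - l) (\<lambda>_. 1) (\<lambda>z. \<i> * 1)" using C1c_entire[of "\<lambda>z. z - l"] by simp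
  obtain h where h: "h holomorphic_on UNIV"
   "integrable lborel (\<lambda>z. (cmod (?v z - h z))\<^sup>2 / ((cmod (z - l))\<^sup>2 * exp (2 * ?\<psi> z)))"
   "(\<integral>z. (cmod (?v z - h z))\<^sup>2 / ((cmod (z - l))\<^sup>2 * exp (2 * ?\<psi> z)) \<partial>lborel) \<le> M1 * V * r\<^sup>2"
   using hormander[OF w' lap0 P v vF Fc I IB] by blast
  let ?G = "\<lambda>z. (cmod (?v z - h z))\<^sup>2 / ((cmod (z - l))\<^sup>2 * exp (2 * ?\<psi> z))"
  have "exp (H l) - h l = 0"
  proof (rule vanishing_of_integrable[OF _ _ R(1) h(2)])
   show "(\<lambda>z. exp (H z) - h z) holomorphic_on ball l (r/2)"
    by (intro holomorphic_on_diff holomorphic_on_subset[OF g] holomorphic_on_subset[OF h(1)]) (use r in auto)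
   show "?v z - h z = exp (H z) - h z" if "z \<in> ball l (r/2)" for z
    using cutoff_1(1)[OF r(1), of "z - l"] that by (simp add: dist_norm norm_minus_commute)
  qed (use r in simp)
  then have val: "h l = of_real (exp (\<psi> l))" by (simp add: H(2) exp_of_real)
  have hm: "wt h \<in> borel_measurable borel" unfolding wt_measurable
   by (rule borel_measurable_continuous_onI[OF holomorphic_on_imp_continuous_on[OF h(1)]])
  let ?B = "\<lambda>z. exp (2 * C) * (indicator (ball l r) z * (2 * exp (2 * S)) + 2 * ?G z)"
  have le: "(cmod (wt h z))\<^sup>2 \<le> ?B z" if zl: "z \<noteq> l" for z
  proof -
   have N: "(cmod (z - l))\<^sup>2 > 0" using zl by simp
   have "(cmod (h z))\<^sup>2 \<le> (cmod (?v z) + cmod (?v z - h z))\<^sup>2" using norm_triangle_ineq4[of "?v z" "?v z - h z"] by (intro power_mono) auto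
   also have "\<dots> \<le> 2 * (cmod (?v z))\<^sup>2 + 2 * (cmod (?v z - h z))\<^sup>2" using two_mult_le[of "cmod (?v z)" "cmod (?v z - h z)"] by (simp add: power2_sum)
   finally have a0: "(cmod (h z))\<^sup>2 * exp (- 2 * \<psi> z) \<le> (2 * (cmod (?v z))\<^sup>2 + 2 * (cmod (?v z - h z))\<^sup>2) * exp (- 2 * \<psi> z)" by (rule mult_right_mono) simp
   have a1: "(2 * (cmod (?v z))\<^sup>2 + 2 * (cmod (?v z - h z))\<^sup>2) * exp (- 2 * \<psi> z) = 2 * ((cmod (?v z))\<^sup>2 * exp (- 2 * \<psi> z)) + 2 * ((cmod (?v z - h z))\<^sup>2 * exp (- 2 * \<psi> z))" by (simp only: distrib_right mult.assoc)
   have a2: "(cmod (?v z))\<^sup>2 * exp (- 2 * \<psi> z) \<le> indicator (ball l r) z * exp (2 * S)"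
   proof (cases "cmod (z - l) < r")
    case True
    have "(cmod (?v z))\<^sup>2 \<le> 1 * (cmod (?g z))\<^sup>2" unfolding norm_mult power_mult_distrib norm_of_real
     using cutoff_range[of r "z - l"] by (intro mult_right_mono) (auto simp: power_le_one_iff)
    then have "(cmod (?v z))\<^sup>2 \<le> exp (2 * Re (H z))" by (simp add: exp_double)
    then have x: "(cmod (?v z))\<^sup>2 * exp (- 2 * \<psi> z) \<le> exp (2 * Re (H z)) * exp (- 2 * \<psi> z)" by (rule mult_right_mono) simp
    have ind: "indicator (ball l r) z = (1::real)" using True by (simp add: dist_norm norm_minus_commute)
    show ?thesis unfolding ind mult_1 by (rule order_trans[OF x H2[OF True]])
   next
    case False
    then show ?thesis using X0[of z] by simp
   qed
   \<comment> \<open>Here the subtracted logarithm is cashed in: R^2 + |z - l|^2 dominates |z -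
     l|^2, so the norm from \<open>hormander\<close> dominates the plain weighted one.\<close>
   have a3: "(cmod (?v z - h z))\<^sup>2 * exp (- 2 * \<psi> z) \<le> ?G z"
   proof -
    have e: "exp (2 * ?\<psi> z) = exp (2 * \<psi> z) / (R\<^sup>2 + (cmod (z - l))\<^sup>2)"
    proof -
     have "R\<^sup>2 + (cmod (z - l))\<^sup>2 > 0" using R(1) by (simp add: add_pos_nonneg)
     then show ?thesis by (simp add: right_diff_distrib exp_diff)
    qed
    have "1 \<le> (R\<^sup>2 + (cmod (z - l))\<^sup>2) / (cmod (z - l))\<^sup>2" using N by (subst pos_le_divide_eq) auto
    from mult_left_mono[OF this, of "(cmod (?v z - h z))\<^sup>2 * exp (- 2 * \<psi> z)"]
    have "(cmod (?v z - h z))\<^sup>2 * exp (- 2 * \<psi> z) \<le> ((cmod (?v z - h z))\<^sup>2 * exp (- 2 * \<psi> z)) * ((R\<^sup>2 + (cmod (z - l))\<^sup>2) / (cmod (z - l))\<^sup>2)"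
     by simp
    also have "\<dots> = ?G z"
    proof -
     have gen: "x * i * (d / n) = x / (n * (e / d))" if "i = inverse e" for x i d n e :: real
      unfolding that by (simp add: divide_inverse mult_ac)
     have "exp (- 2 * \<psi> z) = inverse (exp (2 * \<psi> z))" using exp_minus[of "2 * \<psi> z"] by simp
     from gen[OF this] show ?thesis unfolding e .
    qed
    finally show ?thesis .
   qed
   have gen: "x \<le> i * (2 * e) + 2 * g" if "x \<le> y" "y = 2 * a + 2 * b" "a \<le> i * e" "b \<le> g" for x y a b i e g :: real
   proof -
    have "i * (2 * e) = 2 * (i * e)" by simp
    then show ?thesis using that by linarith
   qed
   from gen[OF a0 a1 a2 a3] have "(cmod (h z))\<^sup>2 * exp (- 2 * \<psi> z) \<le> indicator (ball l r) z * (2 * exp (2 * S)) + 2 * ?G z" .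
   then have b1: "exp (2 * C) * ((cmod (h z))\<^sup>2 * exp (- 2 * \<psi> z)) \<le> ?B z" by (rule mult_left_mono) simp
   have b2: "(cmod (wt h z))\<^sup>2 \<le> exp (2 * C) * ((cmod (h z))\<^sup>2 * exp (- 2 * \<psi> z))"
    unfolding cmod_wt using mult_left_mono[OF exp_weights(2)[of z], of "(cmod (h z))\<^sup>2"] by (simp add: mult_ac)
   show ?thesis by (rule order_trans[OF b2 b1])
  qed
  note iS = integrable_indicator_ball[of r l "2 * exp (2 * S)", OF less_imp_le[OF r(1)]]
  note iG = integrable_mult_right[OF h(2), of 2]
  have iB: "integrable lborel ?B" by (rule integrable_mult_right[OF Bochner_Integration.integrable_add[OF iS(1) iG]])
  have AE: "AE z in lborel. (cmod (wt h z))\<^sup>2 \<le> ?B z"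
   by (rule AE_mp[OF AE_lborel_singleton[of l]], rule AE_I2, rule impI, rule le)
  have i: "integrable lborel (\<lambda>z. (cmod (wt h z))\<^sup>2)"
  proof (rule Bochner_Integration.integrable_bound[OF iB])
   show "(\<lambda>z. (cmod (wt h z))\<^sup>2) \<in> borel_measurable lborel" using hm by simp
   show "AE z in lborel. norm ((cmod (wt h z))\<^sup>2) \<le> norm (?B z)"
    using AE by eventually_elim (unfold real_norm_def, rule order_trans[OF eq_refl[OF abs_of_nonneg] order_trans[OF _ abs_ge_self]], simp_all)
  qed
  have "sqn (wt h) \<le> (\<integral>z. ?B z \<partial>lborel)" unfolding sqn_def by (rule integral_mono_AE[OF i iB AE])
  also have "\<dots> = exp (2 * C) * (2 * exp (2 * S) * V * r\<^sup>2 + 2 * (\<integral>z. ?G z \<partial>lborel))"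
   unfolding integral_mult_right_zero Bochner_Integration.integral_add[OF iS(1) iG] iS(2) V_def ..
  also have "\<dots> \<le> exp (2 * C) * (2 * exp (2 * S) * V * r\<^sup>2 + 2 * (M1 * V * r\<^sup>2))"
   using h(3) by (intro mult_left_mono add_left_mono) auto
  also have "\<dots> = A * r\<^sup>2" unfolding A_def by (simp add: algebra_simps)
  also have "\<dots> \<le> A * s\<^sup>2" using \<open>A > 0\<close> r by (intro mult_left_mono power_mono) auto
  finally have fin: "sqn (wt h) \<le> A * (\<rho> l)\<^sup>2" unfolding s_def .
  have "L2w \<phi> h" unfolding L2w_wt sqi_def using hm i by simp
  then have "h \<in> Fock \<phi>" using h(1) by (simp add: Fock_def)
  then show ?thesis using val fin by blast
 qed
 ultimately show ?thesis by blast
qed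

end

section \<open>Lower bounds for the normalized kernel and necessity\<close>

context fock_regular
begin

text \<open>The peak function f gives K(l,l) \<ge> |f l|^2 / ||f||^2, by Cauchy-Schwarz in the
  reproducing formula. In particular K(l,l) > 0, which the normalization needs, and |nk l|^2 at
  \<open>l\<close> is K(l,l).\<close>

lemma nk_lower: "\<exists>A>0. \<forall>l. sqn (wt (nk \<phi> l)) = 1 \<and> exp (2 * \<psi> l) \<le> A * (\<rho> l)\<^sup>2 * (cmod (nk \<phi> l l))\<^sup>2"
proof -
 obtain A where A: "A > 0" "\<And>l. \<exists>f\<in>Fock \<phi>. f l = of_real (exp (\<psi> l)) \<and> sqn (wt f) \<le> A * (\<rho> l)\<^sup>2" using peak_function by blast
 have "sqn (wt (nk \<phi> l)) = 1 \<and> exp (2 * \<psi> l) \<le> A * (\<rho> l)\<^sup>2 * (cmod (nk \<phi> l l))\<^sup>2" for l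
 proof -
  let ?K = "bergman \<phi> l"
  define x where "x = sqn (wt ?K)"
  have Kl: "?K l = of_real x" unfolding x_def wip_self[symmetric] by (rule bergman(2)[OF bergman(1)])
  obtain f where f: "f \<in> Fock \<phi>" "f l = of_real (exp (\<psi> l))" "sqn (wt f) \<le> A * (\<rho> l)\<^sup>2" using A(2) by blast
  have "f l = ip (wt f) (wt ?K)" using bergman(2)[OF f(1), of l] by (simp add: wip_wt)
  then have "(cmod (f l))\<^sup>2 \<le> sqn (wt f) * x"
   using ip_cauchy_schwarz[of "wt f" "wt ?K"] Fock_L2w[OF f(1)] Fock_L2w[OF bergman(1)] unfolding L2w_wt x_def by simp
  also have "\<dots> \<le> A * (\<rho> l)\<^sup>2 * x" using f(3) by (rule mult_right_mono) (simp add: x_def)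
  finally have le: "exp (2 * \<psi> l) \<le> A * (\<rho> l)\<^sup>2 * x" unfolding f(2) by (simp add: exp_double)
  then have "0 < A * (\<rho> l)\<^sup>2 * x" by (rule less_le_trans[OF exp_gt_zero])
  moreover have "x \<ge> 0" by (simp add: x_def)
  ultimately have x: "x > 0" by (cases "x = 0") auto
  have nk: "nk \<phi> l z = ?K z / of_real (sqrt x)" for z by (simp add: nk_def Kl)
  have "cmod (nk \<phi> l l) = x / sqrt x" unfolding nk Kl norm_divide norm_of_real using x by simp
  then have v: "(cmod (nk \<phi> l l))\<^sup>2 = x" using x by (simp add: real_div_sqrt)
  have "(cmod (wt (nk \<phi> l) z))\<^sup>2 = (cmod (wt ?K z))\<^sup>2 / x" for z
   unfolding cmod_wt nk norm_divide norm_of_real power_divide using x by simp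
  then have "sqn (wt (nk \<phi> l)) = x / x" unfolding sqn_def x_def by simp
  then show ?thesis using le x v by simp
 qed
 then show ?thesis using A(1) by blast
qed

text \<open>In the gauge, q = nk * exp(-H) is holomorphic and bounded by a constant over \<rho> l
  because nk has norm one; Cauchy's inequality bounds its derivative by a constant over (\<rho>
  l)^2. As |q l| is at least a constant over \<rho> l, q cannot lose more than half of it on a small
  multiple of \<rho> l.\<close>

lemma nk_local_lower:
 "\<exists>\<eta>>0. \<exists>a>0. \<forall>l z. cmod (z - l) < \<eta> * \<rho> l \<longrightarrow> exp (2 * \<psi> z) \<le> a * (\<rho> l)\<^sup>2 * (cmod (nk \<phi> l z))\<^sup>2"
proof -
 obtain A where A: "A > 0" and nk1: "\<And>l. sqn (wt (nk \<phi> l)) = 1"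
  and nkl: "\<And>l. exp (2 * \<psi> l) \<le> A * (\<rho> l)\<^sup>2 * (cmod (nk \<phi> l l))\<^sup>2" using nk_lower by blast
 define S where "S = C3 * C"
 define Mq where "Mq = sqrt (1024 * exp (2 * S) / J3)"
 have Mq: "Mq > 0" using J3_pos by (simp add: Mq_def)
 \<comment> \<open>With 64 * Mq / s^2 bounding the derivative of q, a distance below s / (128 * Mq *
   sqrt A) changes q by at most half of the lower bound 1 / (sqrt A * s).\<close>
 define \<eta> where "\<eta> = min (1/32) (1 / (128 * Mq * sqrt A))"
 have eta: "\<eta> > 0" "\<eta> \<le> 1/32" "\<eta> \<le> 1 / (128 * Mq * sqrt A)" using Mq A by (auto simp: \<eta>_def)
 define a where "a = 4 * A * exp (2 * S)"
 have a: "a > 0" using A by (simp add: a_def)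
 have "exp (2 * \<psi> z) \<le> a * (\<rho> l)\<^sup>2 * (cmod (nk \<phi> l z))\<^sup>2" if zl: "cmod (z - l) < \<eta> * \<rho> l" for l z
 proof -
  define s where "s = \<rho> l"
  have s: "s > 0" by (simp add: s_def rho_pos)
  obtain H where H: "H holomorphic_on ball l (s / 8)" "H l = of_real (\<psi> l)" "\<And>z. z \<in> ball l (s / 8) ==> \<bar>\<psi> z - Re (H z)\<bar> \<le> S"
   using gauge_at[of l] unfolding s_def S_def by blast
  have kh: "nk \<phi> l holomorphic_on UNIV" using nk_Fock by (simp add: Fock_def)
  define q where "q z = nk \<phi> l z * exp (- H z)" for z
  have qh: "q holomorphic_on ball l (s / 8)" unfolding q_def
   by (intro holomorphic_on_mult holomorphic_on_subset[OF kh] holomorphic_on_exp' holomorphic_on_minus H(1)) auto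
  have qn: "(cmod (q z))\<^sup>2 = (cmod (nk \<phi> l z))\<^sup>2 * exp (- 2 * Re (H z))" for z
   unfolding q_def norm_mult power_mult_distrib by (simp add: exp_double[symmetric])
  have ik: "integrable lborel (\<lambda>w. exp (2 * S) * (cmod (wt (nk \<phi> l) w))\<^sup>2)"
   using Fock_L2w[OF nk_Fock[of l]] unfolding L2w_wt sqi_def by (intro integrable_mult_right) simp
  have up: "cmod (q z) \<le> Mq / s" if z: "z \<in> ball l (s/16)" for z
  proof -
   have sub: "ball z (s/16) \<subseteq> ball l (s/8)"
   proof
    fix w assume "w \<in> ball z (s/16)"
    then show "w \<in> ball l (s/8)" using z dist_triangle[of l w z] by simp
   qed
   have "J3 * (s/32)\<^sup>2 * (cmod (q z))\<^sup>2 \<le> (\<integral>w. exp (2 * S) * (cmod (wt (nk \<phi> l) w))\<^sup>2 \<partial>lborel)"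
   proof (rule holomorphic_sq_mean[OF holomorphic_on_subset[OF qh sub] _ _ ik])
    fix w assume w: "cmod (w - z) < s/32"
    have "w \<in> ball z (s/16)" using w s by (simp add: dist_norm norm_minus_commute)
    then have "w \<in> ball l (s/8)" using sub by blast
    from H(3)[OF this] have "- 2 * Re (H w) \<le> 2 * S + - 2 * \<psi> w" by linarith
    then have "exp (- 2 * Re (H w)) \<le> exp (2 * S) * exp (- 2 * \<psi> w)" unfolding exp_add[symmetric] exp_le_cancel_iff .
    also have "\<dots> \<le> exp (2 * S) * exp (- 2 * \<phi> w)" using exp_weights(1)[of w] by (intro mult_left_mono) auto
    finally have "(cmod (nk \<phi> l w))\<^sup>2 * exp (- 2 * Re (H w)) \<le> (cmod (nk \<phi> l w))\<^sup>2 * (exp (2 * S) * exp (- 2 * \<phi> w))" by (rule mult_left_mono) simp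
    then show "(cmod (q w))\<^sup>2 \<le> exp (2 * S) * (cmod (wt (nk \<phi> l) w))\<^sup>2" unfolding qn cmod_wt by (simp only: mult_ac)
   qed (use s in auto)
   also have "\<dots> = exp (2 * S)" using nk1[of l] unfolding integral_mult_right_zero sqn_def by simp
   finally have "(cmod (q z))\<^sup>2 \<le> (1024 * exp (2 * S) / J3) / s\<^sup>2" using s J3_pos by (simp add: field_simps power2_eq_square)
   also have "\<dots> = (Mq / s)\<^sup>2" using J3_pos by (simp add: Mq_def power_divide)
   finally show ?thesis by (rule power2_le_imp_le) (use Mq s in simp)
  qed
  have dq: "cmod (deriv q z) \<le> 64 * Mq / s\<^sup>2" if z: "z \<in> ball l (s/32)" for z
  proof -
   have sub: "w \<in> ball l (s/16)" if "dist z w \<le> s/64" for w using z that dist_triangle[of l w z] s by simp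
   have sub2: "cball z (s/64) \<subseteq> ball l (s/8)"
   proof
    fix w assume "w \<in> cball z (s/64)"
    then show "w \<in> ball l (s/8)" using sub[of w] s by simp
   qed
   have "cmod ((deriv ^^ 1) q z) \<le> fact 1 * (Mq / s) / (s/64) ^ 1"
   proof (rule Cauchy_inequality)
    show "q holomorphic_on ball z (s/64)" by (rule holomorphic_on_subset[OF qh]) (use sub2 ball_subset_cball in blast)
    show "continuous_on (cball z (s/64)) q" by (rule holomorphic_on_imp_continuous_on[OF holomorphic_on_subset[OF qh sub2]])
    show "cmod (q w) \<le> Mq / s" if "cmod (z - w) = s/64" for w by (rule up[OF sub]) (use that in \<open>simp add: dist_norm\<close>)
   qed (use s in simp)
   then show ?thesis using s by (simp add: field_simps power2_eq_square)
  qed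
  have zb: "z \<in> ball l (s/32)"
  proof -
   have "\<eta> * s \<le> (1/32) * s" using eta(2) s by (intro mult_right_mono) auto
   then show ?thesis using zl unfolding s_def[symmetric] by (simp add: dist_norm norm_minus_commute)
  qed
  have lb: "l \<in> ball l (s/32)" using s by simp
  have "cmod (q z - q l) \<le> 64 * Mq / s\<^sup>2 * cmod (z - l)"
  proof (rule field_differentiable_bound[OF convex_ball _ dq zb lb])
   fix w assume "w \<in> ball l (s/32)"
   then have "w \<in> ball l (s/8)" using s by simp
   from holomorphic_derivI[OF qh open_ball this] show "(q has_field_derivative deriv q w) (at w within ball l (s/32))" .
  qed
  also have "\<dots> \<le> 64 * Mq / s\<^sup>2 * (s / (128 * Mq * sqrt A))"
  proof (rule mult_left_mono)
   have "\<eta> * s \<le> 1 / (128 * Mq * sqrt A) * s" using eta(3) s by (intro mult_right_mono) auto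
   then show "cmod (z - l) \<le> s / (128 * Mq * sqrt A)" using zl unfolding s_def[symmetric] by simp
  qed (use Mq in simp)
  also have "\<dots> = 1 / (2 * sqrt A * s)" using Mq s A by (simp add: field_simps power2_eq_square)
  finally have d: "cmod (q z - q l) \<le> 1 / (2 * sqrt A * s)" .
  have "1 / (A * s\<^sup>2) \<le> (cmod (nk \<phi> l l))\<^sup>2 * exp (- 2 * \<psi> l)"
  proof -
   have "exp (2 * \<psi> l) * exp (- 2 * \<psi> l) \<le> (A * s\<^sup>2 * (cmod (nk \<phi> l l))\<^sup>2) * exp (- 2 * \<psi> l)"
    using nkl[of l] unfolding s_def by (rule mult_right_mono) simp
   then have "1 \<le> ((cmod (nk \<phi> l l))\<^sup>2 * exp (- 2 * \<psi> l)) * (A * s\<^sup>2)" by (simp add: exp_minus mult_ac)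
   then show ?thesis using A s by (simp add: divide_le_eq)
  qed
  also have "\<dots> = (cmod (q l))\<^sup>2" unfolding qn H(2) by simp
  also have "1 / (A * s\<^sup>2) = (1 / (sqrt A * s))\<^sup>2" using A by (simp add: power_divide power_mult_distrib)
  finally have "1 / (sqrt A * s) \<le> cmod (q l)" by (rule power2_le_imp_le) simp
  moreover have "cmod (q l) \<le> cmod (q z) + cmod (q z - q l)" using norm_triangle_ineq4[of "q z" "q z - q l"] by simp
  moreover have "1 / (sqrt A * s) = 2 * (1 / (2 * sqrt A * s))" by simp
  ultimately have "1 / (2 * sqrt A * s) \<le> cmod (q z)" using d by linarith
  then have "(1 / (2 * sqrt A * s))\<^sup>2 \<le> (cmod (q z))\<^sup>2" using A s by (intro power_mono) auto
  then have "1 / (4 * A * s\<^sup>2) \<le> (cmod (nk \<phi> l z))\<^sup>2 * exp (- 2 * Re (H z))" unfolding qn using A by (simp add: power_divide power_mult_distrib)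
  then have 1: "1 \<le> (cmod (nk \<phi> l z))\<^sup>2 * exp (- 2 * Re (H z)) * (4 * A * s\<^sup>2)" using A s by (simp add: divide_le_eq)
  have "z \<in> ball l (s/8)" using zb s by simp
  from H(3)[OF this] have "2 * \<psi> z + - 2 * Re (H z) \<le> 2 * S" by linarith
  then have 2: "exp (2 * \<psi> z) * exp (- 2 * Re (H z)) \<le> exp (2 * S)" unfolding exp_add[symmetric] exp_le_cancel_iff .
  have "exp (2 * \<psi> z) * 1 \<le> exp (2 * \<psi> z) * ((cmod (nk \<phi> l z))\<^sup>2 * exp (- 2 * Re (H z)) * (4 * A * s\<^sup>2))" using 1 by (intro mult_left_mono) auto
  also have "\<dots> = (exp (2 * \<psi> z) * exp (- 2 * Re (H z))) * ((cmod (nk \<phi> l z))\<^sup>2 * (4 * A * s\<^sup>2))" by (simp only: mult_ac)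
  also have "\<dots> \<le> exp (2 * S) * ((cmod (nk \<phi> l z))\<^sup>2 * (4 * A * s\<^sup>2))" using 2 A by (intro mult_right_mono) auto
  finally show ?thesis unfolding a_def s_def by (simp add: mult_ac)
 qed
 then show ?thesis using eta(1) a by blast
qed

text \<open>Let \<open>k\<close> be the normalized kernel at \<open>l\<close> and \<open>P\<close> the projection of \<open>cnj g * k\<close>. Testing \<open>cnj g * k - P\<close> against
 a radial bump times \<open>(z - l) / k\<close> annihilates the holomorphic quotient \<open>P / k\<close> and leaves a multiple of the conjugate of \<open>deriv g l\<close>.\<close>

lemma hankel_necessary:
 assumes g: "g holomorphic_on UNIV" and k: "\<And>w. L2w \<phi> (\<lambda>z. cnj (g z) * nk \<phi> w z)" and hb: "hankel_bounded \<phi> g"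
 shows "\<exists>B. \<forall>z. cmod (deriv g z) * \<rho> z \<le> B"
proof -
 obtain T N where T: "\<And>f. f \<in> Fock \<phi> ==> L2w \<phi> (T f)" "\<And>f. f \<in> Fock \<phi> ==> wnorm \<phi> (T f) \<le> N * wnorm \<phi> f"
  "\<And>f. f \<in> kspan \<phi> ==> wnorm \<phi> (\<lambda>z. T f z - hankel \<phi> g f z) = 0" using hb unfolding hankel_bounded_def by blast
 obtain \<eta> a where eta: "\<eta> > 0" and a: "a > 0" and lower: "\<And>l z. cmod (z - l) < \<eta> * \<rho> l ==> exp (2 * \<psi> z) \<le> a * (\<rho> l)\<^sup>2 * (cmod (nk \<phi> l z))\<^sup>2"
  using nk_local_lower by blast
 obtain A where nk1: "\<And>l. sqn (wt (nk \<phi> l)) = 1" using nk_lower by blast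
 define V where "V = unit_ball_vol 2"
 have V: "V > 0" by (simp add: V_def)
 \<comment> \<open>288 = 2 * 144: the 2 is from \<open>un\<close>, and 144 = 9 * 16 from the squared
   1/3 of the moment formula and t^4 = (\<eta> * \<rho> l)^4 / 16.\<close>
 define B where "B = 288 * N\<^sup>2 * a * V / (\<eta> ^ 4 * J3\<^sup>2)"
 have "cmod (deriv g l) * \<rho> l \<le> sqrt B" for l
 proof -
  define s where "s = \<rho> l"
  have s: "s > 0" by (simp add: s_def rho_pos)
  let ?k = "nk \<phi> l"
  define P where "P = proj \<phi> (\<lambda>w. cnj (g w) * ?k w)"
  note pr = proj[OF k[of l]]
  have PF: "P \<in> Fock \<phi>" unfolding P_def by (rule pr(1))
  let ?u = "hankel \<phi> g ?k"
  have ue: "?u z = cnj (g z) * ?k z - P z" for z by (simp add: hankel_def P_def)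
  have uL: "L2w \<phi> ?u" unfolding hankel_def by (rule L2w_diff[OF k Fock_L2w[OF pr(1)]])
  have ks: "?k \<in> kspan \<phi>" unfolding kspan_def by (intro CollectI exI[of _ "{l}"] exI[of _ "\<lambda>_. 1"]) simp
  \<comment> \<open>The extension and the Hankel operator agree on the kernel only up to norm zero,
    so the parallelogram bound transfers the estimate, at the price of a factor 2.\<close>
  have un: "sqn (wt ?u) \<le> 2 * N\<^sup>2"
  proof -
   let ?d = "\<lambda>z. T ?k z - ?u z"
   have dL: "L2w \<phi> ?d" by (rule L2w_diff[OF T(1)[OF nk_Fock] uL])
   have d0: "sqn (wt ?d) = 0" using T(3)[OF ks] by (simp add: wnorm_wt)
   have "sqrt (sqn (wt (T ?k))) \<le> N" using T(2)[OF nk_Fock[of l]] by (simp add: wnorm_wt nk1)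
   then have "sqn (wt (T ?k)) \<le> N\<^sup>2" by (rule sqrt_le_D)
   moreover have "sqn (wt (\<lambda>z. T ?k z - ?d z)) \<le> 2 * (sqn (wt (T ?k)) + sqn (wt ?d))" by (rule sqn_diff_le[OF T(1)[OF nk_Fock] dL])
   ultimately show ?thesis using d0 by simp
  qed
  define r where "r = \<eta> * s"
  define t where "t = r / 2"
  have r: "r > 0" using eta s by (simp add: r_def)
  have t: "0 < t" "t < r" using r by (auto simp: t_def)
  have k0: "?k z \<noteq> 0" if "z \<in> ball l r" for z
  proof
   assume "?k z = 0"
   then have "exp (2 * \<psi> z) \<le> 0" using lower[of z l] that by (simp add: r_def s_def dist_norm norm_minus_commute)
   then show False by simp
  qed
  \<comment> \<open>Exponent 2, so that the conjugate moment of
    \<open>bp_holomorphic_moments\<close> produces \<open>bp 3\<close>, for which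
    \<open>bp3_mean_value\<close> evaluates the integral of the derivative.\<close>
  define W where "W z = of_real (bp 2 t (z - l)) * (z - l)" for z
  have W0: "W z = 0" if "cmod (z - l) \<ge> t" for z using bp_eq_0[OF _ t(1) that, of 2] by (simp add: W_def)
  have Wt: "(cmod (W z))\<^sup>2 \<le> t\<^sup>2" if "cmod (z - l) < t" for z
  proof -
   have "cmod (W z) \<le> 1 * t" unfolding W_def norm_mult norm_of_real using that by (intro mult_mono) auto
   then show ?thesis by (intro power_mono) auto
  qed
  \<comment> \<open>The factor exp \<phi> cancels the weight in \<open>wt\<close>, so the inner
    product with \<open>Y\<close> is the unweighted integral of \<open>W\<close> against cnj g -
    P/k; its own size is controlled by \<open>nk_local_lower\<close>.\<close>
  define Y where "Y z = cnj (W z / ?k z) * of_real (exp (\<phi> z))" for z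
  have kh: "?k holomorphic_on UNIV" and Ph: "P holomorphic_on UNIV" using nk_Fock PF by (simp_all add: Fock_def)
  have [measurable]: "?k \<in> borel_measurable borel" by (rule borel_measurable_continuous_onI[OF holomorphic_on_imp_continuous_on[OF kh]])
  have "continuous_on UNIV W" unfolding W_def using t by (intro continuous_intros) auto
  then have [measurable]: "W \<in> borel_measurable borel" by (rule borel_measurable_continuous_onI)
  have Ym: "Y \<in> borel_measurable borel" unfolding Y_def[abs_def] by measurable
  have Yb: "(cmod (Y z))\<^sup>2 \<le> indicator (ball l t) z * (t\<^sup>2 * (a * s\<^sup>2))" for z
  proof (cases "cmod (z - l) < t")
   case True
   then have zr: "cmod (z - l) < r" using t by simp
   then have kz: "(cmod (?k z))\<^sup>2 > 0" using k0[of z] by (simp add: dist_norm norm_minus_commute)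
   have "exp (2 * \<phi> z) \<le> exp (2 * \<psi> z)" using phi_le[of z] by simp
   also have "\<dots> \<le> a * s\<^sup>2 * (cmod (?k z))\<^sup>2" using lower[of z l] zr by (simp add: r_def s_def)
   finally have 1: "exp (2 * \<phi> z) / (cmod (?k z))\<^sup>2 \<le> a * s\<^sup>2" using kz by (simp add: pos_divide_le_eq)
   have "(cmod (Y z))\<^sup>2 = (cmod (W z))\<^sup>2 * (exp (2 * \<phi> z) / (cmod (?k z))\<^sup>2)"
    unfolding Y_def norm_mult power_mult_distrib by (simp add: norm_divide power_divide exp_double)
   also have "\<dots> \<le> t\<^sup>2 * (a * s\<^sup>2)" using Wt[OF True] 1 by (intro mult_mono) auto
   finally show ?thesis using True by (simp add: dist_norm norm_minus_commute)
  next
   case False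
   then have "indicator (ball l t) z = (0::real)" by (simp add: dist_norm norm_minus_commute)
   then show ?thesis using False W0[of z] by (simp add: Y_def)
  qed
  note iI = integrable_indicator_ball[of t l "t\<^sup>2 * (a * s\<^sup>2)", OF less_imp_le[OF t(1)]]
  have Yi: "integrable lborel (\<lambda>z. (cmod (Y z))\<^sup>2)"
  proof (rule Bochner_Integration.integrable_bound[OF iI(1)])
   show "(\<lambda>z. (cmod (Y z))\<^sup>2) \<in> borel_measurable lborel" using Ym by simp
   show "AE z in lborel. norm ((cmod (Y z))\<^sup>2) \<le> norm (indicator (ball l t) z * (t\<^sup>2 * (a * s\<^sup>2)))"
    by (rule AE_I2) (use order_trans[OF Yb abs_ge_self] in simp)
  qed
  have Yq: "sqi Y" unfolding sqi_def using Ym Yi by simp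
  have Yn: "sqn Y \<le> t\<^sup>2 * (a * s\<^sup>2) * V * t\<^sup>2" using integral_mono[OF Yi iI(1) Yb] unfolding iI(2) V_def sqn_def .
  have qh: "(\<lambda>w. P w / ?k w) holomorphic_on ball l r"
   by (intro holomorphic_on_divide holomorphic_on_subset[OF Ph] holomorphic_on_subset[OF kh] k0) auto
  have gh: "g holomorphic_on ball l r" by (rule holomorphic_on_subset[OF g]) simp
  have i2: "integrable lborel (\<lambda>w. W w * cnj (g w))"
  proof -
   have "integrable lborel (\<lambda>w. cnj (of_real (bp 2 t (w - l)) * (cnj (w - l) * g w)))"
    by (rule integrable_cnj[OF bp_holomorphic_moments(3)[OF gh t]]) simp
   then show ?thesis by (simp add: W_def mult.assoc)
  qed
  have v2: "(\<integral>w. W w * cnj (g w) \<partial>lborel) = of_real (t\<^sup>2 / 3 * (J3 * t\<^sup>2)) * cnj (deriv g l)"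
  proof -
   have "(\<integral>w. W w * cnj (g w) \<partial>lborel) = (\<integral>w. cnj (of_real (bp 2 t (w - l)) * (cnj (w - l) * g w)) \<partial>lborel)"
    by (simp add: W_def mult.assoc)
   also have "\<dots> = cnj (of_real (t\<^sup>2 / real (Suc 2)) * (\<integral>w. of_real (bp (Suc 2) t (w - l)) * deriv g w \<partial>lborel))"
    unfolding integral_bounded_linear[OF bounded_linear_cnj bp_holomorphic_moments(3)[OF gh t one_le_numeral]]
     bp_holomorphic_moments(4)[OF gh t one_le_numeral] ..
   also have "(\<integral>w. of_real (bp (Suc 2) t (w - l)) * deriv g w \<partial>lborel) = of_real (J3 * t\<^sup>2) * deriv g l"
    using bp3_mean_value[OF holomorphic_deriv[OF gh open_ball] t] by (simp add: eval_nat_numeral)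
   finally show ?thesis by simp
  qed
  have i1: "integrable lborel (\<lambda>w. W w * (P w / ?k w))" and v1: "(\<integral>w. W w * (P w / ?k w) \<partial>lborel) = 0"
   using bp_holomorphic_moments(1,2)[OF qh t, of 2] by (simp_all only: W_def mult.assoc)
  have pt: "wt ?u z * cnj (Y z) = W z * cnj (g z) - W z * (P z / ?k z)" for z
  proof (cases "cmod (z - l) < t")
   case True
   then have kz: "?k z \<noteq> 0" using k0[of z] t by (simp add: dist_norm norm_minus_commute)
   have "wt ?u z * cnj (Y z) = (cnj (g z) * ?k z - P z) * (W z / ?k z) * (of_real (exp (- \<phi> z)) * of_real (exp (\<phi> z)))"
    unfolding wt_def ue Y_def by (simp add: mult_ac)
   also have "complex_of_real (exp (- \<phi> z)) * of_real (exp (\<phi> z)) = 1" unfolding of_real_mult[symmetric] exp_add[symmetric] by simp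
   finally show ?thesis using kz by (simp add: field_simps)
  next
   case False
   then show ?thesis using W0[of z] by (simp add: Y_def)
  qed
  have "ip (wt ?u) Y = of_real (t\<^sup>2 / 3 * (J3 * t\<^sup>2)) * cnj (deriv g l)"
   unfolding ip_def pt Bochner_Integration.integral_diff[OF i2 i1] v1 v2 by simp
  then have "(cmod (of_real (t\<^sup>2 / 3 * (J3 * t\<^sup>2)) * cnj (deriv g l)))\<^sup>2 \<le> sqn (wt ?u) * sqn Y"
   using ip_cauchy_schwarz[OF _ Yq, of "wt ?u"] uL by (simp only: L2w_wt)
  also have "\<dots> \<le> (2 * N\<^sup>2) * (t\<^sup>2 * (a * s\<^sup>2) * V * t\<^sup>2)" using un Yn by (intro mult_mono) auto
  also have "(cmod (of_real (t\<^sup>2 / 3 * (J3 * t\<^sup>2)) * cnj (deriv g l)))\<^sup>2 = (t\<^sup>2 / 3 * (J3 * t\<^sup>2))\<^sup>2 * (cmod (deriv g l))\<^sup>2"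
   unfolding norm_mult norm_of_real power_mult_distrib power2_abs complex_mod_cnj ..
  finally have main: "(t\<^sup>2 / 3 * (J3 * t\<^sup>2))\<^sup>2 * (cmod (deriv g l))\<^sup>2 \<le> (2 * N\<^sup>2) * (t\<^sup>2 * (a * s\<^sup>2) * V * t\<^sup>2)" .
  have "(t\<^sup>2 * t\<^sup>2 * s\<^sup>2) * ((\<eta> ^ 4 * J3\<^sup>2) * (cmod (deriv g l) * s)\<^sup>2) = 144 * ((t\<^sup>2 / 3 * (J3 * t\<^sup>2))\<^sup>2 * (cmod (deriv g l))\<^sup>2)"
   unfolding t_def r_def by (simp add: field_simps power2_eq_square power4_eq_xxxx)
  also have "\<dots> \<le> 144 * ((2 * N\<^sup>2) * (t\<^sup>2 * (a * s\<^sup>2) * V * t\<^sup>2))" using main by (intro mult_left_mono) auto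
  also have "\<dots> = (t\<^sup>2 * t\<^sup>2 * s\<^sup>2) * (288 * N\<^sup>2 * a * V)" by simp
  finally have "(t\<^sup>2 * t\<^sup>2 * s\<^sup>2) * ((\<eta> ^ 4 * J3\<^sup>2) * (cmod (deriv g l) * s)\<^sup>2) \<le> (t\<^sup>2 * t\<^sup>2 * s\<^sup>2) * (288 * N\<^sup>2 * a * V)" .
  then have "(\<eta> ^ 4 * J3\<^sup>2) * (cmod (deriv g l) * s)\<^sup>2 \<le> 288 * N\<^sup>2 * a * V" by (rule mult_left_le_imp_le) (use t s in simp)
  then have "(cmod (deriv g l) * s)\<^sup>2 \<le> B" unfolding B_def using eta J3_pos by (simp add: pos_le_divide_eq mult.commute)
  then show ?thesis unfolding s_def by (rule real_le_rsqrt)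
 qed
 then show ?thesis by blast
qed

lemma hankel_bounded_iff:
 assumes g: "g holomorphic_on UNIV" and k: "\<And>w. L2w \<phi> (\<lambda>z. cnj (g z) * nk \<phi> w z)"
 shows "hankel_bounded \<phi> g \<longleftrightarrow> (\<exists>B. \<forall>z. cmod (deriv g z) * \<rho> z \<le> B)"
proof
 assume "hankel_bounded \<phi> g"
 then show "\<exists>B. \<forall>z. cmod (deriv g z) * \<rho> z \<le> B" by (rule hankel_necessary[OF g k])
next
 assume "\<exists>B. \<forall>z. cmod (deriv g z) * \<rho> z \<le> B"
 then obtain B where B: "\<And>z. cmod (deriv g z) * \<rho> z \<le> B" by blast
 show "hankel_bounded \<phi> g"
  by (rule hankel_boundedI[where B="exp (2 * C) * (4 * B\<^sup>2 / c)", OF k _ dbar_correction[OF g B]]) (use c_pos in simp_all)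
qed

end

theorem theorem3:
  fixes \<phi> :: "complex \<Rightarrow> real" and \<mu> :: "complex measure" and g :: "complex \<Rightarrow> complex"
  assumes "subharmonic \<phi>" and "\<not> harmonic \<phi>"
    and "is_laplacian \<phi> \<mu>" and "doubling \<mu>"
    and "g holomorphic_on UNIV"
    and "\<forall>w. L2w \<phi> (\<lambda>z. cnj (g z) * nk \<phi> w z)"
  shows "hankel_bounded \<phi> g \<longleftrightarrow> (\<exists>B. \<forall>z. cmod (deriv g z) * rho \<mu> z \<le> B)"
proof -
  interpret doubling_potential \<phi> \<mu>
    by unfold_locales (use assms in simp_all)
  obtain \<psi> p q pp qq c C where w: "weight \<psi> p q pp qq" and c: "c > 0" and
    le: "\<And>z. \<phi> z \<le> \<psi> z" "\<And>z. \<psi> z \<le> \<phi> z + C" and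
    lap: "\<And>z. c \<le> (pp z + qq z) * (rho \<mu> z)\<^sup>2" "\<And>z. (pp z + qq z) * (rho \<mu> z)\<^sup>2 \<le> C"
    using regular_weight by blast
  \<comment> \<open>One constant \<open>C\<close> bounds both \<psi> - \<phi> and the Laplacian
    times \<rho>^2, which is the form the locale asks for.\<close>
  have "fock_regular \<phi> \<psi> C p q pp qq (rho \<mu>) c"
  proof
    show "\<phi> \<in> borel_measurable borel" using phi_borel by simp
    show "continuous_on UNIV \<psi>" using w unfolding weight_def C1c_def by blast
  qed (fact w c le lap rho_pos rho_lipschitz rho_sublinear)+
  then show ?thesis
    by (rule fock_regular.hankel_bounded_iff) (use assms in auto)
qed

end
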